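(* Let $X=\mathbb{R}$ or $X=\mathbb{T}=\mathbb{R}/2\pi\mathbb{Z}$, let $I\subset\mathbb{R}$ be a time interval, and let $\vec{S}:I\times X\to\mathbb{H}^2$ be a sufficiently regular solution of the half-wave maps equation with target $\mathbb{H}^2$, $$\partial_t\vec{S}=\vec{S}\wedge_\eta|\nabla|\vec{S}.$$ Set $\bm{\tilde S}=\vec{S}\cdot\bm{\rho}=\sum_{j=1}^3S_j\rho_j$ and define the operators, acting on $\mathbb{C}^2$-valued functions on $X$, $$L_{\bm{\tilde S}}=[H,\mu_{\bm{\tilde S}}],\qquad B_{\bm{\tilde S}}=-\frac{\mathrm{i}}{2}\left(\mu_{\bm{\tilde S}}|\nabla|+|\nabla|\mu_{\bm{\tilde S}}\right)+\frac{\mathrm{i}}{2}\mu_{|\nabla|\bm{\tilde S}}.$$ Then the following Lax equation holds for all $t\in I$: $$\frac{d}{dt}L_{\bm{\tilde S}}=\mathrm{i}\,[B_{\bm{\tilde S}},L_{\bm{\tilde S}}].$$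
   Context: The hyperbolic plane is embedded in Minkowski space $\mathbb{R}^{1,2}$ (that is, $\mathbb{R}^3$ with the metric $\eta=\mathrm{diag}(-1,+1,+1)$) as $$\mathbb{H}^2=\{\vec{X}\in\mathbb{R}^{1,2}:-X_1^2+X_2^2+X_3^2=-1,\ X_1>0\}.$$ For $\vec{X},\vec{Y}\in\mathbb{R}^{1,2}$, $$\vec{X}\wedge_\eta\vec{Y}=\eta(\vec{X}\wedge\vec{Y})=\left(-(X_2Y_3-X_3Y_2),\,X_3Y_1-X_1Y_3,\,X_1Y_2-X_2Y_1\right).$$ The operator $|\nabla|$ acts in the variable $x$ and is the Fourier multiplier with symbol $|\xi|$ if $X=\mathbb{R}$, and with symbol $|n|$ ($n\in\mathbb{Z}$) if $X=\mathbb{T}$; it acts componentwise on vector- or matrix-valued functions. The matrices $\rho_j$, which span $\mathfrak{su}(1,1)$, are $$\rho_1=\begin{pmatrix}\mathrm{i}&0\\0&-\mathrm{i}\end{pmatrix},\quad\rho_2=\begin{pmatrix}0&1\\1&0\end{pmatrix},\quad\rho_3=\begin{pmatrix}0&\mathrm{i}\\-\mathrm{i}&0\end{pmatrix}.$$ For a $2\times2$-matrix-valued function $\bm{A}=\bm{A}(t,x)$, $\mu_{\bm{A}}$ is the multiplication operator $(\mu_{\bm{A}}\varphi)(t,x)=\bm{A}(t,x)\varphi(x)$ on functions $\varphi:X\to\mathbb{C}^2$. $[A,B]=AB-BA$ is the commutator of operators. $H$ is the Hilbert transform, acting on each component of a $\mathbb{C}^2$-valued function: $$(Hf)(x)=\mathrm{p.v.}\,\frac1\pi\int_{\mathbb{R}}\frac{f(y)}{x-y}\,dy\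 \ (X=\mathbb{R}),\qquad (Hf)(x)=\mathrm{p.v.}\int_{\mathbb{T}}f(y)\cot\left(\frac{x-y}{2}\right)dy\ \ (X=\mathbb{T}).$$ The operators $L_{\bm{\tilde S}}$ (which depends on $t$ through $\vec{S}(t,\cdot)$) and $B_{\bm{\tilde S}}$ are considered on $L^2(X;\mathbb{C}^2)$; $B_{\bm{\tilde S}}$ is unbounded and defined on a suitable dense subspace (e.g. $H^1(X;\mathbb{C}^2)$), and the Lax equation is understood as an identity of operators on such a dense subspace. "Sufficiently regular" is not quantified in the source; it means regular enough for all the expressions involved to be well-defined, and one may take, for instance, $\vec{S}$ bounded and smooth in $(t,x)$, with in addition, for $X=\mathbb{R}$, $\partial_x\vec{S}$ continuous in $t$ with values in every Sobolev space $H^s(\mathbb{R};\mathbb{R}^3)$ (in which case $|\nabla|\vec{S}$ is understood as $H\partial_x\vec{S}$). *)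

theory Defs
  imports "HOL-Analysis.Analysis"
begin

section \<open>Function spaces over the line and the circle\<close>

text \<open>
  The two domains of the space variable: the line \<open>\<real>\<close> and the circle \<open>\<real> / 2\<pi>\<int>\<close>. A function on the
  circle is a \<open>2\<pi>\<close>-periodic function on the reals, with integrals taken over one period. Elements
  of \<open>L\<^sup>2\<close> are represented by functions, and identities between them are meant almost everywhere.
\<close>

datatype base = Line | Circle

primrec periodic_on :: "base \<Rightarrow> (real \<Rightarrow> 'a) \<Rightarrow> bool" where
  "periodic_on Line f \<longleftrightarrow> True"
| "periodic_on Circle f \<longleftrightarrow> (\<forall>x. f (x + 2 * pi) = f x)"

primrec base_measure :: "base \<Rightarrow> real measure" where
  "base_measure Line = lebesgue"
| "base_measure Circle = lebesgue_on {-pi..pi}"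

definition sqnorm :: "real measure \<Rightarrow> (real \<Rightarrow> 'a::real_normed_vector) \<Rightarrow> ennreal" where
  "sqnorm M f = (\<integral>\<^sup>+ x. ennreal ((norm (f x))\<^sup>2) \<partial>M)"

definition L2 :: "base \<Rightarrow> (real \<Rightarrow> 'a::real_normed_vector) set" where
  "L2 X = {f. periodic_on X f \<and> f \<in> borel_measurable lebesgue \<and> sqnorm (base_measure X) f < \<infinity>}"

text \<open>
  Frequencies are real numbers in both cases; on the circle only the integers carry mass.
  On the line, the transform is the \<open>L\<^sup>2\<close> limit of the truncated Fourier integrals,
  so it is determined up to null sets.
\<close>

primrec freq_measure :: "base \<Rightarrow> real measure" where
  "freq_measure Line = lebesgue"
| "freq_measure Circle = count_space \<int>"

definition trunc_fourier :: "real \<Rightarrow> (real \<Rightarrow> complex) \<Rightarrow> real \<Rightarrow> complex" where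
  "trunc_fourier R f \<xi> =
     (LINT x:{-R..R}|lebesgue. exp (- (\<i> * complex_of_real (x * \<xi>))) * f x)"

primrec fourier :: "base \<Rightarrow> (real \<Rightarrow> complex) \<Rightarrow> real \<Rightarrow> complex" where
  "fourier Line f =
     (SOME F. F \<in> borel_measurable lebesgue \<and>
        ((\<lambda>R. sqnorm lebesgue (\<lambda>\<xi>. F \<xi> - trunc_fourier R f \<xi>)) \<longlongrightarrow> 0) at_top)"
| "fourier Circle f = (\<lambda>\<xi>. trunc_fourier pi f \<xi> / complex_of_real (2 * pi))"

definition sobolev_sqnorm :: "base \<Rightarrow> real \<Rightarrow> (real \<Rightarrow> complex) \<Rightarrow> ennreal" where
  "sobolev_sqnorm X s f =
     (\<integral>\<^sup>+ \<xi>. ennreal ((1 + \<xi>\<^sup>2) powr s * (cmod (fourier X f \<xi>))\<^sup>2) \<partial>(freq_measure X))"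

text \<open>This is the Sobolev space only for \<open>s \<ge> 0\<close>, the sole case in which it is used.\<close>

definition sobolev :: "base \<Rightarrow> real \<Rightarrow> (real \<Rightarrow> complex) set" where
  "sobolev X s = {f \<in> L2 X. sobolev_sqnorm X s f < \<infinity>}"

definition H1 :: "base \<Rightarrow> (real \<Rightarrow> complex^2) set" where
  "H1 X = {\<phi>. \<forall>i. (\<lambda>x. \<phi> x $ i) \<in> sobolev X 1}"


section \<open>Hilbert transform and the operator \<open>|\<nabla>|\<close>\<close>

text \<open>
  The kernel on the circle carries no factor \<open>1 / (2\<pi>)\<close>, so there this is \<open>2\<pi>\<close> times the
  multiplier with symbol \<open>-\<i> sgn n\<close>.
\<close>

primrec hilbert ::
  "base \<Rightarrow> (real \<Rightarrow> 'a::{banach,second_countable_topology}) \<Rightarrow> real \<Rightarrow> 'a" where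
  "hilbert Line f = (\<lambda>x. Lim (at_right 0) (\<lambda>\<epsilon>.
     (1 / pi) *\<^sub>R (LINT y:{y. \<epsilon> < \<bar>x - y\<bar>}|lebesgue. (1 / (x - y)) *\<^sub>R f y)))"
| "hilbert Circle f = (\<lambda>x. Lim (at_right 0) (\<lambda>\<epsilon>.
     LINT y:{y. \<epsilon> < \<bar>x - y\<bar> \<and> \<bar>x - y\<bar> \<le> pi}|lebesgue. cot ((x - y) / 2) *\<^sub>R f y))"

text \<open>The Fourier multiplier on \<open>L\<^sup>2\<close> with symbol \<open>|\<xi>|\<close>; its domain is the space \<open>sobolev X 1\<close>.\<close>

definition abs_grad :: "base \<Rightarrow> (real \<Rightarrow> complex) \<Rightarrow> real \<Rightarrow> complex" where
  "abs_grad X f =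
     (SOME g. g \<in> L2 X \<and>
        (AE \<xi> in freq_measure X. fourier X g \<xi> = complex_of_real \<bar>\<xi>\<bar> * fourier X f \<xi>))"

definition abs_grad_vec :: "base \<Rightarrow> (real \<Rightarrow> complex^2) \<Rightarrow> real \<Rightarrow> complex^2" where
  "abs_grad_vec X \<phi> = (\<lambda>x. \<chi> i. abs_grad X (\<lambda>y. \<phi> y $ i) x)"

text \<open>
  \<open>|\<nabla>|\<close> on the components of a bounded smooth map. On the line these need not be square integrable,
  and \<open>|\<nabla>|f\<close> is understood as the Hilbert transform of \<open>f'\<close>. On the circle they are square
  integrable and \<open>|\<nabla>|\<close> is the Fourier multiplier.
\<close>

primrec abs_grad_bdd :: "base \<Rightarrow> (real \<Rightarrow> complex) \<Rightarrow> real \<Rightarrow> complex" where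
  "abs_grad_bdd Line f = hilbert Line (\<lambda>x. vector_derivative f (at x))"
| "abs_grad_bdd Circle f = abs_grad Circle f"

definition abs_grad_map :: "base \<Rightarrow> (real \<Rightarrow> real^3) \<Rightarrow> real \<Rightarrow> real^3" where
  "abs_grad_map X V = (\<lambda>x. \<chi> j. Re (abs_grad_bdd X (\<lambda>y. complex_of_real (V y $ j)) x))"

definition abs_grad_mat :: "base \<Rightarrow> (real \<Rightarrow> complex^2^2) \<Rightarrow> real \<Rightarrow> complex^2^2" where
  "abs_grad_mat X A = (\<lambda>x. \<chi> i j. abs_grad_bdd X (\<lambda>y. A y $ i $ j) x)"


section \<open>Half-wave maps into the hyperbolic plane\<close>

definition hyperbolic_plane :: "(real^3) set" where
  "hyperbolic_plane = {v. - (v$1)\<^sup>2 + (v$2)\<^sup>2 + (v$3)\<^sup>2 = -1 \<and> v$1 > 0}"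

definition wedge_eta :: "real^3 \<Rightarrow> real^3 \<Rightarrow> real^3" where
  "wedge_eta v w = vector [- (v$2 * w$3 - v$3 * w$2), v$3 * w$1 - v$1 * w$3, v$1 * w$2 - v$2 * w$1]"

text \<open>
  Joint differentiability of class \<open>C\<^sup>k\<close> on \<open>I \<times> \<real>\<close>, with one-sided time derivatives at end points
  of the interval \<open>I\<close>.
\<close>

primrec Ck_on :: "nat \<Rightarrow> real set \<Rightarrow> (real \<Rightarrow> real \<Rightarrow> 'a::real_normed_vector) \<Rightarrow> bool" where
  "Ck_on 0 I f \<longleftrightarrow> continuous_on (I \<times> UNIV) (\<lambda>(t, x). f t x)"
| "Ck_on (Suc k) I f \<longleftrightarrow>
     (\<exists>ft fx.
        (\<forall>t\<in>I. \<forall>x. ((\<lambda>s. f s x) has_vector_derivative ft t x) (at t within I)) \<and>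
        (\<forall>t\<in>I. \<forall>x. (f t has_vector_derivative fx t x) (at x)) \<and>
        Ck_on k I ft \<and> Ck_on k I fx)"

text \<open>
  The regularity class: bounded and smooth in \<open>(t, x)\<close>, and, on the line, \<open>\<partial>\<^sub>xS\<close> continuous in time
  with values in every Sobolev space.
\<close>

definition dx :: "(real \<Rightarrow> real \<Rightarrow> real^3) \<Rightarrow> 3 \<Rightarrow> real \<Rightarrow> real \<Rightarrow> complex" where
  "dx S j t x = complex_of_real (vector_derivative (S t) (at x) $ j)"

definition regular_map :: "base \<Rightarrow> real set \<Rightarrow> (real \<Rightarrow> real \<Rightarrow> real^3) \<Rightarrow> bool" where
  "regular_map X I S \<longleftrightarrow>
     (\<forall>t\<in>I. periodic_on X (S t)) \<and>
     (\<exists>C. \<forall>t\<in>I. \<forall>x. norm (S t x) \<le> C) \<and>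
     (\<forall>k. Ck_on k I S) \<and>
     (X = Line \<longrightarrow>
        (\<forall>r\<ge>0. \<forall>j. \<forall>t\<in>I.
           dx S j t \<in> sobolev Line r \<and>
           ((\<lambda>s. sobolev_sqnorm Line r (\<lambda>x. dx S j s x - dx S j t x)) \<longlongrightarrow> 0) (at t within I)))"

text \<open>
  The equation is asked for almost every \<open>x\<close> because on the circle \<open>|\<nabla>|S\<close> is determined only up to
  null sets; for maps in the regularity class, this is the pointwise equation for the continuous
  representative.
\<close>

definition half_wave_map :: "base \<Rightarrow> real set \<Rightarrow> (real \<Rightarrow> real \<Rightarrow> real^3) \<Rightarrow> bool" where
  "half_wave_map X I S \<longleftrightarrow>
     (\<forall>t\<in>I. \<forall>x. S t x \<in> hyperbolic_plane) \<and>
     (\<forall>t\<in>I. AE x in lebesgue.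
        ((\<lambda>s. S s x) has_vector_derivative wedge_eta (S t x) (abs_grad_map X (S t) x))
          (at t within I))"


section \<open>The Lax pair\<close>

definition rho1 :: "complex^2^2" where "rho1 = vector [vector [\<i>, 0], vector [0, -\<i>]]"
definition rho2 :: "complex^2^2" where "rho2 = vector [vector [0, 1], vector [1, 0]]"
definition rho3 :: "complex^2^2" where "rho3 = vector [vector [0, \<i>], vector [-\<i>, 0]]"

definition dot_rho :: "real^3 \<Rightarrow> complex^2^2" where
  "dot_rho v = v$1 *\<^sub>R rho1 + v$2 *\<^sub>R rho2 + v$3 *\<^sub>R rho3"

type_synonym oper = "(real \<Rightarrow> complex^2) \<Rightarrow> real \<Rightarrow> complex^2"

definition mult_op :: "(real \<Rightarrow> complex^2^2) \<Rightarrow> oper" where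
  "mult_op A \<phi> = (\<lambda>x. A x *v \<phi> x)"

definition commutator :: "oper \<Rightarrow> oper \<Rightarrow> oper" where
  "commutator P Q \<phi> = (\<lambda>x. P (Q \<phi>) x - Q (P \<phi>) x)"

definition lax_L :: "base \<Rightarrow> (real \<Rightarrow> complex^2^2) \<Rightarrow> oper" where
  "lax_L X A = commutator (hilbert X) (mult_op A)"

definition lax_B :: "base \<Rightarrow> (real \<Rightarrow> complex^2^2) \<Rightarrow> oper" where
  "lax_B X A \<phi> = (\<lambda>x.
     (- (\<i> / 2)) *s (mult_op A (abs_grad_vec X \<phi>) x + abs_grad_vec X (mult_op A \<phi>) x)
     + (\<i> / 2) *s mult_op (abs_grad_mat X A) \<phi> x)"

text \<open>Differentiability at \<open>t\<close> of a curve defined on \<open>I\<close>, with respect to the norm of \<open>L\<^sup>2\<close>.\<close>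

definition has_L2_derivative ::
  "base \<Rightarrow> (real \<Rightarrow> real \<Rightarrow> 'a::real_normed_vector) \<Rightarrow> (real \<Rightarrow> 'a) \<Rightarrow> real \<Rightarrow> real set \<Rightarrow> bool" where
  "has_L2_derivative X u u' t I \<longleftrightarrow>
     (\<forall>s\<in>I. u s \<in> L2 X) \<and> u' \<in> L2 X \<and>
     ((\<lambda>s. sqnorm (base_measure X) (\<lambda>x. (1 / (s - t)) *\<^sub>R (u s x - u t x) - u' x)) \<longlongrightarrow> 0)
       (at t within I)"

text \<open>
  The identity \<open>d/dt L = Q\<close> of operators on the dense subspace \<open>H1 X\<close>, the time derivative being
  the strong one.
\<close>

definition has_strong_derivative_on_H1 ::
  "base \<Rightarrow> (real \<Rightarrow> oper) \<Rightarrow> oper \<Rightarrow> real \<Rightarrow> real set \<Rightarrow> bool" where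
  "has_strong_derivative_on_H1 X L Q t I \<longleftrightarrow>
     (\<forall>\<phi>\<in>H1 X. has_L2_derivative X (\<lambda>s. L s \<phi>) (Q \<phi>) t I)"

end

theory Submission
  imports Defs
begin

text \<open>
  In the convention where \<open>H\<close> is the multiplier with symbol \<open>-\<i> sgn \<xi>\<close>, we have \<open>|\<nabla>| = H \<partial>\<close> and
  \<open>H\<^sup>2 \<partial> = - \<partial>\<close>. Let \<open>A\<close> be the matrix of the map at a fixed time and \<open>G = |\<nabla>|A = H A'\<close>. The identity of
  Cotlar, \<open>H (f H g + g H f) = H f H g - f g\<close> for \<open>f\<close> without zero mode, applied to the entries of \<open>A'\<close>
  gives \<open>H (A' H \<phi>) = G H \<phi> - A' \<phi> - H (G \<phi>)\<close>. Since the target is the hyperbolic plane, \<open>A\<^sup>2 = -1\<close> and hence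
  \<open>A' A = - A A'\<close>; with these relations all terms of \<open>\<i> [B, L] \<phi>\<close> cancel except \<open>[H, [A, G] / 2] \<phi>\<close>.
  The half-wave maps equation says exactly that \<open>[A, G] / 2\<close> is the time derivative of \<open>A\<close>.

  That \<open>[H, A]\<close> is strongly differentiable in time follows by dominated convergence from a Lipschitz
  bound in time that is uniform in \<open>x\<close>.

  The principal value integral agrees almost everywhere with the multiplier because the truncated
  kernel minus the conjugate Poisson kernel is dominated by the Poisson kernel and has mean zero, so
  that its convolutions with an \<open>L\<^sup>2\<close> function tend to zero at every Lebesgue point.
\<close>

section \<open>Square-integrable functions\<close>

text \<open>Both domains run through one argument: a space measure and a frequency measure that form
  a Plancherel pair, Lebesgue with Lebesgue on the line, one period with the counting measure of the
  integers on the circle. Everything about the pair comes from damping frequencies by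
  \<open>exp (- \<epsilon> * \<bar>\<xi>\<bar>)\<close>, that is, from the Poisson kernel. The
  operators of the statement are choices or limits that fix functions only up to null sets; hence
  multipliers are treated as a relation between representatives, and every identity holds almost
  everywhere. Cotlar's identity is applied to \<open>A'\<close> for two reasons: \<open>A\<close>
  need not be square integrable on the line, and a derivative has no zero mode, which on the circle
  is also what \<open>H (H f) = - f\<close> requires. The missing factor in the circle kernel is
  harmless: \<open>|\<nabla>|\<close> is the genuine multiplier, so both sides of the Lax equation
  are homogeneous of degree one in the Hilbert transform, which can be normalised and its constant
  pulled out.\<close>

definition sqint :: "'a measure \<Rightarrow> ('a \<Rightarrow> complex) \<Rightarrow> bool" where
  "sqint M f \<longleftrightarrow> f \<in> borel_measurable M \<and> integrable M (\<lambda>x. (cmod (f x))\<^sup>2)"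

text \<open>The squared norm replaces the norm throughout: Plancherel, Fatou and dominated
  convergence speak about it directly. The triangle inequality is then available with a factor 2,
  which is harmless for limits and Cauchy sequences.\<close>

definition nsq :: "'a measure \<Rightarrow> ('a \<Rightarrow> complex) \<Rightarrow> real" where
  "nsq M f = (\<integral>x. (cmod (f x))\<^sup>2 \<partial>M)"

lemma sqint_measurable: "sqint M f \<Longrightarrow> f \<in> borel_measurable M"
  and sqint_integrable: "sqint M f \<Longrightarrow> integrable M (\<lambda>x. (cmod (f x))\<^sup>2)"
  by (auto simp: sqint_def)

lemma nsq_nonneg: "0 \<le> nsq M f"
  by (simp add: nsq_def)

lemma sqint_iff_nn:
  "sqint M f \<longleftrightarrow> f \<in> borel_measurable M \<and> (\<integral>\<^sup>+x. ennreal ((cmod (f x))\<^sup>2) \<partial>M) < \<infinity>"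
  unfolding sqint_def
  by (auto simp: integrable_iff_bounded)

lemma nn_eq_nsq: "sqint M f \<Longrightarrow> (\<integral>\<^sup>+x. ennreal ((cmod (f x))\<^sup>2) \<partial>M) = ennreal (nsq M f)"
  unfolding nsq_def by (intro nn_integral_eq_integral) (auto simp: sqint_def)

lemma sqint_cong_AE:
  assumes "sqint M f" "g \<in> borel_measurable M" "AE x in M. f x = g x"
  shows "sqint M g" "nsq M g = nsq M f"
proof -
  have *: "AE x in M. (cmod (f x))\<^sup>2 = (cmod (g x))\<^sup>2" using assms(3) by eventually_elim simp
  have [measurable]: "f \<in> borel_measurable M" "g \<in> borel_measurable M"
    using assms by (auto simp: sqint_def)
  show "sqint M g" using assms unfolding sqint_def
    by (auto intro: integrable_cong_AE_imp[of M "\<lambda>x. (cmod (f x))\<^sup>2"] simp: * eq_commute)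
  show "nsq M g = nsq M f" unfolding nsq_def
    by (rule integral_cong_AE) (use * in \<open>auto simp: eq_commute\<close>)
qed

lemma sqint_dominated:
  assumes "sqint M f" "g \<in> borel_measurable M" "AE x in M. cmod (g x) \<le> C * cmod (f x)"
  shows "sqint M g" "nsq M g \<le> C\<^sup>2 * nsq M f"
proof -
  have [measurable]: "f \<in> borel_measurable M" "g \<in> borel_measurable M"
    using assms by (auto simp: sqint_def)
  have *: "AE x in M. (cmod (g x))\<^sup>2 \<le> C\<^sup>2 * (cmod (f x))\<^sup>2"
    using assms(3)
  proof eventually_elim
    case (elim x)
    have "(cmod (g x))\<^sup>2 \<le> (C * cmod (f x))\<^sup>2" using elim by (intro power_mono) auto
    then show ?case by (simp add: power_mult_distrib)
  qed
  have i: "integrable M (\<lambda>x. C\<^sup>2 * (cmod (f x))\<^sup>2)" using assms by (auto simp: sqint_def)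
  show "sqint M g" unfolding sqint_def
    using Bochner_Integration.integrable_bound[OF i, of "\<lambda>x. (cmod (g x))\<^sup>2"] * assms(2) by auto
  then show "nsq M g \<le> C\<^sup>2 * nsq M f"
    unfolding nsq_def using i * 
    by (subst integral_mult_right_zero[symmetric], intro integral_mono_AE) (auto simp: sqint_def)
qed

lemma norm_add_sq_le: "(norm (a + b))\<^sup>2 \<le> 2 * (norm a)\<^sup>2 + 2 * (norm (b::'a::real_normed_vector))\<^sup>2"
proof -
  have "(norm (a + b))\<^sup>2 \<le> (norm a + norm b)\<^sup>2" by (intro power_mono norm_triangle_ineq) auto
  also have "\<dots> \<le> 2 * (norm a)\<^sup>2 + 2 * (norm b)\<^sup>2"
    using sum_squares_bound[of "norm a" "norm b"] by (simp add: power2_sum)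
  finally show ?thesis .
qed

lemma sqint_add:
  assumes "sqint M f" "sqint M g"
  shows "sqint M (\<lambda>x. f x + g x)" "nsq M (\<lambda>x. f x + g x) \<le> 2 * nsq M f + 2 * nsq M g"
proof -
  have [measurable]: "f \<in> borel_measurable M" "g \<in> borel_measurable M"
    using assms by (auto simp: sqint_def)
  have i: "integrable M (\<lambda>x. 2 * (cmod (f x))\<^sup>2 + 2 * (cmod (g x))\<^sup>2)"
    using assms by (auto simp: sqint_def)
  have j: "integrable M (\<lambda>x. (cmod (f x + g x))\<^sup>2)"
    by (rule Bochner_Integration.integrable_bound[OF i]) (auto intro!: AE_I2 norm_add_sq_le)
  then show "sqint M (\<lambda>x. f x + g x)" by (simp add: sqint_def)
  have "nsq M (\<lambda>x. f x + g x) \<le> (\<integral>x. 2 * (cmod (f x))\<^sup>2 + 2 * (cmod (g x))\<^sup>2 \<partial>M)"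
    unfolding nsq_def by (intro integral_mono i j norm_add_sq_le)
  also have "\<dots> = 2 * nsq M f + 2 * nsq M g"
    using assms unfolding nsq_def sqint_def by simp
  finally show "nsq M (\<lambda>x. f x + g x) \<le> 2 * nsq M f + 2 * nsq M g" .
qed

lemma borel_measurable_cnj [measurable (raw)]:
  "f \<in> borel_measurable M \<Longrightarrow> (\<lambda>x. cnj (f x)) \<in> borel_measurable M"
  by (rule borel_measurable_continuous_on[OF continuous_on_cnj[OF continuous_on_id]])

lemma sqint_cmult: "sqint M f \<Longrightarrow> sqint M (\<lambda>x. c * f x)"
  and sqint_uminus: "sqint M f \<Longrightarrow> sqint M (\<lambda>x. - f x)"
  and sqint_cnj: "sqint M f \<Longrightarrow> sqint M (\<lambda>x. cnj (f x))"
  and sqint_zero: "sqint M (\<lambda>x. 0)"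
  by (auto simp: sqint_def norm_mult power_mult_distrib)

lemma nsq_cmult: "nsq M (\<lambda>x. c * f x) = (cmod c)\<^sup>2 * nsq M f"
  and nsq_cnj: "nsq M (\<lambda>x. cnj (f x)) = nsq M f"
  by (auto simp: nsq_def norm_mult power_mult_distrib)

lemma nsq_commute: "nsq M (\<lambda>x. f x - g x) = nsq M (\<lambda>x. g x - f x)"
  by (simp add: nsq_def norm_minus_commute)

lemma sqint_diff:
  assumes "sqint M f" "sqint M g"
  shows "sqint M (\<lambda>x. f x - g x)" "nsq M (\<lambda>x. f x - g x) \<le> 2 * nsq M f + 2 * nsq M g"
  using sqint_add[OF assms(1) sqint_uminus[OF assms(2)]] by (simp_all add: nsq_def)

lemma nsq_triangle:
  assumes "sqint M f" "sqint M g" "sqint M h"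
  shows "nsq M (\<lambda>x. f x - h x) \<le> 2 * nsq M (\<lambda>x. f x - g x) + 2 * nsq M (\<lambda>x. g x - h x)"
  using sqint_add(2)[OF sqint_diff(1)[OF assms(1,2)] sqint_diff(1)[OF assms(2,3)]] by simp

lemma sqint_bdd_mult:
  assumes "sqint M f" "a \<in> borel_measurable M" "AE x in M. cmod (a x) \<le> C"
  shows "sqint M (\<lambda>x. a x * f x)" "nsq M (\<lambda>x. a x * f x) \<le> C\<^sup>2 * nsq M f"
proof -
  have m: "(\<lambda>x. a x * f x) \<in> borel_measurable M" using assms by (auto simp: sqint_def)
  have "AE x in M. cmod (a x * f x) \<le> C * cmod (f x)"
    using assms(3) by eventually_elim (auto simp: norm_mult intro: mult_right_mono)
  from sqint_dominated[OF assms(1) m this]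
  show "sqint M (\<lambda>x. a x * f x)" "nsq M (\<lambda>x. a x * f x) \<le> C\<^sup>2 * nsq M f" by auto
qed

section \<open>Pairings, Fatou, dominated convergence and completeness\<close>

lemma sqint_prod:
  assumes "sqint M f" "sqint M g"
  shows "integrable M (\<lambda>x. f x * g x)"
proof (rule Bochner_Integration.integrable_bound)
  show "integrable M (\<lambda>x. (cmod (f x))\<^sup>2 + (cmod (g x))\<^sup>2)" using assms by (auto simp: sqint_def)
  show "(\<lambda>x. f x * g x) \<in> borel_measurable M" using assms by (auto simp: sqint_def)
  have "a * b \<le> a\<^sup>2 + b\<^sup>2" if "0 \<le> a" "0 \<le> b" for a b :: real
    using sum_squares_bound[of a b] mult_nonneg_nonneg[OF that] by simp
  then show "AE x in M. norm (f x * g x) \<le> norm ((cmod (f x))\<^sup>2 + (cmod (g x))\<^sup>2)"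
    by (simp add: norm_mult)
qed

lemma cauchy_schwarz:
  assumes "sqint M f" "sqint M g"
  shows "(cmod (\<integral>x. f x * g x \<partial>M))\<^sup>2 \<le> nsq M f * nsq M g"
proof -
  have [measurable]: "f \<in> borel_measurable M" "g \<in> borel_measurable M"
    using assms by (auto simp: sqint_def)
  have "ennreal ((cmod (\<integral>x. f x * g x \<partial>M))\<^sup>2) = (ennreal (cmod (\<integral>x. f x * g x \<partial>M)))\<^sup>2"
    by (simp add: ennreal_power)
  also have "\<dots> \<le> (\<integral>\<^sup>+x. ennreal (cmod (f x * g x)) \<partial>M)\<^sup>2"
    by (intro power_mono integral_norm_bound_ennreal sqint_prod assms) auto
  also have "\<dots> = (\<integral>\<^sup>+x. ennreal (cmod (f x)) * ennreal (cmod (g x)) \<partial>M)\<^sup>2"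
    by (simp add: norm_mult ennreal_mult)
  also have "\<dots> \<le> (\<integral>\<^sup>+x. (ennreal (cmod (f x)))\<^sup>2 \<partial>M) * (\<integral>\<^sup>+x. (ennreal (cmod (g x)))\<^sup>2 \<partial>M)"
    by (rule Cauchy_Schwarz_nn_integral) auto
  also have "\<dots> = ennreal (nsq M f) * ennreal (nsq M g)"
    using assms by (simp add: ennreal_power nn_eq_nsq)
  also have "\<dots> = ennreal (nsq M f * nsq M g)" by (simp add: ennreal_mult nsq_nonneg)
  finally show ?thesis by (simp add: ennreal_le_iff nsq_nonneg)
qed

lemma nsq_eq_0_iff:
  assumes "sqint M f" shows "nsq M f = 0 \<longleftrightarrow> (AE x in M. f x = 0)"
  using integral_nonneg_eq_0_iff_AE[of M "\<lambda>x. (cmod (f x))\<^sup>2"] assms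
  by (auto simp: nsq_def sqint_def)

lemma nsq_diff_expand:
  assumes "sqint M f" "sqint M g"
  shows "nsq M (\<lambda>x. f x - g x) = nsq M f + nsq M g - 2 * Re (\<integral>x. f x * cnj (g x) \<partial>M)"
proof -
  have p: "(cmod (a - b))\<^sup>2 = (cmod a)\<^sup>2 + (cmod b)\<^sup>2 - 2 * Re (a * cnj b)" for a b
    unfolding cmod_power2 by (simp add: power2_eq_square algebra_simps)
  have i: "integrable M (\<lambda>x. f x * cnj (g x))" using sqint_prod[OF assms(1) sqint_cnj[OF assms(2)]] .
  have "nsq M (\<lambda>x. f x - g x)
     = (\<integral>x. ((cmod (f x))\<^sup>2 + (cmod (g x))\<^sup>2) - 2 * Re (f x * cnj (g x)) \<partial>M)"
    unfolding nsq_def p ..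
  also have "\<dots> = nsq M f + nsq M g - 2 * Re (\<integral>x. f x * cnj (g x) \<partial>M)"
    using assms i integrable_Re[OF i] integral_Re[OF i] unfolding nsq_def sqint_def
    by (simp del: times_complex.sel)
  finally show ?thesis .
qed

text \<open>Cauchy-Schwarz for \<open>f n - g\<close> against \<open>h\<close>. Through it,
  identities tested against fixed square-integrable functions pass to limits.\<close>

lemma tendsto_integral_mult:
  assumes fn: "\<And>n. sqint M (f n)" and f: "sqint M g" and h: "sqint M h"
    and lim: "(\<lambda>n. nsq M (\<lambda>x. f n x - g x)) \<longlonglongrightarrow> 0"
  shows "(\<lambda>n. \<integral>x. f n x * h x \<partial>M) \<longlonglongrightarrow> (\<integral>x. g x * h x \<partial>M)"
proof -
  have d: "(\<integral>x. f n x * h x \<partial>M) - (\<integral>x. g x * h x \<partial>M) = (\<integral>x. (f n x - g x) * h x \<partial>M)" for n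
    using sqint_prod[OF fn h] sqint_prod[OF f h] by (simp add: left_diff_distrib)
  have "(\<lambda>n. (cmod ((\<integral>x. f n x * h x \<partial>M) - (\<integral>x. g x * h x \<partial>M)))\<^sup>2) \<longlonglongrightarrow> 0"
  proof (rule tendsto_sandwich[OF _ _ tendsto_const])
    show "\<forall>\<^sub>F n in sequentially. (cmod ((\<integral>x. f n x * h x \<partial>M) - (\<integral>x. g x * h x \<partial>M)))\<^sup>2
        \<le> nsq M (\<lambda>x. f n x - g x) * nsq M h"
      unfolding d by (intro always_eventually allI cauchy_schwarz sqint_diff fn f h)
    show "(\<lambda>n. nsq M (\<lambda>x. f n x - g x) * nsq M h) \<longlonglongrightarrow> 0" using tendsto_mult_right[OF lim, of "nsq M h"] by simp
  qed auto
  then have "(\<lambda>n. cmod ((\<integral>x. f n x * h x \<partial>M) - (\<integral>x. g x * h x \<partial>M))) \<longlonglongrightarrow> 0"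
    using tendsto_real_sqrt by fastforce
  then show ?thesis by (simp add: tendsto_norm_zero_iff LIM_zero_iff)
qed

text \<open>Expanding the squared norm of \<open>f n - g\<close> expresses
  \<open>nsq M (f n)\<close> by that quantity and a cross term, and the cross term converges because
  it is a pairing with a fixed function.\<close>

lemma tendsto_nsq:
  assumes fn: "\<And>n. sqint M (f n)" and f: "sqint M g"
    and lim: "(\<lambda>n. nsq M (\<lambda>x. f n x - g x)) \<longlonglongrightarrow> 0"
  shows "(\<lambda>n. nsq M (f n)) \<longlonglongrightarrow> nsq M g"
proof -
  have e: "nsq M (f n) = nsq M (\<lambda>x. f n x - g x) - nsq M g + 2 * Re (\<integral>x. f n x * cnj (g x) \<partial>M)" for n
    using nsq_diff_expand[OF fn f, of n] by simp
  have g2: "(\<integral>x. g x * cnj (g x) \<partial>M) = complex_of_real (nsq M g)"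
    unfolding nsq_def by (simp add: complex_norm_square[symmetric] del: of_real_power)
  have "(\<lambda>n. nsq M (\<lambda>x. f n x - g x) - nsq M g + 2 * Re (\<integral>x. f n x * cnj (g x) \<partial>M))
      \<longlonglongrightarrow> 0 - nsq M g + 2 * Re (\<integral>x. g x * cnj (g x) \<partial>M)"
    by (intro tendsto_intros lim tendsto_integral_mult fn f sqint_cnj)
  then show ?thesis unfolding e g2 by simp
qed

text \<open>Turns a uniform bound along an almost everywhere convergent sequence into square
  integrability of the limit. Completeness, Bessel's inequality after removal of the damping, and
  the lower Plancherel bound all end with it.\<close>

lemma nsq_fatou:
  assumes h: "\<And>k. sqint M (h k)" and B: "\<And>k::nat. nsq M (h k) \<le> B"
    and lim: "AE x in M. (\<lambda>k. h k x) \<longlonglongrightarrow> g x" and g: "g \<in> borel_measurable M"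
  shows "sqint M g" "nsq M g \<le> B"
proof -
  have [measurable]: "g \<in> borel_measurable M" "\<And>k. h k \<in> borel_measurable M"
    using g h by (auto simp: sqint_def)
  have B0: "0 \<le> B" using B[of 0] nsq_nonneg[of M "h 0"] by linarith
  have "(\<integral>\<^sup>+x. ennreal ((cmod (g x))\<^sup>2) \<partial>M) \<le> (\<integral>\<^sup>+x. liminf (\<lambda>k. ennreal ((cmod (h k x))\<^sup>2)) \<partial>M)"
  proof (rule nn_integral_mono_AE)
    show "AE x in M. ennreal ((cmod (g x))\<^sup>2) \<le> liminf (\<lambda>k. ennreal ((cmod (h k x))\<^sup>2))"
      using lim
    proof eventually_elim
      case (elim x)
      have "(\<lambda>k. ennreal ((cmod (h k x))\<^sup>2)) \<longlonglongrightarrow> ennreal ((cmod (g x))\<^sup>2)"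
        by (intro tendsto_ennrealI tendsto_intros elim)
      from lim_imp_Liminf[OF _ this] show ?case by simp
    qed
  qed
  also have "\<dots> \<le> liminf (\<lambda>k. \<integral>\<^sup>+x. ennreal ((cmod (h k x))\<^sup>2) \<partial>M)"
    by (rule nn_integral_liminf) auto
  also have "\<dots> \<le> liminf (\<lambda>k. ennreal B)"
    by (rule Liminf_mono) (auto simp: nn_eq_nsq[OF h] intro!: always_eventually ennreal_leI B)
  also have "\<dots> = ennreal B" by (simp add: Liminf_const)
  finally have *: "(\<integral>\<^sup>+x. ennreal ((cmod (g x))\<^sup>2) \<partial>M) \<le> ennreal B" .
  then show s: "sqint M g" unfolding sqint_iff_nn using g by (auto simp: le_less_trans)
  show "nsq M g \<le> B" using * unfolding nn_eq_nsq[OF s] by (simp add: B0)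
qed

lemma nsq_dominated_convergence:
  assumes f: "\<And>n::nat. f n \<in> borel_measurable M" and w: "sqint M w"
    and dom: "\<And>n. AE x in M. cmod (f n x) \<le> cmod (w x)"
    and lim: "AE x in M. (\<lambda>n. f n x) \<longlonglongrightarrow> g x" and g: "g \<in> borel_measurable M"
  shows "sqint M g" "(\<lambda>n. nsq M (\<lambda>x. f n x - g x)) \<longlonglongrightarrow> 0"
proof -
  have [measurable]: "g \<in> borel_measurable M" "\<And>k. f k \<in> borel_measurable M" "w \<in> borel_measurable M"
    using f g w by (auto simp: sqint_def)
  have fs: "sqint M (f n)" "nsq M (f n) \<le> nsq M w" for n
    using sqint_dominated[OF w f, of n 1] dom[of n] by auto
  show gs: "sqint M g" using nsq_fatou[of M f, OF fs(1) fs(2) lim g] by auto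
  have gw: "AE x in M. cmod (g x) \<le> cmod (w x)"
  proof -
    have "AE x in M. \<forall>n. cmod (f n x) \<le> cmod (w x)" using dom by (simp add: AE_all_countable)
    with lim show ?thesis
    proof eventually_elim
      case (elim x)
      show ?case by (rule LIMSEQ_le_const2[OF tendsto_norm[OF elim(1)]]) (use elim in auto)
    qed
  qed
  have "(\<lambda>n. \<integral>x. (cmod (f n x - g x))\<^sup>2 \<partial>M) \<longlonglongrightarrow> (\<integral>x. 0 \<partial>M)"
  proof (rule integral_dominated_convergence[where w = "\<lambda>x. 4 * (cmod (w x))\<^sup>2"])
    show "integrable M (\<lambda>x. 4 * (cmod (w x))\<^sup>2)" using w by (auto simp: sqint_def)
    show "AE x in M. (\<lambda>n. (cmod (f n x - g x))\<^sup>2) \<longlonglongrightarrow> 0"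
      using lim
    proof eventually_elim
      case (elim x)
      have "(\<lambda>n. (cmod (f n x - g x))\<^sup>2) \<longlonglongrightarrow> (cmod (g x - g x))\<^sup>2" by (intro tendsto_intros elim)
      then show ?case by simp
    qed
    show "AE x in M. norm ((cmod (f n x - g x))\<^sup>2) \<le> 4 * (cmod (w x))\<^sup>2" for n
      using dom[of n] gw
    proof eventually_elim
      case (elim x)
      have "cmod (f n x - g x) \<le> 2 * cmod (w x)" using elim norm_triangle_ineq4[of "f n x" "g x"] by linarith
      then have "(cmod (f n x - g x))\<^sup>2 \<le> (2 * cmod (w x))\<^sup>2" by (intro power_mono) auto
      then show ?case by simp
    qed
  qed auto
  then show "(\<lambda>n. nsq M (\<lambda>x. f n x - g x)) \<longlonglongrightarrow> 0" by (simp add: nsq_def)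
qed

lemma nsq_limit_AE_subseq:
  assumes fn: "\<And>n. sqint M (f n)" and g: "sqint M g"
    and lim: "(\<lambda>n. nsq M (\<lambda>x. f n x - g x)) \<longlonglongrightarrow> 0"
  obtains r :: "nat \<Rightarrow> nat" where "strict_mono r" "AE x in M. (\<lambda>n. f (r n) x) \<longlonglongrightarrow> g x"
proof -
  have "integrable M (\<lambda>x. (cmod (f n x - g x))\<^sup>2)" for n
    using sqint_diff(1)[OF fn g] by (simp add: sqint_def)
  moreover have "(\<lambda>n. \<integral>x. norm ((cmod (f n x - g x))\<^sup>2) \<partial>M) \<longlonglongrightarrow> 0" using lim by (simp add: nsq_def)
  ultimately obtain r where r: "strict_mono r" and ae: "AE x in M. (\<lambda>n. (cmod (f (r n) x - g x))\<^sup>2) \<longlonglongrightarrow> 0"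
    using tendsto_L1_AE_subseq[of M "\<lambda>n x. (cmod (f n x - g x))\<^sup>2"] by blast
  have "AE x in M. (\<lambda>n. f (r n) x) \<longlonglongrightarrow> g x"
    using ae
  proof eventually_elim
    case (elim x)
    then have "(\<lambda>n. cmod (f (r n) x - g x)) \<longlonglongrightarrow> 0" using tendsto_real_sqrt by fastforce
    then show ?case by (simp add: tendsto_norm_zero_iff LIM_zero_iff)
  qed
  with r that show ?thesis by blast
qed

lemma nsq_limit_AE_unique:
  assumes "\<And>n. sqint M (f n)" "sqint M g"
    and "(\<lambda>n. nsq M (\<lambda>x. f n x - g x)) \<longlonglongrightarrow> 0" and "AE x in M. (\<lambda>n. f n x) \<longlonglongrightarrow> h x"
  shows "AE x in M. g x = h x"
proof -
  obtain r where r: "strict_mono r" "AE x in M. (\<lambda>n. f (r n) x) \<longlonglongrightarrow> g x"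
    using nsq_limit_AE_subseq assms(1-3) by blast
  show ?thesis using r(2) assms(4)
  proof eventually_elim
    case (elim x)
    then show ?case using LIMSEQ_subseq_LIMSEQ[OF elim(2) r(1)] LIMSEQ_unique by (auto simp: o_def)
  qed
qed

text \<open>Riesz-Fischer on an arbitrary measure: a rapidly Cauchy subsequence converges almost
  everywhere, and Fatou turns the Cauchy estimate into convergence of the whole sequence.\<close>

lemma nsq_complete:
  assumes fn: "\<And>n. sqint M (f n)"
    and cau: "\<And>e. e > 0 \<Longrightarrow> \<exists>N. \<forall>m\<ge>N. \<forall>n\<ge>N. nsq M (\<lambda>x. f m x - f n x) < e"
  obtains g where "sqint M g" "(\<lambda>n. nsq M (\<lambda>x. f n x - g x)) \<longlonglongrightarrow> 0"
proof -
  have [measurable]: "\<And>k. f k \<in> borel_measurable M" using fn by (auto simp: sqint_def)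
  have "\<exists>N. \<forall>m\<ge>N. \<forall>n\<ge>N. nsq M (\<lambda>x. f m x - f n x) < (1/4)^k" for k
    by (rule cau) auto
  then obtain N where N: "\<And>k m n. N k \<le> m \<Longrightarrow> N k \<le> n \<Longrightarrow> nsq M (\<lambda>x. f m x - f n x) < (1/4)^k"
    by metis
  \<comment> \<open>Summing all \<open>N i\<close> up to \<open>k\<close> gives a monotone index
    that lies beyond \<open>N k\<close>; the extra \<open>k\<close> ensures
    \<open>k \<le> r k\<close>, so that the subsequence passes every threshold.\<close>
  define r where "r k = (\<Sum>i\<le>k. N i) + k" for k
  have rN: "N k \<le> r k" for k unfolding r_def
    using sum_nonneg_leq_bound[of "{..k}" N "\<Sum>i\<le>k. N i" k] by simp
  have rS: "r k \<le> r (Suc k)" for k by (simp add: r_def)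
  define d where "d k x = cmod (f (r (Suc k)) x - f (r k) x)" for k x
  have [measurable]: "d k \<in> borel_measurable M" for k unfolding d_def by simp
  \<comment> \<open>The squared increments have integral below \<open>(1/4)^k\<close>, so the weight
    \<open>2^k\<close> still leaves a summable series of integrals.\<close>
  have dk: "(\<integral>\<^sup>+x. ennreal (2^k * (d k x)\<^sup>2) \<partial>M) \<le> ennreal ((1/2)^k)" for k
  proof -
    have "(\<integral>\<^sup>+x. ennreal (2^k * (d k x)\<^sup>2) \<partial>M) = ennreal (2^k) * (\<integral>\<^sup>+x. ennreal ((d k x)\<^sup>2) \<partial>M)"
      by (subst nn_integral_cmult[symmetric]) (auto simp: ennreal_mult)
    also have "\<dots> = ennreal (2^k) * ennreal (nsq M (\<lambda>x. f (r (Suc k)) x - f (r k) x))"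
      unfolding d_def by (subst nn_eq_nsq) (auto intro: sqint_diff fn)
    also have "\<dots> \<le> ennreal (2^k) * ennreal ((1/4)^k)"
      by (intro mult_left_mono ennreal_leI less_imp_le[OF N] rN order_trans[OF rN rS]) auto
    also have "\<dots> = ennreal ((1/2)^k)"
      by (simp add: ennreal_mult[symmetric] power_mult_distrib[symmetric])
    finally show ?thesis .
  qed
  have "(\<integral>\<^sup>+x. (\<Sum>k. ennreal (2^k * (d k x)\<^sup>2)) \<partial>M) = (\<Sum>k. \<integral>\<^sup>+x. ennreal (2^k * (d k x)\<^sup>2) \<partial>M)"
    by (rule nn_integral_suminf) auto
  also have "\<dots> \<le> (\<Sum>k. ennreal ((1/2)^k))" by (intro suminf_le dk) auto
  also have "\<dots> = ennreal (\<Sum>k. (1/2)^k)" by (rule suminf_ennreal2) (auto intro: summable_geometric)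
  finally have "(\<integral>\<^sup>+x. (\<Sum>k. ennreal (2^k * (d k x)\<^sup>2)) \<partial>M) \<noteq> \<infinity>" by (auto simp: top_unique)
  then have "AE x in M. (\<Sum>k. ennreal (2^k * (d k x)\<^sup>2)) \<noteq> \<infinity>"
    by (intro nn_integral_PInf_AE) auto
  then have conv: "AE x in M. convergent (\<lambda>k. f (r k) x)"
  proof eventually_elim
    case (elim x)
    have s: "summable (\<lambda>k. 2^k * (d k x)\<^sup>2)" by (rule summable_suminf_not_top) (use elim in auto)
    have "summable (\<lambda>k. 2^k * (d k x)\<^sup>2 + (1/2)^k)" by (intro summable_add s summable_geometric) auto
    moreover have "norm (f (r (Suc k)) x - f (r k) x) \<le> 2^k * (d k x)\<^sup>2 + (1/2)^k" for k
    proof -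
      \<comment> \<open>This square yields \<open>2 * d \<le> 2^k * d^2 + (1/2)^k\<close>, by which
        summability of the weighted squares gives summability of the increments themselves, on
        spaces of infinite measure too.\<close>
      have "0 \<le> (2^k * d k x - 1)\<^sup>2" by simp
      also have "\<dots> = (2^k)\<^sup>2 * (d k x)\<^sup>2 - 2 * 2^k * d k x + 1" by (simp add: power2_diff power_mult_distrib)
      finally have "2^k * (2 * d k x) \<le> 2^k * (2^k * (d k x)\<^sup>2 + (1/2)^k)"
        by (simp add: power2_eq_square algebra_simps power_mult_distrib[symmetric])
      then have "2 * d k x \<le> 2^k * (d k x)\<^sup>2 + (1/2)^k" by (subst (asm) mult_le_cancel_left_pos) auto
      moreover have "0 \<le> d k x" by (simp add: d_def)
      ultimately have "d k x \<le> 2^k * (d k x)\<^sup>2 + (1/2)^k" by linarith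
      then show ?thesis by (simp add: d_def)
    qed
    ultimately have "summable (\<lambda>k. f (r (Suc k)) x - f (r k) x)"
      by (rule summable_comparison_test'[where N = 0])
    then have "convergent (\<lambda>n. \<Sum>k<n. f (r (Suc k)) x - f (r k) x)"
      by (simp add: summable_iff_convergent)
    then have "convergent (\<lambda>n. f (r n) x - f (r 0) x)"
      by (simp only: sum_lessThan_telescope[of "\<lambda>k. f (r k) x"])
    then show ?case using convergent_diff_const_right_iff[of "\<lambda>n. f (r n) x" "f (r 0) x"] by blast
  qed
  define g where "g x = lim (\<lambda>k. f (r k) x)" for x
  have [measurable]: "g \<in> borel_measurable M" unfolding g_def by (rule borel_measurable_lim_metric) simp
  have lim: "AE x in M. (\<lambda>k. f (r k) x) \<longlonglongrightarrow> g x"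
    using conv by eventually_elim (simp add: g_def convergent_LIMSEQ_iff)
  have r_ge: "k \<le> r k" for k by (simp add: r_def)
  \<comment> \<open>Fatou along the subsequence: the bound \<open>e\<close>, valid for all pairs of
    large indices, survives when one index tends to infinity.\<close>
  have main: "sqint M (\<lambda>x. g x - f n x) \<and> nsq M (\<lambda>x. g x - f n x) \<le> e"
    if e: "\<forall>m\<ge>K. \<forall>n\<ge>K. nsq M (\<lambda>x. f m x - f n x) < e" and n: "n \<ge> K" for n K e
  proof -
    have 1: "sqint M (\<lambda>x. f (r (k + K)) x - f n x)" for k by (intro sqint_diff fn)
    have 2: "nsq M (\<lambda>x. f (r (k + K)) x - f n x) \<le> e" for k
      using less_imp_le[OF e[rule_format, OF order_trans[OF le_add2 r_ge[of "k+K"]] n]] .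
    have 3: "AE x in M. (\<lambda>k. f (r (k + K)) x - f n x) \<longlonglongrightarrow> g x - f n x"
      using lim
    proof eventually_elim
      case (elim x)
      show ?case by (rule tendsto_diff[OF LIMSEQ_ignore_initial_segment[OF elim] tendsto_const])
    qed
    show ?thesis using nsq_fatou[of M "\<lambda>k x. f (r (k + K)) x - f n x", OF 1 2 3] by auto
  qed
  obtain K where K: "\<forall>m\<ge>K. \<forall>n\<ge>K. nsq M (\<lambda>x. f m x - f n x) < 1" using cau[of 1] by auto
  have "sqint M (\<lambda>x. (g x - f K x) + f K x)" using main[OF K order_refl] by (intro sqint_add fn) auto
  then have g: "sqint M g" by simp
  have "(\<lambda>n. nsq M (\<lambda>x. f n x - g x)) \<longlonglongrightarrow> 0"
  proof (rule LIMSEQ_I)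
    fix e :: real assume "e > 0"
    then obtain K where K: "\<forall>m\<ge>K. \<forall>n\<ge>K. nsq M (\<lambda>x. f m x - f n x) < e/2" using cau[of "e/2"] by auto
    have "norm (nsq M (\<lambda>x. f n x - g x) - 0) < e" if "n \<ge> K" for n
      using main[OF K that] \<open>e > 0\<close> nsq_nonneg[of M "\<lambda>x. f n x - g x"] by (auto simp: nsq_commute[of M "f n"])
    then show "\<exists>no. \<forall>n\<ge>no. norm (nsq M (\<lambda>x. f n x - g x) - 0) < e" by blast
  qed
  with g that show ?thesis by blast
qed

section \<open>Lebesgue points and kernels dominated by the Poisson kernel\<close>

lemma ident_borel_measurable_lebesgue [measurable (raw)]: "(\<lambda>x::real. x) \<in> borel_measurable lebesgue"
  by (rule measurable_completion) simp

text \<open>On a bounded interval \<open>cmod (f y)\<close> is dominated by its square plus a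
  constant. The shift by \<open>c\<close> is present because Lebesgue points concern
  \<open>f - c\<close> for many values of \<open>c\<close>.\<close>

lemma sqint_set_integrable:
  assumes f: "sqint lebesgue f"
  shows "set_integrable lebesgue {a..b::real} (\<lambda>y. f y - c)"
proof -
  have [measurable]: "f \<in> borel_measurable lebesgue" using f by (simp add: sqint_def)
  have i: "integrable lebesgue (\<lambda>y. (cmod (f y))\<^sup>2 + (1 + cmod c) * indicator {a..b} y)"
    using f by (auto simp: sqint_def intro!: Bochner_Integration.integrable_add integrable_mult_right
      integrable_real_indicator simp: emeasure_lborel_Icc_eq)
  show ?thesis unfolding set_integrable_def
  proof (rule Bochner_Integration.integrable_bound[OF i], measurable)
    show "AE y in lebesgue. norm (indicator {a..b} y *\<^sub>R (f y - c))
       \<le> norm ((cmod (f y))\<^sup>2 + (1 + cmod c) * indicator {a..b} y)"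
    proof (rule AE_I2)
      fix y
      have "2 * cmod (f y) \<le> (cmod (f y))\<^sup>2 + 1" using sum_squares_bound[of "cmod (f y)" 1] by simp
      then have "cmod (f y - c) \<le> (cmod (f y))\<^sup>2 + (1 + cmod c)"
        using norm_triangle_ineq4[of "f y" c] norm_ge_zero[of "f y"] by linarith
      then show "norm (indicator {a..b} y *\<^sub>R (f y - c))
         \<le> norm ((cmod (f y))\<^sup>2 + (1 + cmod c) * indicator {a..b} y)"
        by (auto simp: indicator_def)
    qed
  qed
qed

lemma nn_integral_interval_eq:
  assumes "set_integrable lebesgue {a..b::real} g" "\<And>y. 0 \<le> g y"
  shows "(\<integral>\<^sup>+y\<in>{a..b}. ennreal (g y) \<partial>lebesgue) = ennreal (integral {a..b} g)"
proof -
  have "(\<integral>\<^sup>+y\<in>{a..b}. ennreal (g y) \<partial>lebesgue) = (\<integral>\<^sup>+y. ennreal (indicator {a..b} y *\<^sub>R g y) \<partial>lebesgue)"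
    by (intro nn_integral_cong) (auto simp: indicator_def)
  also have "\<dots> = ennreal (\<integral>y. indicator {a..b} y *\<^sub>R g y \<partial>lebesgue)"
    using assms by (intro nn_integral_eq_integral) (auto simp: set_integrable_def)
  also have "\<dots> = ennreal (integral {a..b} g)"
    using set_lebesgue_integral_eq_integral(2)[OF assms(1)] by (simp add: set_lebesgue_integral_def)
  finally show ?thesis .
qed

text \<open>Lebesgue differentiation for intervals that start at \<open>x\<close>, kept as an upper
  bound only. The intervals that end at \<open>x\<close> are reached below by reflecting the
  line.\<close>

lemma integral_mean_AE:
  fixes g :: "real \<Rightarrow> real"
  assumes "\<And>a b. set_integrable lebesgue {a..b} g"
  shows "AE x in lebesgue. \<forall>e>0. \<exists>d>0. \<forall>h. 0 < h \<and> h < d \<longrightarrow>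
      integral {x..x+h} g \<le> (g x + e) * h"
proof -
  have "g integrable_on cbox a b" for a b
    using set_lebesgue_integral_eq_integral(1)[OF assms, of a b] by simp
  then obtain N where N: "negligible N" and d: "\<And>x e. \<lbrakk>x \<notin> N; 0 < e\<rbrakk> \<Longrightarrow>
               \<exists>d>0. \<forall>h. 0 < h \<and> h < d \<longrightarrow>
                         norm(integral (cbox x (x + h *\<^sub>R One)) g /\<^sub>R h ^ DIM(real) - g x) < e"
    using integrable_ccontinuous_explicit[of g] by blast
  have "AE x in lebesgue. x \<notin> N" using N by (simp add: negligible_iff_null_sets AE_not_in)
  then show ?thesis
  proof eventually_elim
    case (elim x)
    show ?case
    proof (intro allI impI)
      fix e :: real assume "e > 0"
      from d[OF elim this] obtain d where d: "d > 0"
        "\<And>h. 0 < h \<Longrightarrow> h < d \<Longrightarrow> \<bar>integral {x..x+h} g / h - g x\<bar> < e"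
        by (auto simp: divide_inverse mult.commute)
      have "integral {x..x+h} g \<le> (g x + e) * h" if "0 < h" "h < d" for h
        using d(2)[OF that] that by (auto simp: abs_less_iff field_simps)
      with d(1) show "\<exists>d>0. \<forall>h. 0 < h \<and> h < d \<longrightarrow> integral {x..x+h} g \<le> (g x + e) * h" by blast
    qed
  qed
qed

lemma AE_lebesgue_reflect:
  assumes "AE x in lebesgue. P (x::real)"
  shows "AE x in lebesgue. P (- x)"
proof -
  have e: "lebesgue = distr lebesgue lebesgue (\<lambda>x::real. - x)"
    using lebesgue_real_affine[of "-1" 0] by (simp add: density_1)
  have m: "(\<lambda>x::real. - x) \<in> measurable lebesgue lebesgue"
    using lebesgue_affine_measurable[of "\<lambda>_. -1" "0::real"] by simp
  have "AE x in distr lebesgue lebesgue (\<lambda>x::real. - x). P x" by (subst e[symmetric]) (rule assms)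
  then show ?thesis by (rule AE_distrD[OF m])
qed

lemma integral_mean_AE_symmetric:
  fixes g :: "real \<Rightarrow> real"
  assumes g: "\<And>a b. set_integrable lebesgue {a..b} g"
  shows "AE x in lebesgue. \<forall>e>0. \<exists>d>0. \<forall>h. 0 < h \<and> h < d \<longrightarrow>
      integral {x-h..x+h} g \<le> (2 * g x + e) * h"
proof -
  have on: "g integrable_on {a..b}" for a b
    using set_lebesgue_integral_eq_integral(1)[OF g, of a b] .
  have "set_integrable lebesgue {a..b} (\<lambda>y. g (- y))" for a b
  proof -
    have "(\<lambda>y. indicator {-b..-a} y *\<^sub>R g y) \<in> borel_measurable lebesgue"
      using g[of "-b" "-a"] by (auto simp: set_integrable_def)
    then have "integrable lebesgue (\<lambda>y. indicator {-b..-a} (0 + -1 * y) *\<^sub>R g (0 + -1 * y))"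
      using g[of "-b" "-a"] unfolding set_integrable_def
      using lebesgue_real_affine[of "-1" 0] lebesgue_affine_measurable[of "\<lambda>_. -1" "0::real"]
      by (intro integrable_distr[where M = lebesgue and M' = lebesgue and T = "\<lambda>y. 0 + -1 * y"])
         (auto simp: density_1)
    moreover have "indicator {-b..-a} (- y) = (indicator {a..b} y :: real)" for y :: real
      by (auto simp: indicator_def)
    ultimately show ?thesis by (simp add: set_integrable_def)
  qed
  from AE_lebesgue_reflect[OF integral_mean_AE[OF this]] integral_mean_AE[OF g]
  show ?thesis
  proof eventually_elim
    case (elim x)
    show ?case
    proof (intro allI impI)
      fix e :: real assume e: "e > 0"
      obtain d1 where d1: "d1 > 0" "\<And>h. 0 < h \<Longrightarrow> h < d1 \<Longrightarrow> integral {-x..-x+h} (\<lambda>y. g (- y)) \<le> (g x + e/2) * h"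
        using elim(1)[rule_format, of "e/2"] e by auto
      obtain d2 where d2: "d2 > 0" "\<And>h. 0 < h \<Longrightarrow> h < d2 \<Longrightarrow> integral {x..x+h} g \<le> (g x + e/2) * h"
        using elim(2)[rule_format, of "e/2"] e by auto
      have "integral {x-h..x+h} g \<le> (2 * g x + e) * h" if h: "0 < h" "h < min d1 d2" for h
      proof -
        have "integral {x-h..x+h} g = integral {x-h..x} g + integral {x..x+h} g"
          using h by (intro Henstock_Kurzweil_Integration.integral_combine[symmetric] on) auto
        also have "integral {x-h..x} g = integral {-x..-x+h} (\<lambda>y. g (- y))"
          using Henstock_Kurzweil_Integration.integral_reflect_real[of "x" "x-h" g] by (simp add: add.commute)
        finally show ?thesis using d1(2)[of h] d2(2)[of h] h by (simp add: algebra_simps)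
      qed
      then show "\<exists>d>0. \<forall>h. 0 < h \<and> h < d \<longrightarrow> integral {x-h..x+h} g \<le> (2 * g x + e) * h"
        using d1 d2 by (intro exI[of _ "min d1 d2"]) auto
    qed
  qed
qed

text \<open>The nonnegative integral avoids any integrability side condition inside the definition,
  and the length \<open>2 * r\<close> of the interval is absorbed into the arbitrary
  \<open>e\<close>.\<close>

definition leb_point :: "(real \<Rightarrow> complex) \<Rightarrow> real \<Rightarrow> bool" where
  "leb_point f x \<longleftrightarrow> (\<forall>e>0. \<exists>d>0. \<forall>r. 0 < r \<and> r < d \<longrightarrow>
     (\<integral>\<^sup>+y\<in>{x-r..x+r}. ennreal (cmod (f y - f x)) \<partial>lebesgue) \<le> ennreal (e * r))"

text \<open>The averages of \<open>cmod (f y - q)\<close> are controlled off a null set depending on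
  \<open>q\<close>; letting \<open>q\<close> range over a countable dense set leaves a single null
  set, and the value \<open>f x\<close> is then approximated by some \<open>q\<close>.\<close>

lemma AE_leb_point:
  assumes f: "sqint lebesgue f"
  shows "AE x in lebesgue. leb_point f x"
proof -
  obtain Q :: "complex set" where Q: "countable Q" "\<And>S. open S \<Longrightarrow> S \<noteq> {} \<Longrightarrow> \<exists>q\<in>Q. q \<in> S"
    using countable_dense_setE by blast
  have si: "set_integrable lebesgue {a..b} (\<lambda>y. cmod (f y - q))" for a b q
    by (rule set_integrable_norm[OF sqint_set_integrable[OF f]])
  have "AE x in lebesgue. \<forall>q\<in>Q. \<forall>e>0. \<exists>d>0. \<forall>h. 0 < h \<and> h < d \<longrightarrow>
      integral {x-h..x+h} (\<lambda>y. cmod (f y - q)) \<le> (2 * cmod (f x - q) + e) * h"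
    unfolding AE_ball_countable[OF Q(1)] by (intro ballI integral_mean_AE_symmetric si)
  then show ?thesis
  proof eventually_elim
    case (elim x)
    show ?case unfolding leb_point_def
    proof (intro allI impI)
      fix e :: real assume e: "e > 0"
      \<comment> \<open>With \<open>e/8\<close> for the distance and \<open>e/4\<close> in the
        average, the total is at most \<open>(4 * (e/8) + e/4) * r\<close>, which is below
        \<open>e * r\<close>.\<close>
      obtain q where q: "q \<in> Q" "q \<in> ball (f x) (e/8)" using Q(2)[of "ball (f x) (e/8)"] e by auto
      then have fq: "cmod (f x - q) < e/8" by (simp add: dist_norm)
      obtain d where d: "d > 0" "\<And>h. 0 < h \<Longrightarrow> h < d \<Longrightarrow>
          integral {x-h..x+h} (\<lambda>y. cmod (f y - q)) \<le> (2 * cmod (f x - q) + e/4) * h"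
        using elim[rule_format, OF q(1), of "e/4"] e by auto
      have "(\<integral>\<^sup>+y\<in>{x-r..x+r}. ennreal (cmod (f y - f x)) \<partial>lebesgue) \<le> ennreal (e * r)"
        if r: "0 < r" "r < d" for r
      proof -
        have o: "(\<lambda>y. cmod (f y - c)) integrable_on {x-r..x+r}" for c
          using set_lebesgue_integral_eq_integral(1)[OF si] .
        have "integral {x-r..x+r} (\<lambda>y. cmod (f y - f x))
            \<le> integral {x-r..x+r} (\<lambda>y. cmod (f y - q) + cmod (f x - q))"
        proof (rule integral_le[OF o])
          show "(\<lambda>y. cmod (f y - q) + cmod (f x - q)) integrable_on {x-r..x+r}"
            by (intro Henstock_Kurzweil_Integration.integrable_add o integrable_const_ivl)
          show "cmod (f y - f x) \<le> cmod (f y - q) + cmod (f x - q)" for y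
            using norm_triangle_ineq4[of "f y - q" "f x - q"] by simp
        qed
        also have "\<dots> = integral {x-r..x+r} (\<lambda>y. cmod (f y - q)) + 2 * r * cmod (f x - q)"
          using r by (subst Henstock_Kurzweil_Integration.integral_add[OF o integrable_const_ivl]) auto
        also have "\<dots> \<le> (2 * cmod (f x - q) + e/4) * r + 2 * r * cmod (f x - q)" using d(2) r by auto
        also have "\<dots> = (4 * cmod (f x - q) + e/4) * r" by (simp add: algebra_simps)
        also have "\<dots> \<le> e * r" using fq r e by (intro mult_right_mono) linarith+
        finally show ?thesis by (subst nn_integral_interval_eq[OF si]) (auto intro: ennreal_leI)
      qed
      with d(1) show "\<exists>d>0. \<forall>r. 0 < r \<and> r < d \<longrightarrow>
         (\<integral>\<^sup>+y\<in>{x-r..x+r}. ennreal (cmod (f y - f x)) \<partial>lebesgue) \<le> ennreal (e * r)" by blast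
    qed
  qed
qed

text \<open>Square integrability bounds the integral over large radii by a constant plus a multiple
  of \<open>r\<close>, and \<open>sqrt (r / r0) \<ge> 1\<close> there lets one formula serve all
  radii. The growth of order \<open>r * sqrt r\<close> is still beaten by the inverse square decay
  of the Poisson kernel, while the coefficient \<open>e\<close> for small radii is not
  spoiled.\<close>

lemma leb_point_global:
  assumes f: "sqint lebesgue f" and x: "leb_point f x" and e: "e > 0"
  obtains r0 B where "r0 > 0" "B \<ge> 0" "\<And>r. r > 0 \<Longrightarrow>
    (\<integral>\<^sup>+y\<in>{x-r..x+r}. ennreal (cmod (f y - f x)) \<partial>lebesgue) \<le> ennreal (r * (e + B * sqrt (r / r0)))"
proof -
  obtain d where d: "d > 0" "\<And>r. 0 < r \<Longrightarrow> r < d \<Longrightarrow>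
     (\<integral>\<^sup>+y\<in>{x-r..x+r}. ennreal (cmod (f y - f x)) \<partial>lebesgue) \<le> ennreal (e * r)"
    using x e unfolding leb_point_def by blast
  \<comment> \<open>For \<open>r \<ge> d\<close> the first summand times \<open>r\<close> exceeds
    the squared norm, and the second times \<open>r\<close> is exactly
    \<open>(1 + cmod (f x)) * (2 * r)\<close>.\<close>
  define B where "B = nsq lebesgue f / d + 2 * (1 + cmod (f x))"
  have B: "B \<ge> 0" using d(1) by (auto simp: B_def nsq_nonneg)
  have [measurable]: "f \<in> borel_measurable lebesgue" using f by (simp add: sqint_def)
  have "(\<integral>\<^sup>+y\<in>{x-r..x+r}. ennreal (cmod (f y - f x)) \<partial>lebesgue) \<le> ennreal (r * (e + B * sqrt (r / d)))"
    if r: "r > 0" for r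
  proof (cases "r < d")
    case True
    have "e * r \<le> r * (e + B * sqrt (r / d))" using r B d(1) by (auto simp: algebra_simps)
    with d(2)[OF r True] show ?thesis by (meson ennreal_leI order_trans)
  next
    case False
    have "(\<integral>\<^sup>+y\<in>{x-r..x+r}. ennreal (cmod (f y - f x)) \<partial>lebesgue)
        \<le> (\<integral>\<^sup>+y. ennreal ((cmod (f y))\<^sup>2) + ennreal (1 + cmod (f x)) * indicator {x-r..x+r} y \<partial>lebesgue)"
    proof (rule nn_integral_mono)
      fix y
      have "2 * cmod (f y) \<le> (cmod (f y))\<^sup>2 + 1" using sum_squares_bound[of "cmod (f y)" 1] by simp
      then have "cmod (f y - f x) \<le> (cmod (f y))\<^sup>2 + (1 + cmod (f x))"
        using norm_triangle_ineq4[of "f y" "f x"] norm_ge_zero[of "f y"] by linarith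
      then have "ennreal (cmod (f y - f x)) \<le> ennreal ((cmod (f y))\<^sup>2) + ennreal (1 + cmod (f x))"
        by (subst ennreal_plus[symmetric]) (simp_all add: ennreal_leI del: ennreal_plus)
      then show "ennreal (cmod (f y - f x)) * indicator {x-r..x+r} y
         \<le> ennreal ((cmod (f y))\<^sup>2) + ennreal (1 + cmod (f x)) * indicator {x-r..x+r} y"
        by (auto simp: indicator_def)
    qed
    also have "\<dots> = ennreal (nsq lebesgue f) + ennreal (1 + cmod (f x)) * ennreal (2 * r)"
      using r by (subst nn_integral_add) (auto simp: nn_eq_nsq[OF f] nn_integral_cmult_indicator)
    also have "\<dots> = ennreal (nsq lebesgue f + (1 + cmod (f x)) * (2 * r))"
      using r by (subst ennreal_mult[symmetric], simp, simp, subst ennreal_plus[symmetric]) (auto simp: nsq_nonneg)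
    also have "\<dots> \<le> ennreal (r * (e + B * sqrt (r / d)))"
    proof (rule ennreal_leI)
      have "nsq lebesgue f \<le> r * (nsq lebesgue f / d)"
        using False d(1) nsq_nonneg[of lebesgue f] by (simp add: field_simps mult_mono)
      then have "nsq lebesgue f + (1 + cmod (f x)) * (2 * r) \<le> r * B" by (simp add: B_def algebra_simps)
      also have "\<dots> \<le> r * (B * sqrt (r / d))"
        using False d(1) r B mult_left_mono[of 1 "sqrt (r/d)" B] by (intro mult_left_mono) auto
      also have "\<dots> \<le> r * (e + B * sqrt (r / d))" using r e by (intro mult_left_mono) auto
      finally show "nsq lebesgue f + (1 + cmod (f x)) * (2 * r) \<le> r * (e + B * sqrt (r / d))" .
    qed
    finally show ?thesis .
  qed
  with d(1) B that show ?thesis by blast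
qed

text \<open>A single term of the series suffices: that of the least \<open>k\<close> with
  \<open>\<bar>u\<bar> \<le> 2^k * \<epsilon>\<close>. For positive \<open>k\<close>, minimality
  gives \<open>\<bar>u\<bar> > 2^(k-1) * \<epsilon>\<close>, whence the factor 4.\<close>

lemma poisson_dyadic_bound:
  assumes "\<epsilon> > 0"
  shows "ennreal (\<epsilon> / (\<epsilon>\<^sup>2 + u\<^sup>2)) \<le> (\<Sum>k. ennreal (4 / (4^k * \<epsilon>)) * indicator {-(2^k*\<epsilon>)..2^k*\<epsilon>} u)"
proof -
  have ex: "\<exists>k. \<bar>u\<bar> \<le> 2^k * \<epsilon>"
  proof -
    obtain k where "\<bar>u\<bar> / \<epsilon> < 2^k" using real_arch_pow[of 2 "\<bar>u\<bar> / \<epsilon>"] by auto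
    then show ?thesis using assms by (intro exI[of _ k]) (auto simp: field_simps)
  qed
  define k where "k = (LEAST k. \<bar>u\<bar> \<le> 2^k * \<epsilon>)"
  have k: "\<bar>u\<bar> \<le> 2^k * \<epsilon>" unfolding k_def by (rule LeastI_ex[OF ex])
  have "\<epsilon> / (\<epsilon>\<^sup>2 + u\<^sup>2) \<le> 4 / (4^k * \<epsilon>)"
  proof (cases k)
    case 0
    have "\<epsilon> / (\<epsilon>\<^sup>2 + u\<^sup>2) \<le> \<epsilon> / \<epsilon>\<^sup>2" using assms by (intro divide_left_mono) (auto intro!: mult_pos_pos add_pos_nonneg)
    also have "\<dots> \<le> 4 / \<epsilon>" using assms by (simp add: field_simps power2_eq_square)
    finally show ?thesis using 0 by simp
  next
    case (Suc j)
    have "\<not> \<bar>u\<bar> \<le> 2^j * \<epsilon>" using not_less_Least[of j "\<lambda>k. \<bar>u\<bar> \<le> 2^k * \<epsilon>"] Suc k_def by auto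
    then have "(2^j * \<epsilon>)\<^sup>2 \<le> \<bar>u\<bar>\<^sup>2" using assms by (intro power_mono) auto
    then have u: "4^j * \<epsilon>\<^sup>2 \<le> u\<^sup>2" 
    proof -
      have "(2^j)\<^sup>2 = (4::real)^j" by (simp add: power2_eq_square power_mult_distrib[symmetric])
      then show ?thesis using \<open>(2^j * \<epsilon>)\<^sup>2 \<le> \<bar>u\<bar>\<^sup>2\<close> by (simp add: power_mult_distrib)
    qed
    have "\<epsilon> / (\<epsilon>\<^sup>2 + u\<^sup>2) \<le> \<epsilon> / (4^j * \<epsilon>\<^sup>2)"
      using assms u by (intro divide_left_mono) (auto intro!: mult_pos_pos add_pos_nonneg intro: order_trans add_increasing)
    also have "\<dots> = 4 / (4^k * \<epsilon>)" using assms Suc by (simp add: field_simps power2_eq_square)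
    finally show ?thesis .
  qed
  then have *: "ennreal (\<epsilon> / (\<epsilon>\<^sup>2 + u\<^sup>2)) \<le> ennreal (4 / (4^k * \<epsilon>)) * indicator {-(2^k*\<epsilon>)..2^k*\<epsilon>} u"
    using k by (auto simp: indicator_def abs_le_iff intro: ennreal_leI)
  define g :: "nat \<Rightarrow> ennreal" where "g k = ennreal (4 / (4^k * \<epsilon>)) * indicator {-(2^k*\<epsilon>)..2^k*\<epsilon>} u" for k
  have "g k \<le> suminf g" using sum_le_suminf[of g "{k}"] by simp
  with * show ?thesis unfolding g_def by (rule order_trans)
qed

text \<open>On the dyadic interval of index \<open>k\<close> the global estimate costs a factor
  \<open>2^k\<close> against the weight \<open>4^(-k)\<close>, leaving geometric series with ratios
  \<open>1/2\<close> and \<open>1 / sqrt 2\<close>. The first sums to \<open>8 * e\<close> whatever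
  \<open>\<epsilon>\<close> is; the second carries \<open>sqrt (\<epsilon> / r0)\<close> and
  vanishes with \<open>\<epsilon>\<close>.\<close>

lemma leb_point_poisson_bound:
  assumes f: "sqint lebesgue f" and x: "leb_point f x" and e: "e > 0"
  obtains D r0 where "D \<ge> 0" "r0 > 0" "\<And>\<epsilon>. \<epsilon> > 0 \<Longrightarrow>
    (\<integral>\<^sup>+y. ennreal (\<epsilon> / (\<epsilon>\<^sup>2 + (x - y)\<^sup>2)) * ennreal (cmod (f y - f x)) \<partial>lebesgue) \<le> ennreal (8 * e + D * sqrt (\<epsilon> / r0))"
proof -
  obtain r0 B where r0: "r0 > 0" and B: "B \<ge> 0" and bd: "\<And>r. r > 0 \<Longrightarrow>
    (\<integral>\<^sup>+y\<in>{x-r..x+r}. ennreal (cmod (f y - f x)) \<partial>lebesgue) \<le> ennreal (r * (e + B * sqrt (r / r0)))"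
    using leb_point_global[OF assms] by metis
  have [measurable]: "f \<in> borel_measurable lebesgue" using f by (simp add: sqint_def)
  have sq2: "norm (1 / sqrt 2 :: real) < 1" by simp
  define c where "c = (\<Sum>k. (1 / sqrt 2)^k :: real)"
  have c: "c \<ge> 0" unfolding c_def by (rule suminf_nonneg[OF summable_geometric[OF sq2]]) simp
  have main: "(\<integral>\<^sup>+y. ennreal (\<epsilon> / (\<epsilon>\<^sup>2 + (x - y)\<^sup>2)) * ennreal (cmod (f y - f x)) \<partial>lebesgue)
      \<le> ennreal (8 * e + (4 * B * c) * sqrt (\<epsilon> / r0))" if eps: "\<epsilon> > 0" for \<epsilon>
  proof -
    have "(\<integral>\<^sup>+y. ennreal (\<epsilon> / (\<epsilon>\<^sup>2 + (x - y)\<^sup>2)) * ennreal (cmod (f y - f x)) \<partial>lebesgue)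
      \<le> (\<integral>\<^sup>+y. (\<Sum>k. ennreal (4 / (4^k * \<epsilon>)) * (ennreal (cmod (f y - f x)) * indicator {x-2^k*\<epsilon>..x+2^k*\<epsilon>} y)) \<partial>lebesgue)"
    proof (rule nn_integral_mono)
      fix y
      have i: "indicator {-(2^k*\<epsilon>)..2^k*\<epsilon>} (x - y) = (indicator {x-2^k*\<epsilon>..x+2^k*\<epsilon>} y :: ennreal)" for k
        by (auto simp: indicator_def)
      show "ennreal (\<epsilon> / (\<epsilon>\<^sup>2 + (x - y)\<^sup>2)) * ennreal (cmod (f y - f x)) \<le>
        (\<Sum>k. ennreal (4 / (4^k * \<epsilon>)) * (ennreal (cmod (f y - f x)) * indicator {x-2^k*\<epsilon>..x+2^k*\<epsilon>} y))"
        using mult_right_mono[OF poisson_dyadic_bound[OF eps, of "x - y"], of "ennreal (cmod (f y - f x))"]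
        unfolding i ennreal_suminf_multc[symmetric] by (simp add: mult_ac)
    qed
    also have "\<dots> = (\<Sum>k. ennreal (4 / (4^k * \<epsilon>)) *
        (\<integral>\<^sup>+y\<in>{x-2^k*\<epsilon>..x+2^k*\<epsilon>}. ennreal (cmod (f y - f x)) \<partial>lebesgue))"
      by (subst nn_integral_suminf) (auto simp: nn_integral_cmult)
    also have "\<dots> \<le> (\<Sum>k. ennreal (4 * e * (1/2)^k + 4 * B * sqrt (\<epsilon> / r0) * (1 / sqrt 2)^k))"
    proof (rule suminf_le)
      fix k
      have "ennreal (4 / (4^k * \<epsilon>)) * (\<integral>\<^sup>+y\<in>{x-2^k*\<epsilon>..x+2^k*\<epsilon>}. ennreal (cmod (f y - f x)) \<partial>lebesgue)
        \<le> ennreal (4 / (4^k * \<epsilon>)) * ennreal ((2^k*\<epsilon>) * (e + B * sqrt ((2^k*\<epsilon>) / r0)))"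
        by (intro mult_left_mono bd) (use eps in auto)
      also have "\<dots> = ennreal (4 / (4^k * \<epsilon>) * ((2^k*\<epsilon>) * (e + B * sqrt ((2^k*\<epsilon>) / r0))))"
        using eps e B r0 by (subst ennreal_mult) auto
      also have "4 / (4^k * \<epsilon>) * ((2^k*\<epsilon>) * (e + B * sqrt ((2^k*\<epsilon>) / r0)))
          = 4 * e * (1/2)^k + 4 * B * sqrt (\<epsilon> / r0) * (1 / sqrt 2)^k"
      proof -
        have 1: "4 / (4^k * \<epsilon>) * (2^k*\<epsilon>) = 4 * (1/2)^k" 
        proof -
          have "(4::real)^k = 2^k * 2^k" by (simp add: power_mult_distrib[symmetric])
          then show ?thesis using eps by (simp add: field_simps power_divide)
        qed
        have 2: "sqrt ((2^k*\<epsilon>) / r0) = sqrt 2 ^ k * sqrt (\<epsilon> / r0)"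
          by (simp add: real_sqrt_mult real_sqrt_power real_sqrt_divide)
        have 3: "(1/2)^k * sqrt 2 ^ k = (1 / sqrt 2 :: real)^k"
        proof -
          have "1/2 * sqrt 2 = (1 / sqrt 2 :: real)" by (simp add: field_simps)
          then show ?thesis by (metis power_mult_distrib)
        qed
        have 4: "(4 * a) * (e + B * (s * q)) = 4 * e * a + 4 * B * q * (a * s)" for a s q :: real
          by (simp add: algebra_simps)
        have "4 / (4^k * \<epsilon>) * ((2^k*\<epsilon>) * (e + B * sqrt ((2^k*\<epsilon>) / r0)))
           = (4 / (4^k * \<epsilon>) * (2^k*\<epsilon>)) * (e + B * sqrt ((2^k*\<epsilon>) / r0))" by (rule mult.assoc[symmetric])
        also have "\<dots> = 4 * e * (1/2)^k + 4 * B * sqrt (\<epsilon> / r0) * ((1/2)^k * sqrt 2 ^ k)"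
          unfolding 1 2 by (rule 4)
        finally show ?thesis unfolding 3 .
      qed
      finally show "ennreal (4 / (4^k * \<epsilon>)) * (\<integral>\<^sup>+y\<in>{x-2^k*\<epsilon>..x+2^k*\<epsilon>}. ennreal (cmod (f y - f x)) \<partial>lebesgue)
        \<le> ennreal (4 * e * (1/2)^k + 4 * B * sqrt (\<epsilon> / r0) * (1 / sqrt 2)^k)" .
    qed auto
    also have "\<dots> = ennreal (\<Sum>k. 4 * e * (1/2)^k + 4 * B * sqrt (\<epsilon> / r0) * (1 / sqrt 2)^k)"
      using e B r0 eps sq2
      by (intro suminf_ennreal2) (auto intro!: summable_add summable_mult summable_geometric add_nonneg_nonneg mult_nonneg_nonneg)
    also have "(\<Sum>k. 4 * e * (1/2)^k + 4 * B * sqrt (\<epsilon> / r0) * (1 / sqrt 2)^k) = 8 * e + (4 * B * c) * sqrt (\<epsilon> / r0)"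
    proof -
      have "(\<Sum>k. 4 * e * (1/2)^k + 4 * B * sqrt (\<epsilon> / r0) * (1 / sqrt 2)^k)
        = (\<Sum>k. 4 * e * (1/2)^k) + (\<Sum>k. 4 * B * sqrt (\<epsilon> / r0) * (1 / sqrt 2)^k)"
        using sq2 by (intro suminf_add[symmetric] summable_mult summable_geometric) auto
      also have "(\<Sum>k. 4 * e * (1/2)^k) = 4 * e * (\<Sum>k. (1/2)^k)"
        by (intro suminf_mult summable_geometric) auto
      also have "(\<Sum>k. 4 * B * sqrt (\<epsilon> / r0) * (1 / sqrt 2)^k) = 4 * B * sqrt (\<epsilon> / r0) * c"
        unfolding c_def using sq2 by (intro suminf_mult summable_geometric) auto
      finally show ?thesis by (simp add: suminf_geometric mult_ac)
    qed
    finally show ?thesis .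
  qed
  have "0 \<le> 4 * B * c" using B c by simp
  from that[OF this r0 main] show ?thesis .
qed

section \<open>The Cauchy kernel and limits of kernels that it dominates\<close>

lemma nn_integral_cauchy_kernel:
  assumes "\<epsilon> > 0"
  shows "(\<integral>\<^sup>+u. ennreal (\<epsilon> / (\<epsilon>\<^sup>2 + u\<^sup>2)) \<partial>lborel) = ennreal pi"
proof -
  let ?f = "\<lambda>u::real. \<epsilon> / (\<epsilon>\<^sup>2 + u\<^sup>2)"
  have half: "(\<integral>\<^sup>+u. ennreal (?f u) * indicator {0..} u \<partial>lborel) = ennreal (pi/2 - arctan (0/\<epsilon>))"
  proof (rule nn_integral_FTC_atLeast)
    show "DERIV (\<lambda>u. arctan (u/\<epsilon>)) u :> ?f u" for u
    proof -
      have "1 + (u/\<epsilon>)\<^sup>2 = (\<epsilon>\<^sup>2 + u\<^sup>2) / \<epsilon>\<^sup>2"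
        using assms by (simp add: power_divide add_divide_distrib)
      then have *: "inverse (1 + (u/\<epsilon>)\<^sup>2) * (1/\<epsilon>) = \<epsilon> / (\<epsilon>\<^sup>2 + u\<^sup>2)"
        using assms by (simp add: power2_eq_square)
      have "DERIV (\<lambda>u. arctan (u/\<epsilon>)) u :> inverse (1 + (u/\<epsilon>)\<^sup>2) * (1/\<epsilon>)"
        by (rule DERIV_chain'[OF DERIV_cdivide[OF DERIV_ident] DERIV_arctan])
      then show ?thesis unfolding * .
    qed
    show "((\<lambda>u. arctan (u/\<epsilon>)) \<longlongrightarrow> pi/2) at_top"
      by (rule filterlim_compose[OF tendsto_arctan_at_top])
         (use assms filterlim_tendsto_pos_mult_at_top[OF tendsto_const _ filterlim_ident, of "1/\<epsilon>"] in simp)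
  qed (use assms in auto)
  have "(\<integral>\<^sup>+u. ennreal (?f u) * indicator {..<0} u \<partial>lborel) = (\<integral>\<^sup>+u. ennreal (?f u) * indicator {0<..} u \<partial>lborel)"
    by (subst nn_integral_real_affine[where c = "-1" and t = 0]) (auto intro!: nn_integral_cong simp: indicator_def)
  also have "\<dots> = (\<integral>\<^sup>+u. ennreal (?f u) * indicator {0..} u \<partial>lborel)"
  proof (rule nn_integral_cong_AE)
    have "AE u in lborel. u \<noteq> (0::real)" by (rule AE_lborel_singleton)
    then show "AE u in lborel. ennreal (?f u) * indicator {0<..} u = ennreal (?f u) * indicator {0..} u"
      by eventually_elim (auto simp: indicator_def)
  qed
  finally have other: "(\<integral>\<^sup>+u. ennreal (?f u) * indicator {..<0} u \<partial>lborel) = ennreal (pi/2)" using half by simp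
  have "(\<integral>\<^sup>+u. ennreal (?f u) \<partial>lborel)
      = (\<integral>\<^sup>+u. ennreal (?f u) * indicator {0..} u + ennreal (?f u) * indicator {..<0} u \<partial>lborel)"
    by (intro nn_integral_cong) (auto simp: indicator_def)
  also have "\<dots> = ennreal (pi/2) + ennreal (pi/2)"
    using half other by (subst nn_integral_add) auto
  also have "\<dots> = ennreal pi" by (simp flip: ennreal_plus)
  finally show ?thesis .
qed

lemma cauchy_kernel_integral:
  assumes "\<epsilon> > 0"
  shows "integrable lebesgue (\<lambda>y. \<epsilon> / (\<epsilon>\<^sup>2 + (x - y)\<^sup>2))" "(\<integral>y. \<epsilon> / (\<epsilon>\<^sup>2 + (x - y)\<^sup>2) \<partial>lebesgue) = pi"
proof -
  have "(\<integral>\<^sup>+y. ennreal (\<epsilon> / (\<epsilon>\<^sup>2 + (x - y)\<^sup>2)) \<partial>lebesgue) = (\<integral>\<^sup>+y. ennreal (\<epsilon> / (\<epsilon>\<^sup>2 + (x - y)\<^sup>2)) \<partial>lborel)"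
    by (rule nn_integral_completion)
  also have "\<dots> = (\<integral>\<^sup>+u. ennreal (\<epsilon> / (\<epsilon>\<^sup>2 + u\<^sup>2)) \<partial>lborel)"
    by (subst nn_integral_real_affine[where c = "-1" and t = x]) auto
  also have "\<dots> = ennreal pi" by (rule nn_integral_cauchy_kernel[OF assms])
  finally have *: "(\<integral>\<^sup>+y. ennreal (\<epsilon> / (\<epsilon>\<^sup>2 + (x - y)\<^sup>2)) \<partial>lebesgue) = ennreal pi" .
  have "has_bochner_integral lebesgue (\<lambda>y. \<epsilon> / (\<epsilon>\<^sup>2 + (x - y)\<^sup>2)) pi"
    by (rule has_bochner_integral_nn_integral) (use * assms in \<open>auto intro!: measurable_completion\<close>)
  then show "integrable lebesgue (\<lambda>y. \<epsilon> / (\<epsilon>\<^sup>2 + (x - y)\<^sup>2))" "(\<integral>y. \<epsilon> / (\<epsilon>\<^sup>2 + (x - y)\<^sup>2) \<partial>lebesgue) = pi"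
    by (auto simp: has_bochner_integral_iff)
qed

text \<open>Constant mass turns the integral into \<open>\<kappa> * f x\<close> plus an integral
  against \<open>f y - f x\<close>, which the Poisson average at a Lebesgue point controls. It is
  applied to the Poisson kernel itself and, with mass 0, to the truncated Hilbert kernel minus the
  conjugate Poisson kernel.\<close>

lemma kernel_limit:
  assumes f: "sqint lebesgue f" and x: "leb_point f x"
    and meas: "\<And>\<epsilon>. K \<epsilon> \<in> borel_measurable lebesgue"
    and bound: "\<And>\<epsilon> y. 0 < \<epsilon> \<Longrightarrow> \<epsilon> < 1 \<Longrightarrow> \<bar>K \<epsilon> y\<bar> \<le> C * (\<epsilon> / (\<epsilon>\<^sup>2 + (x - y)\<^sup>2))"
    and mass: "\<And>\<epsilon>. 0 < \<epsilon> \<Longrightarrow> \<epsilon> < 1 \<Longrightarrow> (\<integral>y. K \<epsilon> y \<partial>lebesgue) = \<kappa>"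
  shows "((\<lambda>\<epsilon>. \<integral>y. complex_of_real (K \<epsilon> y) * f y \<partial>lebesgue) \<longlongrightarrow> complex_of_real \<kappa> * f x) (at_right 0)"
proof (rule tendstoI)
  fix e :: real assume e: "e > 0"
  have [measurable]: "f \<in> borel_measurable lebesgue" using f by (simp add: sqint_def)
  note meas[measurable]
  have C: "C \<ge> 0"
  proof -
    have "0 \<le> C * ((1/2) / ((1/2)\<^sup>2 + (x - x)\<^sup>2))" using bound[of "1/2" x] by (auto intro: order_trans[OF abs_ge_zero])
    then show ?thesis by (simp add: power2_eq_square)
  qed
  \<comment> \<open>The factor 8 of the Poisson average and the factor \<open>C\<close> of the
    kernel leave at most \<open>e / 4\<close> in the limit; \<open>C + 1\<close> keeps the quotient
    defined when \<open>C\<close> is 0.\<close>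
  have e': "e / (32 * (C + 1)) > 0" using e C by simp
  obtain D r0 where D: "D \<ge> 0" "r0 > 0" and bd: "\<And>\<epsilon>. \<epsilon> > 0 \<Longrightarrow>
    (\<integral>\<^sup>+y. ennreal (\<epsilon> / (\<epsilon>\<^sup>2 + (x - y)\<^sup>2)) * ennreal (cmod (f y - f x)) \<partial>lebesgue)
      \<le> ennreal (8 * (e / (32 * (C + 1))) + D * sqrt (\<epsilon> / r0))"
    using leb_point_poisson_bound[OF f x e'] by blast
  have main: "dist (\<integral>y. complex_of_real (K \<epsilon> y) * f y \<partial>lebesgue) (complex_of_real \<kappa> * f x)
      \<le> C * (8 * (e / (32 * (C + 1))) + D * sqrt (\<epsilon> / r0))" if eps: "0 < \<epsilon>" "\<epsilon> < 1" for \<epsilon>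
  proof -
    let ?R = "C * (8 * (e / (32 * (C + 1))) + D * sqrt (\<epsilon> / r0))"
    have R: "?R \<ge> 0" using C D e eps by (intro mult_nonneg_nonneg add_nonneg_nonneg) auto
    have Ki: "integrable lebesgue (K \<epsilon>)"
      by (rule Bochner_Integration.integrable_bound[OF integrable_mult_right[OF cauchy_kernel_integral(1)[OF eps(1), of x], of C]])
         (simp, rule AE_I2, unfold real_norm_def, rule order_trans[OF bound[OF eps] abs_ge_self])
    have nn: "(\<integral>\<^sup>+y. ennreal (norm (complex_of_real (K \<epsilon> y) * (f y - f x))) \<partial>lebesgue) \<le> ennreal ?R"
    proof -
      have "(\<integral>\<^sup>+y. ennreal (norm (complex_of_real (K \<epsilon> y) * (f y - f x))) \<partial>lebesgue)
        \<le> (\<integral>\<^sup>+y. ennreal C * (ennreal (\<epsilon> / (\<epsilon>\<^sup>2 + (x - y)\<^sup>2)) * ennreal (cmod (f y - f x))) \<partial>lebesgue)"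
      proof (rule nn_integral_mono)
        fix y
        have "norm (complex_of_real (K \<epsilon> y) * (f y - f x)) \<le> C * (\<epsilon> / (\<epsilon>\<^sup>2 + (x - y)\<^sup>2)) * cmod (f y - f x)"
          unfolding norm_mult norm_of_real by (rule mult_right_mono[OF bound[OF eps]]) simp
        then show "ennreal (norm (complex_of_real (K \<epsilon> y) * (f y - f x)))
          \<le> ennreal C * (ennreal (\<epsilon> / (\<epsilon>\<^sup>2 + (x - y)\<^sup>2)) * ennreal (cmod (f y - f x)))"
          using C eps by (simp add: ennreal_mult[symmetric] mult.assoc ennreal_leI)
      qed
      also have "\<dots> = ennreal C * (\<integral>\<^sup>+y. ennreal (\<epsilon> / (\<epsilon>\<^sup>2 + (x - y)\<^sup>2)) * ennreal (cmod (f y - f x)) \<partial>lebesgue)"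
        by (rule nn_integral_cmult) (auto intro!: borel_measurable_times_ennreal measurable_completion)
      also have "\<dots> \<le> ennreal C * ennreal (8 * (e / (32 * (C + 1))) + D * sqrt (\<epsilon> / r0))"
        by (intro mult_left_mono bd eps) auto
      also have "\<dots> = ennreal ?R" using C D e eps by (subst ennreal_mult) auto
      finally show ?thesis .
    qed
    have i: "integrable lebesgue (\<lambda>y. complex_of_real (K \<epsilon> y) * (f y - f x))"
      by (rule integrableI_bounded) (use nn in \<open>auto simp: le_less_trans\<close>)
    have j: "integrable lebesgue (\<lambda>y. complex_of_real (K \<epsilon> y) * f x)" using Ki by auto
    have "(\<integral>y. complex_of_real (K \<epsilon> y) * f y \<partial>lebesgue)
       = (\<integral>y. complex_of_real (K \<epsilon> y) * (f y - f x) + complex_of_real (K \<epsilon> y) * f x \<partial>lebesgue)"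
      by (simp add: algebra_simps)
    also have "\<dots> = (\<integral>y. complex_of_real (K \<epsilon> y) * (f y - f x) \<partial>lebesgue) + complex_of_real \<kappa> * f x"
      using mass[OF eps] by (subst Bochner_Integration.integral_add[OF i j]) auto
    finally have "dist (\<integral>y. complex_of_real (K \<epsilon> y) * f y \<partial>lebesgue) (complex_of_real \<kappa> * f x)
       = norm (\<integral>y. complex_of_real (K \<epsilon> y) * (f y - f x) \<partial>lebesgue)" by (simp add: dist_norm)
    then show ?thesis using order_trans[OF integral_norm_bound_ennreal[OF i] nn] R by (simp add: ennreal_le_iff)
  qed
  have "((\<lambda>\<epsilon>. C * (8 * (e / (32 * (C + 1))) + D * sqrt (\<epsilon> / r0))) \<longlongrightarrow> C * (8 * (e / (32 * (C + 1))) + D * sqrt (0 / r0))) (at_right 0)"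
    by (intro tendsto_intros) (use D in auto)
  moreover have "C * (8 * (e / (32 * (C + 1))) + D * sqrt (0 / r0)) < e"
  proof -
    have "C * (8 * (e / (32 * (C + 1)))) = (C / (C + 1)) * (e / 4)" using C by (simp add: field_simps)
    also have "\<dots> \<le> 1 * (e / 4)" using C e by (intro mult_right_mono) auto
    finally show ?thesis using e by simp
  qed
  ultimately have "\<forall>\<^sub>F \<epsilon> in at_right 0. C * (8 * (e / (32 * (C + 1))) + D * sqrt (\<epsilon> / r0)) < e"
    by (rule order_tendstoD(2))
  moreover have "\<forall>\<^sub>F \<epsilon> in at_right 0. 0 < \<epsilon> \<and> \<epsilon> < (1::real)"
    by (rule eventually_at_rightI[of 0 1]) auto
  ultimately show "\<forall>\<^sub>F \<epsilon> in at_right 0. dist (\<integral>y. complex_of_real (K \<epsilon> y) * f y \<partial>lebesgue) (complex_of_real \<kappa> * f x) < e"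
    by eventually_elim (use main in fastforce)
qed

section \<open>Fourier transforms between a pair of measures on the line\<close>

text \<open>The unnormalised character. It is symmetric in its two arguments, so one kernel serves
  the transform in both directions, and inversion is expressed through complex conjugation.\<close>

definition wave :: "real \<Rightarrow> real \<Rightarrow> complex" where
  "wave x \<xi> = exp (- (\<i> * complex_of_real (x * \<xi>)))"

lemma norm_wave [simp]: "cmod (wave x \<xi>) = 1"
  by (simp add: wave_def norm_exp_eq_Re)

lemma wave_commute: "wave x \<xi> = wave \<xi> x"
  by (simp add: wave_def mult.commute)

lemma wave_add: "wave (x + y) \<xi> = wave x \<xi> * wave y \<xi>"
  by (simp add: wave_def exp_add[symmetric] algebra_simps)

lemma wave_add2: "wave x (\<xi> + \<eta>) = wave x \<xi> * wave x \<eta>"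
  by (simp add: wave_commute[of x] wave_add)

lemma wave_minus: "wave (- x) \<xi> = cnj (wave x \<xi>)"
  and wave_minus2: "wave x (- \<xi>) = cnj (wave x \<xi>)"
  and wave_0 [simp]: "wave 0 \<xi> = 1" and wave_0_right [simp]: "wave x 0 = 1"
  by (auto simp: wave_def exp_cnj)

lemma wave_diff: "wave (x - y) \<xi> = wave x \<xi> * cnj (wave y \<xi>)"
  using wave_add[of x "-y" \<xi>] by (simp add: wave_minus)

lemma wave_diff2: "wave x (\<xi> - \<eta>) = wave x \<xi> * cnj (wave x \<eta>)"
  by (simp add: wave_commute[of x] wave_diff)

lemma borel_measurable_wave [measurable (raw)]:
  assumes "f \<in> borel_measurable M" "g \<in> borel_measurable M"
  shows "(\<lambda>z. wave (f z) (g z)) \<in> borel_measurable M"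
proof -
  have "continuous_on UNIV (\<lambda>r. exp (- (\<i> * complex_of_real r)))" by (intro continuous_intros)
  from borel_measurable_continuous_on[OF this, of "\<lambda>z. f z * g z" M] assms
  show ?thesis by (simp add: wave_def)
qed

definition ftr :: "real measure \<Rightarrow> (real \<Rightarrow> complex) \<Rightarrow> real \<Rightarrow> complex" where
  "ftr M f \<xi> = (\<integral>x. wave x \<xi> * f x \<partial>M)"

text \<open>The common features of Lebesgue measure, of one period and of the counting measure on
  the integers that Fubini and the truncation to bounded sets rely on.\<close>

definition reg_measure :: "real measure \<Rightarrow> bool" where
  "reg_measure M \<longleftrightarrow> sigma_finite_measure M \<and> (\<lambda>x. x) \<in> borel_measurable M \<and>
     (\<forall>R. emeasure M {x\<in>space M. \<bar>x\<bar> \<le> R} < \<infinity>)"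

lemma reg_measureD:
  assumes "reg_measure M"
  shows "sigma_finite_measure M" "(\<lambda>x. x) \<in> borel_measurable M" "emeasure M {x\<in>space M. \<bar>x\<bar> \<le> R} < \<infinity>"
  using assms by (auto simp: reg_measure_def)

lemma integrable_wave:
  assumes "reg_measure M" "integrable M f"
  shows "integrable M (\<lambda>x. wave x \<xi> * f x)" "integrable M (\<lambda>x. cnj (wave x \<xi>) * f x)"
  using assms reg_measureD(2)[OF assms(1)]
  by (auto intro!: Bochner_Integration.integrable_bound[OF assms(2)] simp: norm_mult)

lemma norm_ftr_le: 
  assumes "reg_measure M" "integrable M f"
  shows "cmod (ftr M f \<xi>) \<le> (\<integral>x. cmod (f x) \<partial>M)"
  unfolding ftr_def using integral_norm_bound[of M "\<lambda>x. wave x \<xi> * f x"] by (simp add: norm_mult)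

lemma ftr_add:
  assumes "reg_measure M" "integrable M f" "integrable M g"
  shows "ftr M (\<lambda>x. f x + g x) \<xi> = ftr M f \<xi> + ftr M g \<xi>"
  unfolding ftr_def using integrable_wave[OF assms(1,2)] integrable_wave[OF assms(1,3)]
  by (simp add: distrib_left)

lemma ftr_diff:
  assumes "reg_measure M" "integrable M f" "integrable M g"
  shows "ftr M (\<lambda>x. f x - g x) \<xi> = ftr M f \<xi> - ftr M g \<xi>"
  unfolding ftr_def using integrable_wave[OF assms(1,2)] integrable_wave[OF assms(1,3)]
  by (simp add: right_diff_distrib)

lemma borel_measurable_pair_wave:
  assumes "reg_measure M" "reg_measure N"
  shows "(\<lambda>p. wave (fst p) (snd p)) \<in> borel_measurable (M \<Otimes>\<^sub>M N)"
  by (rule borel_measurable_wave[OF measurable_compose[OF measurable_fst reg_measureD(2)[OF assms(1)]]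
      measurable_compose[OF measurable_snd reg_measureD(2)[OF assms(2)]]])

lemma borel_measurable_ftr:
  assumes M: "reg_measure M" and N: "reg_measure N" and f: "f \<in> borel_measurable M"
  shows "ftr M f \<in> borel_measurable N"
proof -
  interpret M: sigma_finite_measure M using reg_measureD(1)[OF M] .
  have "(\<lambda>p. wave (fst p) (snd p) * f (snd p)) \<in> borel_measurable (N \<Otimes>\<^sub>M M)"
    by (rule borel_measurable_times[OF borel_measurable_pair_wave[OF N M] measurable_compose[OF measurable_snd f]])
  then have "(\<lambda>(\<xi>, x). wave x \<xi> * f x) \<in> borel_measurable (N \<Otimes>\<^sub>M M)"
    by (simp add: split_beta wave_commute[of "fst _"])
  from M.borel_measurable_lebesgue_integral[OF this]
  show ?thesis unfolding ftr_def[abs_def] prod.case .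
qed

text \<open>Fubini, because the integrand has modulus \<open>cmod (f x) * cmod (G \<xi>)\<close>.
  This symmetric formula later characterises the transform on all square-integrable
  functions.\<close>

lemma ftr_multiplication:
  assumes M: "reg_measure M" and N: "reg_measure N" and f: "integrable M f" and G: "integrable N G"
  shows "(\<integral>\<xi>. ftr M f \<xi> * G \<xi> \<partial>N) = (\<integral>x. f x * ftr N G x \<partial>M)"
proof -
  interpret M: sigma_finite_measure M using reg_measureD(1)[OF M] .
  interpret N: sigma_finite_measure N using reg_measureD(1)[OF N] .
  interpret P: pair_sigma_finite M N ..
  have i: "integrable (M \<Otimes>\<^sub>M N) (\<lambda>(x, \<xi>). wave x \<xi> * f x * G \<xi>)"
  proof (rule P.Fubini_integrable)
    have "(\<lambda>p. wave (fst p) (snd p) * f (fst p) * G (snd p)) \<in> borel_measurable (M \<Otimes>\<^sub>M N)"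
      by (rule borel_measurable_times[OF borel_measurable_times[OF borel_measurable_pair_wave[OF M N]
        measurable_compose[OF measurable_fst borel_measurable_integrable[OF f]]]
        measurable_compose[OF measurable_snd borel_measurable_integrable[OF G]]])
    then show "(\<lambda>(x, \<xi>). wave x \<xi> * f x * G \<xi>) \<in> borel_measurable (M \<Otimes>\<^sub>M N)"
      by (simp add: split_beta)
    show "integrable M (\<lambda>x. LINT \<xi>|N. norm (case (x, \<xi>) of (x, \<xi>) \<Rightarrow> wave x \<xi> * f x * G \<xi>))"
    proof -
      have "(LINT \<xi>|N. norm (case (x, \<xi>) of (x, \<xi>) \<Rightarrow> wave x \<xi> * f x * G \<xi>))
          = norm (f x) * (LINT \<xi>|N. norm (G \<xi>))" for x
        by (simp only: prod.case norm_mult norm_wave mult_1 integral_mult_right_zero)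
      then show ?thesis using integrable_mult_left[OF integrable_norm[OF f]] by simp
    qed
    show "AE x in M. integrable N (\<lambda>\<xi>. case (x, \<xi>) of (x, \<xi>) \<Rightarrow> wave x \<xi> * f x * G \<xi>)"
    proof (rule AE_I2)
      fix x
      have "integrable N (\<lambda>\<xi>. wave \<xi> x * (f x * G \<xi>))"
        using G by (intro integrable_wave[OF N]) simp
      then show "integrable N (\<lambda>\<xi>. case (x, \<xi>) of (x, \<xi>) \<Rightarrow> wave x \<xi> * f x * G \<xi>)"
        by (simp add: wave_commute[of x] mult.assoc)
    qed
  qed
  have "(\<integral>\<xi>. ftr M f \<xi> * G \<xi> \<partial>N) = (\<integral>\<xi>. (\<integral>x. wave x \<xi> * f x * G \<xi> \<partial>M) \<partial>N)"
    unfolding ftr_def by (simp only: integral_mult_left_zero)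
  also have "\<dots> = (\<integral>x. (\<integral>\<xi>. wave x \<xi> * f x * G \<xi> \<partial>N) \<partial>M)"
    by (rule P.Fubini_integral[OF i])
  also have "\<dots> = (\<integral>x. f x * ftr N G x \<partial>M)"
  proof (intro Bochner_Integration.integral_cong refl)
    fix x
    have "(\<integral>\<xi>. wave x \<xi> * f x * G \<xi> \<partial>N) = (\<integral>\<xi>. f x * (wave \<xi> x * G \<xi>) \<partial>N)"
      by (intro Bochner_Integration.integral_cong refl) (metis wave_commute mult.assoc mult.commute)
    then show "(\<integral>\<xi>. wave x \<xi> * f x * G \<xi> \<partial>N) = f x * ftr N G x"
      by (simp add: ftr_def)
  qed
  finally show ?thesis .
qed

lemma truncation:
  assumes M: "reg_measure M" and f: "sqint M f"
  shows "sqint M (\<lambda>x. indicator {-R..R} x * f x)" "integrable M (\<lambda>x. indicator {-R..R} x * f x)"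
    and "(\<lambda>n. nsq M (\<lambda>x. indicator {-real n..real n} x * f x - f x)) \<longlonglongrightarrow> 0"
proof -
  note [measurable (raw)] = reg_measureD(2)[OF M]
  have [measurable]: "f \<in> borel_measurable M" using f by (simp add: sqint_def)
  have ind: "(\<lambda>x. indicator {-R..R} x :: complex) \<in> borel_measurable M" for R :: real by measurable
  show s: "sqint M (\<lambda>x. indicator {-R..R} x * f x)" for R
    by (rule sqint_bdd_mult(1)[OF f ind, where C = 1]) (auto simp: indicator_def)
  have fin: "integrable M (\<lambda>x. indicator {x\<in>space M. \<bar>x\<bar> \<le> R} x :: real)"
    by (rule integrable_real_indicator) (use reg_measureD(3)[OF M] in auto)
  show "integrable M (\<lambda>x. indicator {-R..R} x * f x)"
  proof (rule Bochner_Integration.integrable_bound)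
    show "integrable M (\<lambda>x. (cmod (f x))\<^sup>2 + indicator {x\<in>space M. \<bar>x\<bar> \<le> R} x)"
      by (intro Bochner_Integration.integrable_add fin sqint_integrable f)
    show "AE x in M. norm (indicator {-R..R} x * f x) \<le> norm ((cmod (f x))\<^sup>2 + indicator {x\<in>space M. \<bar>x\<bar> \<le> R} x)"
    proof (rule AE_I2)
      fix x assume "x \<in> space M"
      have "2 * cmod (f x) \<le> (cmod (f x))\<^sup>2 + 1" using sum_squares_bound[of "cmod (f x)" 1] by simp
      then have "cmod (f x) \<le> (cmod (f x))\<^sup>2 + 1" using norm_ge_zero[of "f x"] by linarith
      then show "norm (indicator {-R..R} x * f x) \<le> norm ((cmod (f x))\<^sup>2 + indicator {x\<in>space M. \<bar>x\<bar> \<le> R} x)"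
        using \<open>x \<in> space M\<close> by (auto simp: indicator_def abs_le_iff)
    qed
  qed (use s[of R] in \<open>simp add: sqint_def\<close>)
  show "(\<lambda>n. nsq M (\<lambda>x. indicator {-real n..real n} x * f x - f x)) \<longlonglongrightarrow> 0"
  proof (rule nsq_dominated_convergence(2)[OF sqint_measurable[OF s] f])
    show "AE x in M. cmod (indicator {-real n..real n} x * f x) \<le> cmod (f x)" for n
      by (auto simp: indicator_def)
    show "AE x in M. (\<lambda>n. indicator {-real n..real n} x * f x) \<longlonglongrightarrow> f x"
    proof (rule AE_I2, rule tendsto_eventually)
      fix x
      show "\<forall>\<^sub>F n in sequentially. indicator {-real n..real n} x * f x = f x"
        using eventually_ge_at_top[of "nat \<lceil>\<bar>x\<bar>\<rceil>"]
        by eventually_elim (auto simp: indicator_def abs_le_iff ceiling_le_iff nat_le_iff)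
    qed
  qed simp
qed

text \<open>The test functions are truncations of \<open>cnj (D x)\<close>, which are integrable as
  well as square integrable; letting the truncation grow produces the squared norm of
  \<open>D\<close>.\<close>

lemma AE_zero_if_orthogonal:
  assumes M: "reg_measure M" and D: "sqint M D"
    and orth: "\<And>G. integrable M G \<Longrightarrow> sqint M G \<Longrightarrow> (\<integral>x. D x * G x \<partial>M) = 0"
  shows "AE x in M. D x = 0"
proof -
  let ?G = "\<lambda>n x. indicator {-real n..real n} x * cnj (D x)"
  have "(\<lambda>n. \<integral>x. ?G n x * D x \<partial>M) \<longlonglongrightarrow> (\<integral>x. cnj (D x) * D x \<partial>M)"
    by (rule tendsto_integral_mult[OF _ _ D]) (intro truncation M sqint_cnj D)+
  moreover have "(\<integral>x. ?G n x * D x \<partial>M) = 0" for n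
    using orth[OF truncation(2,1)[OF M sqint_cnj[OF D]]] by (simp add: mult.commute)
  ultimately have "(\<integral>x. cnj (D x) * D x \<partial>M) = 0" using LIMSEQ_unique[OF _ tendsto_const] by simp
  moreover have "(\<integral>x. cnj (D x) * D x \<partial>M) = complex_of_real (nsq M D)"
    unfolding nsq_def by (simp add: complex_norm_square[symmetric] mult.commute[of "cnj _"] del: of_real_power)
  ultimately show ?thesis using nsq_eq_0_iff[OF D] by simp
qed

text \<open>Plancherel is demanded in both directions with the same constant. For the unnormalised
  character this constant is \<open>2 * pi\<close> on the line and also between one period and the
  integers. By the symmetry, every consequence can be used with the two measures exchanged.\<close>

definition fourier_pair :: "real measure \<Rightarrow> real measure \<Rightarrow> bool" where
  "fourier_pair M N \<longleftrightarrow> reg_measure M \<and> reg_measure N \<and>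
     (\<forall>f. integrable M f \<and> sqint M f \<longrightarrow> sqint N (ftr M f) \<and> nsq N (ftr M f) = 2 * pi * nsq M f) \<and>
     (\<forall>f. integrable N f \<and> sqint N f \<longrightarrow> sqint M (ftr N f) \<and> nsq M (ftr N f) = 2 * pi * nsq N f)"

lemma fourier_pair_swap: "fourier_pair M N \<Longrightarrow> fourier_pair N M"
  by (auto simp: fourier_pair_def)

lemma fourier_pairD:
  assumes "fourier_pair M N"
  shows "reg_measure M" "reg_measure N"
    and "integrable M f \<Longrightarrow> sqint M f \<Longrightarrow> sqint N (ftr M f)"
    and "integrable M f \<Longrightarrow> sqint M f \<Longrightarrow> nsq N (ftr M f) = 2 * pi * nsq M f"
  using assms by (auto simp: fourier_pair_def)

text \<open>The transform on all of \<open>L\<^sup>2\<close>, characterised by the multiplication formula.\<close>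

definition Ft :: "real measure \<Rightarrow> real measure \<Rightarrow> (real \<Rightarrow> complex) \<Rightarrow> (real \<Rightarrow> complex) \<Rightarrow> bool" where
  "Ft M N f F \<longleftrightarrow> sqint M f \<and> sqint N F \<and>
     (\<forall>G. integrable N G \<longrightarrow> sqint N G \<longrightarrow> (\<integral>\<xi>. F \<xi> * G \<xi> \<partial>N) = (\<integral>x. f x * ftr N G x \<partial>M))"

lemma FtD:
  assumes "Ft M N f F"
  shows "sqint M f" "sqint N F"
    and "integrable N G \<Longrightarrow> sqint N G \<Longrightarrow> (\<integral>\<xi>. F \<xi> * G \<xi> \<partial>N) = (\<integral>x. f x * ftr N G x \<partial>M)"
  using assms by (auto simp: Ft_def)

context
  fixes M N assumes P: "fourier_pair M N"
begin

lemma sqint_ftr_dual: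
  assumes "integrable N G" "sqint N G" shows "sqint M (ftr N G)"
  using fourier_pairD(3)[OF fourier_pair_swap[OF P] assms] .

lemma Ft_ftr:
  assumes "integrable M f" "sqint M f"
  shows "Ft M N f (ftr M f)"
  unfolding Ft_def using assms fourier_pairD[OF P] by (auto intro: ftr_multiplication)

lemma Ft_unique:
  assumes "Ft M N f F" "Ft M N f F'"
  shows "AE \<xi> in N. F \<xi> = F' \<xi>"
proof -
  have "AE \<xi> in N. F \<xi> - F' \<xi> = 0"
  proof (rule AE_zero_if_orthogonal[OF fourier_pairD(2)[OF P]])
    show "sqint N (\<lambda>\<xi>. F \<xi> - F' \<xi>)" using assms by (intro sqint_diff) (auto simp: Ft_def)
    show "(\<integral>\<xi>. (F \<xi> - F' \<xi>) * G \<xi> \<partial>N) = 0" if "integrable N G" "sqint N G" for G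
      using FtD(3)[OF assms(1) that] FtD(3)[OF assms(2) that]
        sqint_prod[OF FtD(2)[OF assms(1)] that(2)] sqint_prod[OF FtD(2)[OF assms(2)] that(2)]
      by (simp add: left_diff_distrib)
  qed
  then show ?thesis by simp
qed

lemma Ft_cong:
  assumes "Ft M N f F" "AE x in M. f x = f' x" "f' \<in> borel_measurable M"
    and "AE \<xi> in N. F \<xi> = F' \<xi>" "F' \<in> borel_measurable N"
  shows "Ft M N f' F'"
  unfolding Ft_def
proof (intro conjI allI impI)
  show s: "sqint M f'" "sqint N F'" using sqint_cong_AE FtD[OF assms(1)] assms(2-) by blast+
  fix G assume G: "integrable N G" "sqint N G"
  have [measurable]: "ftr N G \<in> borel_measurable M" "f \<in> borel_measurable M" "f' \<in> borel_measurable M"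
     "F \<in> borel_measurable N" "F' \<in> borel_measurable N" "G \<in> borel_measurable N"
    using sqint_measurable[OF sqint_ftr_dual[OF G]] sqint_measurable[OF s(1)] sqint_measurable[OF s(2)]
      sqint_measurable[OF G(2)] sqint_measurable[OF FtD(1)[OF assms(1)]] sqint_measurable[OF FtD(2)[OF assms(1)]] by auto
  have "(\<integral>\<xi>. F' \<xi> * G \<xi> \<partial>N) = (\<integral>\<xi>. F \<xi> * G \<xi> \<partial>N)"
    by (rule integral_cong_AE) (use assms(4) in auto)
  also have "\<dots> = (\<integral>x. f x * ftr N G x \<partial>M)" by (rule FtD(3)[OF assms(1) G])
  also have "\<dots> = (\<integral>x. f' x * ftr N G x \<partial>M)"
    by (rule integral_cong_AE) (use assms(2) in auto)
  finally show "(\<integral>\<xi>. F' \<xi> * G \<xi> \<partial>N) = (\<integral>x. f' x * ftr N G x \<partial>M)" .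
qed

lemma Ft_add:
  assumes "Ft M N f F" "Ft M N g G"
  shows "Ft M N (\<lambda>x. f x + g x) (\<lambda>\<xi>. F \<xi> + G \<xi>)"
  unfolding Ft_def
proof (intro conjI allI impI)
  fix K assume K: "integrable N K" "sqint N K"
  note k = sqint_ftr_dual[OF K]
  show "(\<integral>\<xi>. (F \<xi> + G \<xi>) * K \<xi> \<partial>N) = (\<integral>x. (f x + g x) * ftr N K x \<partial>M)"
    using FtD(3)[OF assms(1) K] FtD(3)[OF assms(2) K] 
      sqint_prod[OF FtD(2)[OF assms(1)] K(2)] sqint_prod[OF FtD(2)[OF assms(2)] K(2)]
      sqint_prod[OF FtD(1)[OF assms(1)] k] sqint_prod[OF FtD(1)[OF assms(2)] k]
    by (simp add: distrib_right)
qed (use assms in \<open>auto intro: sqint_add simp: Ft_def\<close>)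

lemma Ft_cmult:
  assumes "Ft M N f F" shows "Ft M N (\<lambda>x. c * f x) (\<lambda>\<xi>. c * F \<xi>)"
  using assms unfolding Ft_def by (auto intro: sqint_cmult simp: mult.assoc)

lemma Ft_diff:
  assumes "Ft M N f F" "Ft M N g G"
  shows "Ft M N (\<lambda>x. f x - g x) (\<lambda>\<xi>. F \<xi> - G \<xi>)"
  using Ft_add[OF assms(1) Ft_cmult[OF assms(2), of "-1"]] by simp

lemma Ft_lim:
  assumes "\<And>n. Ft M N (f n) (F n)" "sqint M g" "sqint N G"
    and "(\<lambda>n. nsq M (\<lambda>x. f n x - g x)) \<longlonglongrightarrow> 0" "(\<lambda>n. nsq N (\<lambda>\<xi>. F n \<xi> - G \<xi>)) \<longlonglongrightarrow> 0"
  shows "Ft M N g G"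
  unfolding Ft_def
proof (intro conjI allI impI assms)
  fix K assume K: "integrable N K" "sqint N K"
  have 1: "(\<lambda>n. \<integral>\<xi>. F n \<xi> * K \<xi> \<partial>N) \<longlonglongrightarrow> (\<integral>\<xi>. G \<xi> * K \<xi> \<partial>N)"
    by (rule tendsto_integral_mult[OF FtD(2)[OF assms(1)] assms(3) K(2) assms(5)])
  have 2: "(\<lambda>n. \<integral>x. f n x * ftr N K x \<partial>M) \<longlonglongrightarrow> (\<integral>x. g x * ftr N K x \<partial>M)"
    by (rule tendsto_integral_mult[OF FtD(1)[OF assms(1)] assms(2) sqint_ftr_dual[OF K] assms(4)])
  show "(\<integral>\<xi>. G \<xi> * K \<xi> \<partial>N) = (\<integral>x. g x * ftr N K x \<partial>M)"
    using LIMSEQ_unique[OF 1] 2 FtD(3)[OF assms(1) K] by simp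
qed

text \<open>Plancherel on integrable functions makes the transforms of the truncations a Cauchy
  sequence; its limit inherits both the multiplication formula and the norm.\<close>

lemma Ft_ex_aux:
  assumes f: "sqint M f"
  shows "\<exists>F. Ft M N f F \<and> nsq N F = 2 * pi * nsq M f"
proof -
  note RM = fourier_pairD(1)[OF P]
  define f' where "f' n x = indicator {-real n..real n} x * f x" for n x
  have f': "sqint M (f' n)" "integrable M (f' n)" for n
    unfolding f'_def using truncation[OF RM f] by auto
  have lim: "(\<lambda>n. nsq M (\<lambda>x. f' n x - f x)) \<longlonglongrightarrow> 0" unfolding f'_def by (rule truncation(3)[OF RM f])
  have sF: "sqint N (ftr M (f' n))" for n by (rule fourier_pairD(3)[OF P f'(2,1)])
  have d: "nsq N (\<lambda>\<xi>. ftr M (f' m) \<xi> - ftr M (f' n) \<xi>)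
      \<le> 2 * pi * (2 * nsq M (\<lambda>x. f' m x - f x) + 2 * nsq M (\<lambda>x. f' n x - f x))" for m n
  proof -
    have "nsq N (\<lambda>\<xi>. ftr M (f' m) \<xi> - ftr M (f' n) \<xi>) = nsq N (ftr M (\<lambda>x. f' m x - f' n x))"
      by (rule arg_cong[where f = "nsq N"]) (rule ext, rule ftr_diff[OF RM f'(2) f'(2), symmetric])
    also have "\<dots> = 2 * pi * nsq M (\<lambda>x. f' m x - f' n x)"
      using f' by (intro fourier_pairD(4)[OF P]) (auto intro: sqint_diff)
    also have "\<dots> \<le> 2 * pi * (2 * nsq M (\<lambda>x. f' m x - f x) + 2 * nsq M (\<lambda>x. f' n x - f x))"
      using nsq_triangle[OF f'(1) f f'(1), of m n] by (intro mult_left_mono) (auto simp: nsq_commute[of M f])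
    finally show ?thesis .
  qed
  obtain F where F: "sqint N F" "(\<lambda>n. nsq N (\<lambda>\<xi>. ftr M (f' n) \<xi> - F \<xi>)) \<longlonglongrightarrow> 0"
  proof (rule nsq_complete[of N "\<lambda>n. ftr M (f' n)", OF sF])
    fix e :: real assume e: "e > 0"
    obtain K where K: "\<And>n. n \<ge> K \<Longrightarrow> nsq M (\<lambda>x. f' n x - f x) < e / (8 * pi)"
      using LIMSEQ_D[OF lim, of "e / (8 * pi)"] e by (auto simp: nsq_nonneg)
    have "nsq N (\<lambda>\<xi>. ftr M (f' m) \<xi> - ftr M (f' n) \<xi>) < e" if "m \<ge> K" "n \<ge> K" for m n
    proof -
      have "2 * nsq M (\<lambda>x. f' m x - f x) + 2 * nsq M (\<lambda>x. f' n x - f x) < 4 * (e / (8 * pi))"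
        using K[OF that(1)] K[OF that(2)] by linarith
      then have "2 * pi * (2 * nsq M (\<lambda>x. f' m x - f x) + 2 * nsq M (\<lambda>x. f' n x - f x)) < 2 * pi * (4 * (e / (8 * pi)))"
        by (intro mult_strict_left_mono) auto
      also have "2 * pi * (4 * (e / (8 * pi))) = e" by simp
      finally show ?thesis using d[of m n] by linarith
    qed
    then show "\<exists>K. \<forall>m\<ge>K. \<forall>n\<ge>K. nsq N (\<lambda>\<xi>. ftr M (f' m) \<xi> - ftr M (f' n) \<xi>) < e" by blast
  qed
  have "Ft M N f F" by (rule Ft_lim[OF Ft_ftr[OF f'(2,1)] f F(1) lim F(2)])
  moreover have "nsq N F = 2 * pi * nsq M f"
  proof (rule LIMSEQ_unique[OF tendsto_nsq[OF sF F]])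
    have "(\<lambda>n. 2 * pi * nsq M (f' n)) \<longlonglongrightarrow> 2 * pi * nsq M f"
      by (intro tendsto_intros tendsto_nsq[OF f'(1) f lim])
    then show "(\<lambda>n. nsq N (ftr M (f' n))) \<longlonglongrightarrow> 2 * pi * nsq M f"
      using fourier_pairD(4)[OF P f'(2,1)] by simp
  qed
  ultimately show ?thesis by blast
qed

lemma Ft_ex: "sqint M f \<Longrightarrow> \<exists>F. Ft M N f F"
  using Ft_ex_aux by blast

lemma Ft_plancherel:
  assumes "Ft M N f F" shows "nsq N F = 2 * pi * nsq M f"
proof -
  obtain F' where F': "Ft M N f F'" "nsq N F' = 2 * pi * nsq M f" using Ft_ex_aux[OF FtD(1)[OF assms]] by blast
  have "nsq N F = nsq N F'"
    using sqint_cong_AE(2)[OF FtD(2)[OF F'(1)] sqint_measurable[OF FtD(2)[OF assms]] Ft_unique[OF F'(1) assms]] .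
  with F' show ?thesis by simp
qed

lemma Ft_inj:
  assumes "Ft M N f F" "Ft M N g G" "AE \<xi> in N. F \<xi> = G \<xi>"
  shows "AE x in M. f x = g x"
proof -
  note d = Ft_diff[OF assms(1,2)]
  have "nsq N (\<lambda>\<xi>. F \<xi> - G \<xi>) = 0" using nsq_eq_0_iff[OF FtD(2)[OF d]] assms(3) by simp
  then have "nsq M (\<lambda>x. f x - g x) = 0" using Ft_plancherel[OF d] by simp
  then show ?thesis using nsq_eq_0_iff[OF FtD(1)[OF d]] by simp
qed

end

context
  fixes M N assumes P: "fourier_pair M N"
begin

text \<open>Extends the multiplication formula to test functions that are merely square integrable:
  \<open>K\<close> is truncated, and Plancherel in the dual direction controls the transforms of the
  truncations.\<close>

lemma Ft_pairing:
  assumes f: "Ft M N f F" and k: "Ft N M K k"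
  shows "(\<integral>\<xi>. F \<xi> * K \<xi> \<partial>N) = (\<integral>x. f x * k x \<partial>M)"
proof -
  note Q = fourier_pair_swap[OF P] and RN = fourier_pairD(2)[OF P]
  define K' where "K' n x = indicator {-real n..real n} x * K x" for n x
  have K': "sqint N (K' n)" "integrable N (K' n)" for n
    unfolding K'_def using truncation[OF RN FtD(1)[OF k]] by auto
  have lim: "(\<lambda>n. nsq N (\<lambda>x. K' n x - K x)) \<longlonglongrightarrow> 0" unfolding K'_def by (rule truncation(3)[OF RN FtD(1)[OF k]])
  have FK: "Ft N M (K' n) (ftr N (K' n))" for n by (rule Ft_ftr[OF Q K'(2,1)])
  have "nsq M (\<lambda>x. ftr N (K' n) x - k x) = 2 * pi * nsq N (\<lambda>x. K' n x - K x)" for n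
    by (rule Ft_plancherel[OF Q Ft_diff[OF Q FK k]])
  then have lim2: "(\<lambda>n. nsq M (\<lambda>x. ftr N (K' n) x - k x)) \<longlonglongrightarrow> 0"
    using tendsto_mult_left[OF lim, of "2 * pi"] by simp
  have "(\<lambda>n. \<integral>\<xi>. K' n \<xi> * F \<xi> \<partial>N) \<longlonglongrightarrow> (\<integral>\<xi>. K \<xi> * F \<xi> \<partial>N)"
    by (rule tendsto_integral_mult[OF K'(1) FtD(1)[OF k] FtD(2)[OF f] lim])
  moreover have "(\<lambda>n. \<integral>x. ftr N (K' n) x * f x \<partial>M) \<longlonglongrightarrow> (\<integral>x. k x * f x \<partial>M)"
    by (rule tendsto_integral_mult[OF FtD(2)[OF FK] FtD(2)[OF k] FtD(1)[OF f] lim2])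
  moreover have "(\<integral>\<xi>. K' n \<xi> * F \<xi> \<partial>N) = (\<integral>x. ftr N (K' n) x * f x \<partial>M)" for n
    using FtD(3)[OF f K'(2,1), of n] by (simp add: mult.commute)
  ultimately have "(\<integral>\<xi>. K \<xi> * F \<xi> \<partial>N) = (\<integral>x. k x * f x \<partial>M)" using LIMSEQ_unique by simp
  then show ?thesis by (simp add: mult.commute)
qed

text \<open>No pointwise inversion is performed. In the expansion of the squared norm of
  \<open>F - 2 * pi * G\<close>, Plancherel gives both norms and the pairing formula gives the cross
  term; each equals \<open>(2 * pi)^2 * nsq N G\<close>, so the difference vanishes.\<close>

lemma Ft_inversion:
  fixes G :: "real \<Rightarrow> complex"
  assumes h: "Ft N M (\<lambda>\<xi>. cnj (G \<xi>)) h"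
  shows "Ft M N (\<lambda>x. cnj (h x)) (\<lambda>\<xi>. 2 * pi * G \<xi>)"
proof -
  note Q = fourier_pair_swap[OF P]
  have G: "sqint N G" using sqint_cnj[OF FtD(1)[OF h]] by simp
  have s: "sqint M (\<lambda>x. cnj (h x))" by (rule sqint_cnj[OF FtD(2)[OF h]])
  obtain F where F: "Ft M N (\<lambda>x. cnj (h x)) F" using Ft_ex[OF P s] by blast
  have nh: "nsq M h = 2 * pi * nsq N G" using Ft_plancherel[OF Q h] by (simp add: nsq_cnj)
  have nF: "nsq N F = 2 * pi * (2 * pi * nsq N G)" using Ft_plancherel[OF P F] nh by (simp add: nsq_cnj)
  have "(\<integral>\<xi>. F \<xi> * cnj (G \<xi>) \<partial>N) = (\<integral>x. cnj (h x) * h x \<partial>M)" by (rule Ft_pairing[OF F h])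
  also have "\<dots> = complex_of_real (nsq M h)"
    unfolding nsq_def by (simp add: complex_norm_square[symmetric] mult.commute[of "cnj _"] del: of_real_power)
  finally have FG': "(\<integral>\<xi>. F \<xi> * cnj (G \<xi>) \<partial>N) = complex_of_real (2 * pi * nsq N G)" using nh by simp
  have "(\<integral>\<xi>. F \<xi> * cnj (2 * pi * G \<xi>) \<partial>N) = (\<integral>\<xi>. complex_of_real (2 * pi) * (F \<xi> * cnj (G \<xi>)) \<partial>N)"
    by (simp add: mult_ac)
  also have "\<dots> = complex_of_real (2 * pi) * complex_of_real (2 * pi * nsq N G)"
    unfolding integral_mult_right_zero FG' ..
  finally have FG: "(\<integral>\<xi>. F \<xi> * cnj (2 * pi * G \<xi>) \<partial>N) = complex_of_real (2 * pi * (2 * pi * nsq N G))"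
    by simp
  have "nsq N (\<lambda>\<xi>. F \<xi> - 2 * pi * G \<xi>) = 0"
    unfolding nsq_diff_expand[OF FtD(2)[OF F] sqint_cmult[OF G]] FG nsq_cmult nF
    by (simp add: norm_mult power2_eq_square)
  then have "AE \<xi> in N. F \<xi> = 2 * pi * G \<xi>"
    using nsq_eq_0_iff[OF sqint_diff(1)[OF FtD(2)[OF F] sqint_cmult[OF G, of "2*pi"]]] by simp
  then show ?thesis
    by (intro Ft_cong[OF P F]) (use sqint_measurable[OF s] sqint_measurable[OF sqint_cmult[OF G, of "2*pi"]] in auto)
qed

lemma Ft_surj:
  assumes "sqint N G" obtains f where "Ft M N f G"
proof -
  obtain h where h: "Ft N M (\<lambda>\<xi>. cnj (G \<xi>)) h"
    using Ft_ex[OF fourier_pair_swap[OF P] sqint_cnj[OF assms]] by blast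
  have "Ft M N (\<lambda>x. (1 / (2 * pi)) * cnj (h x)) (\<lambda>\<xi>. (1 / (2 * pi)) * (2 * pi * G \<xi>))"
    by (rule Ft_cmult[OF P Ft_inversion[OF h]])
  then show ?thesis by (intro that) simp
qed

lemma Ft_inversion_L1:
  assumes f: "Ft M N f F" and F: "integrable N F"
  shows "AE x in M. f x = cnj (ftr N (\<lambda>\<xi>. cnj (F \<xi>)) x) / (2 * pi)"
proof -
  have "Ft N M (\<lambda>\<xi>. cnj (F \<xi>)) (ftr N (\<lambda>\<xi>. cnj (F \<xi>)))"
    using F sqint_cnj[OF FtD(2)[OF f]] by (intro Ft_ftr[OF fourier_pair_swap[OF P]]) auto
  from Ft_inj[OF P Ft_cmult[OF P f, of "2 * pi"] Ft_inversion[OF this]]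
  show ?thesis by (auto simp: field_simps)
qed

text \<open>Inversion for an integrable transform, with its factor \<open>1 / (2 * pi)\<close>
  estimated by 1.\<close>

lemma Ft_sup_bound:
  assumes f: "Ft M N f F" and F: "integrable N F"
  shows "AE x in M. cmod (f x) \<le> (\<integral>\<xi>. cmod (F \<xi>) \<partial>N)"
  using Ft_inversion_L1[OF assms]
proof eventually_elim
  case (elim x)
  have "cmod (ftr N (\<lambda>\<xi>. cnj (F \<xi>)) x) \<le> (\<integral>\<xi>. cmod (F \<xi>) \<partial>N)"
    using norm_ftr_le[OF fourier_pairD(2)[OF P], of "\<lambda>\<xi>. cnj (F \<xi>)" x] F by simp
  moreover have "cmod (f x) = cmod (ftr N (\<lambda>\<xi>. cnj (F \<xi>)) x) / (2 * pi)"
    by (simp add: elim norm_divide norm_mult)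
  moreover have "a / (2 * pi) \<le> a" if "0 \<le> a" for a :: real
    using divide_left_mono[of 1 "2 * pi" a] that pi_gt3 by simp
  ultimately show ?case using norm_ge_zero[of "ftr N (\<lambda>\<xi>. cnj (F \<xi>)) x"] by (metis order_trans)
qed

text \<open>The pairing formula with \<open>h\<close>, the transform of
  \<open>cnj (G \<xi>)\<close>; inversion identifies \<open>cnj (h x)\<close> with
  \<open>2 * pi * g x\<close>.\<close>

lemma Ft_parseval:
  assumes f: "Ft M N f F" and g: "Ft M N g G"
  shows "(\<integral>\<xi>. F \<xi> * cnj (G \<xi>) \<partial>N) = 2 * pi * (\<integral>x. f x * cnj (g x) \<partial>M)"
proof -
  note Q = fourier_pair_swap[OF P]
  obtain h where h: "Ft N M (\<lambda>\<xi>. cnj (G \<xi>)) h" using Ft_ex[OF Q sqint_cnj[OF FtD(2)[OF g]]] by blast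
  have ae: "AE x in M. cnj (h x) = 2 * pi * g x"
    by (rule Ft_inj[OF P Ft_inversion[OF h] Ft_cmult[OF P g, of "2 * pi"]]) simp
  have [measurable]: "f \<in> borel_measurable M" "g \<in> borel_measurable M" "h \<in> borel_measurable M"
    using sqint_measurable[OF FtD(1)[OF f]] sqint_measurable[OF FtD(1)[OF g]] sqint_measurable[OF FtD(2)[OF h]] by auto
  have "(\<integral>\<xi>. F \<xi> * cnj (G \<xi>) \<partial>N) = (\<integral>x. f x * h x \<partial>M)" by (rule Ft_pairing[OF f h])
  also have "\<dots> = (\<integral>x. 2 * pi * (f x * cnj (g x)) \<partial>M)"
  proof (rule integral_cong_AE)
    show "AE x in M. f x * h x = 2 * pi * (f x * cnj (g x))"
      using ae
    proof eventually_elim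
      case (elim x)
      have "h x = cnj (2 * pi * g x)" using elim by (metis complex_cnj_cnj)
      then show ?case by simp
    qed
  qed auto
  finally show ?thesis by simp
qed

end

section \<open>The measures of the line and of the circle\<close>

lemma sigma_finite_lebesgue: "sigma_finite_measure (lebesgue :: real measure)"
proof
  show "\<exists>A. countable A \<and> A \<subseteq> sets (lebesgue :: real measure) \<and> \<Union>A = space lebesgue \<and> (\<forall>a\<in>A. emeasure lebesgue a \<noteq> \<infinity>)"
  proof (intro exI[of _ "range (\<lambda>n. {-real n..real n})"] conjI ballI)
    show "\<Union>(range (\<lambda>n. {-real n..real n})) = space lebesgue"
    proof -
      have "\<exists>n. -real n \<le> x \<and> x \<le> real n" for x :: real
      proof -
        obtain n where "\<bar>x\<bar> \<le> real n" using real_arch_simple by blast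
        then show ?thesis by (intro exI[of _ n]) linarith
      qed
      then show ?thesis by auto
    qed
  qed auto
qed

lemma sigma_finite_base_measure: "sigma_finite_measure (base_measure X)"
proof (cases X)
  case Circle
  have "finite_measure (lebesgue_on {-pi..pi})"
    by (rule finite_measureI) (simp add: emeasure_restrict_space)
  then show ?thesis using Circle by (simp add: finite_measure_def)
qed (simp add: sigma_finite_lebesgue)

lemma sigma_finite_freq_measure: "sigma_finite_measure (freq_measure X)"
  by (cases X) (auto simp: sigma_finite_lebesgue countable_int Ints_def intro!: sigma_finite_measure_count_space_countable)

lemma reg_base_measure: "reg_measure (base_measure X)"
  unfolding reg_measure_def
proof (intro conjI allI sigma_finite_base_measure)
  show "(\<lambda>x. x) \<in> borel_measurable (base_measure X)"
    by (cases X) (auto intro: measurable_restrict_space1 ident_borel_measurable_lebesgue)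
  have "{x. \<bar>x\<bar> \<le> R} = {-R..R}" for R :: real by (auto simp: abs_le_iff)
  moreover have "{x \<in> {-pi..pi}. \<bar>x\<bar> \<le> R} = {max (-pi) (-R)..min pi R}" for R by (auto simp: abs_le_iff)
  ultimately show "emeasure (base_measure X) {x \<in> space (base_measure X). \<bar>x\<bar> \<le> R} < \<infinity>" for R
    by (cases X) (auto simp: emeasure_restrict_space emeasure_lborel_Icc_eq)
qed

lemma finite_Ints_bounded: "finite {x\<in>\<int>. \<bar>x\<bar> \<le> (R::real)}"
proof -
  have "{x\<in>\<int>. \<bar>x\<bar> \<le> R} \<subseteq> real_of_int ` {-\<lceil>R\<rceil>..\<lceil>R\<rceil>}"
  proof
    fix x assume x: "x \<in> {x\<in>\<int>. \<bar>x\<bar> \<le> R}"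
    then obtain k where k: "x = of_int k" by (auto elim: Ints_cases)
    have "k \<in> {-\<lceil>R\<rceil>..\<lceil>R\<rceil>}" using x k le_of_int_ceiling[of R] by (auto simp: abs_le_iff; linarith)
    then show "x \<in> real_of_int ` {-\<lceil>R\<rceil>..\<lceil>R\<rceil>}" using k by blast
  qed
  then show ?thesis by (rule finite_subset) simp
qed

lemma reg_freq_measure: "reg_measure (freq_measure X)"
proof (cases X)
  case Line
  then show ?thesis using reg_base_measure[of Line] by simp
next
  case Circle
  have "emeasure (count_space \<int>) {x \<in> \<int>. \<bar>x\<bar> \<le> R} < \<infinity>" for R :: real
    using finite_Ints_bounded[of R] by (subst emeasure_count_space_finite) (auto simp: of_nat_less_top)
  then show ?thesis using Circle sigma_finite_freq_measure[of X] by (simp add: reg_measure_def)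
qed

text \<open>Convolutions of transforms rest on this substitution. The centre must itself be a
  frequency: on the circle \<open>c - \<xi>\<close> permutes the integers when \<open>c\<close> is
  an integer.\<close>

lemma freq_measure_reflect:
  assumes "c \<in> space (freq_measure X)"
  shows "distr (freq_measure X) (freq_measure X) (\<lambda>\<xi>. c - \<xi>) = freq_measure X"
    and "(\<lambda>\<xi>. c - \<xi>) \<in> measurable (freq_measure X) (freq_measure X)"
proof -
  have "lebesgue = distr lebesgue lebesgue (\<lambda>\<xi>::real. c - \<xi>)"
    using lebesgue_real_affine[of "-1" c] by (simp add: density_1)
  moreover have "bij_betw (\<lambda>\<xi>::real. c - \<xi>) \<int> \<int>" if "c \<in> \<int>"
    by (rule bij_betw_byWitness[where f' = "\<lambda>\<xi>. c - \<xi>"]) (use that in auto)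
  ultimately show "distr (freq_measure X) (freq_measure X) (\<lambda>\<xi>. c - \<xi>) = freq_measure X"
    using assms by (cases X) (auto simp: distr_bij_count_space)
  have "(\<lambda>\<xi>. c - \<xi>) \<in> measurable lebesgue lebesgue"
    using lebesgue_affine_measurable[of "\<lambda>_. -1" "c::real"] by simp
  then show "(\<lambda>\<xi>. c - \<xi>) \<in> measurable (freq_measure X) (freq_measure X)"
    using assms by (cases X) auto
qed

lemma integral_freq_reflect:
  fixes f :: "real \<Rightarrow> complex"
  assumes c: "c \<in> space (freq_measure X)" and f: "f \<in> borel_measurable (freq_measure X)"
  shows "integrable (freq_measure X) (\<lambda>\<xi>. f (c - \<xi>)) \<longleftrightarrow> integrable (freq_measure X) f"
    and "(\<integral>\<xi>. f (c - \<xi>) \<partial>freq_measure X) = (\<integral>\<xi>. f \<xi> \<partial>freq_measure X)"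
  using integrable_distr_eq[OF freq_measure_reflect(2)[OF c] f] integral_distr[OF freq_measure_reflect(2)[OF c] f]
  unfolding freq_measure_reflect(1)[OF c] by auto

lemma sqint_freq_reflect:
  assumes c: "c \<in> space (freq_measure X)" and f: "sqint (freq_measure X) f"
  shows "sqint (freq_measure X) (\<lambda>\<xi>. f (c - \<xi>))" "nsq (freq_measure X) (\<lambda>\<xi>. f (c - \<xi>)) = nsq (freq_measure X) f"
proof -
  note m = freq_measure_reflect(2)[OF c]
  have fm: "f \<in> borel_measurable (freq_measure X)" using f by (simp add: sqint_def)
  have fm2: "(\<lambda>\<xi>. (cmod (f \<xi>))\<^sup>2) \<in> borel_measurable (freq_measure X)" using fm by simp
  show "sqint (freq_measure X) (\<lambda>\<xi>. f (c - \<xi>))"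
    using f measurable_compose[OF m fm] integrable_distr_eq[OF m fm2]
    unfolding freq_measure_reflect(1)[OF c] sqint_def by auto
  show "nsq (freq_measure X) (\<lambda>\<xi>. f (c - \<xi>)) = nsq (freq_measure X) f"
    using integral_distr[OF m fm2] unfolding freq_measure_reflect(1)[OF c] nsq_def by auto
qed

lemma zero_in_freq: "0 \<in> space (freq_measure X)"
  by (cases X) auto

section \<open>Poisson kernels\<close>

text \<open>Closed form of the integral of \<open>exp (- z * \<xi>)\<close> over the positive
  frequencies: a Laplace integral on the line, a geometric series on the circle.\<close>

primrec half_sum :: "base \<Rightarrow> complex \<Rightarrow> complex" where
  "half_sum Line z = 1 / z"
| "half_sum Circle z = exp (- z) / (1 - exp (- z))"

lemma exp_half_line:
  assumes z: "Re z > 0"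
  shows "has_bochner_integral lebesgue (\<lambda>\<xi>. indicator {0<..} \<xi> *\<^sub>R exp (- (z * complex_of_real \<xi>))) (1 / z)"
proof -
  let ?f = "\<lambda>\<xi>::real. exp (- (z * complex_of_real \<xi>))" and ?F = "\<lambda>\<xi>::real. - exp (- (z * complex_of_real \<xi>)) / z"
  have z0: "z \<noteq> 0" using z by auto
  have nf: "cmod (?f \<xi>) = exp (- (Re z * \<xi>))" for \<xi> by (simp add: norm_exp_eq_Re)
  have lim: "((\<lambda>\<xi>. exp (- (Re z * \<xi>))) \<longlongrightarrow> 0) at_top"
    using z by real_asymp
  have nn: "(\<integral>\<^sup>+\<xi>. ennreal (exp (- (Re z * \<xi>))) * indicator {0..} \<xi> \<partial>lborel) = ennreal (0 - (- exp (- (Re z * 0)) / Re z))"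
  proof (rule nn_integral_FTC_atLeast)
    show "((\<lambda>\<xi>. - exp (- (Re z * \<xi>)) / Re z) \<longlongrightarrow> 0) at_top"
      using tendsto_minus[OF tendsto_divide[OF lim tendsto_const, of "Re z"]] z by simp
    show "DERIV (\<lambda>\<xi>. - exp (- (Re z * \<xi>)) / Re z) x :> exp (- (Re z * x))" for x
      using z by (auto intro!: derivative_eq_intros)
  qed auto
  have i: "integrable lborel (\<lambda>\<xi>. indicator {0<..} \<xi> *\<^sub>R ?f \<xi>)"
  proof (rule integrableI_bounded)
    have "(\<integral>\<^sup>+\<xi>. ennreal (norm (indicator {0<..} \<xi> *\<^sub>R ?f \<xi>)) \<partial>lborel)
      \<le> (\<integral>\<^sup>+\<xi>. ennreal (exp (- (Re z * \<xi>))) * indicator {0..} \<xi> \<partial>lborel)"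
      by (intro nn_integral_mono) (auto simp: indicator_def nf)
    also have "\<dots> < \<infinity>" unfolding nn by simp
    finally show "(\<integral>\<^sup>+\<xi>. ennreal (norm (indicator {0<..} \<xi> *\<^sub>R ?f \<xi>)) \<partial>lborel) < \<infinity>" .
  qed simp
  have e: "einterval 0 \<infinity> = {0<..}" using einterval_eq_Ici[of 0] by (simp add: zero_ereal_def)
  have "(LBINT \<xi>=0..\<infinity>. ?f \<xi>) = 0 - (- 1 / z)"
  proof (rule interval_integral_FTC_integrable[where F = ?F])
    show "(?F has_vector_derivative ?f \<xi>) (at \<xi>)" for \<xi>
    proof -
      have "((\<lambda>w. - exp (- (z * w)) / z) has_field_derivative exp (- (z * complex_of_real \<xi>))) (at (complex_of_real \<xi>))"
        using z0 by (auto intro!: derivative_eq_intros)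
      from has_vector_derivative_real_field[OF this] show ?thesis .
    qed
    show "isCont ?f \<xi>" for \<xi> by (intro continuous_intros)
    show "set_integrable lborel (einterval 0 \<infinity>) ?f" unfolding e set_integrable_def by (rule i)
    have "isCont ?F 0" by (intro continuous_intros) (use z0 in auto)
    then have "(?F \<longlongrightarrow> - 1 / z) (at_right 0)"
      using filterlim_mono[OF isContD order_refl at_le[OF subset_UNIV]] by fastforce
    then show "((?F \<circ> real_of_ereal) \<longlongrightarrow> - 1 / z) (at_right 0)"
      unfolding zero_ereal_def ereal_tendsto_simps .
    have "(?f \<longlongrightarrow> 0) at_top" by (rule tendsto_norm_zero_cancel) (use lim in \<open>simp add: nf\<close>)
    from tendsto_minus[OF tendsto_divide[OF this tendsto_const, of z]]
    have "(?F \<longlongrightarrow> 0) at_top" using z0 by simp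
    then show "((?F \<circ> real_of_ereal) \<longlongrightarrow> 0) (at_left \<infinity>)"
      unfolding ereal_tendsto_simps .
  qed auto
  then have "(\<integral>\<xi>. indicator {0<..} \<xi> *\<^sub>R ?f \<xi> \<partial>lborel) = 1 / z"
    by (simp add: interval_lebesgue_integral_def e set_lebesgue_integral_def)
  then show ?thesis using i
    by (simp add: has_bochner_integral_iff integrable_completion integral_completion)
qed

lemma exp_half_integers:
  assumes z: "Re z > 0"
  shows "has_bochner_integral (count_space \<int>) (\<lambda>\<xi>. indicator {0<..} \<xi> *\<^sub>R exp (- (z * complex_of_real \<xi>)))
    (exp (- z) / (1 - exp (- z)))"
proof -
  let ?f = "\<lambda>\<xi>::real. exp (- (z * complex_of_real \<xi>))"
  let ?q = "exp (- z)"
  have q: "cmod ?q < 1" using z by (simp add: norm_exp_eq_Re)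
  have f: "?f (real (Suc n)) = ?q ^ Suc n" for n
    unfolding exp_of_nat_mult[symmetric] by (simp add: mult.commute)
  have bij: "bij_betw (\<lambda>n. real (Suc n)) UNIV (\<int> \<inter> {0<..})"
  proof (rule bij_betw_imageI)
    show "inj (\<lambda>n. real (Suc n))" by (auto simp: inj_on_def)
    show "range (\<lambda>n. real (Suc n)) = \<int> \<inter> {0<..}"
    proof safe
      fix x :: real assume "x \<in> \<int>" "0 < x"
      then obtain k where k: "x = of_int k" "k > 0" by (auto elim: Ints_cases)
      then have "x = real (Suc (nat (k - 1)))" by simp
      then show "x \<in> range (\<lambda>n. real (Suc n))" by blast
    qed auto
  qed
  have s: "summable (\<lambda>n. norm (?q ^ Suc n))"
    using q by (simp add: norm_power norm_mult summable_mult summable_geometric)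
  have i: "integrable (count_space UNIV) (\<lambda>n. ?f (real (Suc n)))"
    unfolding integrable_count_space_nat_iff f by (rule s)
  have v: "(\<integral>n. ?f (real (Suc n)) \<partial>count_space UNIV) = ?q / (1 - ?q)"
  proof -
    have "(\<integral>n. ?f (real (Suc n)) \<partial>count_space UNIV) = (\<Sum>n. ?q ^ Suc n)"
      using integral_count_space_nat[OF i] by (simp only: f)
    also have "\<dots> = ?q * (\<Sum>n. ?q ^ n)" using q by (simp add: suminf_mult summable_geometric)
    finally show ?thesis using q by (simp add: suminf_geometric)
  qed
  have r: "restrict_space (count_space \<int>) {0<..} = count_space (\<int> \<inter> {0<..} :: real set)"
    by (simp add: restrict_count_space Int_commute)
  have "integrable (restrict_space (count_space \<int>) {0<..}) ?f"
    unfolding r using i integrable_bij_count_space[OF bij, of ?f] by blast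
  then have 1: "integrable (count_space \<int>) (\<lambda>\<xi>. indicator {0<..} \<xi> *\<^sub>R ?f \<xi>)"
    by (subst (asm) integrable_restrict_space) auto
  have "integral\<^sup>L (restrict_space (count_space \<int>) {0<..}) ?f = ?q / (1 - ?q)"
    unfolding r using v integral_bij_count_space[OF bij, of ?f] by simp
  then have 2: "(\<integral>\<xi>. indicator {0<..} \<xi> *\<^sub>R ?f \<xi> \<partial>count_space \<int>) = ?q / (1 - ?q)"
    by (subst (asm) integral_restrict_space) auto
  show ?thesis using 1 2 by (simp add: has_bochner_integral_iff)
qed

lemma half_sum_integral:
  assumes "Re z > 0"
  shows "has_bochner_integral (freq_measure X) (\<lambda>\<xi>. indicator {0<..} \<xi> *\<^sub>R exp (- (z * complex_of_real \<xi>))) (half_sum X z)"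
  using exp_half_line[OF assms] exp_half_integers[OF assms] by (cases X) auto

text \<open>Splitting a frequency integral by sign leaves the point 0, a null set on the line and an
  atom on the circle.\<close>

primrec zero_mass :: "base \<Rightarrow> real" where "zero_mass Line = 0" | "zero_mass Circle = 1"

lemma zero_mass_integral:
  "has_bochner_integral (freq_measure X) (\<lambda>\<xi>. indicator {0} \<xi> *\<^sub>R (c::complex)) (zero_mass X *\<^sub>R c)"
proof -
  have m: "measure (freq_measure X) {0} = zero_mass X" 
    by (cases X) (auto simp: measure_def emeasure_count_space_finite)
  show ?thesis using has_bochner_integral_indicator[of "{0}" "freq_measure X" c] m
    by (cases X) (auto simp: emeasure_count_space_finite)
qed

text \<open>Normalised to total mass \<open>2 * pi\<close> on both domains. On the circle the
  classical radius is \<open>exp (-\<epsilon>)\<close>, so that both kernels come from the same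
  damping in frequency.\<close>

primrec poisson :: "base \<Rightarrow> real \<Rightarrow> real \<Rightarrow> real" where
  "poisson Line \<epsilon> u = 2 * (\<epsilon> / (\<epsilon>\<^sup>2 + u\<^sup>2))"
| "poisson Circle \<epsilon> u = (1 - (exp (-\<epsilon>))\<^sup>2) / (1 - 2 * exp (-\<epsilon>) * cos u + (exp (-\<epsilon>))\<^sup>2)"

primrec conj_poisson :: "base \<Rightarrow> real \<Rightarrow> real \<Rightarrow> real" where
  "conj_poisson Line \<epsilon> u = 2 * (u / (\<epsilon>\<^sup>2 + u\<^sup>2))"
| "conj_poisson Circle \<epsilon> u = 2 * exp (-\<epsilon>) * sin u / (1 - 2 * exp (-\<epsilon>) * cos u + (exp (-\<epsilon>))\<^sup>2)"

lemma half_sum_poisson: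
  assumes "\<epsilon> > 0"
  shows "2 * Re (half_sum X (Complex \<epsilon> (-u))) + zero_mass X = poisson X \<epsilon> u"
    and "2 * Im (half_sum X (Complex \<epsilon> (-u))) = conj_poisson X \<epsilon> u"
proof -
  define q where "q = exp (- Complex \<epsilon> (-u))"
  define r where "r = exp (-\<epsilon>)"
  have r: "0 < r" "r < 1" using assms by (auto simp: r_def)
  have q: "Re q = r * cos u" "Im q = r * sin u" unfolding q_def r_def Re_exp Im_exp by auto
  have sc: "(sin u)\<^sup>2 = 1 - (cos u)\<^sup>2" by (simp add: sin_squared_eq)
  have D: "(Re (1 - q))\<^sup>2 + (Im (1 - q))\<^sup>2 = 1 - 2 * r * cos u + r\<^sup>2"
    by (simp add: q power2_diff power_mult_distrib sc algebra_simps)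
  have D0: "1 - 2 * r * cos u + r\<^sup>2 > 0"
  proof -
    have "r * cos u \<le> r * 1" using r by (intro mult_left_mono) auto
    then have "1 - 2 * r * cos u + r\<^sup>2 \<ge> (1 - r)\<^sup>2" by (simp add: power2_diff)
    moreover have "(1 - r)\<^sup>2 > 0" using r by simp
    ultimately show ?thesis by linarith
  qed
  have re: "Re (q / (1 - q)) = (r * cos u - r\<^sup>2) / (1 - 2 * r * cos u + r\<^sup>2)"
    unfolding Re_divide D by (simp add: q power_mult_distrib power2_eq_square[of "sin u", symmetric] sc algebra_simps power2_eq_square[of r] power2_eq_square[of "cos u"])
  have im: "Im (q / (1 - q)) = r * sin u / (1 - 2 * r * cos u + r\<^sup>2)"
    unfolding Im_divide D by (simp add: q algebra_simps)
  have "2 * Re (q / (1 - q)) + 1 = (1 - r\<^sup>2) / (1 - 2 * r * cos u + r\<^sup>2)"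
  proof -
    have "2 * (a / D) + 1 = (2 * a + D) / D" if "D > 0" for a D :: real
      using that by (simp add: field_simps)
    note this[OF D0, of "r * cos u - r\<^sup>2"]
    moreover have "2 * (r * cos u - r\<^sup>2) + (1 - 2 * r * cos u + r\<^sup>2) = 1 - r\<^sup>2" by simp
    ultimately show ?thesis unfolding re by (simp only:)
  qed
  then show "2 * Re (half_sum X (Complex \<epsilon> (-u))) + zero_mass X = poisson X \<epsilon> u"
    by (cases X) (auto simp: Re_divide q_def[symmetric] r_def[symmetric])
  show "2 * Im (half_sum X (Complex \<epsilon> (-u))) = conj_poisson X \<epsilon> u"
    using im by (cases X) (auto simp: Im_divide q_def[symmetric] r_def[symmetric])
qed

text \<open>The integrand is the positive half \<open>g\<close>, its reflected conjugate, and the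
  atom at 0. Their sum produces the Poisson kernel; with the sign factor the atom drops out and the
  difference of the halves produces the conjugate kernel.\<close>

lemma poisson_frequency_integral:
  assumes e: "\<epsilon> > 0"
  shows "has_bochner_integral (freq_measure X) (\<lambda>\<xi>. complex_of_real (exp (- \<epsilon> * \<bar>\<xi>\<bar>)) * cnj (wave u \<xi>))
      (complex_of_real (poisson X \<epsilon> u))" (is ?P)
    and "has_bochner_integral (freq_measure X)
      (\<lambda>\<xi>. (- \<i> * complex_of_real (sgn \<xi>)) * (complex_of_real (exp (- \<epsilon> * \<bar>\<xi>\<bar>)) * cnj (wave u \<xi>)))
      (complex_of_real (conj_poisson X \<epsilon> u))" (is ?Q)
proof -
  let ?N = "freq_measure X" and ?z = "Complex \<epsilon> (-u)"
  define g where "g \<xi> = indicator {0<..} \<xi> *\<^sub>R exp (- (?z * complex_of_real \<xi>))" for \<xi> :: real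
  define Z where "Z = half_sum X ?z"
  have g: "has_bochner_integral ?N g Z" unfolding g_def Z_def by (rule half_sum_integral) (use e in simp)
  have ge: "exp (- (?z * complex_of_real \<xi>)) = complex_of_real (exp (- \<epsilon> * \<xi>)) * cnj (wave u \<xi>)" for \<xi>
  proof -
    have "- (?z * complex_of_real \<xi>) = complex_of_real (- \<epsilon> * \<xi>) + \<i> * complex_of_real (u * \<xi>)"
      by (simp add: complex_eq_iff)
    moreover have "cnj (wave u \<xi>) = exp (\<i> * complex_of_real (u * \<xi>))"
      by (simp add: wave_def exp_cnj)
    ultimately show ?thesis by (simp add: exp_add exp_of_real[symmetric] del: of_real_minus of_real_mult)
  qed
  have ge': "exp (?z * complex_of_real \<xi>) = complex_of_real (exp (\<epsilon> * \<xi>)) * wave u \<xi>" for \<xi>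
    using ge[of "- \<xi>"] by (simp add: wave_minus2)
  have gm: "g \<in> borel_measurable ?N" using g by (auto simp: has_bochner_integral_iff)
  have "has_bochner_integral ?N (\<lambda>\<xi>. g (0 - \<xi>)) Z"
    using g integral_freq_reflect[OF zero_in_freq gm] by (simp add: has_bochner_integral_iff)
  then have g': "has_bochner_integral ?N (\<lambda>\<xi>. cnj (g (- \<xi>))) (cnj Z)"
    using has_bochner_integral_bounded_linear[OF bounded_linear_cnj] by fastforce
  have p: "complex_of_real (exp (- \<epsilon> * \<bar>\<xi>\<bar>)) * cnj (wave u \<xi>) = g \<xi> + cnj (g (- \<xi>)) + indicator {0} \<xi> *\<^sub>R 1" for \<xi>
    by (cases "\<xi> > 0"; cases "\<xi> < 0") (auto simp: g_def ge ge' wave_minus2)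
  have q: "(- \<i> * complex_of_real (sgn \<xi>)) * (complex_of_real (exp (- \<epsilon> * \<bar>\<xi>\<bar>)) * cnj (wave u \<xi>)) = - \<i> * (g \<xi> - cnj (g (- \<xi>)))" for \<xi>
    by (cases "\<xi> > 0"; cases "\<xi> < 0") (auto simp: g_def ge ge' wave_minus2)
  have "Z + cnj Z + zero_mass X *\<^sub>R 1 = complex_of_real (poisson X \<epsilon> u)"
    using half_sum_poisson(1)[OF e, of X u] by (simp add: complex_eq_iff Z_def)
  then show ?P unfolding p
    using has_bochner_integral_add[OF has_bochner_integral_add[OF g g'] zero_mass_integral[of X 1]] by simp
  have "- \<i> * (Z - cnj Z) = complex_of_real (conj_poisson X \<epsilon> u)"
    using half_sum_poisson(2)[OF e, of X u] by (simp add: complex_eq_iff Z_def)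
  then show ?Q unfolding q
    using has_bochner_integral_mult_right[OF has_bochner_integral_diff[OF g g'], of "- \<i>"] by simp
qed

lemma poisson_denominator:
  fixes \<epsilon> :: real
  assumes "\<epsilon> > 0"
  shows "1 - 2 * exp (-\<epsilon>) * cos u + (exp (-\<epsilon>))\<^sup>2 = (1 - exp (-\<epsilon>))\<^sup>2 + 2 * exp (-\<epsilon>) * (1 - cos u)"
    and "1 - 2 * exp (-\<epsilon>) * cos u + (exp (-\<epsilon>))\<^sup>2 > 0"
proof -
  show e: "1 - 2 * exp (-\<epsilon>) * cos u + (exp (-\<epsilon>))\<^sup>2 = (1 - exp (-\<epsilon>))\<^sup>2 + 2 * exp (-\<epsilon>) * (1 - cos u)"
    by (simp add: power2_diff algebra_simps)
  have "2 * exp (-\<epsilon>) * (1 - cos u) \<ge> 0" by simp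
  moreover have "(1 - exp (-\<epsilon>))\<^sup>2 > 0" using assms by simp
  ultimately show "1 - 2 * exp (-\<epsilon>) * cos u + (exp (-\<epsilon>))\<^sup>2 > 0" unfolding e by linarith
qed

lemma poisson_nonneg: "\<epsilon> > 0 \<Longrightarrow> poisson X \<epsilon> u \<ge> 0"
proof (cases X)
  case Circle
  assume e: "\<epsilon> > 0"
  have "(exp (-\<epsilon>))\<^sup>2 \<le> 1" using e by (simp add: power_le_one)
  then show ?thesis using poisson_denominator(2)[OF e, of u] Circle by simp
qed simp

lemma poisson_even: "poisson X \<epsilon> (- u) = poisson X \<epsilon> u"
  by (cases X) auto

text \<open>The test function for the multiplication formula whose transform is the Poisson kernel
  centred at \<open>x\<close>.\<close>

definition poisson_wave :: "real \<Rightarrow> real \<Rightarrow> real \<Rightarrow> complex" where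
  "poisson_wave \<epsilon> x \<xi> = complex_of_real (exp (- \<epsilon> * \<bar>\<xi>\<bar>)) * cnj (wave x \<xi>)"

lemma norm_poisson_wave [simp]: "cmod (poisson_wave \<epsilon> x \<xi>) = exp (- \<epsilon> * \<bar>\<xi>\<bar>)"
  by (simp add: poisson_wave_def norm_mult)

lemma poisson_wave_integrable:
  assumes "\<epsilon> > 0"
  shows "integrable (freq_measure X) (poisson_wave \<epsilon> x)" "sqint (freq_measure X) (poisson_wave \<epsilon> x)"
proof -
  show i: "integrable (freq_measure X) (poisson_wave \<epsilon> x)"
    using poisson_frequency_integral(1)[OF assms, of X x]
    unfolding has_bochner_integral_iff poisson_wave_def[abs_def] by blast
  have "integrable (freq_measure X) (\<lambda>\<xi>. complex_of_real (exp (- (2 * \<epsilon>) * \<bar>\<xi>\<bar>)) * cnj (wave 0 \<xi>))"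
    using poisson_frequency_integral(1)[of "2 * \<epsilon>" X 0] assms unfolding has_bochner_integral_iff by simp
  from integrable_norm[OF this]
  have "integrable (freq_measure X) (\<lambda>\<xi>. exp (- (2 * \<epsilon>) * \<bar>\<xi>\<bar>))" by (simp add: norm_mult)
  moreover have "(cmod (poisson_wave \<epsilon> x \<xi>))\<^sup>2 = exp (- (2 * \<epsilon>) * \<bar>\<xi>\<bar>)" for \<xi>
    by (simp add: power2_eq_square exp_add[symmetric])
  ultimately show "sqint (freq_measure X) (poisson_wave \<epsilon> x)"
    unfolding sqint_def using i by simp
qed

lemma exp_weight_integrable:
  assumes "\<epsilon> > 0" shows "integrable (freq_measure X) (\<lambda>\<xi>. exp (- \<epsilon> * \<bar>\<xi>\<bar>))"
  using integrable_norm[OF poisson_wave_integrable(1)[OF assms, of X 0]] by simp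

lemma ftr_poisson_wave:
  assumes "\<epsilon> > 0"
  shows "ftr (freq_measure X) (poisson_wave \<epsilon> x) y = complex_of_real (poisson X \<epsilon> (x - y))"
proof -
  have "wave \<xi> y * poisson_wave \<epsilon> x \<xi> = complex_of_real (exp (- \<epsilon> * \<bar>\<xi>\<bar>)) * cnj (wave (x - y) \<xi>)" for \<xi>
    unfolding poisson_wave_def wave_diff by (simp add: wave_commute[of \<xi> y])
  then have "ftr (freq_measure X) (poisson_wave \<epsilon> x) y
     = (\<integral>\<xi>. complex_of_real (exp (- \<epsilon> * \<bar>\<xi>\<bar>)) * cnj (wave (x - y) \<xi>) \<partial>freq_measure X)"
    unfolding ftr_def by (simp only:)
  then show ?thesis
    using poisson_frequency_integral(1)[OF assms, of X "x - y"] by (simp only: has_bochner_integral_iff)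
qed

lemma ftr_conj_poisson_wave:
  assumes "\<epsilon> > 0"
  shows "ftr (freq_measure X) (\<lambda>\<xi>. (- \<i> * complex_of_real (sgn \<xi>)) * poisson_wave \<epsilon> x \<xi>) y
    = complex_of_real (conj_poisson X \<epsilon> (x - y))"
    and "integrable (freq_measure X) (\<lambda>\<xi>. (- \<i> * complex_of_real (sgn \<xi>)) * poisson_wave \<epsilon> x \<xi>)"
    and "sqint (freq_measure X) (\<lambda>\<xi>. (- \<i> * complex_of_real (sgn \<xi>)) * poisson_wave \<epsilon> x \<xi>)"
proof -
  have "wave \<xi> y * ((- \<i> * complex_of_real (sgn \<xi>)) * poisson_wave \<epsilon> x \<xi>)
    = (- \<i> * complex_of_real (sgn \<xi>)) * (complex_of_real (exp (- \<epsilon> * \<bar>\<xi>\<bar>)) * cnj (wave (x - y) \<xi>))" for \<xi>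
    unfolding poisson_wave_def wave_diff by (simp add: wave_commute[of \<xi> y])
  then have "ftr (freq_measure X) (\<lambda>\<xi>. (- \<i> * complex_of_real (sgn \<xi>)) * poisson_wave \<epsilon> x \<xi>) y
     = (\<integral>\<xi>. (- \<i> * complex_of_real (sgn \<xi>)) * (complex_of_real (exp (- \<epsilon> * \<bar>\<xi>\<bar>)) * cnj (wave (x - y) \<xi>)) \<partial>freq_measure X)"
    unfolding ftr_def by (simp only:)
  then show "ftr (freq_measure X) (\<lambda>\<xi>. (- \<i> * complex_of_real (sgn \<xi>)) * poisson_wave \<epsilon> x \<xi>) y
    = complex_of_real (conj_poisson X \<epsilon> (x - y))"
    using poisson_frequency_integral(2)[OF assms, of X "x - y"] by (simp only: has_bochner_integral_iff)
  show i: "integrable (freq_measure X) (\<lambda>\<xi>. (- \<i> * complex_of_real (sgn \<xi>)) * poisson_wave \<epsilon> x \<xi>)"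
    using poisson_frequency_integral(2)[OF assms, of X x]
    unfolding has_bochner_integral_iff poisson_wave_def by blast
  show "sqint (freq_measure X) (\<lambda>\<xi>. (- \<i> * complex_of_real (sgn \<xi>)) * poisson_wave \<epsilon> x \<xi>)"
    by (rule sqint_dominated(1)[OF poisson_wave_integrable(2)[OF assms, of X x] borel_measurable_integrable[OF i], where C = 1])
       (auto simp: norm_mult sgn_if)
qed

text \<open>Orthogonality of the characters: for a nonzero integer frequency the primitive is again
  a multiple of the character and takes equal values at both ends of the period.\<close>

lemma ftr_one_circle:
  assumes "\<xi> \<in> \<int>"
  shows "ftr (lebesgue_on {-pi..pi}) (\<lambda>_. 1) \<xi> = complex_of_real (2 * pi * indicator {0} \<xi>)"
proof (cases "\<xi> = 0")
  case True
  then show ?thesis by (simp add: ftr_def measure_restrict_space scaleR_conv_of_real)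
next
  case False
  have c: "continuous_on {-pi..pi} (\<lambda>x. wave x \<xi>)" unfolding wave_def by (intro continuous_intros)
  have i: "integrable (lebesgue_on {-pi..pi}) (\<lambda>x. wave x \<xi>)"
    by (rule continuous_imp_integrable_real[OF c])
  let ?F = "\<lambda>x. wave x \<xi> / (- \<i> * complex_of_real \<xi>)"
  have "((\<lambda>x. wave x \<xi>) has_integral (?F pi - ?F (-pi))) {-pi..pi}"
  proof (rule fundamental_theorem_of_calculus)
    fix x
    have "((\<lambda>w. exp (- (\<i> * (w * complex_of_real \<xi>))) / (- \<i> * complex_of_real \<xi>)) has_field_derivative
        exp (- (\<i> * (complex_of_real x * complex_of_real \<xi>)))) (at (complex_of_real x))"
      using False by (auto intro!: derivative_eq_intros simp: mult_ac)
    from has_vector_derivative_real_field[OF this]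
    show "(?F has_vector_derivative wave x \<xi>) (at x within {-pi..pi})"
      by (simp add: wave_def has_vector_derivative_at_within)
  qed simp
  moreover have "wave pi \<xi> = wave (-pi) \<xi>"
  proof -
    obtain k where k: "\<xi> = of_int k" using assms by (auto elim: Ints_cases)
    have "wave (2 * pi) \<xi> = exp (complex_of_real (2 * of_int (- k) * pi) * \<i>)"
      unfolding wave_def k by (rule arg_cong[where f = exp]) (simp add: complex_eq_iff)
    also have "\<dots> = 1" by (rule exp_integer_2pi) simp
    finally have "wave (-pi + 2 * pi) \<xi> = wave (-pi) \<xi>" unfolding wave_add by simp
    then show ?thesis by simp
  qed
  ultimately have "integral {-pi..pi} (\<lambda>x. wave x \<xi>) = 0" by (simp add: integral_unique)
  then show ?thesis using False lebesgue_integral_eq_integral[OF i] by (simp add: ftr_def)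
qed

section \<open>Mass of the Poisson kernel and the upper half of Plancherel\<close>

lemma poisson_measurable: "(\<lambda>u. poisson X \<epsilon> u) \<in> borel_measurable borel"
  by (cases X; simp only: poisson.simps; measurable)

lemma conj_poisson_measurable: "(\<lambda>u. conj_poisson X \<epsilon> u) \<in> borel_measurable borel"
  by (cases X; simp only: conj_poisson.simps; measurable)

lemma poisson_diff_measurable:
  "(\<lambda>y. poisson X \<epsilon> (x - y)) \<in> borel_measurable (base_measure X)"
  by (rule measurable_compose[OF borel_measurable_diff[OF borel_measurable_const reg_measureD(2)[OF reg_base_measure]] poisson_measurable])

text \<open>On the circle no primitive is computed: the constant 1 is paired with
  \<open>poisson_wave\<close>, and since its transform sits at frequency 0 only the value of the
  test function there survives.\<close>

lemma poisson_mass: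
  assumes e: "\<epsilon> > 0"
  shows "has_bochner_integral (base_measure X) (\<lambda>y. poisson X \<epsilon> (x - y)) (2 * pi)"
proof (cases X)
  case Line
  have "has_bochner_integral lebesgue (\<lambda>y. \<epsilon> / (\<epsilon>\<^sup>2 + (x - y)\<^sup>2)) pi"
    using cauchy_kernel_integral[OF e, of x] by (simp add: has_bochner_integral_iff)
  from has_bochner_integral_mult_right[OF this, of 2] show ?thesis using Line by simp
next
  case Circle
  let ?M = "base_measure X" and ?N = "freq_measure X"
  have fin: "finite_measure ?M" using Circle by (auto intro!: finite_measureI simp: emeasure_restrict_space)
  interpret finite_measure ?M by (rule fin)
  note pw = poisson_wave_integrable[OF e, of X x]
  have i: "integrable ?M (\<lambda>y. ftr ?N (poisson_wave \<epsilon> x) y)"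
    by (rule integrable_const_bound[OF AE_I2[OF norm_ftr_le[OF reg_freq_measure pw(1)]]
        borel_measurable_ftr[OF reg_freq_measure reg_base_measure borel_measurable_integrable[OF pw(1)]]])
  have one: "integrable ?M (\<lambda>_. 1 :: complex)" by simp
  have "(\<integral>y. ftr ?N (poisson_wave \<epsilon> x) y \<partial>?M) = (\<integral>y. 1 * ftr ?N (poisson_wave \<epsilon> x) y \<partial>?M)" by simp
  also have "\<dots> = (\<integral>\<xi>. ftr ?M (\<lambda>_. 1) \<xi> * poisson_wave \<epsilon> x \<xi> \<partial>?N)"
    by (rule ftr_multiplication[OF reg_base_measure reg_freq_measure one pw(1), symmetric])
  also have "\<dots> = (\<integral>\<xi>. indicator {0} \<xi> *\<^sub>R complex_of_real (2 * pi) \<partial>?N)"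
    using Circle ftr_one_circle
    by (intro Bochner_Integration.integral_cong) (auto simp: indicator_def poisson_wave_def)
  also have "\<dots> = complex_of_real (2 * pi)"
    using zero_mass_integral[of X "complex_of_real (2 * pi)"] Circle by (simp add: has_bochner_integral_iff)
  finally have "has_bochner_integral ?M (\<lambda>y. complex_of_real (poisson X \<epsilon> (x - y))) (complex_of_real (2 * pi))"
    using i unfolding ftr_poisson_wave[OF e] by (simp add: has_bochner_integral_iff)
  from has_bochner_integral_bounded_linear[OF bounded_linear_Re this] show ?thesis by simp
qed

lemma nn_poisson_mass:
  assumes e: "\<epsilon> > 0"
  shows "(\<integral>\<^sup>+y. ennreal (poisson X \<epsilon> (x - y)) \<partial>base_measure X) = ennreal (2 * pi)"
  using poisson_mass[OF e, of X x] poisson_nonneg[OF e]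
  by (subst nn_integral_eq_integral) (auto simp: has_bochner_integral_iff)

text \<open>Schur's test: the product \<open>cmod (f x) * cmod (f y)\<close> is at most half the sum
  of the squares, and the kernel has mass \<open>2 * pi\<close> in either variable. The bound does
  not depend on \<open>\<epsilon>\<close>.\<close>

lemma poisson_schur:
  assumes e: "\<epsilon> > 0" and f: "sqint (base_measure X) f"
  shows "(\<integral>\<^sup>+x. ennreal (cmod (f x)) * (\<integral>\<^sup>+y. ennreal (cmod (f y)) * ennreal (poisson X \<epsilon> (x - y)) \<partial>base_measure X) \<partial>base_measure X)
    \<le> ennreal (2 * pi * nsq (base_measure X) f)"
proof -
  let ?M = "base_measure X"
  interpret sigma_finite_measure ?M by (rule sigma_finite_base_measure)
  interpret P: pair_sigma_finite ?M ?M ..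
  note id = reg_measureD(2)[OF reg_base_measure, of X]
  have fm: "f \<in> borel_measurable ?M" using f by (simp add: sqint_def)
  have pm: "(\<lambda>p. poisson X \<epsilon> (fst p - snd p)) \<in> borel_measurable (?M \<Otimes>\<^sub>M ?M)"
    by (rule measurable_compose[OF borel_measurable_diff[OF measurable_compose[OF measurable_fst id] measurable_compose[OF measurable_snd id]] poisson_measurable])
  define a where "a x = ennreal ((cmod (f x))\<^sup>2 / 2)" for x
  have am: "a \<in> borel_measurable ?M" unfolding a_def using fm by simp
  define p where "p x y = ennreal (poisson X \<epsilon> (x - y))" for x y
  have pm1: "(\<lambda>y. p x y) \<in> borel_measurable ?M" for x unfolding p_def using poisson_diff_measurable by simp
  have p1: "(\<integral>\<^sup>+y. p x y \<partial>?M) = ennreal (2 * pi)" for x unfolding p_def by (rule nn_poisson_mass[OF e])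
  have p2: "(\<integral>\<^sup>+x. p x y \<partial>?M) = ennreal (2 * pi)" for y
    using nn_poisson_mass[OF e, of X y] unfolding p_def by (metis (no_types, lifting) minus_diff_eq poisson_even nn_integral_cong)
  have aI: "(\<integral>\<^sup>+x. a x \<partial>?M) = ennreal (nsq ?M f / 2)"
  proof -
    have "(\<integral>\<^sup>+x. a x \<partial>?M) = (\<integral>\<^sup>+x. ennreal ((cmod (f x))\<^sup>2) * ennreal (1/2) \<partial>?M)"
      unfolding a_def by (intro nn_integral_cong, subst ennreal_mult[symmetric]) auto
    also have "\<dots> = ennreal (nsq ?M f) * ennreal (1/2)"
      using fm by (subst nn_integral_multc) (auto simp: nn_eq_nsq[OF f])
    also have "\<dots> = ennreal (nsq ?M f / 2)" by (subst ennreal_mult[symmetric]) (auto simp: nsq_nonneg)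
    finally show ?thesis .
  qed
  have m2: "(\<lambda>(x, y). a y * p x y) \<in> borel_measurable (?M \<Otimes>\<^sub>M ?M)"
  proof -
    have "(\<lambda>q. a (snd q) * ennreal (poisson X \<epsilon> (fst q - snd q))) \<in> borel_measurable (?M \<Otimes>\<^sub>M ?M)"
      using pm measurable_compose[OF measurable_snd am] by (intro borel_measurable_times_ennreal) auto
    then show ?thesis by (simp add: split_beta p_def)
  qed
  have "(\<integral>\<^sup>+x. ennreal (cmod (f x)) * (\<integral>\<^sup>+y. ennreal (cmod (f y)) * ennreal (poisson X \<epsilon> (x - y)) \<partial>?M) \<partial>?M)
     = (\<integral>\<^sup>+x. (\<integral>\<^sup>+y. ennreal (cmod (f x)) * (ennreal (cmod (f y)) * p x y) \<partial>?M) \<partial>?M)"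
    unfolding p_def[symmetric] using fm pm1 by (intro nn_integral_cong nn_integral_cmult[symmetric]) auto
  also have "\<dots> \<le> (\<integral>\<^sup>+x. (\<integral>\<^sup>+y. a x * p x y + a y * p x y \<partial>?M) \<partial>?M)"
  proof (intro nn_integral_mono)
    fix x y
    have "cmod (f x) * cmod (f y) \<le> (cmod (f x))\<^sup>2 / 2 + (cmod (f y))\<^sup>2 / 2"
      using sum_squares_bound[of "cmod (f x)" "cmod (f y)"] by simp
    then have "ennreal (cmod (f x) * cmod (f y)) \<le> a x + a y"
      unfolding a_def by (subst ennreal_plus[symmetric]) (auto simp del: ennreal_plus intro: ennreal_leI)
    then have "ennreal (cmod (f x) * cmod (f y)) * p x y \<le> (a x + a y) * p x y" by (rule mult_right_mono) simp
    then show "ennreal (cmod (f x)) * (ennreal (cmod (f y)) * p x y) \<le> a x * p x y + a y * p x y"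
      by (simp add: ennreal_mult distrib_right mult.assoc)
  qed
  also have "\<dots> = (\<integral>\<^sup>+x. a x * ennreal (2 * pi) + (\<integral>\<^sup>+y. a y * p x y \<partial>?M) \<partial>?M)"
    using pm1 am by (intro nn_integral_cong) (simp add: nn_integral_add nn_integral_cmult p1)
  also have "\<dots> = (\<integral>\<^sup>+x. a x * ennreal (2 * pi) \<partial>?M) + (\<integral>\<^sup>+x. (\<integral>\<^sup>+y. a y * p x y \<partial>?M) \<partial>?M)"
    using am borel_measurable_nn_integral[OF m2] by (intro nn_integral_add) auto
  also have "(\<integral>\<^sup>+x. (\<integral>\<^sup>+y. a y * p x y \<partial>?M) \<partial>?M) = (\<integral>\<^sup>+y. (\<integral>\<^sup>+x. a y * p x y \<partial>?M) \<partial>?M)"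
    using P.Fubini'[OF m2] by simp
  also have "\<dots> = (\<integral>\<^sup>+y. a y * ennreal (2 * pi) \<partial>?M)"
  proof (intro nn_integral_cong)
    fix y
    have "(\<lambda>x. p x y) \<in> borel_measurable ?M"
      using pm1[of y] unfolding p_def by (subst poisson_even[symmetric]) simp
    then show "(\<integral>\<^sup>+x. a y * p x y \<partial>?M) = a y * ennreal (2 * pi)" by (simp add: nn_integral_cmult p2)
  qed
  also have "(\<integral>\<^sup>+x. a x * ennreal (2 * pi) \<partial>?M) = ennreal (nsq ?M f / 2) * ennreal (2 * pi)"
    using am by (simp add: nn_integral_multc aI)
  also have "ennreal (nsq ?M f / 2) * ennreal (2 * pi) + ennreal (nsq ?M f / 2) * ennreal (2 * pi) = ennreal (2 * pi * nsq ?M f)"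
    by (simp add: ennreal_mult[symmetric] nsq_nonneg flip: ennreal_plus)
  finally show ?thesis .
qed

lemma poisson_convolution_frequency:
  assumes e: "\<epsilon> > 0" and f: "integrable (base_measure X) f"
  shows "(\<integral>\<xi>. ftr (base_measure X) f \<xi> * poisson_wave \<epsilon> x \<xi> \<partial>freq_measure X)
      = (\<integral>y. f y * complex_of_real (poisson X \<epsilon> (x - y)) \<partial>base_measure X)" (is ?A)
    and "(\<integral>\<xi>. ftr (base_measure X) f \<xi> * poisson_wave \<epsilon> x \<xi> \<partial>freq_measure X)
      = cnj (ftr (freq_measure X) (\<lambda>\<xi>. complex_of_real (exp (- \<epsilon> * \<bar>\<xi>\<bar>)) * cnj (ftr (base_measure X) f \<xi>)) x)" (is ?B)
proof -
  show ?A
    using ftr_multiplication[OF reg_base_measure reg_freq_measure f poisson_wave_integrable(1)[OF e, of X x]]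
    unfolding ftr_poisson_wave[OF e] .
  have "ftr (base_measure X) f \<xi> * poisson_wave \<epsilon> x \<xi>
    = cnj (wave \<xi> x * (complex_of_real (exp (- \<epsilon> * \<bar>\<xi>\<bar>)) * cnj (ftr (base_measure X) f \<xi>)))" for \<xi>
    by (simp add: poisson_wave_def wave_commute[of \<xi> x])
  then show ?B
    using Bochner_Integration.integral_cnj[of "freq_measure X" "\<lambda>\<xi>. wave \<xi> x * (complex_of_real (exp (- \<epsilon> * \<bar>\<xi>\<bar>)) * cnj (ftr (base_measure X) f \<xi>))"]
    by (simp only: ftr_def[of "freq_measure X"])
qed

text \<open>The damped squared norm of the transform equals a double integral of \<open>f\<close>
  against itself with the Poisson kernel, which Schur's test bounds uniformly in
  \<open>\<epsilon>\<close>. The transform is bounded, so the damping makes everything integrable;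
  Fatou removes the damping.\<close>

lemma bessel_inequality:
  assumes f: "integrable (base_measure X) f" "sqint (base_measure X) f"
  shows "sqint (freq_measure X) (ftr (base_measure X) f)"
    and "nsq (freq_measure X) (ftr (base_measure X) f) \<le> 2 * pi * nsq (base_measure X) f"
proof -
  let ?M = "base_measure X" and ?N = "freq_measure X"
  note RM = reg_base_measure[of X] and RN = reg_freq_measure[of X]
  define T where "T = ftr ?M f"
  define C where "C = (\<integral>x. cmod (f x) \<partial>?M)"
  have Tm: "T \<in> borel_measurable ?N" unfolding T_def using f by (intro borel_measurable_ftr RM RN) auto
  have TC: "cmod (T \<xi>) \<le> C" for \<xi> unfolding T_def C_def by (rule norm_ftr_le[OF RM f(1)])
  have C0: "C \<ge> 0" unfolding C_def by simp
  have wm: "(\<lambda>\<xi>. exp (- \<epsilon> * \<bar>\<xi>\<bar>)) \<in> borel_measurable ?N" if "\<epsilon> > 0" for \<epsilon>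
    using exp_weight_integrable[OF that] by auto
  have weighted: "integrable ?N (\<lambda>\<xi>. exp (- \<epsilon> * \<bar>\<xi>\<bar>) * (cmod (T \<xi>))\<^sup>2)"
    "(\<integral>\<xi>. exp (- \<epsilon> * \<bar>\<xi>\<bar>) * (cmod (T \<xi>))\<^sup>2 \<partial>?N) \<le> 2 * pi * nsq ?M f" if e: "\<epsilon> > 0" for \<epsilon>
  proof -
    let ?G = "\<lambda>\<xi>. complex_of_real (exp (- \<epsilon> * \<bar>\<xi>\<bar>)) * cnj (T \<xi>)"
    have i: "integrable ?N (\<lambda>\<xi>. C\<^sup>2 * exp (- \<epsilon> * \<bar>\<xi>\<bar>))" "integrable ?N (\<lambda>\<xi>. C * exp (- \<epsilon> * \<bar>\<xi>\<bar>))"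
      using exp_weight_integrable[OF e, of X] by auto
    show ii: "integrable ?N (\<lambda>\<xi>. exp (- \<epsilon> * \<bar>\<xi>\<bar>) * (cmod (T \<xi>))\<^sup>2)"
    proof (rule Bochner_Integration.integrable_bound[OF i(1)])
      show "AE \<xi> in ?N. norm (exp (- \<epsilon> * \<bar>\<xi>\<bar>) * (cmod (T \<xi>))\<^sup>2) \<le> norm (C\<^sup>2 * exp (- \<epsilon> * \<bar>\<xi>\<bar>))"
        by (intro AE_I2) (simp add: abs_mult power_mono TC)
    qed (use Tm wm[OF e] in simp)
    have G: "integrable ?N ?G"
      by (rule Bochner_Integration.integrable_bound[OF i(2)])
         (use Tm wm[OF e] TC C0 in \<open>auto simp: norm_mult intro!: AE_I2 borel_measurable_times borel_measurable_of_real borel_measurable_cnj\<close>)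
    have "complex_of_real (\<integral>\<xi>. exp (- \<epsilon> * \<bar>\<xi>\<bar>) * (cmod (T \<xi>))\<^sup>2 \<partial>?N) = (\<integral>\<xi>. T \<xi> * ?G \<xi> \<partial>?N)"
      unfolding integral_complex_of_real[symmetric]
      by (intro Bochner_Integration.integral_cong refl) (simp add: complex_norm_square[symmetric] mult.left_commute del: of_real_power)
    also have "\<dots> = (\<integral>x. f x * ftr ?N ?G x \<partial>?M)" unfolding T_def[symmetric]
      using ftr_multiplication[OF RM RN f(1) G] by (simp add: T_def)
    finally have A: "complex_of_real (\<integral>\<xi>. exp (- \<epsilon> * \<bar>\<xi>\<bar>) * (cmod (T \<xi>))\<^sup>2 \<partial>?N) = (\<integral>x. f x * ftr ?N ?G x \<partial>?M)" .
    have bound: "ennreal (cmod (ftr ?N ?G x)) \<le> (\<integral>\<^sup>+y. ennreal (cmod (f y)) * ennreal (poisson X \<epsilon> (x - y)) \<partial>?M)" for x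
    proof -
      have c: "cnj (ftr ?N ?G x) = (\<integral>y. f y * complex_of_real (poisson X \<epsilon> (x - y)) \<partial>?M)"
        using poisson_convolution_frequency[OF e f(1), of x] by (simp add: T_def)
      have "ennreal (cmod (ftr ?N ?G x)) = ennreal (cmod (\<integral>y. f y * complex_of_real (poisson X \<epsilon> (x - y)) \<partial>?M))"
        unfolding c[symmetric] by simp
      also have "\<dots> \<le> (\<integral>\<^sup>+y. ennreal (cmod (f y * complex_of_real (poisson X \<epsilon> (x - y)))) \<partial>?M)"
        by (cases "integrable ?M (\<lambda>y. f y * complex_of_real (poisson X \<epsilon> (x - y)))")
           (auto simp: integral_norm_bound_ennreal not_integrable_integral_eq)
      also have "\<dots> = (\<integral>\<^sup>+y. ennreal (cmod (f y)) * ennreal (poisson X \<epsilon> (x - y)) \<partial>?M)"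
        using poisson_nonneg[OF e] by (simp add: norm_mult ennreal_mult)
      finally show ?thesis .
    qed
    have "ennreal (\<integral>\<xi>. exp (- \<epsilon> * \<bar>\<xi>\<bar>) * (cmod (T \<xi>))\<^sup>2 \<partial>?N) = ennreal (cmod (\<integral>x. f x * ftr ?N ?G x \<partial>?M))"
      unfolding A[symmetric] by simp
    also have "\<dots> \<le> (\<integral>\<^sup>+x. ennreal (cmod (f x * ftr ?N ?G x)) \<partial>?M)"
      by (cases "integrable ?M (\<lambda>x. f x * ftr ?N ?G x)")
         (auto simp: integral_norm_bound_ennreal not_integrable_integral_eq)
    also have "\<dots> \<le> (\<integral>\<^sup>+x. ennreal (cmod (f x)) * (\<integral>\<^sup>+y. ennreal (cmod (f y)) * ennreal (poisson X \<epsilon> (x - y)) \<partial>?M) \<partial>?M)"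
      unfolding norm_mult using bound by (intro nn_integral_mono) (simp add: ennreal_mult mult_left_mono)
    also have "\<dots> \<le> ennreal (2 * pi * nsq ?M f)" by (rule poisson_schur[OF e f(2)])
    finally show "(\<integral>\<xi>. exp (- \<epsilon> * \<bar>\<xi>\<bar>) * (cmod (T \<xi>))\<^sup>2 \<partial>?N) \<le> 2 * pi * nsq ?M f"
      by (simp add: ennreal_le_iff nsq_nonneg)
  qed
  \<comment> \<open>Squaring doubles the exponent of the weight, so the weighted bound is used at
    \<open>2 / real (Suc n)\<close>.\<close>
  define h where "h n \<xi> = complex_of_real (exp (- (1 / real (Suc n)) * \<bar>\<xi>\<bar>)) * T \<xi>" for n \<xi>
  have hn: "(cmod (h n \<xi>))\<^sup>2 = exp (- (2 / real (Suc n)) * \<bar>\<xi>\<bar>) * (cmod (T \<xi>))\<^sup>2" for n \<xi>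
    unfolding h_def norm_mult power_mult_distrib by (simp add: power2_eq_square exp_add[symmetric])
  have hm: "h n \<in> borel_measurable ?N" for n
    unfolding h_def using Tm wm[of "1 / real (Suc n)"] by (intro borel_measurable_times borel_measurable_of_real) auto
  have 1: "sqint ?N (h n)" for n unfolding sqint_def hn using hm weighted(1)[of "2 / real (Suc n)"] by simp
  have 2: "nsq ?N (h n) \<le> 2 * pi * nsq ?M f" for n
    unfolding nsq_def[of ?N] hn using weighted(2)[of "2 / real (Suc n)"] by simp
  have 3: "AE \<xi> in ?N. (\<lambda>n. h n \<xi>) \<longlonglongrightarrow> T \<xi>"
  proof (rule AE_I2)
    fix \<xi>
    have "(\<lambda>n. 1 / real (Suc n)) \<longlonglongrightarrow> 0" by real_asymp
    then have "(\<lambda>n. h n \<xi>) \<longlonglongrightarrow> complex_of_real (exp (- 0 * \<bar>\<xi>\<bar>)) * T \<xi>"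
      unfolding h_def by (intro tendsto_intros)
    then show "(\<lambda>n. h n \<xi>) \<longlonglongrightarrow> T \<xi>" by simp
  qed
  show "sqint ?N (ftr ?M f)" "nsq ?N (ftr ?M f) \<le> 2 * pi * nsq ?M f"
    using nsq_fatou[OF 1 2 3 Tm] unfolding T_def by auto
qed

text \<open>Duality: the squared norm of the cut-off transform \<open>h n\<close> is a pairing of
  \<open>G\<close> with the transform of its conjugate. Cauchy-Schwarz and Bessel bound the square
  of that number by itself times \<open>2 * pi * nsq N G\<close>, and one factor cancels. The cutoff
  is what makes \<open>h n\<close> admissible in Bessel's inequality.\<close>

lemma dual_bessel:
  assumes M: "reg_measure M" and N: "reg_measure N"
    and bessel: "\<And>f. integrable M f \<Longrightarrow> sqint M f \<Longrightarrow> sqint N (ftr M f) \<and> nsq N (ftr M f) \<le> 2 * pi * nsq M f"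
    and G: "integrable N G" "sqint N G"
  shows "sqint M (ftr N G)" "nsq M (ftr N G) \<le> 2 * pi * nsq N G"
proof -
  define g where "g = ftr N G"
  have gm: "g \<in> borel_measurable M" unfolding g_def using G by (intro borel_measurable_ftr N M) auto
  define C where "C = (\<integral>x. cmod (G x) \<partial>N)"
  have gC: "cmod (g x) \<le> C" for x unfolding g_def C_def by (rule norm_ftr_le[OF N G(1)])
  have sets: "{x\<in>space M. \<bar>x\<bar> \<le> R} \<in> sets M" for R
  proof -
    have "(\<lambda>x. x) -` {-R..R} \<inter> space M \<in> sets M"
      by (rule measurable_sets[OF reg_measureD(2)[OF M]]) simp
    also have "(\<lambda>x. x) -` {-R..R} \<inter> space M = {x\<in>space M. \<bar>x\<bar> \<le> R}" by (auto simp: abs_le_iff)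
    finally show ?thesis .
  qed
  define h where "h n x = indicator {x\<in>space M. \<bar>x\<bar> \<le> real n} x * g x" for n x
  have ind: "integrable M (\<lambda>x. indicator {x\<in>space M. \<bar>x\<bar> \<le> real n} x :: complex)"
    and ind2: "sqint M (\<lambda>x. indicator {x\<in>space M. \<bar>x\<bar> \<le> real n} x)" for n
  proof -
    have r: "integrable M (\<lambda>x. indicator {x\<in>space M. \<bar>x\<bar> \<le> real n} x :: real)"
      using sets reg_measureD(3)[OF M] by (intro integrable_real_indicator) auto
    have i: "(\<lambda>x. indicator {x\<in>space M. \<bar>x\<bar> \<le> real n} x :: complex) = (\<lambda>x. complex_of_real (indicator {x\<in>space M. \<bar>x\<bar> \<le> real n} x))"
      by (auto simp: indicator_def)
    show 1: "integrable M (\<lambda>x. indicator {x\<in>space M. \<bar>x\<bar> \<le> real n} x :: complex)" unfolding i using r by simp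
    have "(\<lambda>x. (cmod (indicator {x\<in>space M. \<bar>x\<bar> \<le> real n} x))\<^sup>2) = (\<lambda>x. indicator {x\<in>space M. \<bar>x\<bar> \<le> real n} x :: real)"
      by (auto simp: indicator_def)
    then show "sqint M (\<lambda>x. indicator {x\<in>space M. \<bar>x\<bar> \<le> real n} x)"
      unfolding sqint_def using r 1 by simp
  qed
  have hm: "h n \<in> borel_measurable M" for n
    unfolding h_def using ind gm by (intro borel_measurable_times) auto
  have hle: "cmod (h n x) \<le> C * cmod (indicator {x\<in>space M. \<bar>x\<bar> \<le> real n} x)" for n x
    unfolding h_def norm_mult using gC[of x] by (auto simp: indicator_def)
  have hs: "sqint M (h n)" for n using sqint_dominated(1)[OF ind2 hm] hle by blast
  have hi: "integrable M (h n)" for n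
    by (rule Bochner_Integration.integrable_bound[OF integrable_mult_right[OF ind[of n], of "complex_of_real C"] hm])
       (use hle[of n] in \<open>auto simp: norm_mult intro!: AE_I2 order_trans[OF hle] mult_right_mono\<close>)
  have hB: "nsq M (h n) \<le> 2 * pi * nsq N G" for n
  proof -
    have c: "integrable M (\<lambda>x. cnj (h n x))" "sqint M (\<lambda>x. cnj (h n x))" using hi hs by (auto intro: sqint_cnj)
    have e: "cnj (h n x) * g x = complex_of_real ((cmod (h n x))\<^sup>2)" for x
    proof -
      have "cnj z * z = complex_of_real ((cmod z)\<^sup>2)" for z by (metis complex_norm_square mult.commute of_real_power)
      then show ?thesis by (simp add: h_def indicator_def)
    qed
    have "complex_of_real (nsq M (h n)) = (\<integral>x. cnj (h n x) * g x \<partial>M)"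
      unfolding nsq_def e integral_complex_of_real ..
    also have "\<dots> = (\<integral>\<xi>. ftr M (\<lambda>x. cnj (h n x)) \<xi> * G \<xi> \<partial>N)"
      unfolding g_def by (rule ftr_multiplication[OF M N c(1) G(1), symmetric])
    finally have "(nsq M (h n))\<^sup>2 = (cmod (\<integral>\<xi>. ftr M (\<lambda>x. cnj (h n x)) \<xi> * G \<xi> \<partial>N))\<^sup>2"
      by (metis norm_of_real power2_abs)
    also have "\<dots> \<le> nsq N (ftr M (\<lambda>x. cnj (h n x))) * nsq N G"
      using bessel[OF c] by (intro cauchy_schwarz G) auto
    also have "\<dots> \<le> (2 * pi * nsq M (h n)) * nsq N G"
      using bessel[OF c] by (intro mult_right_mono nsq_nonneg) (auto simp: nsq_cnj)
    finally have "nsq M (h n) * nsq M (h n) \<le> nsq M (h n) * (2 * pi * nsq N G)"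
      by (simp add: power2_eq_square mult_ac)
    then show ?thesis
      using nsq_nonneg[of M "h n"] nsq_nonneg[of N G] by (cases "nsq M (h n) = 0") (auto simp: mult_le_cancel_left)
  qed
  have lim: "AE x in M. (\<lambda>n. h n x) \<longlonglongrightarrow> g x"
  proof (rule AE_I2, rule tendsto_eventually)
    fix x assume x: "x \<in> space M"
    show "\<forall>\<^sub>F n in sequentially. h n x = g x"
      using eventually_ge_at_top[of "nat \<lceil>\<bar>x\<bar>\<rceil>"]
      by eventually_elim (use x in \<open>auto simp: h_def indicator_def abs_le_iff ceiling_le_iff nat_le_iff\<close>)
  qed
  show "sqint M (ftr N G)" "nsq M (ftr N G) \<le> 2 * pi * nsq N G"
    using nsq_fatou[OF hs hB lim gm] unfolding g_def by auto
qed

text \<open>On \<open>[0, 1]\<close> the cosine is at least \<open>1/2\<close> because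
  \<open>pi / 3 > 1\<close>, so \<open>sin v \<ge> v / 2\<close>. On the remaining compact interval
  the sine has a positive minimum because \<open>b < pi\<close>.\<close>

lemma sin_linear_lower_bound:
  assumes b: "b < pi"
  obtains c where "c > 0" "\<And>v. 0 \<le> v \<Longrightarrow> v \<le> b \<Longrightarrow> c * v \<le> sin v"
proof -
  have small: "(1/2) * v \<le> sin v" if "0 \<le> v" "v \<le> 1" for v :: real
  proof -
    have "(\<lambda>v. sin v - (1/2) * v) 0 \<le> (\<lambda>v. sin v - (1/2) * v) v"
    proof (rule DERIV_nonneg_imp_nondecreasing[OF that(1)])
      fix x assume x: "0 \<le> x" "x \<le> v"
      have "cos (pi/3) \<le> cos x" using x that pi_gt3 by (intro cos_monotone_0_pi_le) auto
      then have "0 \<le> cos x - 1/2" by (simp add: cos_60)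
      moreover have "((\<lambda>v. sin v - (1/2) * v) has_real_derivative cos x - 1/2) (at x)"
        by (auto intro!: derivative_eq_intros)
      ultimately show "\<exists>y. ((\<lambda>v. sin v - (1/2) * v) has_real_derivative y) (at x) \<and> y \<ge> 0" by blast
    qed
    then show ?thesis by simp
  qed
  show ?thesis
  proof (cases "b \<ge> 1")
    case False
    then show ?thesis using small by (intro that[of "1/2"]) auto
  next
    case True
    have "\<exists>x\<in>{1..b}. \<forall>y\<in>{1..b}. sin x \<le> sin y"
      using True by (intro continuous_attains_inf continuous_intros) auto
    then obtain m where m: "m \<in> {1..b}" "\<And>v. v \<in> {1..b} \<Longrightarrow> sin m \<le> sin v" by blast
    have sm: "sin m > 0" using m(1) b by (intro sin_gt_zero) auto
    have b0: "b > 0" using True by simp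
    show ?thesis
    proof (rule that[of "min (1/2) (sin m / b)"])
      show "min (1/2) (sin m / b) > 0" using sm b0 by simp
      fix v assume v: "0 \<le> v" "v \<le> b"
      show "min (1/2) (sin m / b) * v \<le> sin v"
      proof (cases "v \<le> 1")
        case True
        have "min (1/2) (sin m / b) * v \<le> (1/2) * v" by (rule mult_right_mono[OF min.cobounded1 v(1)])
        with small[OF v(1) True] show ?thesis by simp
      next
        case False
        have "min (1/2) (sin m / b) * v \<le> (sin m / b) * v" by (rule mult_right_mono[OF min.cobounded2 v(1)])
        also have "\<dots> \<le> (sin m / b) * b" using v sm b0 by (intro mult_left_mono) auto
        also have "\<dots> = sin m" using b0 by simp
        also have "\<dots> \<le> sin v" using m(2) False v by simp
        finally show ?thesis .
      qed
    qed
  qed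
qed

text \<open>Comparison of the circle denominators with
  \<open>\<epsilon>\<^sup>2 + u\<^sup>2\<close>, by which the estimates of the line carry over. It
  degenerates at \<open>u = 2 * pi\<close>, where \<open>1 - cos u\<close> vanishes, hence the
  condition on \<open>a\<close>.\<close>

lemma circle_denominator_bound:
  assumes a: "a < 2 * pi"
  obtains c where "c > 0" "\<And>\<epsilon> u. 0 < \<epsilon> \<Longrightarrow> \<epsilon> < 1 \<Longrightarrow> \<bar>u\<bar> \<le> a \<Longrightarrow>
     c * (\<epsilon>\<^sup>2 + u\<^sup>2) \<le> 1 - 2 * exp (-\<epsilon>) * cos u + (exp (-\<epsilon>))\<^sup>2"
    "\<And>u. \<bar>u\<bar> \<le> a \<Longrightarrow> c * u\<^sup>2 \<le> 1 - cos u"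
proof -
  obtain k where k: "k > 0" "\<And>v. 0 \<le> v \<Longrightarrow> v \<le> a/2 \<Longrightarrow> k * v \<le> sin v"
    using sin_linear_lower_bound[of "a/2"] a by auto
  have cosu: "k\<^sup>2 / 2 * u\<^sup>2 \<le> 1 - cos u" if "\<bar>u\<bar> \<le> a" for u
  proof -
    have "k * \<bar>u/2\<bar> \<le> sin \<bar>u/2\<bar>" using that by (intro k(2)) auto
    then have "(k * \<bar>u/2\<bar>)\<^sup>2 \<le> (sin \<bar>u/2\<bar>)\<^sup>2" using k(1) by (intro power_mono) auto
    also have "(sin \<bar>u/2\<bar>)\<^sup>2 = (sin (u/2))\<^sup>2" by (simp add: abs_if)
    also have "\<dots> = (1 - cos u) / 2" using cos_double_sin[of "u/2"] by simp
    finally show ?thesis by (simp add: power_mult_distrib power_divide)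
  qed
  \<comment> \<open>The value \<open>1/4\<close> comes from
    \<open>1 - exp (-\<epsilon>) \<ge> \<epsilon> / 2\<close>. The value
    \<open>k\<^sup>2 / 3\<close> is \<open>2 * (1/3) * (k\<^sup>2 / 2)\<close>, from
    \<open>exp (-\<epsilon>) \<ge> 1/3\<close> and the lower bound on
    \<open>1 - cos u\<close>.\<close>
  define c where "c = min (1/4) (k\<^sup>2 / 3)"
  have c: "c > 0" "c \<le> 1/4" "c \<le> k\<^sup>2 / 3" using k(1) by (auto simp: c_def)
  show ?thesis
  proof (rule that[OF c(1)])
    fix \<epsilon> u :: real assume e: "0 < \<epsilon>" "\<epsilon> < 1" and u: "\<bar>u\<bar> \<le> a"
    define r where "r = exp (-\<epsilon>)"
    have "exp (-\<epsilon>) * (1 + \<epsilon>) \<le> exp (-\<epsilon>) * exp \<epsilon>" by (intro mult_left_mono exp_ge_add_one_self) auto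
    then have "r * (1 + \<epsilon>) \<le> 1" by (simp add: r_def exp_add[symmetric])
    then have "r \<le> 1 / (1 + \<epsilon>)" using e by (simp add: field_simps)
    also have "\<dots> \<le> 1 - \<epsilon>/2" using e by (simp add: field_simps)
    finally have "\<epsilon>/2 \<le> 1 - r" by simp
    then have "(\<epsilon>/2)\<^sup>2 \<le> (1 - r)\<^sup>2" using e by (intro power_mono) auto
    then have 1: "c * \<epsilon>\<^sup>2 \<le> (1 - r)\<^sup>2"
      using mult_right_mono[OF c(2), of "\<epsilon>\<^sup>2"] by (simp add: power_divide)
    have "exp (-1) \<le> r" unfolding r_def using e by simp
    moreover have "(1/3 :: real) \<le> exp (-1)" using exp_le by (simp add: exp_minus field_simps)
    ultimately have r: "1/3 \<le> r" by linarith
    have "c * u\<^sup>2 \<le> k\<^sup>2 / 3 * u\<^sup>2" by (intro mult_right_mono c) auto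
    also have "\<dots> = 2 * (1/3) * (k\<^sup>2 / 2 * u\<^sup>2)" by simp
    also have "\<dots> \<le> 2 * r * (1 - cos u)" using r cosu[OF u] by (intro mult_mono) auto
    finally have 2: "c * u\<^sup>2 \<le> 2 * r * (1 - cos u)" .
    show "c * (\<epsilon>\<^sup>2 + u\<^sup>2) \<le> 1 - 2 * exp (-\<epsilon>) * cos u + (exp (-\<epsilon>))\<^sup>2"
      using poisson_denominator(1)[OF e(1), of u] 1 2 distrib_left[of c "\<epsilon>\<^sup>2" "u\<^sup>2"]
      unfolding r_def[symmetric] by linarith
  next
    fix u :: real assume u: "\<bar>u\<bar> \<le> a"
    have "c \<le> k\<^sup>2 / 2" using c(3) zero_le_power2[of k] by linarith
    then have "c * u\<^sup>2 \<le> k\<^sup>2 / 2 * u\<^sup>2" by (intro mult_right_mono) auto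
    with cosu[OF u] show "c * u\<^sup>2 \<le> 1 - cos u" by simp
  qed
qed

lemma poisson_circle_bound:
  assumes a: "a < 2 * pi"
  obtains C where "\<And>\<epsilon> u. 0 < \<epsilon> \<Longrightarrow> \<epsilon> < 1 \<Longrightarrow> \<bar>u\<bar> \<le> a \<Longrightarrow> \<bar>poisson Circle \<epsilon> u\<bar> \<le> C * (\<epsilon> / (\<epsilon>\<^sup>2 + u\<^sup>2))"
proof -
  obtain c where c: "c > 0" "\<And>\<epsilon> u. 0 < \<epsilon> \<Longrightarrow> \<epsilon> < 1 \<Longrightarrow> \<bar>u\<bar> \<le> a \<Longrightarrow>
     c * (\<epsilon>\<^sup>2 + u\<^sup>2) \<le> 1 - 2 * exp (-\<epsilon>) * cos u + (exp (-\<epsilon>))\<^sup>2"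
    using circle_denominator_bound[OF a] by metis
  show ?thesis
  proof (rule that[of "2 / c"])
    fix \<epsilon> u :: real assume e: "0 < \<epsilon>" "\<epsilon> < 1" and u: "\<bar>u\<bar> \<le> a"
    define r where "r = exp (-\<epsilon>)"
    have r: "0 < r" "r < 1" using e by (auto simp: r_def)
    have "1 - \<epsilon> \<le> r" using exp_ge_add_one_self[of "-\<epsilon>"] by (simp add: r_def)
    moreover have "1 - r\<^sup>2 = (1 - r) * (1 + r)" by (simp add: power2_eq_square algebra_simps)
    moreover have "(1 - r) * (1 + r) \<le> (1 - r) * 2" using r by (intro mult_left_mono) auto
    ultimately have "1 - \<epsilon> \<le> r" "1 - r\<^sup>2 \<le> (1 - r) * 2" by simp_all
    moreover have "(1 - r) * 2 \<le> 2 * \<epsilon>" using \<open>1 - \<epsilon> \<le> r\<close> by simp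
    ultimately have num: "1 - r\<^sup>2 \<le> 2 * \<epsilon>" by (blast intro: order_trans)
    have p: "0 < c * (\<epsilon>\<^sup>2 + u\<^sup>2)" using c(1) e by (intro mult_pos_pos add_pos_nonneg) auto
    have "poisson Circle \<epsilon> u \<le> (2 * \<epsilon>) / (c * (\<epsilon>\<^sup>2 + u\<^sup>2))"
      unfolding poisson.simps r_def[symmetric] using num c(2)[OF e u] e p unfolding r_def[symmetric]
      by (intro frac_le) auto
    also have "\<dots> = 2 / c * (\<epsilon> / (\<epsilon>\<^sup>2 + u\<^sup>2))" by simp
    finally show "\<bar>poisson Circle \<epsilon> u\<bar> \<le> 2 / c * (\<epsilon> / (\<epsilon>\<^sup>2 + u\<^sup>2))"
      using poisson_nonneg[OF e(1), of Circle u] by (simp del: poisson.simps)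
  qed
qed

section \<open>Recovery from Poisson integrals and the lower half of Plancherel\<close>

lemma sqint_indicator_extension:
  assumes f: "sqint (lebesgue_on {-pi..pi}) f"
  shows "sqint lebesgue (\<lambda>x. indicator {-pi..pi} x * f x)"
proof -
  have m: "(\<lambda>x. indicator {-pi..pi} x *\<^sub>R f x) \<in> borel_measurable lebesgue"
    using f borel_measurable_restrict_space_iff[of "{-pi..pi}" lebesgue f] by (simp add: sqint_def)
  have e: "(\<lambda>x. indicator {-pi..pi} x *\<^sub>R f x) = (\<lambda>x. indicator {-pi..pi} x * f x)" by (auto simp: indicator_def)
  have "integrable lebesgue (\<lambda>x. indicator {-pi..pi} x *\<^sub>R (cmod (f x))\<^sup>2)"
    using f by (simp add: sqint_def integrable_restrict_space)
  also have "(\<lambda>x. indicator {-pi..pi} x *\<^sub>R (cmod (f x))\<^sup>2) = (\<lambda>x. (cmod (indicator {-pi..pi} x * f x))\<^sup>2)"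
    by (auto simp: indicator_def)
  finally show ?thesis using m unfolding e sqint_def by simp
qed

text \<open>On the circle both the function and the kernel are cut off to the period, so that the
  limit theorem on the line applies; the cut-off kernel still has mass
  \<open>2 * pi\<close>.\<close>

lemma poisson_limit:
  fixes f :: "real \<Rightarrow> complex"
  assumes f: "sqint (base_measure X) f"
  shows "AE x in base_measure X.
    ((\<lambda>\<epsilon>. \<integral>y. f y * complex_of_real (poisson X \<epsilon> (x - y)) \<partial>base_measure X) \<longlongrightarrow> 2 * pi * f x) (at_right 0)"
proof (cases X)
  case Line
  have f': "sqint lebesgue f" using f Line by simp
  have "AE x in lebesgue. ((\<lambda>\<epsilon>. \<integral>y. f y * complex_of_real (poisson Line \<epsilon> (x - y)) \<partial>lebesgue) \<longlongrightarrow> 2 * pi * f x) (at_right 0)"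
    using AE_leb_point[OF f']
  proof eventually_elim
    case (elim x)
    have "((\<lambda>\<epsilon>. \<integral>y. complex_of_real (poisson Line \<epsilon> (x - y)) * f y \<partial>lebesgue) \<longlongrightarrow> complex_of_real (2 * pi) * f x) (at_right 0)"
    proof (rule kernel_limit[OF f' elim, where C = 2])
      show "(\<lambda>y. poisson Line \<epsilon> (x - y)) \<in> borel_measurable lebesgue" for \<epsilon>
        using poisson_diff_measurable[of Line \<epsilon> x] by simp
      show "\<bar>poisson Line \<epsilon> (x - y)\<bar> \<le> 2 * (\<epsilon> / (\<epsilon>\<^sup>2 + (x - y)\<^sup>2))" if "0 < \<epsilon>" "\<epsilon> < 1" for \<epsilon> y
        using that by simp
      show "(\<integral>y. poisson Line \<epsilon> (x - y) \<partial>lebesgue) = 2 * pi" if "0 < \<epsilon>" "\<epsilon> < 1" for \<epsilon>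
        using poisson_mass[OF that(1), of Line x] by (simp only: has_bochner_integral_iff base_measure.simps)
    qed
    then show ?case by (simp add: mult.commute)
  qed
  then show ?thesis unfolding Line base_measure.simps .
next
  case Circle
  let ?I = "{-pi..pi}"
  define g where "g y = indicator ?I y * f y" for y
  have g: "sqint lebesgue g" unfolding g_def using f Circle by (intro sqint_indicator_extension) simp
  have ends: "AE x in lebesgue. x \<noteq> pi \<and> x \<noteq> -pi"
    by (intro AE_conjI; rule AE_completion; rule AE_lborel_singleton)
  have "AE x in lebesgue. x \<in> ?I \<longrightarrow>
     ((\<lambda>\<epsilon>. \<integral>y. f y * complex_of_real (poisson Circle \<epsilon> (x - y)) \<partial>lebesgue_on ?I) \<longlongrightarrow> 2 * pi * f x) (at_right 0)"
    using AE_leb_point[OF g] ends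
  proof eventually_elim
    case (elim x)
    show ?case
    proof
      assume xI: "x \<in> ?I"
      \<comment> \<open>For \<open>y\<close> in the period \<open>\<bar>x - y\<bar>\<close> is at
        most \<open>a\<close>, and \<open>a < 2 * pi\<close> because the two end points of the
        period, a null set, have been excluded.\<close>
      define a where "a = pi + \<bar>x\<bar>"
      have a: "a < 2 * pi" using xI elim by (auto simp: a_def abs_less_iff)
      obtain C where C: "\<And>\<epsilon> u. 0 < \<epsilon> \<Longrightarrow> \<epsilon> < 1 \<Longrightarrow> \<bar>u\<bar> \<le> a \<Longrightarrow> \<bar>poisson Circle \<epsilon> u\<bar> \<le> C * (\<epsilon> / (\<epsilon>\<^sup>2 + u\<^sup>2))"
        using poisson_circle_bound[OF a] by metis
      have C0: "0 \<le> \<bar>C\<bar> * (\<epsilon> / (\<epsilon>\<^sup>2 + u\<^sup>2))" if "0 < \<epsilon>" for \<epsilon> u :: real using that by simp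
      have "((\<lambda>\<epsilon>. \<integral>y. complex_of_real (indicator ?I y * poisson Circle \<epsilon> (x - y)) * g y \<partial>lebesgue) \<longlongrightarrow> complex_of_real (2 * pi) * g x) (at_right 0)"
      proof (rule kernel_limit[OF g elim(1), where C = "\<bar>C\<bar>"])
        show "(\<lambda>y. indicator ?I y * poisson Circle \<epsilon> (x - y)) \<in> borel_measurable lebesgue" for \<epsilon>
          using poisson_diff_measurable[of Circle \<epsilon> x] borel_measurable_restrict_space_iff[of ?I lebesgue "\<lambda>y. poisson Circle \<epsilon> (x - y)"]
          by simp
        show "\<bar>indicator ?I y * poisson Circle \<epsilon> (x - y)\<bar> \<le> \<bar>C\<bar> * (\<epsilon> / (\<epsilon>\<^sup>2 + (x - y)\<^sup>2))" if e: "0 < \<epsilon>" "\<epsilon> < 1" for \<epsilon> y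
        proof (cases "y \<in> ?I")
          case True
          then have "\<bar>x - y\<bar> \<le> a" by (auto simp: a_def abs_le_iff)
          from C[OF e this] have "\<bar>poisson Circle \<epsilon> (x - y)\<bar> \<le> C * (\<epsilon> / (\<epsilon>\<^sup>2 + (x - y)\<^sup>2))" .
          also have "\<dots> \<le> \<bar>C\<bar> * (\<epsilon> / (\<epsilon>\<^sup>2 + (x - y)\<^sup>2))" using e by (intro mult_right_mono) auto
          finally show ?thesis using True by simp
        qed (use C0[OF e(1)] in simp)
        show "(\<integral>y. indicator ?I y * poisson Circle \<epsilon> (x - y) \<partial>lebesgue) = 2 * pi" if "0 < \<epsilon>" "\<epsilon> < 1" for \<epsilon>
          using poisson_mass[OF that(1), of Circle x] integral_restrict_space[of ?I lebesgue "\<lambda>y. poisson Circle \<epsilon> (x - y)"]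
          unfolding has_bochner_integral_iff base_measure.simps real_scaleR_def by simp
      qed
      moreover have "(\<integral>y. complex_of_real (indicator ?I y * poisson Circle \<epsilon> (x - y)) * g y \<partial>lebesgue)
         = (\<integral>y. f y * complex_of_real (poisson Circle \<epsilon> (x - y)) \<partial>lebesgue_on ?I)" for \<epsilon>
        by (subst integral_restrict_space) (auto intro!: Bochner_Integration.integral_cong simp: g_def indicator_def simp del: poisson.simps)
      moreover have "g x = f x" using xI by (simp add: g_def)
      ultimately show "((\<lambda>\<epsilon>. \<integral>y. f y * complex_of_real (poisson Circle \<epsilon> (x - y)) \<partial>lebesgue_on ?I) \<longlongrightarrow> 2 * pi * f x) (at_right 0)"
        by simp
    qed
  qed
  then show ?thesis unfolding Circle base_measure.simps by (subst AE_restrict_space_iff) auto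
qed

text \<open>The Poisson integrals of \<open>f\<close> converge almost everywhere to
  \<open>2 * pi * f x\<close>, and they are transforms of damped versions of \<open>T\<close>, so
  dual Bessel bounds their squared norms by \<open>2 * pi\<close> times that of \<open>T\<close>.
  Fatou gives \<open>(2 * pi)^2 * nsq f \<le> 2 * pi * nsq T\<close>.\<close>

lemma plancherel_lower_bound:
  fixes f :: "real \<Rightarrow> complex"
  assumes f: "integrable (base_measure X) f" "sqint (base_measure X) f"
  shows "2 * pi * nsq (base_measure X) f \<le> nsq (freq_measure X) (ftr (base_measure X) f)"
proof -
  let ?M = "base_measure X" and ?N = "freq_measure X"
  note RM = reg_base_measure[of X] and RN = reg_freq_measure[of X]
  define T where "T = ftr ?M f"
  have sT: "sqint ?N T" unfolding T_def by (rule bessel_inequality(1)[OF f])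
  define G where "G \<epsilon> \<xi> = complex_of_real (exp (- \<epsilon> * \<bar>\<xi>\<bar>)) * cnj (T \<xi>)" for \<epsilon> \<xi>
  have wm: "(\<lambda>\<xi>. complex_of_real (exp (- \<epsilon> * \<bar>\<xi>\<bar>))) \<in> borel_measurable ?N" if "\<epsilon> > 0" for \<epsilon>
    by (rule measurable_compose[OF borel_measurable_integrable[OF exp_weight_integrable[OF that]] borel_measurable_of_real])
  have G: "sqint ?N (G \<epsilon>)" "nsq ?N (G \<epsilon>) \<le> 1\<^sup>2 * nsq ?N T" "integrable ?N (G \<epsilon>)" if e: "\<epsilon> > 0" for \<epsilon>
  proof -
    have "AE \<xi> in ?N. cmod (complex_of_real (exp (- \<epsilon> * \<bar>\<xi>\<bar>))) \<le> 1" using e by (intro AE_I2) auto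
    from sqint_bdd_mult[OF sqint_cnj[OF sT] wm[OF e] this]
    show "sqint ?N (G \<epsilon>)" "nsq ?N (G \<epsilon>) \<le> 1\<^sup>2 * nsq ?N T" unfolding G_def[abs_def] by (simp_all add: nsq_cnj)
    have "sqint ?N (\<lambda>\<xi>. complex_of_real (exp (- \<epsilon> * \<bar>\<xi>\<bar>)))"
      using poisson_wave_integrable(2)[OF e, of X 0] by (simp add: poisson_wave_def[abs_def])
    from sqint_prod[OF this sqint_cnj[OF sT]] show "integrable ?N (G \<epsilon>)" unfolding G_def[abs_def] .
  qed
  define h where "h n x = cnj (ftr ?N (G (1 / real (Suc n))) x)" for n x
  have h1: "sqint ?M (h n)" "nsq ?M (h n) \<le> 2 * pi * nsq ?N T" for n
  proof -
    have e: "1 / real (Suc n) > 0" by simp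
    note d = dual_bessel[OF RM RN conjI[OF bessel_inequality] G(3)[OF e] G(1)[OF e]]
    show "sqint ?M (h n)" unfolding h_def by (rule sqint_cnj[OF d(1)])
    have "nsq ?M (h n) \<le> 2 * pi * nsq ?N (G (1 / real (Suc n)))" unfolding h_def nsq_cnj by (rule d(2))
    also have "\<dots> \<le> 2 * pi * nsq ?N T" using G(2)[OF e] by simp
    finally show "nsq ?M (h n) \<le> 2 * pi * nsq ?N T" .
  qed
  have hp: "h n x = (\<integral>y. f y * complex_of_real (poisson X (1 / real (Suc n)) (x - y)) \<partial>?M)" for n x
    using poisson_convolution_frequency[of "1 / real (Suc n)" X f x, OF _ f(1)]
    unfolding h_def G_def[abs_def] T_def by simp
  have seq: "filterlim (\<lambda>n. 1 / real (Suc n)) (at_right 0) sequentially"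
    by (rule filterlim_at_withinI; real_asymp?) auto
  have lim: "AE x in ?M. (\<lambda>n. h n x) \<longlonglongrightarrow> 2 * pi * f x"
    using poisson_limit[OF f(2)]
  proof eventually_elim
    case (elim x)
    show ?case unfolding hp using filterlim_compose[OF elim seq] .
  qed
  have m: "(\<lambda>x. 2 * pi * f x) \<in> borel_measurable ?M" using sqint_measurable[OF sqint_cmult[OF f(2)]] by simp
  have "nsq ?M (\<lambda>x. 2 * pi * f x) \<le> 2 * pi * nsq ?N T" by (rule nsq_fatou(2)[OF h1 lim m])
  then have "(2 * pi) * (2 * pi * nsq ?M f) \<le> (2 * pi) * nsq ?N T"
    by (simp add: nsq_cmult norm_mult power2_eq_square)
  then show ?thesis unfolding T_def by (rule mult_left_le_imp_le) simp
qed

lemma ftr_wave_circle: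
  assumes "\<xi> \<in> \<int>" "\<eta> \<in> \<int>"
  shows "ftr (lebesgue_on {-pi..pi}) (\<lambda>x. wave x \<xi>) \<eta> = complex_of_real (2 * pi * indicator {0} (\<eta> + \<xi>))"
proof -
  have "ftr (lebesgue_on {-pi..pi}) (\<lambda>x. wave x \<xi>) \<eta> = ftr (lebesgue_on {-pi..pi}) (\<lambda>_. 1) (\<eta> + \<xi>)"
    unfolding ftr_def by (simp add: wave_add2)
  then show ?thesis using ftr_one_circle[of "\<eta> + \<xi>"] assms by simp
qed

text \<open>The line is self-dual. On the circle the transform \<open>g\<close> of \<open>G\<close>
  is bounded on a finite measure space and its own transform at \<open>\<xi>\<close> is exactly
  \<open>2 * pi * G (- \<xi>)\<close>, so Bessel's inequality for \<open>g\<close> is the required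
  bound.\<close>

lemma plancherel_lower_bound_dual:
  fixes G :: "real \<Rightarrow> complex"
  assumes G: "integrable (freq_measure X) G" "sqint (freq_measure X) G"
  shows "2 * pi * nsq (freq_measure X) G \<le> nsq (base_measure X) (ftr (freq_measure X) G)"
proof (cases X)
  case Line
  then show ?thesis using plancherel_lower_bound[of Line G] G by simp
next
  case Circle
  let ?M = "base_measure X" and ?N = "freq_measure X"
  note RM = reg_base_measure[of X] and RN = reg_freq_measure[of X]
  have "finite_measure ?M" using Circle by (auto intro!: finite_measureI simp: emeasure_restrict_space)
  then interpret finite_measure ?M .
  define g where "g = ftr ?N G"
  have gs: "sqint ?M g" unfolding g_def by (rule dual_bessel(1)[OF RM RN conjI[OF bessel_inequality] G])
  have gi: "integrable ?M g"
    unfolding g_def by (rule integrable_const_bound[OF AE_I2[OF norm_ftr_le[OF RN G(1)]] borel_measurable_ftr[OF RN RM borel_measurable_integrable[OF G(1)]]])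
  have inv: "ftr ?M g \<xi> = 2 * pi * G (0 - \<xi>)" if xi: "\<xi> \<in> space ?N" for \<xi>
  proof -
    have xi': "\<xi> \<in> \<int>" using xi Circle by simp
    have wi: "integrable ?M (\<lambda>x. wave x \<xi>)" using integrable_wave(1)[OF RM, of "\<lambda>_. 1"] by simp
    have "ftr ?M g \<xi> = (\<integral>\<eta>. ftr ?M (\<lambda>x. wave x \<xi>) \<eta> * G \<eta> \<partial>?N)"
      unfolding g_def ftr_def[of ?M "ftr ?N G"] by (rule ftr_multiplication[OF RM RN wi G(1), symmetric])
    also have "\<dots> = (\<integral>\<eta>. complex_of_real (2 * pi * indicator {0} (\<eta> + \<xi>)) * G \<eta> \<partial>?N)"
      using Circle ftr_wave_circle[OF xi'] by (intro Bochner_Integration.integral_cong) auto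
    also have "\<dots> = (\<integral>\<eta>. complex_of_real (2 * pi * indicator {0} ((0 - \<eta>) + \<xi>)) * G (0 - \<eta>) \<partial>?N)"
      using Circle by (intro integral_freq_reflect(2)[OF zero_in_freq, symmetric]) auto
    also have "\<dots> = (\<integral>\<eta>. indicator {\<xi>} \<eta> *\<^sub>R (2 * pi * G (0 - \<xi>)) \<partial>?N)"
      by (intro Bochner_Integration.integral_cong) (auto simp: indicator_def)
    also have "\<dots> = measure ?N {\<xi>} *\<^sub>R (2 * pi * G (0 - \<xi>))"
      using has_bochner_integral_indicator[of "{\<xi>}" ?N "2 * pi * G (0 - \<xi>)"] Circle xi'
      by (simp add: has_bochner_integral_iff emeasure_count_space_finite)
    also have "measure ?N {\<xi>} = 1" using Circle xi' by (simp add: measure_def emeasure_count_space_finite)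
    finally show ?thesis by simp
  qed
  have "nsq ?N (ftr ?M g) = nsq ?N (\<lambda>\<xi>. 2 * pi * G (0 - \<xi>))"
    unfolding nsq_def by (intro Bochner_Integration.integral_cong) (auto simp: inv)
  also have "\<dots> = (2 * pi) * (2 * pi * nsq ?N G)"
    using sqint_freq_reflect(2)[OF zero_in_freq G(2)] by (simp add: nsq_cmult norm_mult power2_eq_square)
  finally have "(2 * pi) * (2 * pi * nsq ?N G) \<le> (2 * pi) * nsq ?M g"
    using bessel_inequality(2)[OF gi gs] by simp
  then show ?thesis unfolding g_def by (rule mult_left_le_imp_le) simp
qed

theorem fourier_pair_base: "fourier_pair (base_measure X) (freq_measure X)"
  unfolding fourier_pair_def
proof (intro conjI allI impI)
  let ?M = "base_measure X" and ?N = "freq_measure X"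
  note RM = reg_base_measure[of X] and RN = reg_freq_measure[of X]
  show "reg_measure ?M" "reg_measure ?N" by (rule RM, rule RN)
  fix f
  { assume f: "integrable ?M f \<and> sqint ?M f"
    show "sqint ?N (ftr ?M f)" using f bessel_inequality(1) by blast
    show "nsq ?N (ftr ?M f) = 2 * pi * nsq ?M f"
      using f bessel_inequality(2)[of X f] plancherel_lower_bound[of X f] by force }
  { assume f: "integrable ?N f \<and> sqint ?N f"
    note d = dual_bessel[OF RM RN conjI[OF bessel_inequality] conjunct1[OF f] conjunct2[OF f]]
    show "sqint ?M (ftr ?N f)" by (rule d(1))
    show "nsq ?M (ftr ?N f) = 2 * pi * nsq ?N f"
      using d(2) plancherel_lower_bound_dual[of X f] f by force }
qed

section \<open>Periodic functions\<close>

lemma lebesgue_shift: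
  shows "distr lebesgue lebesgue (\<lambda>x::real. x + c) = lebesgue"
    and "(\<lambda>x::real. x + c) \<in> measurable lebesgue lebesgue"
  using lebesgue_real_affine[of 1 c] lebesgue_affine_measurable[of "\<lambda>_. 1" "c::real"]
  by (simp_all add: density_1 add.commute)

lemma AE_lebesgue_shift:
  assumes "AE x in lebesgue. P (x::real)"
  shows "AE x in lebesgue. P (x + c)"
proof -
  have "AE x in distr lebesgue lebesgue (\<lambda>x::real. x + c). P x"
    by (subst lebesgue_shift(1)) (rule assms)
  then show ?thesis by (rule AE_distrD[OF lebesgue_shift(2)])
qed

lemma nn_integral_lebesgue_shift:
  assumes "u \<in> borel_measurable lebesgue"
  shows "(\<integral>\<^sup>+x. u (x + c) \<partial>lebesgue) = (\<integral>\<^sup>+x. u x \<partial>(lebesgue :: real measure))"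
  using nn_integral_distr[OF lebesgue_shift(2)[of c], of u] assms unfolding lebesgue_shift(1) by simp

section \<open>Passing between one period and the whole line\<close>

lemma periodic_int_multiple:
  assumes "\<forall>x. u (x + 2 * pi) = u x"
  shows "u (x + 2 * pi * of_int k) = u x"
proof -
  have n: "u (x + 2 * pi * real n) = u x" for n x
  proof (induction n)
    case (Suc n)
    have "u (x + 2 * pi * real (Suc n)) = u ((x + 2 * pi * real n) + 2 * pi)" by (simp add: algebra_simps)
    then show ?case using assms Suc by simp
  qed simp
  show ?thesis
  proof (cases "k \<ge> 0")
    case True
    then show ?thesis using n[of x "nat k"] by simp
  next
    case False
    then show ?thesis using n[of "x + 2 * pi * of_int k" "nat (- k)"] by (simp add: algebra_simps)
  qed
qed

definition period_rep :: "real \<Rightarrow> real" where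
  "period_rep x = x + 2 * pi * of_int (- \<lfloor>(x + pi) / (2 * pi)\<rfloor>)"

lemma period_rep_range: "- pi \<le> period_rep x" "period_rep x < pi"
proof -
  have "of_int \<lfloor>(x + pi) / (2 * pi)\<rfloor> * (2 * pi) \<le> x + pi"
    using mult_right_mono[OF of_int_floor_le[of "(x + pi) / (2 * pi)"], of "2 * pi"] by simp
  then show "- pi \<le> period_rep x" by (simp add: period_rep_def algebra_simps)
  have "(x + pi) / (2 * pi) < of_int \<lfloor>(x + pi) / (2 * pi)\<rfloor> + 1" by linarith
  then have "x + pi < (of_int \<lfloor>(x + pi) / (2 * pi)\<rfloor> + 1) * (2 * pi)" 
    using mult_strict_right_mono[of "(x + pi) / (2 * pi)" "of_int \<lfloor>(x + pi) / (2 * pi)\<rfloor> + 1" "2 * pi"] by simp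
  then show "period_rep x < pi" by (simp add: period_rep_def algebra_simps)
qed

lemma period_rep_shift: "period_rep (x + 2 * pi) = period_rep x"
proof -
  have "(x + 2 * pi + pi) / (2 * pi) = (x + pi) / (2 * pi) + 1" by (simp add: field_simps)
  then show ?thesis by (simp add: period_rep_def algebra_simps)
qed

lemma period_rep_id:
  assumes "- pi \<le> x" "x < pi" shows "period_rep x = x"
proof -
  have "\<lfloor>(x + pi) / (2 * pi)\<rfloor> = 0" using assms by (intro floor_unique) (auto simp: field_simps)
  then show ?thesis by (simp add: period_rep_def)
qed

lemma period_rep_value:
  assumes "\<forall>x. u (x + 2 * pi) = u x" shows "u (period_rep x) = u x"
  unfolding period_rep_def by (rule periodic_int_multiple[OF assms])

lemma AE_not_pi: "AE x in lebesgue. x \<noteq> pi \<and> x \<noteq> -pi"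
  by (intro AE_conjI; rule AE_completion; rule AE_lborel_singleton)

text \<open>The translates of the exceptional set of one period by multiples of
  \<open>2 * pi\<close> are countably many. Identities can therefore be proved on one period and
  used almost everywhere on the line, where the Hilbert transform integrates across the ends of the
  period.\<close>

lemma AE_base_periodic:
  assumes P: "periodic_on X P" and ae: "AE x in base_measure X. P x"
  shows "AE x in lebesgue. P x"
proof (cases X)
  case Circle
  have "AE x in lebesgue. x \<in> {-pi..pi} \<longrightarrow> P x"
    using ae AE_restrict_space_iff[of "{-pi..pi}" lebesgue P] unfolding Circle base_measure.simps by simp
  then have "AE x in lebesgue. \<forall>k::int. x + 2 * pi * of_int k \<in> {-pi..pi} \<longrightarrow> P (x + 2 * pi * of_int k)"
    unfolding AE_all_countable by (intro allI AE_lebesgue_shift)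
  then show ?thesis
  proof eventually_elim
    case (elim x)
    have "P (period_rep x)"
      using elim[rule_format, of "- \<lfloor>(x + pi) / (2 * pi)\<rfloor>"] period_rep_range[of x] by (simp add: period_rep_def)
    then show ?case using period_rep_value[of P x] P Circle by simp
  qed
next
  case Line
  show ?thesis using ae unfolding Line base_measure.simps .
qed

lemma AE_base_of_lebesgue:
  assumes "AE x in lebesgue. P x" shows "AE x in base_measure X. P x"
proof (cases X)
  case Circle
  have "AE x in lebesgue. x \<in> {-pi..pi} \<longrightarrow> P x" using assms by eventually_elim simp
  then show ?thesis using AE_restrict_space_iff[of "{-pi..pi}" lebesgue P] unfolding Circle base_measure.simps by simp
next
  case Line
  show ?thesis using assms unfolding Line base_measure.simps .
qed

lemma measurable_base_of_lebesgue: "u \<in> borel_measurable lebesgue \<Longrightarrow> u \<in> borel_measurable (base_measure X)"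
  by (cases X) (auto intro: measurable_restrict_space1)

lemma nn_integral_period_window:
  fixes u :: "real \<Rightarrow> ennreal"
  assumes p: "\<forall>x. u (x + 2 * pi) = u x" and m: "u \<in> borel_measurable lebesgue" and h: "0 \<le> h" "h \<le> 2 * pi"
  shows "(\<integral>\<^sup>+x. u x * indicator {-pi+h..<pi+h} x \<partial>lebesgue) = (\<integral>\<^sup>+x. u x * indicator {-pi..<pi} x \<partial>lebesgue)"
proof -
  have m': "(\<lambda>x. u x * indicator {a..<b} x) \<in> borel_measurable lebesgue" for a b
    by (intro borel_measurable_times_ennreal m borel_measurable_indicator) simp
  have "(\<integral>\<^sup>+x. u x * indicator {-pi+h..<pi+h} x \<partial>lebesgue)
     = (\<integral>\<^sup>+x. u x * indicator {-pi+h..<pi} x + u x * indicator {pi..<pi+h} x \<partial>lebesgue)"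
    using h by (intro nn_integral_cong) (auto simp: indicator_def)
  also have "\<dots> = (\<integral>\<^sup>+x. u x * indicator {-pi+h..<pi} x \<partial>lebesgue) + (\<integral>\<^sup>+x. u x * indicator {pi..<pi+h} x \<partial>lebesgue)"
    by (rule nn_integral_add[OF m' m'])
  also have "(\<integral>\<^sup>+x. u x * indicator {pi..<pi+h} x \<partial>lebesgue)
     = (\<integral>\<^sup>+x. u (x + 2 * pi) * indicator {pi..<pi+h} (x + 2 * pi) \<partial>lebesgue)"
    by (rule nn_integral_lebesgue_shift[OF m', symmetric])
  also have "\<dots> = (\<integral>\<^sup>+x. u x * indicator {-pi..<-pi+h} x \<partial>lebesgue)"
    using p by (intro nn_integral_cong) (auto simp: indicator_def)
  also have "(\<integral>\<^sup>+x. u x * indicator {-pi+h..<pi} x \<partial>lebesgue) + (\<integral>\<^sup>+x. u x * indicator {-pi..<-pi+h} x \<partial>lebesgue)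
     = (\<integral>\<^sup>+x. u x * indicator {-pi+h..<pi} x + u x * indicator {-pi..<-pi+h} x \<partial>lebesgue)"
    by (rule nn_integral_add[OF m' m', symmetric])
  also have "\<dots> = (\<integral>\<^sup>+x. u x * indicator {-pi..<pi} x \<partial>lebesgue)"
    using h by (intro nn_integral_cong) (auto simp: indicator_def)
  finally show ?thesis .
qed

lemma nn_integral_base_shift:
  fixes u :: "real \<Rightarrow> ennreal"
  assumes p: "periodic_on X u" and m: "u \<in> borel_measurable lebesgue"
  shows "(\<integral>\<^sup>+x. u (x + h) \<partial>base_measure X) = (\<integral>\<^sup>+x. u x \<partial>base_measure X)"
proof (cases X)
  case Line
  then show ?thesis using nn_integral_lebesgue_shift[OF m] by simp
next
  case Circle
  have p': "\<forall>x. u (x + 2 * pi) = u x" using p Circle by simp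
  have ms: "(\<lambda>x. u (x + h)) \<in> borel_measurable lebesgue" by (rule measurable_compose[OF lebesgue_shift(2) m])
  have base: "(\<integral>\<^sup>+x. v x \<partial>base_measure X) = (\<integral>\<^sup>+x. v x * indicator {-pi..<pi} x \<partial>lebesgue)"
    for v :: "real \<Rightarrow> ennreal"
  proof -
    have "(\<integral>\<^sup>+x. v x \<partial>base_measure X) = (\<integral>\<^sup>+x. v x * indicator {-pi..pi} x \<partial>lebesgue)"
      unfolding Circle base_measure.simps by (rule nn_integral_restrict_space) simp
    also have "\<dots> = (\<integral>\<^sup>+x. v x * indicator {-pi..<pi} x \<partial>lebesgue)"
    proof (rule nn_integral_cong_AE)
      show "AE x in lebesgue. v x * indicator {-pi..pi} x = v x * indicator {-pi..<pi} x"
        using AE_not_pi by eventually_elim (auto simp: indicator_def)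
    qed
    finally show ?thesis .
  qed
  \<comment> \<open>The shift is reduced to between 0 and \<open>2 * pi\<close>, so that the moved
    window meets only the given period and the next one.\<close>
  define h' where "h' = period_rep (h - pi) + pi"
  have h': "0 \<le> h'" "h' \<le> 2 * pi" using period_rep_range[of "h - pi"] by (auto simp: h'_def)
  have "u (x + h) = u (x + h')" for x
  proof -
    have "u ((x + h) + 2 * pi * of_int (- \<lfloor>(h - pi + pi) / (2 * pi)\<rfloor>)) = u (x + h)"
      by (rule periodic_int_multiple[OF p'])
    then show ?thesis by (simp add: h'_def period_rep_def algebra_simps)
  qed
  then have "(\<integral>\<^sup>+x. u (x + h) \<partial>base_measure X) = (\<integral>\<^sup>+x. u (x + h') * indicator {-pi+h'..<pi+h'} (x + h') \<partial>lebesgue)"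
    unfolding base by (intro nn_integral_cong) (auto simp: indicator_def)
  also have "\<dots> = (\<integral>\<^sup>+x. u x * indicator {-pi+h'..<pi+h'} x \<partial>lebesgue)"
    by (rule nn_integral_lebesgue_shift[where u = "\<lambda>x. u x * indicator {-pi+h'..<pi+h'} x"])
       (intro borel_measurable_times_ennreal m borel_measurable_indicator, simp)
  also have "\<dots> = (\<integral>\<^sup>+x. u x * indicator {-pi..<pi} x \<partial>lebesgue)"
    by (rule nn_integral_period_window[OF p' m h'])
  finally show ?thesis unfolding base .
qed

lemma integral_base_shift_real:
  fixes u :: "real \<Rightarrow> real"
  assumes p: "periodic_on X u" and m: "u \<in> borel_measurable lebesgue" and i: "integrable (base_measure X) u"
  shows "integrable (base_measure X) (\<lambda>x. u (x + h))"
    and "(\<integral>x. u (x + h) \<partial>base_measure X) = (\<integral>x. u x \<partial>base_measure X)"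
proof -
  have p': "periodic_on X (\<lambda>x. ennreal (w (u x)))" for w :: "real \<Rightarrow> real" using p by (cases X) auto
  have ms: "(\<lambda>x. u (x + h)) \<in> borel_measurable (base_measure X)"
    by (rule measurable_base_of_lebesgue[OF measurable_compose[OF lebesgue_shift(2) m]])
  have s: "(\<integral>\<^sup>+x. ennreal (w (u (x + h))) \<partial>base_measure X) = (\<integral>\<^sup>+x. ennreal (w (u x)) \<partial>base_measure X)"
    if "w \<in> borel_measurable borel" for w :: "real \<Rightarrow> real"
    by (rule nn_integral_base_shift[OF p'])
       (rule measurable_compose[OF measurable_compose[OF m that] measurable_ennreal])
  show i': "integrable (base_measure X) (\<lambda>x. u (x + h))"
    using i ms s[of "\<lambda>r. norm r"] by (simp add: integrable_iff_bounded)
  show "(\<integral>x. u (x + h) \<partial>base_measure X) = (\<integral>x. u x \<partial>base_measure X)"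
    unfolding real_lebesgue_integral_def[OF i] real_lebesgue_integral_def[OF i']
    using s[of "\<lambda>r. r"] s[of "\<lambda>r. - r"] by simp
qed

lemma integral_base_shift:
  fixes u :: "real \<Rightarrow> complex"
  assumes p: "periodic_on X u" and m: "u \<in> borel_measurable lebesgue" and i: "integrable (base_measure X) u"
  shows "integrable (base_measure X) (\<lambda>x. u (x + h))"
    and "(\<integral>x. u (x + h) \<partial>base_measure X) = (\<integral>x. u x \<partial>base_measure X)"
proof -
  have pr: "periodic_on X (\<lambda>x. Re (u x))" "periodic_on X (\<lambda>x. Im (u x))" using p by (cases X; simp)+
  have mr: "(\<lambda>x. Re (u x)) \<in> borel_measurable lebesgue" "(\<lambda>x. Im (u x)) \<in> borel_measurable lebesgue"
    using m by auto
  note re = integral_base_shift_real[OF pr(1) mr(1) integrable_Re[OF i], of h]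
    and im = integral_base_shift_real[OF pr(2) mr(2) integrable_Im[OF i], of h]
  show i': "integrable (base_measure X) (\<lambda>x. u (x + h))"
  proof -
    have "integrable (base_measure X) (\<lambda>x. complex_of_real (Re (u (x + h))) + \<i> * complex_of_real (Im (u (x + h))))"
      by (intro Bochner_Integration.integrable_add integrable_mult_right integrable_of_real re(1) im(1))
    then show ?thesis by (simp add: complex_eq[symmetric])
  qed
  show "(\<integral>x. u (x + h) \<partial>base_measure X) = (\<integral>x. u x \<partial>base_measure X)"
    using re(2) im(2) integral_Re[OF i] integral_Re[OF i'] integral_Im[OF i] integral_Im[OF i']
    by (simp add: complex_eq_iff)
qed

text \<open>Surjectivity of the transform yields functions that matter on one period only.
  Composition with \<open>period_rep\<close> is safe for Borel functions, whence the passage to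
  Borel versions of the real and imaginary parts first.\<close>

lemma periodic_representative:
  assumes g: "g \<in> borel_measurable (base_measure X)"
  obtains g' :: "real \<Rightarrow> complex" where "periodic_on X g'" "g' \<in> borel_measurable lebesgue"
    "AE x in base_measure X. g x = g' x"
proof (cases X)
  case Line
  then show ?thesis using g by (intro that[of g]) auto
next
  case Circle
  let ?I = "{-pi..pi}"
  have g0: "(\<lambda>x. indicator ?I x *\<^sub>R g x) \<in> borel_measurable lebesgue"
    using g borel_measurable_restrict_space_iff[of ?I lebesgue g] Circle by simp
  obtain gr where gr: "gr \<in> borel_measurable lborel" "AE x in lborel. Re (indicator ?I x *\<^sub>R g x) = gr x"
    using completion_ex_borel_measurable_real[OF measurable_compose[OF g0 borel_measurable_Re]]
    by auto
  obtain gi where gi: "gi \<in> borel_measurable lborel" "AE x in lborel. Im (indicator ?I x *\<^sub>R g x) = gi x"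
    using completion_ex_borel_measurable_real[OF measurable_compose[OF g0 borel_measurable_Im]]
    by auto
  have r: "period_rep \<in> borel_measurable borel"
    unfolding period_rep_def[abs_def] by measurable
  define g' where "g' x = Complex (gr (period_rep x)) (gi (period_rep x))" for x
  have e: "g' = (\<lambda>x. complex_of_real (gr (period_rep x)) + \<i> * complex_of_real (gi (period_rep x)))"
    by (auto simp: g'_def complex_eq_iff)
  have "g' \<in> borel_measurable borel"
    unfolding e using measurable_compose[OF r, of gr] measurable_compose[OF r, of gi] gr(1) gi(1)
    by (intro borel_measurable_add borel_measurable_times borel_measurable_const measurable_compose[OF _ borel_measurable_of_real]) auto
  then have m: "g' \<in> borel_measurable lebesgue" by (intro measurable_completion) simp
  have "AE x in lebesgue. x \<in> ?I \<longrightarrow> g x = g' x"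
    using AE_completion[OF gr(2)] AE_completion[OF gi(2)] AE_not_pi
  proof eventually_elim
    case (elim x)
    show ?case
    proof
      assume x: "x \<in> ?I"
      then have "period_rep x = x" using elim(3) by (intro period_rep_id) auto
      then show "g x = g' x" using elim x by (simp add: g'_def complex_eq_iff)
    qed
  qed
  then have "AE x in base_measure X. g x = g' x"
    using AE_restrict_space_iff[of ?I lebesgue "\<lambda>x. g x = g' x"] unfolding Circle base_measure.simps by simp
  moreover have "periodic_on X g'" using Circle by (simp add: g'_def period_rep_shift)
  ultimately show ?thesis using m that by blast
qed

section \<open>Fourier multipliers on the line and the circle\<close>

lemma sqnorm_eq_nsq: "sqint M f \<Longrightarrow> sqnorm M f = ennreal (nsq M f)"
  unfolding sqnorm_def by (rule nn_eq_nsq)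

lemma L2_iff:
  fixes f :: "real \<Rightarrow> complex"
  shows "f \<in> L2 X \<longleftrightarrow> periodic_on X f \<and> f \<in> borel_measurable lebesgue \<and> sqint (base_measure X) f"
  unfolding L2_def sqint_iff_nn sqnorm_def using measurable_base_of_lebesgue by auto

lemma L2_D:
  fixes f :: "real \<Rightarrow> complex"
  assumes "f \<in> L2 X"
  shows "periodic_on X f" "f \<in> borel_measurable lebesgue" "sqint (base_measure X) f"
  using assms by (auto simp: L2_iff)

lemma L2_add: "f \<in> L2 X \<Longrightarrow> g \<in> L2 X \<Longrightarrow> (\<lambda>x. f x + g x :: complex) \<in> L2 X"
  unfolding L2_iff by (cases X) (auto intro: sqint_add)

lemma L2_cmult: "f \<in> L2 X \<Longrightarrow> (\<lambda>x. c * f x :: complex) \<in> L2 X"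
  unfolding L2_iff by (cases X) (auto intro: sqint_cmult)

lemma L2_diff: "f \<in> L2 X \<Longrightarrow> g \<in> L2 X \<Longrightarrow> (\<lambda>x. f x - g x :: complex) \<in> L2 X"
  unfolding L2_iff by (cases X) (auto intro: sqint_diff)

lemma L2_zero: "(\<lambda>x. 0 :: complex) \<in> L2 X"
  unfolding L2_iff by (cases X) (auto intro: sqint_zero)

lemma L2_bdd_mult:
  assumes "f \<in> L2 X" "periodic_on X a" "a \<in> borel_measurable lebesgue" "AE x in lebesgue. cmod (a x) \<le> C"
  shows "(\<lambda>x. a x * f x :: complex) \<in> L2 X"
proof -
  have "sqint (base_measure X) (\<lambda>x. a x * f x)"
    by (rule sqint_bdd_mult(1)[OF L2_D(3)[OF assms(1)] measurable_base_of_lebesgue[OF assms(3)] AE_base_of_lebesgue[OF assms(4)]])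
  then show ?thesis using assms L2_D[OF assms(1)] unfolding L2_iff by (cases X) auto
qed

lemma L2_cong_AE:
  assumes "f \<in> L2 X" "AE x in lebesgue. f x = g x" "periodic_on X g"
  shows "(g :: real \<Rightarrow> complex) \<in> L2 X"
proof -
  have m: "g \<in> borel_measurable lebesgue"
    by (rule borel_measurable_AE[OF L2_D(2)[OF assms(1)] assms(2)])
  show ?thesis unfolding L2_iff
    using sqint_cong_AE(1)[OF L2_D(3)[OF assms(1)] measurable_base_of_lebesgue[OF m] AE_base_of_lebesgue[OF assms(2)]] assms(3) m
    by blast
qed

lemma L2_AE_eq:
  assumes "f \<in> L2 X" "g \<in> L2 X" "AE x in base_measure X. f x = (g x :: complex)"
  shows "AE x in lebesgue. f x = g x"
proof (rule AE_base_periodic[OF _ assms(3)])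
  show "periodic_on X (\<lambda>x. f x = g x)" using L2_D(1)[OF assms(1)] L2_D(1)[OF assms(2)] by (cases X) auto
qed

text \<open>The factor between the unnormalised transform and \<open>fourier\<close>, which divides
  by \<open>2 * pi\<close> on the circle.\<close>

primrec fourier_const :: "base \<Rightarrow> real" where
  "fourier_const Line = 1" | "fourier_const Circle = 2 * pi"

section \<open>Agreement with \<open>fourier\<close>, and multipliers as a relation\<close>

lemma trunc_fourier_eq:
  "trunc_fourier R f \<xi> = ftr lebesgue (\<lambda>x. indicator {-R..R} x * f x) \<xi>"
  unfolding trunc_fourier_def ftr_def set_lebesgue_integral_def wave_def
  by (intro Bochner_Integration.integral_cong) (auto simp: indicator_def)

text \<open>The choice in \<open>fourier\<close> has content once some limit of the truncated
  transforms is known to exist; the abstract transform is one. Conversely, whichever limit is chosen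
  satisfies the multiplication formula, since that formula passes to limits.\<close>

lemma Ft_fourier_Line:
  assumes f: "sqint lebesgue f"
  shows "Ft lebesgue lebesgue f (fourier Line f)"
proof -
  have P: "fourier_pair (lebesgue :: real measure) lebesgue" using fourier_pair_base[of Line] by simp
  have RM: "reg_measure (lebesgue :: real measure)" using reg_base_measure[of Line] by simp
  define c where "c R x = indicator {-R..R} x * f x" for R x
  have c: "sqint lebesgue (c R)" "integrable lebesgue (c R)" for R
    unfolding c_def by (rule truncation[OF RM f])+
  have cF: "Ft lebesgue lebesgue (c R) (trunc_fourier R f)" for R
    using Ft_ftr[OF P c(2,1), of R] unfolding trunc_fourier_eq[abs_def] c_def .
  define t where "t R = nsq lebesgue (\<lambda>x. f x - c R x)" for R
  have tn: "(\<lambda>n. t (real n)) \<longlonglongrightarrow> 0"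
    using truncation(3)[OF RM f] unfolding t_def c_def by (simp add: nsq_commute[of lebesgue f])
  \<comment> \<open>The discarded tail shrinks as the truncation grows, so convergence along the
    integers gives convergence along all real radii.\<close>
  have mono: "t R \<le> t r" if "r \<le> R" for r R
  proof -
    have "nsq lebesgue (\<lambda>x. f x - c R x) \<le> 1\<^sup>2 * nsq lebesgue (\<lambda>x. f x - c r x)"
      by (rule sqint_dominated(2)[OF sqint_diff(1)[OF f c(1)] sqint_measurable[OF sqint_diff(1)[OF f c(1)]]])
         (use that in \<open>auto simp: c_def indicator_def\<close>)
    then show ?thesis by (simp add: t_def)
  qed
  have tlim: "(t \<longlongrightarrow> 0) at_top"
  proof (rule order_tendstoI)
    fix a :: real assume "a < 0"
    then show "\<forall>\<^sub>F R in at_top. a < t R" by (intro always_eventually) (auto simp: t_def intro: less_le_trans nsq_nonneg)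
  next
    fix a :: real assume "0 < a"
    then obtain n where n: "t (real n) < a" using order_tendstoD(2)[OF tn] by (auto simp: eventually_sequentially)
    show "\<forall>\<^sub>F R in at_top. t R < a"
      using eventually_ge_at_top[of "real n"] by eventually_elim (use mono n in \<open>force intro: le_less_trans\<close>)
  qed
  let ?P = "\<lambda>F. F \<in> borel_measurable lebesgue \<and>
        ((\<lambda>R. sqnorm lebesgue (\<lambda>\<xi>. F \<xi> - trunc_fourier R f \<xi>)) \<longlongrightarrow> 0) at_top"
  obtain F where F: "Ft lebesgue lebesgue f F" using Ft_ex[OF P f] by blast
  have PF: "?P F"
  proof
    show "F \<in> borel_measurable lebesgue" using FtD(2)[OF F] by (simp add: sqint_def)
    have "sqnorm lebesgue (\<lambda>\<xi>. F \<xi> - trunc_fourier R f \<xi>) = ennreal (2 * pi * t R)" for R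
      using Ft_plancherel[OF P Ft_diff[OF P F cF]] FtD(2)[OF Ft_diff[OF P F cF]]
      by (simp add: sqnorm_eq_nsq t_def)
    moreover have "((\<lambda>R. ennreal (2 * pi * t R)) \<longlongrightarrow> ennreal (2 * pi * 0)) at_top"
      by (intro tendsto_ennrealI tendsto_intros tlim)
    ultimately show "((\<lambda>R. sqnorm lebesgue (\<lambda>\<xi>. F \<xi> - trunc_fourier R f \<xi>)) \<longlongrightarrow> 0) at_top" by simp
  qed
  define F' where "F' = fourier Line f"
  have PF': "?P F'" unfolding F'_def fourier.simps by (rule someI[of ?P, OF PF])
  have seq: "(\<lambda>n. sqnorm lebesgue (\<lambda>\<xi>. F' \<xi> - trunc_fourier (real n) f \<xi>)) \<longlonglongrightarrow> 0"
    using filterlim_compose[OF conjunct2[OF PF'] filterlim_real_sequentially] .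
  have mT: "trunc_fourier R f \<in> borel_measurable lebesgue" for R using FtD(2)[OF cF] by (simp add: sqint_def)
  have mF': "F' \<in> borel_measurable lebesgue" using PF' by blast
  \<comment> \<open>The distance between the chosen limit and a truncated transform is known to be
    finite only from some index on; from there the chosen limit is seen to be square
    integrable.\<close>
  obtain N where N: "\<And>n. n \<ge> N \<Longrightarrow> sqnorm lebesgue (\<lambda>\<xi>. F' \<xi> - trunc_fourier (real n) f \<xi>) < 1"
    using order_tendstoD(2)[OF seq, of 1] by (auto simp: eventually_sequentially)
  have s: "sqint lebesgue (\<lambda>\<xi>. F' \<xi> - trunc_fourier (real (n + N)) f \<xi>)" for n
  proof -
    have "sqnorm lebesgue (\<lambda>\<xi>. F' \<xi> - trunc_fourier (real (n + N)) f \<xi>) < \<infinity>"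
      using N[of "n + N"] by (auto intro: less_trans)
    then show ?thesis unfolding sqint_iff_nn sqnorm_def using mF' mT by simp
  qed
  have sF': "sqint lebesgue F'"
    using sqint_add(1)[OF s[of 0] FtD(2)[OF cF[of "real (0 + N)"]]] by simp
  have lim: "(\<lambda>n. nsq lebesgue (\<lambda>\<xi>. trunc_fourier (real (n + N)) f \<xi> - F' \<xi>)) \<longlonglongrightarrow> 0"
  proof -
    have "(\<lambda>n. ennreal (nsq lebesgue (\<lambda>\<xi>. F' \<xi> - trunc_fourier (real (n + N)) f \<xi>))) \<longlonglongrightarrow> ennreal 0"
      using LIMSEQ_ignore_initial_segment[OF seq, of N] s by (simp add: sqnorm_eq_nsq)
    then have "(\<lambda>n. nsq lebesgue (\<lambda>\<xi>. F' \<xi> - trunc_fourier (real (n + N)) f \<xi>)) \<longlonglongrightarrow> 0"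
      by (subst (asm) tendsto_ennreal_iff) (auto simp: nsq_nonneg)
    then show ?thesis by (subst nsq_commute)
  qed
  have "(\<lambda>n. nsq lebesgue (\<lambda>x. c (real (n + N)) x - f x)) \<longlonglongrightarrow> 0"
    using LIMSEQ_ignore_initial_segment[OF tn, of N] unfolding t_def by (subst nsq_commute)
  from Ft_lim[OF P cF f sF' this lim] show ?thesis unfolding F'_def .
qed

lemma integrable_circle:
  assumes "sqint (base_measure Circle) f" shows "integrable (base_measure Circle) f"
proof -
  have "finite_measure (base_measure Circle)" by (auto intro!: finite_measureI simp: emeasure_restrict_space)
  then interpret finite_measure "base_measure Circle" .
  have "sqint (base_measure Circle) (\<lambda>_. 1)" by (simp add: sqint_def)
  from sqint_prod[OF this assms] show ?thesis by simp
qed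

lemma Ft_fourier:
  assumes f: "f \<in> L2 X"
  shows "Ft (base_measure X) (freq_measure X) f (\<lambda>\<xi>. complex_of_real (fourier_const X) * fourier X f \<xi>)"
proof (cases X)
  case Line
  then show ?thesis using Ft_fourier_Line[of f] L2_D(3)[OF f] by simp
next
  case Circle
  have s: "sqint (base_measure Circle) f" using L2_D(3)[OF f] Circle by simp
  have "trunc_fourier pi f \<xi> = ftr (base_measure Circle) f \<xi>" for \<xi>
    unfolding trunc_fourier_def ftr_def set_lebesgue_integral_def base_measure.simps wave_def
    by (subst integral_restrict_space) auto
  then have "(\<lambda>\<xi>. complex_of_real (fourier_const X) * fourier X f \<xi>) = ftr (base_measure Circle) f"
    using Circle by (auto simp: fun_eq_iff)
  then show ?thesis using Ft_ftr[OF fourier_pair_base integrable_circle[OF s] s] Circle by simp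
qed

text \<open>A relation, because transform and image are determined only up to null sets and because
  unbounded symbols have a proper domain. Membership in \<open>L2\<close> forces both
  representatives to be periodic and measurable on the whole line.\<close>

definition mulrel :: "base \<Rightarrow> (real \<Rightarrow> complex) \<Rightarrow> (real \<Rightarrow> complex) \<Rightarrow> (real \<Rightarrow> complex) \<Rightarrow> bool" where
  "mulrel X m f g \<longleftrightarrow> f \<in> L2 X \<and> g \<in> L2 X \<and>
     (\<exists>F. Ft (base_measure X) (freq_measure X) f F \<and> Ft (base_measure X) (freq_measure X) g (\<lambda>\<xi>. m \<xi> * F \<xi>))"

lemma mulrelD: "mulrel X m f g \<Longrightarrow> f \<in> L2 X" "mulrel X m f g \<Longrightarrow> g \<in> L2 X"
  by (auto simp: mulrel_def)

lemma freq_measurable: "m \<in> borel_measurable borel \<Longrightarrow> m \<in> borel_measurable (freq_measure X)"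
  by (rule measurable_compose[OF reg_measureD(2)[OF reg_freq_measure]])

lemma mulrel_transform:
  assumes "mulrel X m f g" "Ft (base_measure X) (freq_measure X) f F" "m \<in> borel_measurable borel"
  shows "Ft (base_measure X) (freq_measure X) g (\<lambda>\<xi>. m \<xi> * F \<xi>)"
proof -
  note P = fourier_pair_base[of X]
  obtain F' where F': "Ft (base_measure X) (freq_measure X) f F'"
    "Ft (base_measure X) (freq_measure X) g (\<lambda>\<xi>. m \<xi> * F' \<xi>)" using assms(1) by (auto simp: mulrel_def)
  show ?thesis
  proof (rule Ft_cong[OF P F'(2)])
    show "AE \<xi> in freq_measure X. m \<xi> * F' \<xi> = m \<xi> * F \<xi>"
      using Ft_unique[OF P F'(1) assms(2)] by eventually_elim simp
    show "(\<lambda>\<xi>. m \<xi> * F \<xi>) \<in> borel_measurable (freq_measure X)"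
      by (intro borel_measurable_times freq_measurable assms sqint_measurable FtD(2)[OF assms(2)])
    show "g \<in> borel_measurable (base_measure X)" using FtD(1)[OF F'(2)] by (rule sqint_measurable)
  qed simp
qed

text \<open>The bridge to the definitions, which speak of \<open>fourier\<close>; the normalising
  constant is the same on both sides and cancels.\<close>

lemma mulrel_fourier_iff:
  assumes f: "f \<in> L2 X" and g: "g \<in> L2 X" and m: "m \<in> borel_measurable borel"
  shows "mulrel X m f g \<longleftrightarrow> (AE \<xi> in freq_measure X. fourier X g \<xi> = m \<xi> * fourier X f \<xi>)"
proof -
  note P = fourier_pair_base[of X]
  let ?k = "complex_of_real (fourier_const X)"
  have k: "?k \<noteq> 0" by (cases X) auto
  show ?thesis
  proof
    assume "mulrel X m f g"
    from Ft_unique[OF P mulrel_transform[OF this Ft_fourier[OF f] m] Ft_fourier[OF g]]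
    show "AE \<xi> in freq_measure X. fourier X g \<xi> = m \<xi> * fourier X f \<xi>"
      by eventually_elim (use k in \<open>auto simp: mult.left_commute[of _ ?k]\<close>)
  next
    assume ae: "AE \<xi> in freq_measure X. fourier X g \<xi> = m \<xi> * fourier X f \<xi>"
    have "Ft (base_measure X) (freq_measure X) g (\<lambda>\<xi>. m \<xi> * (?k * fourier X f \<xi>))"
    proof (rule Ft_cong[OF P Ft_fourier[OF g]])
      show "AE \<xi> in freq_measure X. ?k * fourier X g \<xi> = m \<xi> * (?k * fourier X f \<xi>)"
        using ae by eventually_elim simp
      show "(\<lambda>\<xi>. m \<xi> * (?k * fourier X f \<xi>)) \<in> borel_measurable (freq_measure X)"
        by (intro borel_measurable_times freq_measurable m sqint_measurable[OF FtD(2)[OF Ft_fourier[OF f]]])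
      show "g \<in> borel_measurable (base_measure X)" using L2_D(3)[OF g] by (rule sqint_measurable)
    qed simp
    then show "mulrel X m f g" unfolding mulrel_def using Ft_fourier[OF f] f g by blast
  qed
qed

lemma mulrel_unique:
  assumes "mulrel X m f g" "mulrel X m f' g'" "AE x in lebesgue. f x = f' x" "m \<in> borel_measurable borel"
  shows "AE x in lebesgue. g x = g' x"
proof (rule L2_AE_eq)
  note P = fourier_pair_base[of X]
  show "g \<in> L2 X" "g' \<in> L2 X" using assms by (auto simp: mulrel_def)
  obtain F where F: "Ft (base_measure X) (freq_measure X) f F"
    "Ft (base_measure X) (freq_measure X) g (\<lambda>\<xi>. m \<xi> * F \<xi>)" using assms(1) by (auto simp: mulrel_def)
  have "Ft (base_measure X) (freq_measure X) f' F"
    by (rule Ft_cong[OF P F(1) AE_base_of_lebesgue[OF assms(3)]])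
       (use mulrelD(1)[OF assms(2)] FtD(2)[OF F(1)] in \<open>auto intro: sqint_measurable simp: L2_iff\<close>)
  from Ft_inj[OF P F(2) mulrel_transform[OF assms(2) this assms(4)]]
  show "AE x in base_measure X. g x = g' x" by simp
qed

lemma mulrel_cong:
  assumes "mulrel X m f g" "AE x in lebesgue. f x = f' x" "periodic_on X f'"
    "AE x in lebesgue. g x = g' x" "periodic_on X g'"
  shows "mulrel X m f' g'"
proof -
  note P = fourier_pair_base[of X]
  have f': "f' \<in> L2 X" and g': "g' \<in> L2 X"
    using L2_cong_AE[OF mulrelD(1)[OF assms(1)] assms(2,3)] L2_cong_AE[OF mulrelD(2)[OF assms(1)] assms(4,5)] by auto
  obtain F where F: "Ft (base_measure X) (freq_measure X) f F"
    "Ft (base_measure X) (freq_measure X) g (\<lambda>\<xi>. m \<xi> * F \<xi>)" using assms(1) by (auto simp: mulrel_def)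
  have "Ft (base_measure X) (freq_measure X) f' F" "Ft (base_measure X) (freq_measure X) g' (\<lambda>\<xi>. m \<xi> * F \<xi>)"
    by (rule Ft_cong[OF P F(1) AE_base_of_lebesgue[OF assms(2)]], use f' FtD(2)[OF F(1)] in \<open>auto intro: sqint_measurable simp: L2_iff\<close>)
       (rule Ft_cong[OF P F(2) AE_base_of_lebesgue[OF assms(4)]], use g' FtD(2)[OF F(2)] in \<open>auto intro: sqint_measurable simp: L2_iff\<close>)
  then show ?thesis unfolding mulrel_def using f' g' by blast
qed

lemma mulrel_add:
  assumes "mulrel X m f g" "mulrel X m f' g'" "m \<in> borel_measurable borel"
  shows "mulrel X m (\<lambda>x. f x + f' x) (\<lambda>x. g x + g' x)"
proof -
  note P = fourier_pair_base[of X]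
  obtain F F' where F: "Ft (base_measure X) (freq_measure X) f F" "Ft (base_measure X) (freq_measure X) g (\<lambda>\<xi>. m \<xi> * F \<xi>)"
    and F': "Ft (base_measure X) (freq_measure X) f' F'" "Ft (base_measure X) (freq_measure X) g' (\<lambda>\<xi>. m \<xi> * F' \<xi>)"
    using assms by (auto simp: mulrel_def)
  have "Ft (base_measure X) (freq_measure X) (\<lambda>x. g x + g' x) (\<lambda>\<xi>. m \<xi> * (F \<xi> + F' \<xi>))"
    using Ft_add[OF P F(2) F'(2)] by (simp add: distrib_left)
  then show ?thesis using Ft_add[OF P F(1) F'(1)] L2_add assms unfolding mulrel_def by blast
qed

lemma mulrel_cmult:
  assumes "mulrel X m f g"
  shows "mulrel X m (\<lambda>x. c * f x) (\<lambda>x. c * g x)" "mulrel X (\<lambda>\<xi>. c * m \<xi>) f (\<lambda>x. c * g x)"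
proof -
  note P = fourier_pair_base[of X]
  obtain F where F: "Ft (base_measure X) (freq_measure X) f F" "Ft (base_measure X) (freq_measure X) g (\<lambda>\<xi>. m \<xi> * F \<xi>)"
    using assms by (auto simp: mulrel_def)
  have "Ft (base_measure X) (freq_measure X) (\<lambda>x. c * g x) (\<lambda>\<xi>. m \<xi> * (c * F \<xi>))"
    "Ft (base_measure X) (freq_measure X) (\<lambda>x. c * g x) (\<lambda>\<xi>. (c * m \<xi>) * F \<xi>)"
    using Ft_cmult[OF P F(2), of c] by (simp_all add: mult_ac)
  then show "mulrel X m (\<lambda>x. c * f x) (\<lambda>x. c * g x)" "mulrel X (\<lambda>\<xi>. c * m \<xi>) f (\<lambda>x. c * g x)"
    using Ft_cmult[OF P F(1), of c] L2_cmult assms F(1) unfolding mulrel_def by blast+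
qed

lemma mulrel_diff:
  assumes "mulrel X m f g" "mulrel X m f' g'" "m \<in> borel_measurable borel"
  shows "mulrel X m (\<lambda>x. f x - f' x) (\<lambda>x. g x - g' x)"
  using mulrel_add[OF assms(1) mulrel_cmult(1)[OF assms(2), of "-1"] assms(3)] by simp

lemma mulrel_comp:
  assumes "mulrel X m f g" "mulrel X m' g h" "m' \<in> borel_measurable borel"
  shows "mulrel X (\<lambda>\<xi>. m' \<xi> * m \<xi>) f h"
proof -
  obtain F where F: "Ft (base_measure X) (freq_measure X) f F" "Ft (base_measure X) (freq_measure X) g (\<lambda>\<xi>. m \<xi> * F \<xi>)"
    using assms by (auto simp: mulrel_def)
  then show ?thesis using mulrel_transform[OF assms(2) F(2) assms(3)] assms(1,2)
    unfolding mulrel_def by (auto simp: mult.assoc)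
qed

lemma mulrel_exists:
  assumes f: "f \<in> L2 X" and F: "Ft (base_measure X) (freq_measure X) f F"
    and s: "sqint (freq_measure X) (\<lambda>\<xi>. m \<xi> * F \<xi>)"
  obtains g where "mulrel X m f g"
proof -
  note P = fourier_pair_base[of X]
  obtain g where g: "Ft (base_measure X) (freq_measure X) g (\<lambda>\<xi>. m \<xi> * F \<xi>)" using Ft_surj[OF P s] by blast
  have gm: "g \<in> borel_measurable (base_measure X)" using FtD(1)[OF g] by (rule sqint_measurable)
  obtain g' where g': "periodic_on X g'" "g' \<in> borel_measurable lebesgue" "AE x in base_measure X. g x = g' x"
    using periodic_representative[OF gm] .
  have Fg: "Ft (base_measure X) (freq_measure X) g' (\<lambda>\<xi>. m \<xi> * F \<xi>)"
    by (rule Ft_cong[OF P g g'(3) measurable_base_of_lebesgue[OF g'(2)]]) (use sqint_measurable[OF s] in auto)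
  then have "g' \<in> L2 X" unfolding L2_iff using g' FtD(1)[OF Fg] by blast
  then show ?thesis using that f F Fg unfolding mulrel_def by blast
qed

lemma mulrel_exists_bdd:
  assumes f: "f \<in> L2 X" and m: "m \<in> borel_measurable borel" and b: "\<And>\<xi>. cmod (m \<xi>) \<le> C"
  obtains g where "mulrel X m f g"
proof -
  note F = Ft_fourier[OF f]
  have "sqint (freq_measure X) (\<lambda>\<xi>. m \<xi> * (complex_of_real (fourier_const X) * fourier X f \<xi>))"
    by (rule sqint_bdd_mult(1)[OF FtD(2)[OF F] freq_measurable[OF m], where C = C]) (use b in auto)
  then show ?thesis using mulrel_exists[OF f F] that by blast
qed

lemma ftr_freq_periodic:
  assumes "X = Circle" shows "ftr (freq_measure X) G (x + 2 * pi) = ftr (freq_measure X) G x"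
proof -
  have "wave \<xi> (x + 2 * pi) = wave \<xi> x" if xi: "\<xi> \<in> \<int>" for \<xi>
  proof -
    obtain k where k: "\<xi> = of_int k" using xi by (rule Ints_cases)
    have "wave \<xi> (2 * pi) = exp (complex_of_real (2 * of_int (- k) * pi) * \<i>)"
      unfolding wave_def k by (rule arg_cong[where f = exp]) (simp add: complex_eq_iff)
    also have "\<dots> = 1" by (rule exp_integer_2pi) simp
    finally show ?thesis by (simp add: wave_add2)
  qed
  then show ?thesis unfolding ftr_def using assms by (intro Bochner_Integration.integral_cong) auto
qed

text \<open>The multiplication formula moves the translation onto the transform of the test
  function, where it is multiplication of the test function by a character.\<close>

lemma mulrel_shift:
  assumes f: "f \<in> L2 X"
  shows "mulrel X (\<lambda>\<xi>. cnj (wave h \<xi>)) f (\<lambda>x. f (x + h))"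
proof -
  let ?M = "base_measure X" and ?N = "freq_measure X"
  note P = fourier_pair_base[of X]
  note F = Ft_fourier[OF f]
  define F where "F \<xi> = complex_of_real (fourier_const X) * fourier X f \<xi>" for \<xi>
  have F: "Ft ?M ?N f F" unfolding F_def by (rule F)
  have wm: "(\<lambda>\<xi>. cnj (wave h \<xi>)) \<in> borel_measurable ?N"
    by (intro borel_measurable_cnj borel_measurable_wave borel_measurable_const reg_measureD(2) reg_freq_measure)
  have per: "periodic_on X (\<lambda>x. f (x + h))" 
  proof (cases X)
    case Circle
    have "f (x + 2 * pi + h) = f (x + h)" for x
    proof -
      have "x + 2 * pi + h = (x + h) + 2 * pi" by simp
      then show ?thesis using L2_D(1)[OF f] Circle by (simp only: periodic_on.simps)
    qed
    then show ?thesis using Circle by simp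
  qed simp
  have fm: "(\<lambda>x. f (x + h)) \<in> borel_measurable lebesgue"
    by (rule measurable_compose[OF lebesgue_shift(2) L2_D(2)[OF f]])
  have sq: "sqint ?M (\<lambda>x. f (x + h))"
  proof -
    have p: "periodic_on X (\<lambda>x. (cmod (f x))\<^sup>2)" using L2_D(1)[OF f] by (cases X) auto
    have m: "(\<lambda>x. (cmod (f x))\<^sup>2) \<in> borel_measurable lebesgue" using L2_D(2)[OF f] by simp
    show ?thesis
      unfolding sqint_def using integral_base_shift_real(1)[OF p m sqint_integrable[OF L2_D(3)[OF f]], of h]
        measurable_base_of_lebesgue[OF fm] by simp
  qed
  have "Ft ?M ?N (\<lambda>x. f (x + h)) (\<lambda>\<xi>. cnj (wave h \<xi>) * F \<xi>)"
    unfolding Ft_def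
  proof (intro conjI allI impI sq)
    show "sqint ?N (\<lambda>\<xi>. cnj (wave h \<xi>) * F \<xi>)"
      by (rule sqint_bdd_mult(1)[OF FtD(2)[OF F] wm, where C = 1]) simp
    fix G assume G: "integrable ?N G" "sqint ?N G"
    have wG: "integrable ?N (\<lambda>\<xi>. cnj (wave h \<xi>) * G \<xi>)" "sqint ?N (\<lambda>\<xi>. cnj (wave h \<xi>) * G \<xi>)"
      using integrable_wave(2)[OF reg_freq_measure G(1), of h] sqint_bdd_mult(1)[OF G(2) wm, where C = 1]
      by (auto simp: wave_commute[of h])
    have tr: "ftr ?N (\<lambda>\<xi>. cnj (wave h \<xi>) * G \<xi>) y = ftr ?N G (y - h)" for y
      unfolding ftr_def by (intro Bochner_Integration.integral_cong refl)
        (simp add: wave_diff2 wave_commute[of h])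
    have km: "ftr ?N G \<in> borel_measurable lebesgue"
      using borel_measurable_ftr[OF reg_freq_measure reg_base_measure[of Line] borel_measurable_integrable[OF G(1)]] by simp
    define u where "u y = f y * ftr ?N G (y - h)" for y
    have um: "u \<in> borel_measurable lebesgue"
      unfolding u_def using measurable_compose[OF lebesgue_shift(2)[of "-h"] km] L2_D(2)[OF f]
      by (intro borel_measurable_times) auto
    have up: "periodic_on X u"
    proof (cases X)
      case Circle
      have "ftr ?N G (y + 2 * pi - h) = ftr ?N G (y - h)" for y
        using ftr_freq_periodic[OF Circle, of G "y - h"] Circle by (simp add: algebra_simps)
      then show ?thesis using L2_D(1)[OF f] Circle unfolding u_def by simp
    qed simp
    have ui: "integrable ?M u"
      using sqint_prod[OF L2_D(3)[OF f] sqint_ftr_dual[OF P wG]] unfolding u_def tr .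
    have "(\<integral>\<xi>. cnj (wave h \<xi>) * F \<xi> * G \<xi> \<partial>?N) = (\<integral>\<xi>. F \<xi> * (cnj (wave h \<xi>) * G \<xi>) \<partial>?N)"
      by (simp add: mult_ac)
    also have "\<dots> = (\<integral>y. u y \<partial>?M)" unfolding FtD(3)[OF F wG] tr u_def ..
    also have "\<dots> = (\<integral>y. u (y + h) \<partial>?M)" by (rule integral_base_shift(2)[OF up um ui, symmetric])
    finally show "(\<integral>\<xi>. cnj (wave h \<xi>) * F \<xi> * G \<xi> \<partial>?N) = (\<integral>x. f (x + h) * ftr ?N G x \<partial>?M)"
      by (simp add: u_def)
  qed
  then show ?thesis unfolding mulrel_def using F f per fm sq L2_iff by blast
qed

text \<open>Plancherel turns convergence of the images into convergence on the frequency side, where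
  the pointwise limit of the symbols identifies the limit. The limiting symbol may be unbounded, as
  it is for the derivative.\<close>

lemma mulrel_lim:
  assumes r: "\<And>n::nat. mulrel X (m n) f' (g n)" and f: "f' \<in> L2 X" and g: "g' \<in> L2 X"
    and lg: "(\<lambda>n. nsq (base_measure X) (\<lambda>x. g n x - g' x)) \<longlonglongrightarrow> 0"
    and m: "\<And>\<xi>. (\<lambda>n. m n \<xi>) \<longlonglongrightarrow> m' \<xi>"
    and mm: "\<And>n. m n \<in> borel_measurable borel" "m' \<in> borel_measurable borel"
  shows "mulrel X m' f' g'"
proof -
  note P = fourier_pair_base[of X]
  note F = Ft_fourier[OF f] and G = Ft_fourier[OF g]
  let ?k = "complex_of_real (fourier_const X)"
  have 1: "Ft (base_measure X) (freq_measure X) (g n) (\<lambda>\<xi>. m n \<xi> * (?k * fourier X f' \<xi>))" for n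
    by (rule mulrel_transform[OF r F mm(1)])
  have "(\<lambda>n. nsq (freq_measure X) (\<lambda>\<xi>. m n \<xi> * (?k * fourier X f' \<xi>) - ?k * fourier X g' \<xi>)) \<longlonglongrightarrow> 0"
    using tendsto_mult_left[OF lg, of "2 * pi"] Ft_plancherel[OF P Ft_diff[OF P 1 G]] by simp
  moreover have "AE \<xi> in freq_measure X. (\<lambda>n. m n \<xi> * (?k * fourier X f' \<xi>)) \<longlonglongrightarrow> m' \<xi> * (?k * fourier X f' \<xi>)"
    by (intro AE_I2 tendsto_mult m tendsto_const)
  ultimately have "AE \<xi> in freq_measure X. ?k * fourier X g' \<xi> = m' \<xi> * (?k * fourier X f' \<xi>)"
    by (rule nsq_limit_AE_unique[OF FtD(2)[OF 1] FtD(2)[OF G]])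
  moreover have "?k \<noteq> 0" by (cases X) auto
  ultimately have "AE \<xi> in freq_measure X. fourier X g' \<xi> = m' \<xi> * fourier X f' \<xi>"
    by (simp add: mult.left_commute[of _ ?k])
  then show ?thesis using mulrel_fourier_iff[OF f g mm(2)] by simp
qed

section \<open>The Hilbert transform as a Fourier multiplier\<close>

definition hilbert_symbol :: "real \<Rightarrow> complex" where
  "hilbert_symbol \<xi> = - \<i> * complex_of_real (sgn \<xi>)"

primrec hilbert_const :: "base \<Rightarrow> real" where
  "hilbert_const Line = 1" | "hilbert_const Circle = 2 * pi"

text \<open>Scaled to be the formal limit of \<open>conj_poisson\<close> as
  \<open>\<epsilon>\<close> tends to 0, namely \<open>2 / u\<close> and \<open>cot (u / 2)\<close>.
  The constants of the actual transform are restored in \<open>hilbert_eq\<close>.\<close>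

primrec hilbert_kernel :: "base \<Rightarrow> real \<Rightarrow> real \<Rightarrow> real" where
  "hilbert_kernel Line \<epsilon> u = (if \<epsilon> < \<bar>u\<bar> then 2 / u else 0)"
| "hilbert_kernel Circle \<epsilon> u = (if \<epsilon> < \<bar>u\<bar> \<and> \<bar>u\<bar> \<le> pi then cot (u / 2) else 0)"

primrec window :: "base \<Rightarrow> real set" where
  "window Line = UNIV" | "window Circle = {-pi..pi}"

lemma hilbert_symbol_measurable: "hilbert_symbol \<in> borel_measurable borel"
  unfolding hilbert_symbol_def[abs_def] sgn_if by measurable

lemma norm_hilbert_symbol: "cmod (hilbert_symbol \<xi>) \<le> 1"
  by (simp add: hilbert_symbol_def norm_mult sgn_if)

text \<open>The symbol is moved from the test function to \<open>f\<close>: the conjugate Poisson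
  integral of \<open>f\<close> is the Poisson integral of its Hilbert transform.\<close>

lemma conj_poisson_convolution:
  assumes r: "mulrel X hilbert_symbol f g" and e: "\<epsilon> > 0"
  shows "(\<integral>y. f y * complex_of_real (conj_poisson X \<epsilon> (x - y)) \<partial>base_measure X)
    = (\<integral>y. g y * complex_of_real (poisson X \<epsilon> (x - y)) \<partial>base_measure X)"
    and "integrable (base_measure X) (\<lambda>y. f y * complex_of_real (conj_poisson X \<epsilon> (x - y)))"
proof -
  let ?M = "base_measure X" and ?N = "freq_measure X"
  obtain F where F: "Ft ?M ?N f F" "Ft ?M ?N g (\<lambda>\<xi>. hilbert_symbol \<xi> * F \<xi>)"
    using r by (auto simp: mulrel_def)
  note q = ftr_conj_poisson_wave[OF e, of X x] and p = poisson_wave_integrable[OF e, of X x]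
  have "(\<integral>y. f y * complex_of_real (conj_poisson X \<epsilon> (x - y)) \<partial>?M)
     = (\<integral>\<xi>. F \<xi> * ((- \<i> * complex_of_real (sgn \<xi>)) * poisson_wave \<epsilon> x \<xi>) \<partial>?N)"
    using FtD(3)[OF F(1) q(2,3)] unfolding q(1) by simp
  also have "\<dots> = (\<integral>\<xi>. hilbert_symbol \<xi> * F \<xi> * poisson_wave \<epsilon> x \<xi> \<partial>?N)"
    unfolding hilbert_symbol_def by (intro Bochner_Integration.integral_cong refl) (simp add: mult_ac)
  also have "\<dots> = (\<integral>y. g y * complex_of_real (poisson X \<epsilon> (x - y)) \<partial>?M)"
    using FtD(3)[OF F(2) p] unfolding ftr_poisson_wave[OF e] .
  finally show "(\<integral>y. f y * complex_of_real (conj_poisson X \<epsilon> (x - y)) \<partial>?M)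
    = (\<integral>y. g y * complex_of_real (poisson X \<epsilon> (x - y)) \<partial>?M)" .
  show "integrable ?M (\<lambda>y. f y * complex_of_real (conj_poisson X \<epsilon> (x - y)))"
    using sqint_prod[OF FtD(1)[OF F(1)] sqint_ftr_dual[OF fourier_pair_base q(2,3)]] unfolding q(1) .
qed

lemma cot_half:
  assumes "cos u \<noteq> 1" shows "cot (u / 2) = sin u / (1 - cos u)"
proof -
  have s: "sin u = 2 * sin (u/2) * cos (u/2)" using sin_double[of "u/2"] by simp
  have c: "1 - cos u = 2 * sin (u/2) * sin (u/2)" using cos_double_sin[of "u/2"] by (simp add: power2_eq_square)
  have "sin (u/2) \<noteq> 0" using assms c by auto
  then show ?thesis unfolding s c cot_def by simp
qed

text \<open>Outside the truncation the two kernels differ by their common limit times a factor of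
  order \<open>\<epsilon>\<^sup>2 / (\<epsilon>\<^sup>2 + u\<^sup>2)\<close>, with
  \<open>(1 - r)\<^sup>2 / D\<close> in that role on the circle. Inside, the conjugate kernel alone
  is already dominated, because \<open>\<bar>u\<bar> \<le> \<epsilon>\<close>.\<close>

lemma hilbert_kernel_bound:
  obtains C where "C \<ge> 0" "\<And>\<epsilon> u. 0 < \<epsilon> \<Longrightarrow> \<epsilon> < 1 \<Longrightarrow> u \<in> window X \<Longrightarrow>
      \<bar>hilbert_kernel X \<epsilon> u - conj_poisson X \<epsilon> u\<bar> \<le> C * (\<epsilon> / (\<epsilon>\<^sup>2 + u\<^sup>2))"
    "\<And>\<epsilon> u. 0 < \<epsilon> \<Longrightarrow> \<bar>hilbert_kernel X \<epsilon> u\<bar> \<le> C / \<epsilon>"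
proof (cases X)
  case Line
  show ?thesis
  proof (rule that[of 2])
    fix \<epsilon> u :: real assume e: "0 < \<epsilon>"
    have d: "\<epsilon>\<^sup>2 + u\<^sup>2 > 0" using e by (intro add_pos_nonneg) auto
    show "\<bar>hilbert_kernel X \<epsilon> u\<bar> \<le> 2 / \<epsilon>" using e Line by (auto simp: frac_le)
    show "\<bar>hilbert_kernel X \<epsilon> u - conj_poisson X \<epsilon> u\<bar> \<le> 2 * (\<epsilon> / (\<epsilon>\<^sup>2 + u\<^sup>2))"
    proof (cases "\<epsilon> < \<bar>u\<bar>")
      case True
      have u0: "u \<noteq> 0" using True e by auto
      have "2 / u - 2 * (u / (\<epsilon>\<^sup>2 + u\<^sup>2)) = 2 * \<epsilon>\<^sup>2 / (u * (\<epsilon>\<^sup>2 + u\<^sup>2))"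
        using u0 d by (simp add: divide_simps) (simp add: algebra_simps power2_eq_square)
      then have "\<bar>2 / u - 2 * (u / (\<epsilon>\<^sup>2 + u\<^sup>2))\<bar> = 2 * \<epsilon>\<^sup>2 / (\<bar>u\<bar> * (\<epsilon>\<^sup>2 + u\<^sup>2))"
        using d by (simp add: abs_mult)
      also have "\<dots> \<le> 2 * \<epsilon>\<^sup>2 / (\<epsilon> * (\<epsilon>\<^sup>2 + u\<^sup>2))"
        using True e d by (intro divide_left_mono mult_right_mono mult_pos_pos) auto
      also have "\<dots> = 2 * (\<epsilon> / (\<epsilon>\<^sup>2 + u\<^sup>2))" using e by (simp add: power2_eq_square)
      finally show ?thesis using True Line by simp
    next
      case False
      have "\<bar>2 * (u / (\<epsilon>\<^sup>2 + u\<^sup>2))\<bar> = 2 * (\<bar>u\<bar> / (\<epsilon>\<^sup>2 + u\<^sup>2))" using d by (simp add: abs_mult)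
      also have "\<dots> \<le> 2 * (\<epsilon> / (\<epsilon>\<^sup>2 + u\<^sup>2))" using False d by (intro mult_left_mono divide_right_mono) auto
      finally show ?thesis using False Line by simp
    qed
  qed simp
next
  case Circle
  obtain c where c: "c > 0" "\<And>\<epsilon> u. 0 < \<epsilon> \<Longrightarrow> \<epsilon> < 1 \<Longrightarrow> \<bar>u\<bar> \<le> pi \<Longrightarrow>
     c * (\<epsilon>\<^sup>2 + u\<^sup>2) \<le> 1 - 2 * exp (-\<epsilon>) * cos u + (exp (-\<epsilon>))\<^sup>2"
    and cc: "\<And>u. \<bar>u\<bar> \<le> pi \<Longrightarrow> c * u\<^sup>2 \<le> 1 - cos u"
    using circle_denominator_bound[of pi] by (metis pi_gt_zero mult_2 less_add_same_cancel1)
  have quot: "\<bar>sin u\<bar> / (1 - cos u) \<le> 1 / (c * \<epsilon>)" "cos u \<noteq> 1" if e: "0 < \<epsilon>" "\<epsilon> < \<bar>u\<bar>" and u: "\<bar>u\<bar> \<le> pi" for \<epsilon> u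
  proof -
    have p: "0 < c * u\<^sup>2" using c(1) e by auto
    then show "cos u \<noteq> 1" using cc[OF u] by auto
    have "\<bar>sin u\<bar> / (1 - cos u) \<le> \<bar>u\<bar> / (c * u\<^sup>2)"
      using cc[OF u] p abs_sin_x_le_abs_x[of u] by (intro frac_le) auto
    also have "\<dots> = 1 / (c * \<bar>u\<bar>)"
    proof -
      have u2: "u\<^sup>2 = \<bar>u\<bar> * \<bar>u\<bar>" by (simp add: power2_eq_square)
      have "w / (c * (w * w)) = 1 / (c * w)" if "w > 0" for w :: real using that by simp
      then show ?thesis unfolding u2 by (rule) (use e in auto)
    qed
    also have "\<dots> \<le> 1 / (c * \<epsilon>)" using e c(1) by (intro divide_left_mono mult_left_mono) auto
    finally show "\<bar>sin u\<bar> / (1 - cos u) \<le> 1 / (c * \<epsilon>)" .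
  qed
  \<comment> \<open>In this order: the size of the truncated kernel, the difference outside the
    truncation, and the conjugate kernel inside it.\<close>
  define C where "C = max (1 / c) (max (1 / c\<^sup>2) (2 / c))"
  have C: "0 \<le> C" "1 / c \<le> C" "1 / c\<^sup>2 \<le> C" "2 / c \<le> C" using c(1) by (auto simp: C_def le_max_iff_disj)
  show ?thesis
  proof (rule that[OF C(1)])
    fix \<epsilon> u :: real assume e: "0 < \<epsilon>"
    show "\<bar>hilbert_kernel X \<epsilon> u\<bar> \<le> C / \<epsilon>"
    proof (cases "\<epsilon> < \<bar>u\<bar> \<and> \<bar>u\<bar> \<le> pi")
      case True
      then have q: "\<bar>sin u\<bar> / (1 - cos u) \<le> 1 / (c * \<epsilon>)" "cos u \<noteq> 1" using quot[OF e] by auto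
      have "\<bar>cot (u/2)\<bar> = \<bar>sin u\<bar> / (1 - cos u)" unfolding cot_half[OF q(2)] by simp
      also have "\<dots> \<le> (1 / c) / \<epsilon>" using q(1) by simp
      also have "\<dots> \<le> C / \<epsilon>" using C(2) e by (intro divide_right_mono) auto
      finally show ?thesis using True Circle by simp
    next
      case False
      then have "hilbert_kernel X \<epsilon> u = 0" using Circle by auto
      then show ?thesis using C(1) e by simp
    qed
  next
    fix \<epsilon> u :: real assume e: "0 < \<epsilon>" "\<epsilon> < 1" and uw: "u \<in> window X"
    have u: "\<bar>u\<bar> \<le> pi" using uw Circle by auto
    define r where "r = exp (-\<epsilon>)"
    define D where "D = 1 - 2 * r * cos u + r\<^sup>2"
    have r: "0 < r" "r < 1" "1 - \<epsilon> \<le> r" using e exp_ge_add_one_self[of "-\<epsilon>"] by (auto simp: r_def)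
    have Dc: "c * (\<epsilon>\<^sup>2 + u\<^sup>2) \<le> D" using c(2)[OF e u] unfolding D_def r_def .
    have p: "0 < c * (\<epsilon>\<^sup>2 + u\<^sup>2)" using c(1) e by (intro mult_pos_pos add_pos_nonneg) auto
    then have D0: "D > 0" using Dc by linarith
    have q: "conj_poisson X \<epsilon> u = 2 * r * sin u / D" using Circle by (simp add: r_def D_def)
    show "\<bar>hilbert_kernel X \<epsilon> u - conj_poisson X \<epsilon> u\<bar> \<le> C * (\<epsilon> / (\<epsilon>\<^sup>2 + u\<^sup>2))"
    proof (cases "\<epsilon> < \<bar>u\<bar>")
      case True
      note qq = quot[OF e(1) True u]
      have n0: "1 - cos u > 0" using qq(2) cos_le_one[of u] by linarith
      have "cot (u/2) - 2 * r * sin u / D = (sin u / (1 - cos u)) * ((1 - r)\<^sup>2 / D)"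
      proof -
        have DD: "D = (1 - r)\<^sup>2 + 2 * r * (1 - cos u)" by (simp add: D_def power2_diff algebra_simps)
        have "a / b - 2 * r * a / D = (a / b) * ((1 - r)\<^sup>2 / D)" if "b > 0" "D = (1 - r)\<^sup>2 + 2 * r * b" for a b
        proof -
          have "a / b - 2 * r * a / D = (a / b) * ((D - 2 * r * b) / D)" using that(1) D0 by (simp add: divide_simps) (simp add: algebra_simps)
          then show ?thesis using that(2) by simp
        qed
        from this[OF n0 DD] show ?thesis unfolding cot_half[OF qq(2)] .
      qed
      then have "\<bar>cot (u/2) - 2 * r * sin u / D\<bar> = (\<bar>sin u\<bar> / (1 - cos u)) * ((1 - r)\<^sup>2 / D)"
        using n0 D0 by (simp add: abs_mult)
      also have "\<dots> \<le> (1 / (c * \<epsilon>)) * (\<epsilon>\<^sup>2 / (c * (\<epsilon>\<^sup>2 + u\<^sup>2)))"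
        using r e D0 Dc p n0 c(1) by (intro mult_mono qq(1) frac_le power_mono) auto
      also have "\<dots> = 1 / c\<^sup>2 * (\<epsilon> / (\<epsilon>\<^sup>2 + u\<^sup>2))" using e c(1) by (simp add: power2_eq_square)
      also have "\<dots> \<le> C * (\<epsilon> / (\<epsilon>\<^sup>2 + u\<^sup>2))" using C(3) e by (intro mult_right_mono) auto
      finally show ?thesis using True u Circle q by simp
    next
      case False
      have "\<bar>2 * r * sin u / D\<bar> = 2 * (r * \<bar>sin u\<bar>) / D" using r D0 by (simp add: abs_mult)
      also have "\<dots> \<le> 2 * \<epsilon> / (c * (\<epsilon>\<^sup>2 + u\<^sup>2))"
      proof (intro frac_le mult_left_mono)
        have "r * \<bar>sin u\<bar> \<le> 1 * \<bar>u\<bar>" using r abs_sin_x_le_abs_x[of u] by (intro mult_mono) auto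
        then show "r * \<bar>sin u\<bar> \<le> \<epsilon>" using False by simp
      qed (use e Dc p in auto)
      also have "\<dots> = 2 / c * (\<epsilon> / (\<epsilon>\<^sup>2 + u\<^sup>2))" by simp
      also have "\<dots> \<le> C * (\<epsilon> / (\<epsilon>\<^sup>2 + u\<^sup>2))" using C(4) e by (intro mult_right_mono) auto
      finally show ?thesis using False Circle q by simp
    qed
  qed
qed

section \<open>The principal value integral compared with the conjugate Poisson integral\<close>

lemma hilbert_kernel_measurable: "(\<lambda>u. hilbert_kernel X \<epsilon> u) \<in> borel_measurable borel"
  by (cases X; simp only: hilbert_kernel.simps cot_def; measurable)

lemma hilbert_kernel_odd: "hilbert_kernel X \<epsilon> (- u) = - hilbert_kernel X \<epsilon> u"
  and conj_poisson_odd: "conj_poisson X \<epsilon> (- u) = - conj_poisson X \<epsilon> u"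
  by (cases X; auto)+

lemma window_symmetric: "- u \<in> window X \<longleftrightarrow> u \<in> window X"
  by (cases X) auto

lemma borel_measurable_lebesgue_diff:
  assumes "k \<in> borel_measurable borel" shows "(\<lambda>y::real. k (x - y)) \<in> borel_measurable lebesgue"
  by (rule measurable_compose[OF borel_measurable_diff[OF borel_measurable_const ident_borel_measurable_lebesgue] assms])

lemma odd_integral_zero:
  fixes k :: "real \<Rightarrow> real"
  assumes m: "k \<in> borel_measurable lebesgue" and odd: "\<And>y. k (2 * x - y) = - k y"
  shows "(\<integral>y. k y \<partial>lebesgue) = 0"
proof -
  have c: "2 * x \<in> space (freq_measure Line)" by simp
  have m': "k \<in> borel_measurable (freq_measure Line)" using m by simp
  have "(\<integral>y. k y \<partial>lebesgue) = (\<integral>y. k (2 * x - y) \<partial>lebesgue)"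
    using integral_distr[OF freq_measure_reflect(2)[OF c] m'] unfolding freq_measure_reflect(1)[OF c] by simp
  then show ?thesis unfolding odd by simp
qed

text \<open>Replaces the fixed period by the one centred at \<open>x\<close>. The truncated kernel
  lives on that window and is odd about its centre.\<close>

lemma window_integral:
  fixes v :: "real \<Rightarrow> complex"
  assumes p: "periodic_on X v" and m: "v \<in> borel_measurable lebesgue" and i: "integrable (base_measure X) v"
  shows "integrable lebesgue (\<lambda>y. indicator (window X) (x - y) *\<^sub>R v y)"
    and "(\<integral>y. indicator (window X) (x - y) *\<^sub>R v y \<partial>lebesgue) = (\<integral>y. v y \<partial>base_measure X)"
proof -
  let ?w = "\<lambda>y. indicator (window X) (x - y) *\<^sub>R v y"
  have ws: "window X \<in> sets borel" by (cases X) auto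
  have wm: "?w \<in> borel_measurable lebesgue"
    using borel_measurable_lebesgue_diff[OF borel_measurable_indicator[OF ws], of x] m
    by (rule borel_measurable_scaleR)
  have e: "integrable lebesgue ?w \<longleftrightarrow> integrable lebesgue (\<lambda>y. ?w (y + x))"
      "(\<integral>y. ?w y \<partial>lebesgue) = (\<integral>y. ?w (y + x) \<partial>lebesgue)"
    using integrable_distr_eq[OF lebesgue_shift(2)[of x] wm] integral_distr[OF lebesgue_shift(2)[of x] wm]
    unfolding lebesgue_shift(1) by auto
  have sh: "?w (y + x) = indicator (window X) y *\<^sub>R v (y + x)" for y
    using window_symmetric[of y X] by (auto simp: indicator_def)
  have b: "integrable (base_measure X) (\<lambda>y. v (y + x)) \<longleftrightarrow> integrable lebesgue (\<lambda>y. indicator (window X) y *\<^sub>R v (y + x))"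
    "(\<integral>y. v (y + x) \<partial>base_measure X) = (\<integral>y. indicator (window X) y *\<^sub>R v (y + x) \<partial>lebesgue)"
    by (cases X; simp add: integrable_restrict_space integral_restrict_space)+
  show "integrable lebesgue ?w" "(\<integral>y. ?w y \<partial>lebesgue) = (\<integral>y. v y \<partial>base_measure X)"
    using integral_base_shift[OF p m i, of x] unfolding e sh b by auto
qed

lemma sqint_lebesgue_shift:
  fixes f :: "real \<Rightarrow> complex"
  assumes "sqint lebesgue f" shows "sqint lebesgue (\<lambda>x. f (x + c))"
proof -
  have m: "f \<in> borel_measurable lebesgue" using assms by (simp add: sqint_def)
  have m2: "(\<lambda>x. (cmod (f x))\<^sup>2) \<in> borel_measurable lebesgue" using m by simp
  show ?thesis unfolding sqint_def
    using measurable_compose[OF lebesgue_shift(2) m] assms integrable_distr_eq[OF lebesgue_shift(2)[of c] m2]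
    unfolding lebesgue_shift(1) sqint_def by auto
qed

text \<open>For \<open>x\<close> in the period and \<open>x - y\<close> in the window,
  \<open>y\<close> stays within \<open>{-2*pi..2*pi}\<close>. The limit theorem for kernels asks for
  square integrability on the whole line, so the periodic function is replaced by one that agrees
  with it there.\<close>

lemma L2_local:
  assumes f: "f \<in> L2 X"
  obtains g where "sqint lebesgue g" "\<And>x. x \<in> {-2*pi..2*pi} \<or> X = Line \<Longrightarrow> g x = f x"
proof (cases X)
  case Line
  then show ?thesis using L2_D(3)[OF f] by (intro that[of f]) auto
next
  case Circle
  define g0 where "g0 x = indicator {-pi..pi} x * f x" for x
  have g0: "sqint lebesgue g0" unfolding g0_def using L2_D(3)[OF f] Circle by (intro sqint_indicator_extension) simp
  have nrm: "sqint lebesgue (\<lambda>x. complex_of_real (cmod (g0 (x + c))))" for c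
  proof -
    have s: "sqint lebesgue (\<lambda>x. g0 (x + c))" by (rule sqint_lebesgue_shift[OF g0])
    then have "(\<lambda>x. complex_of_real (cmod (g0 (x + c)))) \<in> borel_measurable lebesgue"
      using measurable_compose[OF measurable_compose[OF sqint_measurable[OF s] borel_measurable_norm] borel_measurable_of_real] by simp
    from sqint_dominated(1)[OF s this, where C = 1] show ?thesis by simp
  qed
  \<comment> \<open>Three translates of one period cover the cut-off interval; taking absolute
    values makes their sum a dominating function.\<close>
  define w where "w x = complex_of_real (cmod (g0 (x + 0))) + complex_of_real (cmod (g0 (x + 2 * pi))) + complex_of_real (cmod (g0 (x + (- 2 * pi))))" for x
  have w: "sqint lebesgue w" unfolding w_def by (intro sqint_add nrm)
  have wv: "cmod (w x) = cmod (g0 x) + cmod (g0 (x + 2 * pi)) + cmod (g0 (x + (- 2 * pi)))" for x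
    unfolding w_def of_real_add[symmetric] norm_of_real by simp
  have fp: "f (x + 2 * pi) = f x" "f (x + (- 2 * pi)) = f x" for x
  proof -
    show 1: "f (x + 2 * pi) = f x" for x using L2_D(1)[OF f] Circle by simp
    show "f (x + (- 2 * pi)) = f x" using 1[of "x + (- 2 * pi)"] by simp
  qed
  define g where "g x = indicator {-2*pi..2*pi} x * f x" for x
  have gm: "g \<in> borel_measurable lebesgue"
    unfolding g_def using L2_D(2)[OF f] by (intro borel_measurable_times borel_measurable_indicator) simp_all
  have "cmod (g x) \<le> 1 * cmod (w x)" for x
  proof (cases "x \<in> {-2*pi..2*pi}")
    case True
    then consider "x \<in> {-pi..pi}" | "x + 2 * pi \<in> {-pi..pi}" | "x + (- 2 * pi) \<in> {-pi..pi}" by fastforce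
    then show ?thesis
    proof cases
      case 1 then show ?thesis unfolding wv using True by (simp add: g_def g0_def)
    next
      case 2
      then have "cmod (g0 (x + 2 * pi)) = cmod (f x)" using fp by (simp add: g0_def)
      then show ?thesis unfolding wv using True by (simp add: g_def)
    next
      case 3
      then have "cmod (g0 (x + (- 2 * pi))) = cmod (f x)" using fp(2)[of x] unfolding g0_def by simp
      then show ?thesis unfolding wv using True by (simp add: g_def)
    qed
  qed (simp add: g_def)
  then have "sqint lebesgue g" by (intro sqint_dominated(1)[OF w gm, where C = 1]) auto
  then show ?thesis by (rule that) (use Circle in \<open>auto simp: g_def\<close>)
qed

lemma sqint_cauchy_kernel:
  assumes e: "\<epsilon> > 0"
  shows "sqint lebesgue (\<lambda>y. complex_of_real (\<epsilon> / (\<epsilon>\<^sup>2 + (x - y)\<^sup>2)))"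
  unfolding sqint_def
proof
  note i = cauchy_kernel_integral(1)[OF e, of x]
  show m: "(\<lambda>y. complex_of_real (\<epsilon> / (\<epsilon>\<^sup>2 + (x - y)\<^sup>2))) \<in> borel_measurable lebesgue"
    using measurable_compose[OF borel_measurable_integrable[OF i] borel_measurable_of_real] .
  show "integrable lebesgue (\<lambda>y. (cmod (complex_of_real (\<epsilon> / (\<epsilon>\<^sup>2 + (x - y)\<^sup>2))))\<^sup>2)"
  proof (rule Bochner_Integration.integrable_bound[OF integrable_mult_right[OF i, of "1 / \<epsilon>"]])
    show "(\<lambda>y. (cmod (complex_of_real (\<epsilon> / (\<epsilon>\<^sup>2 + (x - y)\<^sup>2))))\<^sup>2) \<in> borel_measurable lebesgue"
      using m by simp
    show "AE y in lebesgue. norm ((cmod (complex_of_real (\<epsilon> / (\<epsilon>\<^sup>2 + (x - y)\<^sup>2))))\<^sup>2) \<le> norm (1 / \<epsilon> * (\<epsilon> / (\<epsilon>\<^sup>2 + (x - y)\<^sup>2)))"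
    proof (rule AE_I2)
      fix y
      define k where "k = \<epsilon> / (\<epsilon>\<^sup>2 + (x - y)\<^sup>2)"
      have d: "\<epsilon>\<^sup>2 + (x - y)\<^sup>2 > 0" using e by (intro add_pos_nonneg) auto
      have k0: "k \<ge> 0" using e by (simp add: k_def)
      have "k \<le> \<epsilon> / \<epsilon>\<^sup>2" unfolding k_def using e d by (intro divide_left_mono mult_pos_pos) auto
      then have "k * k \<le> (1 / \<epsilon>) * k" using e k0 by (intro mult_right_mono) (auto simp: power2_eq_square)
      then show "norm ((cmod (complex_of_real (\<epsilon> / (\<epsilon>\<^sup>2 + (x - y)\<^sup>2))))\<^sup>2) \<le> norm (1 / \<epsilon> * (\<epsilon> / (\<epsilon>\<^sup>2 + (x - y)\<^sup>2)))"
        unfolding k_def[symmetric] norm_of_real using k0 e by (simp add: power2_eq_square)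
    qed
  qed
qed

lemma conj_poisson_periodic: "conj_poisson Circle \<epsilon> (u - 2 * pi) = conj_poisson Circle \<epsilon> u"
  by (simp add: sin_diff cos_diff)

text \<open>On the line the truncated kernel decays only like \<open>1 / u\<close>. It is split into
  the conjugate Poisson kernel, which is integrable against \<open>f\<close> by the multiplication
  formula, and a remainder dominated by the Poisson kernel, hence square integrable. On the circle
  the kernel is bounded and supported in one window.\<close>

lemma hilbert_kernel_integrable:
  fixes f :: "real \<Rightarrow> complex"
  assumes f: "f \<in> L2 X" and e: "0 < \<epsilon>" "\<epsilon> < 1"
  shows "integrable lebesgue (\<lambda>y. hilbert_kernel X \<epsilon> (x - y) *\<^sub>R f y)"
    and "(\<integral>y. indicator (window X) (x - y) *\<^sub>R (hilbert_kernel X \<epsilon> (x - y) - conj_poisson X \<epsilon> (x - y)) *\<^sub>R f y \<partial>lebesgue)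
      = (\<integral>y. hilbert_kernel X \<epsilon> (x - y) *\<^sub>R f y \<partial>lebesgue) - (\<integral>y. f y * complex_of_real (conj_poisson X \<epsilon> (x - y)) \<partial>base_measure X)"
proof -
  obtain h where "mulrel X hilbert_symbol f h"
    using mulrel_exists_bdd[OF f hilbert_symbol_measurable norm_hilbert_symbol] .
  note qi = conj_poisson_convolution(2)[OF this e(1), of x]
  define v where "v y = f y * complex_of_real (conj_poisson X \<epsilon> (x - y))" for y
  have vp: "periodic_on X v"
  proof (cases X)
    case Circle
    have "conj_poisson Circle \<epsilon> (x - (y + 2 * pi)) = conj_poisson Circle \<epsilon> (x - y)" for y
      using conj_poisson_periodic[of \<epsilon> "x - y"] by (simp only: diff_diff_eq)
    then show ?thesis using L2_D(1)[OF f] Circle by (simp add: v_def del: conj_poisson.simps)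
  qed simp
  have vm: "v \<in> borel_measurable lebesgue"
    unfolding v_def by (intro borel_measurable_times L2_D(2)[OF f] measurable_compose[OF _ borel_measurable_of_real] borel_measurable_lebesgue_diff conj_poisson_measurable)
  have vi: "integrable (base_measure X) v" using qi unfolding v_def .
  note W = window_integral[OF vp vm vi, of x]
  have km: "(\<lambda>y. hilbert_kernel X \<epsilon> (x - y) *\<^sub>R f y) \<in> borel_measurable lebesgue"
    by (intro borel_measurable_scaleR L2_D(2)[OF f] borel_measurable_lebesgue_diff hilbert_kernel_measurable)
  show K: "integrable lebesgue (\<lambda>y. hilbert_kernel X \<epsilon> (x - y) *\<^sub>R f y)"
  proof (cases X)
    case Line
    obtain C where C: "C \<ge> 0" "\<And>\<epsilon> u. 0 < \<epsilon> \<Longrightarrow> \<epsilon> < 1 \<Longrightarrow> u \<in> window X \<Longrightarrow>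
      \<bar>hilbert_kernel X \<epsilon> u - conj_poisson X \<epsilon> u\<bar> \<le> C * (\<epsilon> / (\<epsilon>\<^sup>2 + u\<^sup>2))"
      using hilbert_kernel_bound[of X] by metis
    have fs: "sqint lebesgue f" using L2_D(3)[OF f] Line by simp
    define d where "d y = hilbert_kernel X \<epsilon> (x - y) - conj_poisson X \<epsilon> (x - y)" for y
    have dm: "d \<in> borel_measurable lebesgue"
      unfolding d_def by (intro borel_measurable_diff borel_measurable_lebesgue_diff hilbert_kernel_measurable conj_poisson_measurable)
    have "cmod (complex_of_real (d y)) \<le> C * cmod (complex_of_real (\<epsilon> / (\<epsilon>\<^sup>2 + (x - y)\<^sup>2)))" for y
    proof -
      have "\<bar>d y\<bar> \<le> C * (\<epsilon> / (\<epsilon>\<^sup>2 + (x - y)\<^sup>2))" unfolding d_def using Line by (intro C(2)[OF e]) simp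
      moreover have "\<epsilon> / (\<epsilon>\<^sup>2 + (x - y)\<^sup>2) \<ge> 0" using e by simp
      ultimately show ?thesis using e unfolding norm_of_real by simp
    qed
    then have "sqint lebesgue (\<lambda>y. complex_of_real (d y))"
      by (intro sqint_dominated(1)[OF sqint_cauchy_kernel[OF e(1), of x] measurable_compose[OF dm borel_measurable_of_real], where C = C] AE_I2)
    from sqint_prod[OF this fs] have 1: "integrable lebesgue (\<lambda>y. complex_of_real (d y) * f y)" .
    have "integrable lebesgue (\<lambda>y. complex_of_real (d y) * f y + v y)"
      using 1 vi Line by (intro Bochner_Integration.integrable_add) auto
    also have "(\<lambda>y. complex_of_real (d y) * f y + v y) = (\<lambda>y. hilbert_kernel X \<epsilon> (x - y) *\<^sub>R f y)"
      by (auto simp: d_def v_def scaleR_conv_of_real algebra_simps)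
    finally show ?thesis .
  next
    case Circle
    obtain C where C: "\<And>\<epsilon> u. 0 < \<epsilon> \<Longrightarrow> \<bar>hilbert_kernel X \<epsilon> u\<bar> \<le> C / \<epsilon>"
      using hilbert_kernel_bound[of X] by metis
    have fi: "integrable (base_measure X) f" using integrable_circle L2_D(3)[OF f] Circle by simp
    note w = window_integral(1)[OF L2_D(1,2)[OF f] fi, of x]
    show ?thesis
    proof (rule Bochner_Integration.integrable_bound[OF integrable_scaleR_right[OF w, of "C / \<epsilon>"] km])
      show "AE y in lebesgue. norm (hilbert_kernel X \<epsilon> (x - y) *\<^sub>R f y) \<le> norm ((C / \<epsilon>) *\<^sub>R (indicator (window X) (x - y) *\<^sub>R f y))"
      proof (rule AE_I2)
        fix y
        show "norm (hilbert_kernel X \<epsilon> (x - y) *\<^sub>R f y) \<le> norm ((C / \<epsilon>) *\<^sub>R (indicator (window X) (x - y) *\<^sub>R f y))"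
        proof (cases "x - y \<in> window X")
          case True
          have "\<bar>hilbert_kernel X \<epsilon> (x - y)\<bar> \<le> \<bar>C / \<epsilon>\<bar>" using C[OF e(1), of "x - y"] by linarith
          from mult_right_mono[OF this, of "cmod (f y)"] show ?thesis using True by (simp del: hilbert_kernel.simps)
        next
          case False
          then have "hilbert_kernel X \<epsilon> (x - y) = 0" using Circle by (auto simp: abs_le_iff)
          then show ?thesis by simp
        qed
      qed
    qed
  qed
  have "indicator (window X) (x - y) *\<^sub>R (hilbert_kernel X \<epsilon> (x - y) - conj_poisson X \<epsilon> (x - y)) *\<^sub>R f y
      = hilbert_kernel X \<epsilon> (x - y) *\<^sub>R f y - indicator (window X) (x - y) *\<^sub>R v y" for y
  proof (cases "x - y \<in> window X")
    case True
    then show ?thesis by (simp add: v_def scaleR_conv_of_real algebra_simps del: hilbert_kernel.simps conj_poisson.simps)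
  next
    case False
    then have "hilbert_kernel X \<epsilon> (x - y) = 0" by (cases X) (auto simp: abs_le_iff)
    then show ?thesis using False by simp
  qed
  then show "(\<integral>y. indicator (window X) (x - y) *\<^sub>R (hilbert_kernel X \<epsilon> (x - y) - conj_poisson X \<epsilon> (x - y)) *\<^sub>R f y \<partial>lebesgue)
      = (\<integral>y. hilbert_kernel X \<epsilon> (x - y) *\<^sub>R f y \<partial>lebesgue) - (\<integral>y. f y * complex_of_real (conj_poisson X \<epsilon> (x - y)) \<partial>base_measure X)"
    using Bochner_Integration.integral_diff[OF K W(1)] W(2) unfolding v_def by simp
qed

text \<open>The truncated integral is the integral against the kernel difference plus the conjugate
  Poisson integral. The first tends to 0 at Lebesgue points, its kernel being odd about
  \<open>x\<close> and hence of mass 0; the second is the Poisson integral of \<open>g\<close> and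
  tends to \<open>2 * pi * g x\<close>.\<close>

lemma hilbert_kernel_limit:
  fixes f g :: "real \<Rightarrow> complex"
  assumes r: "mulrel X hilbert_symbol f g"
  shows "AE x in base_measure X. ((\<lambda>\<epsilon>. \<integral>y. hilbert_kernel X \<epsilon> (x - y) *\<^sub>R f y \<partial>lebesgue) \<longlongrightarrow> 2 * pi * g x) (at_right 0)"
proof -
  have f: "f \<in> L2 X" and g: "g \<in> L2 X" using mulrelD[OF r] by auto
  obtain f' where f': "sqint lebesgue f'" "\<And>x. x \<in> {-2*pi..2*pi} \<or> X = Line \<Longrightarrow> f' x = f x"
    using L2_local[OF f] by metis
  obtain C where C: "\<And>\<epsilon> u. 0 < \<epsilon> \<Longrightarrow> \<epsilon> < 1 \<Longrightarrow> u \<in> window X \<Longrightarrow>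
      \<bar>hilbert_kernel X \<epsilon> u - conj_poisson X \<epsilon> u\<bar> \<le> C * (\<epsilon> / (\<epsilon>\<^sup>2 + u\<^sup>2))" and C0: "C \<ge> 0"
    using hilbert_kernel_bound[of X] by metis
  have "AE x in base_measure X. x \<in> window X"
  proof (cases X)
    case Circle
    show ?thesis unfolding Circle base_measure.simps window.simps
      using AE_space[of "lebesgue_on {-pi..pi}"] by simp
  qed simp
  with AE_base_of_lebesgue[OF AE_leb_point[OF f'(1)], of X] poisson_limit[OF L2_D(3)[OF g]]
  show ?thesis
  proof eventually_elim
    case (elim x)
    define K where "K \<epsilon> y = indicator (window X) (x - y) * (hilbert_kernel X \<epsilon> (x - y) - conj_poisson X \<epsilon> (x - y))" for \<epsilon> y
    have ws: "window X \<in> sets borel" by (cases X) auto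
    have Km: "K \<epsilon> \<in> borel_measurable lebesgue" for \<epsilon>
      unfolding K_def
      by (intro borel_measurable_times borel_measurable_diff borel_measurable_lebesgue_diff[OF borel_measurable_indicator[OF ws]]
         borel_measurable_lebesgue_diff[OF hilbert_kernel_measurable] borel_measurable_lebesgue_diff[OF conj_poisson_measurable])
    have lim: "((\<lambda>\<epsilon>. \<integral>y. complex_of_real (K \<epsilon> y) * f' y \<partial>lebesgue) \<longlongrightarrow> complex_of_real 0 * f' x) (at_right 0)"
    proof (rule kernel_limit[OF f'(1) elim(1) Km, where C = C])
      show "\<bar>K \<epsilon> y\<bar> \<le> C * (\<epsilon> / (\<epsilon>\<^sup>2 + (x - y)\<^sup>2))" if "0 < \<epsilon>" "\<epsilon> < 1" for \<epsilon> y
        using C[OF that, of "x - y"] C0 that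
        by (cases "x - y \<in> window X") (auto simp: K_def simp del: hilbert_kernel.simps conj_poisson.simps)
      show "(\<integral>y. K \<epsilon> y \<partial>lebesgue) = 0" for \<epsilon>
      proof -
        have "K \<epsilon> (2 * x - y) = - K \<epsilon> y" for y
        proof -
          have "x - (2 * x - y) = - (x - y)" by simp
          moreover have "indicator (window X) (- (x - y)) = (indicator (window X) (x - y) :: real)"
            using window_symmetric[of "x - y" X] unfolding indicator_def by simp
          ultimately show ?thesis
            unfolding K_def by (simp only: hilbert_kernel_odd conj_poisson_odd) (simp only: algebra_simps)
        qed
        from odd_integral_zero[OF Km this] show ?thesis .
      qed
    qed
    have ff: "complex_of_real (K \<epsilon> y) * f' y = indicator (window X) (x - y) *\<^sub>R (hilbert_kernel X \<epsilon> (x - y) - conj_poisson X \<epsilon> (x - y)) *\<^sub>R f y" for \<epsilon> y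
    proof (cases "x - y \<in> window X")
      case True
      then have "f' y = f y" using elim(3) by (intro f'(2), cases X) auto
      then show ?thesis using True by (simp add: K_def scaleR_conv_of_real del: hilbert_kernel.simps conj_poisson.simps)
    qed (simp add: K_def)
    have "\<forall>\<^sub>F \<epsilon> in at_right 0. 0 < \<epsilon> \<and> \<epsilon> < (1::real)" by (rule eventually_at_rightI[of 0 1]) auto
    then have ev: "\<forall>\<^sub>F \<epsilon> in at_right 0. (\<integral>y. complex_of_real (K \<epsilon> y) * f' y \<partial>lebesgue) + (\<integral>y. g y * complex_of_real (poisson X \<epsilon> (x - y)) \<partial>base_measure X)
       = (\<integral>y. hilbert_kernel X \<epsilon> (x - y) *\<^sub>R f y \<partial>lebesgue)"
    proof eventually_elim
      case (elim \<epsilon>)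
      then show ?case unfolding ff using hilbert_kernel_integrable(2)[OF f, of \<epsilon> x] conj_poisson_convolution(1)[OF r, of \<epsilon> x] by simp
    qed
    have "((\<lambda>\<epsilon>. (\<integral>y. complex_of_real (K \<epsilon> y) * f' y \<partial>lebesgue) + (\<integral>y. g y * complex_of_real (poisson X \<epsilon> (x - y)) \<partial>base_measure X))
       \<longlongrightarrow> complex_of_real 0 * f' x + 2 * pi * g x) (at_right 0)"
      by (rule tendsto_add[OF lim elim(2)])
    then show ?case using tendsto_cong[OF ev] by simp
  qed
qed

lemma hilbert_eq:
  fixes f :: "real \<Rightarrow> 'a::{banach,second_countable_topology}"
  shows "hilbert X f x = Lim (at_right 0) (\<lambda>\<epsilon>. (hilbert_const X / (2 * pi)) *\<^sub>R (\<integral>y. hilbert_kernel X \<epsilon> (x - y) *\<^sub>R f y \<partial>lebesgue))"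
proof (cases X)
  case Line
  have "indicator {y. \<epsilon> < \<bar>x - y\<bar>} y *\<^sub>R (1 / (x - y)) *\<^sub>R f y = (1/2) *\<^sub>R (hilbert_kernel Line \<epsilon> (x - y) *\<^sub>R f y)" for \<epsilon> y
    by (auto simp: indicator_def)
  then have "(LINT y:{y. \<epsilon> < \<bar>x - y\<bar>}|lebesgue. (1 / (x - y)) *\<^sub>R f y) = (1/2) *\<^sub>R (\<integral>y. hilbert_kernel Line \<epsilon> (x - y) *\<^sub>R f y \<partial>lebesgue)" for \<epsilon>
    unfolding set_lebesgue_integral_def by (simp only: integral_scaleR_right)
  then show ?thesis using Line by (simp add: mult.commute del: hilbert_kernel.simps)
next
  case Circle
  have "indicator {y. \<epsilon> < \<bar>x - y\<bar> \<and> \<bar>x - y\<bar> \<le> pi} y *\<^sub>R cot ((x - y) / 2) *\<^sub>R f y = hilbert_kernel Circle \<epsilon> (x - y) *\<^sub>R f y" for \<epsilon> y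
    by (auto simp: indicator_def)
  then have "(LINT y:{y. \<epsilon> < \<bar>x - y\<bar> \<and> \<bar>x - y\<bar> \<le> pi}|lebesgue. cot ((x - y) / 2) *\<^sub>R f y) = (\<integral>y. hilbert_kernel Circle \<epsilon> (x - y) *\<^sub>R f y \<partial>lebesgue)" for \<epsilon>
    unfolding set_lebesgue_integral_def by (simp only:)
  then show ?thesis using Circle by (simp del: hilbert_kernel.simps)
qed

lemma hilbert_periodic:
  fixes f :: "real \<Rightarrow> 'a::{banach,second_countable_topology}"
  assumes p: "periodic_on X f" and m: "f \<in> borel_measurable lebesgue"
  shows "periodic_on X (hilbert X f)"
proof (cases X)
  case Circle
  have "(\<integral>y. hilbert_kernel X \<epsilon> (x + 2 * pi - y) *\<^sub>R f y \<partial>lebesgue) = (\<integral>y. hilbert_kernel X \<epsilon> (x - y) *\<^sub>R f y \<partial>lebesgue)" for x \<epsilon>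
  proof -
    have km: "(\<lambda>y. hilbert_kernel X \<epsilon> (x + 2 * pi - y) *\<^sub>R f y) \<in> borel_measurable lebesgue"
      by (intro borel_measurable_scaleR m borel_measurable_lebesgue_diff hilbert_kernel_measurable)
    have "(\<integral>y. hilbert_kernel X \<epsilon> (x + 2 * pi - y) *\<^sub>R f y \<partial>lebesgue)
       = (\<integral>y. hilbert_kernel X \<epsilon> (x + 2 * pi - (y + 2 * pi)) *\<^sub>R f (y + 2 * pi) \<partial>lebesgue)"
      using integral_distr[OF lebesgue_shift(2)[of "2 * pi"] km] unfolding lebesgue_shift(1) .
    then show ?thesis using p Circle by (simp del: hilbert_kernel.simps)
  qed
  then show ?thesis unfolding Circle periodic_on.simps hilbert_eq by simp
qed simp

lemma hilbert_mulrel_AE: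
  assumes r: "mulrel X hilbert_symbol f g"
  shows "AE x in lebesgue. hilbert X f x = complex_of_real (hilbert_const X) * g x"
proof (rule AE_base_periodic)
  note f = L2_D[OF mulrelD(1)[OF r]] and g = L2_D[OF mulrelD(2)[OF r]]
  show "periodic_on X (\<lambda>x. hilbert X f x = complex_of_real (hilbert_const X) * g x)"
    using hilbert_periodic[OF f(1,2)] g(1) by (cases X) (auto simp del: hilbert.simps)
  show "AE x in base_measure X. hilbert X f x = complex_of_real (hilbert_const X) * g x"
    using hilbert_kernel_limit[OF r]
  proof eventually_elim
    case (elim x)
    have "((\<lambda>\<epsilon>. (hilbert_const X / (2 * pi)) *\<^sub>R (\<integral>y. hilbert_kernel X \<epsilon> (x - y) *\<^sub>R f y \<partial>lebesgue))
       \<longlongrightarrow> (hilbert_const X / (2 * pi)) *\<^sub>R (2 * pi * g x)) (at_right 0)"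
      by (intro tendsto_scaleR tendsto_const elim)
    then have "hilbert X f x = (hilbert_const X / (2 * pi)) *\<^sub>R (2 * pi * g x)"
      unfolding hilbert_eq by (rule tendsto_Lim[rotated]) simp
    then show ?case by (simp add: scaleR_conv_of_real)
  qed
qed

text \<open>The kernel is real, so the approximations to \<open>g\<close> are real.
  \<open>abs_grad_map\<close> keeps a real part, and this shows that nothing is lost by it.\<close>

lemma hilbert_mulrel_real:
  assumes r: "mulrel X hilbert_symbol f g" and re: "\<And>x. Im (f x) = 0"
  shows "AE x in base_measure X. Im (g x) = 0"
  using hilbert_kernel_limit[OF r]
proof eventually_elim
  case (elim x)
  have f: "f = (\<lambda>y. complex_of_real (Re (f y)))" using re by (simp add: fun_eq_iff complex_eq_iff)
  have "Im (\<integral>y. hilbert_kernel X \<epsilon> (x - y) *\<^sub>R f y \<partial>lebesgue) = 0" for \<epsilon>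
  proof -
    have "(\<integral>y. hilbert_kernel X \<epsilon> (x - y) *\<^sub>R f y \<partial>lebesgue) = (\<integral>y. complex_of_real (hilbert_kernel X \<epsilon> (x - y) * Re (f y)) \<partial>lebesgue)"
      by (subst f) (simp add: scaleR_conv_of_real del: hilbert_kernel.simps)
    then show ?thesis unfolding integral_complex_of_real by simp
  qed
  then have "((\<lambda>\<epsilon>. 0) \<longlongrightarrow> Im (2 * pi * g x)) (at_right (0::real))"
    using tendsto_Im[OF elim] by (simp del: hilbert_kernel.simps)
  from tendsto_unique[OF _ tendsto_const this] show ?case by simp
qed

section \<open>Vector-valued functions by components\<close>

definition vec_L2 :: "base \<Rightarrow> (real \<Rightarrow> complex^2) \<Rightarrow> bool" where
  "vec_L2 X \<phi> \<longleftrightarrow> (\<forall>i. (\<lambda>x. \<phi> x $ i) \<in> L2 X)"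

definition vec_mulrel :: "base \<Rightarrow> (real \<Rightarrow> complex) \<Rightarrow> (real \<Rightarrow> complex^2) \<Rightarrow> (real \<Rightarrow> complex^2) \<Rightarrow> bool" where
  "vec_mulrel X m \<phi> \<psi> \<longleftrightarrow> (\<forall>i. mulrel X m (\<lambda>x. \<phi> x $ i) (\<lambda>x. \<psi> x $ i))"

lemma bounded_linear_axis: "bounded_linear (axis i :: complex \<Rightarrow> complex^2)"
  by (intro linear_conv_bounded_linear[THEN iffD1] linearI) (auto simp: axis_def vec_eq_iff)

lemma vec2_axis_sum: "(v :: complex^2) = axis 1 (v $ 1) + axis 2 (v $ 2)"
  by (simp add: vec_eq_iff axis_def forall_2)

lemma borel_measurable_vec2:
  assumes "\<And>i. (\<lambda>x. \<phi> x $ i) \<in> borel_measurable M"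
  shows "(\<phi> :: _ \<Rightarrow> complex^2) \<in> borel_measurable M"
proof -
  have a: "(axis i :: complex \<Rightarrow> complex^2) \<in> borel_measurable borel" for i
    by (intro borel_measurable_continuous_onI linear_continuous_on bounded_linear_axis)
  have "(\<lambda>x. axis 1 (\<phi> x $ 1) + axis 2 (\<phi> x $ 2) :: complex^2) \<in> borel_measurable M"
    by (intro borel_measurable_add measurable_compose[OF assms a])
  then show ?thesis by (subst (asm) vec2_axis_sum[symmetric])
qed

lemma integral_vec2:
  fixes v :: "_ \<Rightarrow> complex^2"
  assumes i: "\<And>i. integrable M (\<lambda>y. v y $ i)"
  shows "(\<integral>y. v y \<partial>M) $ i = (\<integral>y. v y $ i \<partial>M)"
proof -
  have "integrable M (\<lambda>y. axis 1 (v y $ 1) + axis 2 (v y $ 2) :: complex^2)"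
    by (intro Bochner_Integration.integrable_add integrable_bounded_linear[OF bounded_linear_axis] i)
  then have "integrable M v" by (subst (asm) vec2_axis_sum[symmetric])
  from integral_bounded_linear[OF bounded_linear_vec_nth this] show ?thesis by simp
qed

lemma vec_L2_D:
  assumes "vec_L2 X \<phi>"
  shows "periodic_on X \<phi>" "\<phi> \<in> borel_measurable lebesgue" "(\<lambda>x. \<phi> x $ i) \<in> L2 X"
proof -
  show "(\<lambda>x. \<phi> x $ i) \<in> L2 X" using assms by (simp add: vec_L2_def)
  show "periodic_on X \<phi>"
    using assms unfolding vec_L2_def L2_iff by (cases X) (auto simp: vec_eq_iff)
  show "\<phi> \<in> borel_measurable lebesgue"
    using assms unfolding vec_L2_def L2_iff by (intro borel_measurable_vec2) auto
qed

lemma vec_mulrelD: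
  assumes "vec_mulrel X m \<phi> \<psi>"
  shows "vec_L2 X \<phi>" "vec_L2 X \<psi>" "mulrel X m (\<lambda>x. \<phi> x $ i) (\<lambda>x. \<psi> x $ i)"
  using assms mulrelD unfolding vec_mulrel_def vec_L2_def by blast+

lemma vec_AE_iff:
  "(AE x in M. \<phi> x = (\<psi> x :: complex^2)) \<longleftrightarrow> (\<forall>i. AE x in M. \<phi> x $ i = \<psi> x $ i)"
  unfolding vec_eq_iff forall_2 by simp

text \<open>\<open>hilbert\<close> uses the vector-valued integral, whose components are the scalar
  integrals once these are known to be integrable; hence the comparison is made for
  \<open>\<epsilon>\<close> below 1 and then passed to the limit.\<close>

lemma hilbert_vec_mulrel_AE:
  assumes r: "vec_mulrel X hilbert_symbol \<phi> \<psi>"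
  shows "AE x in lebesgue. hilbert X \<phi> x = hilbert_const X *\<^sub>R \<psi> x"
proof (rule AE_base_periodic)
  note f = vec_L2_D[OF vec_mulrelD(1)[OF r]] and g = vec_L2_D[OF vec_mulrelD(2)[OF r]]
  show "periodic_on X (\<lambda>x. hilbert X \<phi> x = hilbert_const X *\<^sub>R \<psi> x)"
    using hilbert_periodic[OF f(1,2)] g(1) by (cases X) (auto simp del: hilbert.simps)
  show "AE x in base_measure X. hilbert X \<phi> x = hilbert_const X *\<^sub>R \<psi> x"
    using hilbert_kernel_limit[OF vec_mulrelD(3)[OF r, of 1]] hilbert_kernel_limit[OF vec_mulrelD(3)[OF r, of 2]]
  proof eventually_elim
    case (elim x)
    have lim: "((\<lambda>\<epsilon>. \<integral>y. hilbert_kernel X \<epsilon> (x - y) *\<^sub>R \<phi> y $ i \<partial>lebesgue) \<longlongrightarrow> 2 * pi * (\<psi> x $ i)) (at_right 0)" for i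
      using elim exhaust_2[of i] by auto
    have "((\<lambda>\<epsilon>. \<integral>y. hilbert_kernel X \<epsilon> (x - y) *\<^sub>R \<phi> y \<partial>lebesgue) \<longlongrightarrow> (2 * pi) *\<^sub>R \<psi> x) (at_right 0)"
    proof (rule vec_tendstoI)
      fix i
      have "\<forall>\<^sub>F \<epsilon> in at_right 0. 0 < \<epsilon> \<and> \<epsilon> < (1::real)" by (rule eventually_at_rightI[of 0 1]) auto
      then have "\<forall>\<^sub>F \<epsilon> in at_right 0. (\<integral>y. hilbert_kernel X \<epsilon> (x - y) *\<^sub>R \<phi> y $ i \<partial>lebesgue)
          = (\<integral>y. hilbert_kernel X \<epsilon> (x - y) *\<^sub>R \<phi> y \<partial>lebesgue) $ i"
      proof eventually_elim
        case (elim \<epsilon>)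
        have "integrable lebesgue (\<lambda>y. (hilbert_kernel X \<epsilon> (x - y) *\<^sub>R \<phi> y) $ i)" for i
          using hilbert_kernel_integrable(1)[OF f(3), of \<epsilon> x i] elim by (simp del: hilbert_kernel.simps)
        from integral_vec2[OF this] show ?case by (simp del: hilbert_kernel.simps)
      qed
      from iffD1[OF tendsto_cong[OF this] lim[of i]]
      have "((\<lambda>\<epsilon>. (\<integral>y. hilbert_kernel X \<epsilon> (x - y) *\<^sub>R \<phi> y \<partial>lebesgue) $ i) \<longlongrightarrow> 2 * pi * (\<psi> x $ i)) (at_right 0)" .
      moreover have "2 * pi * (\<psi> x $ i) = ((2 * pi) *\<^sub>R \<psi> x) $ i"
        unfolding vector_scaleR_component by (simp add: scaleR_conv_of_real)
      ultimately show "((\<lambda>\<epsilon>. (\<integral>y. hilbert_kernel X \<epsilon> (x - y) *\<^sub>R \<phi> y \<partial>lebesgue) $ i) \<longlongrightarrow> ((2 * pi) *\<^sub>R \<psi> x) $ i) (at_right 0)"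
        by (simp only:)
    qed
    then have "((\<lambda>\<epsilon>. (hilbert_const X / (2 * pi)) *\<^sub>R (\<integral>y. hilbert_kernel X \<epsilon> (x - y) *\<^sub>R \<phi> y \<partial>lebesgue))
       \<longlongrightarrow> (hilbert_const X / (2 * pi)) *\<^sub>R ((2 * pi) *\<^sub>R \<psi> x)) (at_right 0)"
      by (intro tendsto_scaleR tendsto_const)
    then have "hilbert X \<phi> x = (hilbert_const X / (2 * pi)) *\<^sub>R ((2 * pi) *\<^sub>R \<psi> x)"
      unfolding hilbert_eq by (rule tendsto_Lim[rotated]) simp
    then show ?case by simp
  qed
qed

section \<open>Sobolev functions and weak derivatives\<close>

definition deriv_symbol :: "real \<Rightarrow> complex" where
  "deriv_symbol \<xi> = \<i> * complex_of_real \<xi>"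

lemma deriv_symbol_measurable: "deriv_symbol \<in> borel_measurable borel"
  unfolding deriv_symbol_def[abs_def] by measurable

lemma sobolev_sqnorm_eq:
  assumes r: "mulrel X deriv_symbol f f'"
  shows "sobolev_sqnorm X 1 f = ennreal (nsq (freq_measure X) (fourier X f) + nsq (freq_measure X) (\<lambda>\<xi>. deriv_symbol \<xi> * fourier X f \<xi>))"
proof -
  let ?N = "freq_measure X" and ?k = "complex_of_real (fourier_const X)"
  have k: "?k \<noteq> 0" by (cases X) auto
  note f = mulrelD(1)[OF r]
  let ?F = "\<lambda>\<xi>. ?k * fourier X f \<xi>"
  note F = Ft_fourier[OF f]
  note F' = mulrel_transform[OF r F deriv_symbol_measurable]
  have s1: "sqint ?N (fourier X f)" using sqint_cmult[OF FtD(2)[OF F], of "1 / ?k"] k by simp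
  have s2: "sqint ?N (\<lambda>\<xi>. deriv_symbol \<xi> * fourier X f \<xi>)"
    using sqint_cmult[OF FtD(2)[OF F'], of "1 / ?k"] k by (simp add: mult_ac)
  have "sobolev_sqnorm X 1 f = (\<integral>\<^sup>+\<xi>. ennreal ((cmod (fourier X f \<xi>))\<^sup>2) + ennreal ((cmod (deriv_symbol \<xi> * fourier X f \<xi>))\<^sup>2) \<partial>?N)"
    unfolding sobolev_sqnorm_def
  proof (intro nn_integral_cong)
    fix \<xi> :: real
    have "(1 + \<xi>\<^sup>2) powr 1 * (cmod (fourier X f \<xi>))\<^sup>2 = (cmod (fourier X f \<xi>))\<^sup>2 + (cmod (deriv_symbol \<xi> * fourier X f \<xi>))\<^sup>2"
      by (simp add: deriv_symbol_def norm_mult power_mult_distrib distrib_right add_pos_nonneg)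
    then show "ennreal ((1 + \<xi>\<^sup>2) powr 1 * (cmod (fourier X f \<xi>))\<^sup>2) = ennreal ((cmod (fourier X f \<xi>))\<^sup>2) + ennreal ((cmod (deriv_symbol \<xi> * fourier X f \<xi>))\<^sup>2)"
      by (simp flip: ennreal_plus)
  qed
  also have "\<dots> = ennreal (nsq ?N (fourier X f)) + ennreal (nsq ?N (\<lambda>\<xi>. deriv_symbol \<xi> * fourier X f \<xi>))"
    using sqint_measurable[OF s1] sqint_measurable[OF s2]
    by (subst nn_integral_add) (auto simp: nn_eq_nsq[OF s1] nn_eq_nsq[OF s2])
  finally show ?thesis by (simp add: ennreal_plus nsq_nonneg)
qed

text \<open>The weight is 1 plus the squared modulus of \<open>deriv_symbol\<close>, so the Sobolev
  space of order 1 is exactly the domain of the weak derivative. Afterwards only the relation is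
  used.\<close>

lemma sobolev_iff:
  "f \<in> sobolev X 1 \<longleftrightarrow> (\<exists>f'. mulrel X deriv_symbol f f')"
proof
  let ?N = "freq_measure X" and ?k = "complex_of_real (fourier_const X)"
  have k: "?k \<noteq> 0" by (cases X) auto
  { assume "f \<in> sobolev X 1"
    then have f: "f \<in> L2 X" and s: "sobolev_sqnorm X 1 f < \<infinity>" by (auto simp: sobolev_def)
    let ?F = "\<lambda>\<xi>. ?k * fourier X f \<xi>"
    note F = Ft_fourier[OF f]
    have Fm: "?F \<in> borel_measurable ?N" using FtD(2)[OF F] by (rule sqint_measurable)
    have "sqint ?N (\<lambda>\<xi>. deriv_symbol \<xi> * ?F \<xi>)"
      unfolding sqint_iff_nn
    proof
      show m: "(\<lambda>\<xi>. deriv_symbol \<xi> * ?F \<xi>) \<in> borel_measurable ?N"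
        by (intro borel_measurable_times freq_measurable deriv_symbol_measurable Fm)
      have gm: "(\<lambda>\<xi>. ennreal ((1 + \<xi>\<^sup>2) powr 1 * (cmod (fourier X f \<xi>))\<^sup>2)) \<in> borel_measurable ?N"
      proof -
        have "(\<lambda>\<xi>. (1 / ?k) * ?F \<xi>) \<in> borel_measurable ?N"
          by (intro borel_measurable_times borel_measurable_const Fm)
        then have fm: "fourier X f \<in> borel_measurable ?N" using k by simp
        have "(\<lambda>\<xi>. (1 + \<xi>\<^sup>2) powr 1 :: real) \<in> borel_measurable borel" by simp
        note pm = measurable_compose[OF reg_measureD(2)[OF reg_freq_measure] this]
        have "(\<lambda>\<xi>. (1 + \<xi>\<^sup>2) powr 1 * (cmod (fourier X f \<xi>))\<^sup>2) \<in> borel_measurable ?N"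
          by (rule borel_measurable_times[OF pm borel_measurable_power[OF measurable_compose[OF fm borel_measurable_norm]]])
        then show ?thesis by simp
      qed
      have "(\<integral>\<^sup>+\<xi>. ennreal ((cmod (deriv_symbol \<xi> * ?F \<xi>))\<^sup>2) \<partial>?N)
        \<le> (\<integral>\<^sup>+\<xi>. ennreal ((cmod ?k)\<^sup>2) * ennreal ((1 + \<xi>\<^sup>2) powr 1 * (cmod (fourier X f \<xi>))\<^sup>2) \<partial>?N)"
      proof (rule nn_integral_mono)
        fix \<xi> :: real
        have "(cmod (deriv_symbol \<xi> * ?F \<xi>))\<^sup>2 = (cmod ?k)\<^sup>2 * (\<xi>\<^sup>2 * (cmod (fourier X f \<xi>))\<^sup>2)"
          by (simp add: deriv_symbol_def norm_mult power_mult_distrib mult_ac)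
        also have "\<dots> \<le> (cmod ?k)\<^sup>2 * ((1 + \<xi>\<^sup>2) powr 1 * (cmod (fourier X f \<xi>))\<^sup>2)"
          by (intro mult_left_mono mult_right_mono) (auto simp: add_pos_nonneg)
        finally show "ennreal ((cmod (deriv_symbol \<xi> * ?F \<xi>))\<^sup>2)
           \<le> ennreal ((cmod ?k)\<^sup>2) * ennreal ((1 + \<xi>\<^sup>2) powr 1 * (cmod (fourier X f \<xi>))\<^sup>2)"
          by (subst ennreal_mult[symmetric]) (auto intro: ennreal_leI)
      qed
      also have "\<dots> = ennreal ((cmod ?k)\<^sup>2) * sobolev_sqnorm X 1 f"
        unfolding sobolev_sqnorm_def by (rule nn_integral_cmult[OF gm])
      also have "\<dots> < \<infinity>" using s by (simp add: ennreal_mult_less_top)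
      finally show "(\<integral>\<^sup>+\<xi>. ennreal ((cmod (deriv_symbol \<xi> * ?F \<xi>))\<^sup>2) \<partial>?N) < \<infinity>" .
    qed
    then obtain f' where "mulrel X deriv_symbol f f'" using mulrel_exists[OF f F] by blast
    then show "\<exists>f'. mulrel X deriv_symbol f f'" by blast }
  { assume "\<exists>f'. mulrel X deriv_symbol f f'"
    then obtain f' where r: "mulrel X deriv_symbol f f'" by blast
    then show "f \<in> sobolev X 1" using mulrelD(1)[OF r] sobolev_sqnorm_eq[OF r] by (simp add: sobolev_def) }
qed

text \<open>The symbol factors as
  \<open>(- \<i> * sgn \<xi>) * (\<i> * \<xi>) = \<bar>\<xi>\<bar>\<close>. The function
  \<open>g\<close> shows that the choice in \<open>abs_grad\<close> succeeds, and uniqueness of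
  multiplier images identifies the chosen function with it.\<close>

lemma abs_grad_AE:
  assumes d: "mulrel X deriv_symbol f f'" and h: "mulrel X hilbert_symbol f' g"
  shows "AE x in lebesgue. abs_grad X f x = g x" "abs_grad X f \<in> L2 X"
proof -
  let ?m = "\<lambda>\<xi>. complex_of_real \<bar>\<xi>\<bar>"
  have mm: "?m \<in> borel_measurable borel" by measurable
  have "hilbert_symbol \<xi> * deriv_symbol \<xi> = ?m \<xi>" for \<xi>
    by (simp add: hilbert_symbol_def deriv_symbol_def abs_sgn mult_ac)
  then have r: "mulrel X ?m f g" using mulrel_comp[OF d h hilbert_symbol_measurable] by simp
  note f = mulrelD(1)[OF r] and g = mulrelD(2)[OF r]
  let ?P = "\<lambda>g. g \<in> L2 X \<and> (AE \<xi> in freq_measure X. fourier X g \<xi> = complex_of_real \<bar>\<xi>\<bar> * fourier X f \<xi>)"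
  have "?P g" using r mulrel_fourier_iff[OF f g mm] g by simp
  then have P: "?P (abs_grad X f)" unfolding abs_grad_def by (rule someI[of ?P])
  then show L: "abs_grad X f \<in> L2 X" by blast
  have "mulrel X ?m f (abs_grad X f)" using P mulrel_fourier_iff[OF f L mm] by simp
  from mulrel_unique[OF this r _ mm] show "AE x in lebesgue. abs_grad X f x = g x" by simp
qed

section \<open>Weak derivatives as limits of difference quotients\<close>

definition diff_quot :: "nat \<Rightarrow> (real \<Rightarrow> complex) \<Rightarrow> real \<Rightarrow> complex" where
  "diff_quot n f x = real (Suc n) *\<^sub>R (f (x + 1 / real (Suc n)) - f x)"

definition diff_symbol :: "nat \<Rightarrow> real \<Rightarrow> complex" where
  "diff_symbol n \<xi> = real (Suc n) *\<^sub>R (cnj (wave (1 / real (Suc n)) \<xi>) - 1)"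

lemma diff_symbol_measurable: "diff_symbol n \<in> borel_measurable borel"
  unfolding diff_symbol_def[abs_def] wave_def by measurable

lemma has_vector_derivative_quotient:
  assumes "(f has_vector_derivative f') (at x within S)"
  shows "((\<lambda>y. (f y - f x) /\<^sub>R (y - x)) \<longlongrightarrow> f') (at x within S)"
proof -
  have "((\<lambda>y. norm (f y - f x - (y - x) *\<^sub>R f') / norm (y - x)) \<longlongrightarrow> 0) (at x within S)"
    using assms by (simp add: has_vector_derivative_def has_derivative_iff_norm)
  moreover have "\<forall>\<^sub>F y in at x within S. norm (f y - f x - (y - x) *\<^sub>R f') / norm (y - x) = norm ((f y - f x) /\<^sub>R (y - x) - f')"
    unfolding eventually_at_filter
  proof (intro always_eventually allI impI)
    fix y assume y: "y \<noteq> x"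
    then have "(f y - f x) /\<^sub>R (y - x) - f' = (f y - f x - (y - x) *\<^sub>R f') /\<^sub>R (y - x)"
      by (simp add: scaleR_right_diff_distrib)
    then show "norm (f y - f x - (y - x) *\<^sub>R f') / norm (y - x) = norm ((f y - f x) /\<^sub>R (y - x) - f')"
      by (simp add: divide_inverse mult.commute abs_inverse)
  qed
  ultimately have "((\<lambda>y. norm ((f y - f x) /\<^sub>R (y - x) - f')) \<longlongrightarrow> 0) (at x within S)"
    using tendsto_cong by force
  then show ?thesis using tendsto_norm_zero_iff Lim_null by blast
qed

lemma diff_symbol_limit: "(\<lambda>n. diff_symbol n \<xi>) \<longlonglongrightarrow> deriv_symbol \<xi>"
proof -
  have "((\<lambda>t. exp (\<i> * complex_of_real t * complex_of_real \<xi>)) has_vector_derivative \<i> * complex_of_real \<xi>) (at 0)"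
  proof -
    have "((\<lambda>w. exp (\<i> * w * complex_of_real \<xi>)) has_field_derivative \<i> * complex_of_real \<xi>) (at (complex_of_real 0))"
      by (auto intro!: derivative_eq_intros)
    from has_vector_derivative_real_field[OF this] show ?thesis by simp
  qed
  then have "((\<lambda>t. (exp (\<i> * complex_of_real t * complex_of_real \<xi>) - 1) /\<^sub>R t) \<longlongrightarrow> \<i> * complex_of_real \<xi>) (at 0)"
    using has_vector_derivative_quotient by fastforce
  moreover have "filterlim (\<lambda>n. 1 / real (Suc n)) (at 0) sequentially"
    by (rule filterlim_atI; real_asymp?) auto
  ultimately have "(\<lambda>n. (exp (\<i> * complex_of_real (1 / real (Suc n)) * complex_of_real \<xi>) - 1) /\<^sub>R (1 / real (Suc n))) \<longlonglongrightarrow> \<i> * complex_of_real \<xi>"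
    by (rule filterlim_compose)
  moreover have "(exp (\<i> * complex_of_real (1 / real (Suc n)) * complex_of_real \<xi>) - 1) /\<^sub>R (1 / real (Suc n)) = diff_symbol n \<xi>" for n
    unfolding diff_symbol_def wave_def by (simp add: exp_cnj mult.assoc)
  ultimately show ?thesis by (simp add: deriv_symbol_def)
qed

text \<open>The chord of the unit circle is no longer than the arc. This is the domination under
  which the difference quotients converge on the frequency side.\<close>

lemma norm_diff_symbol_le: "cmod (diff_symbol n \<xi>) \<le> cmod (deriv_symbol \<xi>)"
proof -
  have "cmod (exp (\<i> * complex_of_real t) - 1) \<le> \<bar>t\<bar>" for t
  proof -
    have "(cmod (exp (\<i> * complex_of_real t) - 1))\<^sup>2 = (cos t - 1)\<^sup>2 + (sin t)\<^sup>2"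
      unfolding cmod_power2 by (simp add: Re_exp Im_exp)
    also have "\<dots> = 2 * (1 - cos t)" by (simp add: power2_diff sin_squared_eq)
    also have "\<dots> = 4 * (sin (t/2))\<^sup>2" using cos_double_sin[of "t/2"] by simp
    also have "\<dots> \<le> 4 * (\<bar>t/2\<bar>)\<^sup>2"
      using power_mono[OF abs_sin_x_le_abs_x[of "t/2"], of 2] by simp
    also have "\<dots> = \<bar>t\<bar>\<^sup>2" by (simp add: power_divide)
    finally show ?thesis by (rule power2_le_imp_le) simp
  qed
  from this[of "1 / real (Suc n) * \<xi>"]
  have "cmod (cnj (wave (1 / real (Suc n)) \<xi>) - 1) \<le> \<bar>1 / real (Suc n) * \<xi>\<bar>"
    by (simp add: wave_def exp_cnj)
  then have "real (Suc n) * cmod (cnj (wave (1 / real (Suc n)) \<xi>) - 1) \<le> real (Suc n) * \<bar>1 / real (Suc n) * \<xi>\<bar>"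
    by (rule mult_left_mono) simp
  also have "\<dots> = \<bar>\<xi>\<bar>" by (simp add: abs_mult)
  finally show ?thesis by (simp add: diff_symbol_def deriv_symbol_def norm_mult)
qed

lemma diff_quot_mulrel:
  assumes "f \<in> L2 X" shows "mulrel X (diff_symbol n) f (diff_quot n f)"
proof -
  note P = fourier_pair_base[of X]
  obtain F where F: "Ft (base_measure X) (freq_measure X) f F"
    "Ft (base_measure X) (freq_measure X) (\<lambda>x. f (x + 1 / real (Suc n))) (\<lambda>\<xi>. cnj (wave (1 / real (Suc n)) \<xi>) * F \<xi>)"
    and L: "(\<lambda>x. f (x + 1 / real (Suc n))) \<in> L2 X"
    using mulrel_shift[OF assms, of "1 / real (Suc n)"] by (auto simp: mulrel_def)
  have "Ft (base_measure X) (freq_measure X) (\<lambda>x. complex_of_real (real (Suc n)) * (f (x + 1 / real (Suc n)) - f x))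
     (\<lambda>\<xi>. complex_of_real (real (Suc n)) * (cnj (wave (1 / real (Suc n)) \<xi>) * F \<xi> - F \<xi>))"
    by (rule Ft_cmult[OF P Ft_diff[OF P F(2,1)]])
  then have "Ft (base_measure X) (freq_measure X) (diff_quot n f) (\<lambda>\<xi>. diff_symbol n \<xi> * F \<xi>)"
    unfolding diff_quot_def[abs_def] diff_symbol_def scaleR_conv_of_real
    by (simp add: left_diff_distrib right_diff_distrib mult.assoc del: of_nat_Suc)
  moreover have "diff_quot n f \<in> L2 X"
    unfolding diff_quot_def[abs_def] scaleR_conv_of_real by (rule L2_cmult[OF L2_diff[OF L assms]])
  ultimately show ?thesis unfolding mulrel_def using assms F(1) by blast
qed

lemma diff_quot_tendsto:
  assumes d: "mulrel X deriv_symbol f f'"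
  shows "(\<lambda>n. nsq (base_measure X) (\<lambda>x. diff_quot n f x - f' x)) \<longlonglongrightarrow> 0"
proof -
  note P = fourier_pair_base[of X] and f = mulrelD(1)[OF d]
  let ?N = "freq_measure X"
  obtain F where F: "Ft (base_measure X) ?N f F" "Ft (base_measure X) ?N f' (\<lambda>\<xi>. deriv_symbol \<xi> * F \<xi>)"
    using d by (auto simp: mulrel_def)
  have Fn: "Ft (base_measure X) ?N (diff_quot n f) (\<lambda>\<xi>. diff_symbol n \<xi> * F \<xi>)" for n
    by (rule mulrel_transform[OF diff_quot_mulrel[OF f] F(1) diff_symbol_measurable])
  have "(\<lambda>n. nsq ?N (\<lambda>\<xi>. diff_symbol n \<xi> * F \<xi> - deriv_symbol \<xi> * F \<xi>)) \<longlonglongrightarrow> 0"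
  proof (rule nsq_dominated_convergence(2)[OF sqint_measurable[OF FtD(2)[OF Fn]] FtD(2)[OF F(2)]])
    show "AE \<xi> in ?N. cmod (diff_symbol n \<xi> * F \<xi>) \<le> cmod (deriv_symbol \<xi> * F \<xi>)" for n
      unfolding norm_mult by (intro AE_I2 mult_right_mono norm_diff_symbol_le) simp
    show "AE \<xi> in ?N. (\<lambda>n. diff_symbol n \<xi> * F \<xi>) \<longlonglongrightarrow> deriv_symbol \<xi> * F \<xi>"
      by (intro AE_I2 tendsto_mult diff_symbol_limit tendsto_const)
    show "(\<lambda>\<xi>. deriv_symbol \<xi> * F \<xi>) \<in> borel_measurable ?N" by (rule sqint_measurable[OF FtD(2)[OF F(2)]])
  qed
  then have "(\<lambda>n. 2 * pi * nsq (base_measure X) (\<lambda>x. diff_quot n f x - f' x)) \<longlonglongrightarrow> 0"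
    using Ft_plancherel[OF P Ft_diff[OF P Fn F(2)]] by simp
  from tendsto_mult_left[OF this, of "1 / (2 * pi)"] show ?thesis by simp
qed

text \<open>The converse of \<open>diff_quot_tendsto\<close>. Together they replace the weak
  derivative by a limit of difference quotients, a form in which the product rule can be
  checked.\<close>

lemma diff_quot_limit_mulrel:
  assumes f: "f \<in> L2 X" and g: "g \<in> L2 X"
    and lim: "(\<lambda>n. nsq (base_measure X) (\<lambda>x. diff_quot n f x - g x)) \<longlonglongrightarrow> 0"
  shows "mulrel X deriv_symbol f g"
  by (rule mulrel_lim[OF diff_quot_mulrel[OF f] f g lim diff_symbol_limit diff_symbol_measurable deriv_symbol_measurable])

lemma diff_quot_real_limit:
  assumes "(a has_vector_derivative a') (at x)"
  shows "(\<lambda>n. diff_quot n a x) \<longlonglongrightarrow> a'"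
proof -
  have "((\<lambda>y. (a y - a x) /\<^sub>R (y - x)) \<longlongrightarrow> a') (at x)"
    by (rule has_vector_derivative_quotient[OF assms])
  moreover have "filterlim (\<lambda>n. x + 1 / real (Suc n)) (at x) sequentially"
  proof (rule filterlim_atI)
    have "(\<lambda>n. x + 1 / real (Suc n)) \<longlonglongrightarrow> x + 0" by (intro tendsto_intros LIMSEQ_Suc lim_1_over_n)
    then show "(\<lambda>n. x + 1 / real (Suc n)) \<longlonglongrightarrow> x" by simp
  qed auto
  ultimately have "(\<lambda>n. (a (x + 1 / real (Suc n)) - a x) /\<^sub>R (x + 1 / real (Suc n) - x)) \<longlonglongrightarrow> a'"
    by (rule filterlim_compose)
  then show ?thesis by (simp add: diff_quot_def)
qed

text \<open>Leibniz for difference quotients. The coefficient is bounded with bounded derivative,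
  hence Lipschitz, but need not be square integrable; all decay is supplied by \<open>f\<close> and
  \<open>f'\<close>.\<close>

lemma mulrel_product_rule:
  assumes d: "mulrel X deriv_symbol f f'"
    and a: "periodic_on X a" "\<And>x. (a has_vector_derivative a' x) (at x)"
    and b: "\<And>x. cmod (a x) \<le> A" "\<And>x. cmod (a' x) \<le> B"
    and a': "a' \<in> borel_measurable lebesgue" "periodic_on X a'"
  shows "mulrel X deriv_symbol (\<lambda>x. a x * f x) (\<lambda>x. a' x * f x + a x * f' x)"
proof -
  let ?M = "base_measure X"
  note f = mulrelD(1)[OF d] and f' = mulrelD(2)[OF d]
  define h where "h n = 1 / real (Suc n)" for n
  have h0: "h \<longlonglongrightarrow> 0" unfolding h_def by (rule LIMSEQ_Suc[OF lim_1_over_n])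
  have ca: "continuous_on UNIV a"
    by (rule continuous_at_imp_continuous_on) (use a(2) has_vector_derivative_continuous in blast)
  have am: "a \<in> borel_measurable lebesgue"
    by (rule measurable_completion) (use borel_measurable_continuous_onI[OF ca] in simp)
  have ash: "(\<lambda>x. a (x + c)) \<in> borel_measurable lebesgue" for c
    by (rule measurable_compose[OF lebesgue_shift(2) am])
  have lip: "cmod (a y - a x) \<le> B * \<bar>y - x\<bar>" for x y
  proof -
    have "norm (a y - a x) \<le> B * norm (y - x)"
    proof (rule differentiable_bound[OF convex_UNIV])
      show "(a has_derivative (\<lambda>t. t *\<^sub>R a' z)) (at z within UNIV)" for z
        using a(2)[of z] by (simp add: has_vector_derivative_def)
      show "onorm (\<lambda>t. t *\<^sub>R a' z) \<le> B" for z
      proof (rule onorm_le)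
        fix t :: real
        show "norm (t *\<^sub>R a' z) \<le> B * norm t" using mult_right_mono[OF b(2)[of z], of "\<bar>t\<bar>"] by (simp add: mult.commute)
      qed
    qed auto
    then show ?thesis by simp
  qed
  have dq: "cmod (diff_quot n a x) \<le> B" for n x
    using mult_left_mono[OF lip[of "x + h n" x], of "real (Suc n)"] by (simp add: diff_quot_def h_def)
  have B0: "B \<ge> 0" using order_trans[OF norm_ge_zero b(2)] .
  have A0: "A \<ge> 0" using order_trans[OF norm_ge_zero b(1)] .
  have af: "(\<lambda>x. a x * f x) \<in> L2 X" by (rule L2_bdd_mult[OF f a(1) am, where C = A]) (use b in simp)
  have r: "(\<lambda>x. a' x * f x + a x * f' x) \<in> L2 X"
    by (intro L2_add L2_bdd_mult[OF f a'(2,1), where C = B] L2_bdd_mult[OF f' a(1) am, where C = A]) (use b in simp_all)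
  note MB = measurable_base_of_lebesgue
  define u where "u n x = a (x + h n) * (diff_quot n f x - f' x)" for n x
  define v where "v n x = a (x + h n) * f' x - a x * f' x" for n x
  define w where "w n x = diff_quot n a x * f x - a' x * f x" for n x
  \<comment> \<open>The three errors: the difference quotient of \<open>f\<close> against its limit,
    the translation of \<open>a\<close> in front of \<open>f'\<close>, and the difference quotient
    of \<open>a\<close> against \<open>a'\<close>. The first is small in norm, the other two by
    dominated convergence.\<close>
  have split: "diff_quot n (\<lambda>x. a x * f x) x - (a' x * f x + a x * f' x) = (u n x + v n x) + w n x" for n x
    unfolding u_def v_def w_def diff_quot_def h_def scaleR_conv_of_real by (simp add: algebra_simps del: of_nat_Suc)
  have dqL: "sqint ?M (\<lambda>x. diff_quot n f x - f' x)" for n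
    using L2_D(3)[OF L2_diff[OF mulrelD(2)[OF diff_quot_mulrel[OF f]] f']] .
  have un: "sqint ?M (u n)" "nsq ?M (u n) \<le> A\<^sup>2 * nsq ?M (\<lambda>x. diff_quot n f x - f' x)" for n
    unfolding u_def using sqint_bdd_mult[OF dqL MB[OF ash], where C = A] b(1) by auto
  have s1: "sqint ?M (\<lambda>x. a (x + c) * f' x)" for c
    using sqint_bdd_mult(1)[OF L2_D(3)[OF f'] MB[OF ash], where C = A] b(1) by auto
  have s2: "sqint ?M (\<lambda>x. diff_quot n a x * f x)" for n
  proof (rule sqint_bdd_mult(1)[OF L2_D(3)[OF f] MB, where C = B])
    show "diff_quot n a \<in> borel_measurable lebesgue"
      unfolding diff_quot_def[abs_def] using ash am by (intro borel_measurable_scaleR borel_measurable_diff borel_measurable_const) auto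
  qed (use dq in simp)
  have s3: "sqint ?M (\<lambda>x. a' x * f x)"
    using sqint_bdd_mult(1)[OF L2_D(3)[OF f] MB[OF a'(1)], where C = B] b(2) by auto
  have vn: "sqint ?M (v n)" for n unfolding v_def using sqint_diff(1)[OF s1 s1[of 0]] by simp
  have wn: "sqint ?M (w n)" for n unfolding w_def by (rule sqint_diff(1)[OF s2 s3])
  have l1: "(\<lambda>n. nsq ?M (u n)) \<longlonglongrightarrow> 0"
  proof (rule tendsto_sandwich[OF _ _ tendsto_const])
    show "\<forall>\<^sub>F n in sequentially. nsq ?M (u n) \<le> A\<^sup>2 * nsq ?M (\<lambda>x. diff_quot n f x - f' x)" using un(2) by simp
    show "(\<lambda>n. A\<^sup>2 * nsq ?M (\<lambda>x. diff_quot n f x - f' x)) \<longlonglongrightarrow> 0"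
      using tendsto_mult_left[OF diff_quot_tendsto[OF d], of "A\<^sup>2"] by simp
  qed (simp add: nsq_nonneg)
  have l2: "(\<lambda>n. nsq ?M (v n)) \<longlonglongrightarrow> 0"
    unfolding v_def
  proof (rule nsq_dominated_convergence(2)[OF sqint_measurable[OF s1] sqint_cmult[OF L2_D(3)[OF f'], of "complex_of_real A"]])
    show "AE x in ?M. cmod (a (x + h n) * f' x) \<le> cmod (complex_of_real A * f' x)" for n
      using b(1) A0 by (auto simp: norm_mult intro!: AE_I2 mult_right_mono)
    show "AE x in ?M. (\<lambda>n. a (x + h n) * f' x) \<longlonglongrightarrow> a x * f' x"
    proof (intro AE_I2 tendsto_mult tendsto_const)
      fix x
      have "isCont a x" using ca by (simp add: continuous_on_eq_continuous_at)
      moreover have "(\<lambda>n. x + h n) \<longlonglongrightarrow> x" using tendsto_add[OF tendsto_const h0, of x] by simp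
      ultimately show "(\<lambda>n. a (x + h n)) \<longlonglongrightarrow> a x" by (rule isCont_tendsto_compose)
    qed
    show "(\<lambda>x. a x * f' x) \<in> borel_measurable ?M" using sqint_measurable[OF s1[of 0]] by simp
  qed
  have l3: "(\<lambda>n. nsq ?M (w n)) \<longlonglongrightarrow> 0"
    unfolding w_def
  proof (rule nsq_dominated_convergence(2)[OF sqint_measurable[OF s2] sqint_cmult[OF L2_D(3)[OF f], of "complex_of_real B"]])
    show "AE x in ?M. cmod (diff_quot n a x * f x) \<le> cmod (complex_of_real B * f x)" for n
      using dq B0 by (auto simp: norm_mult intro!: AE_I2 mult_right_mono)
    show "AE x in ?M. (\<lambda>n. diff_quot n a x * f x) \<longlonglongrightarrow> a' x * f x"
      by (intro AE_I2 tendsto_mult tendsto_const diff_quot_real_limit a(2))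
    show "(\<lambda>x. a' x * f x) \<in> borel_measurable ?M" by (rule sqint_measurable[OF s3])
  qed
  have "(\<lambda>n. nsq ?M (\<lambda>x. diff_quot n (\<lambda>x. a x * f x) x - (a' x * f x + a x * f' x))) \<longlonglongrightarrow> 0"
    unfolding split
  proof (rule tendsto_sandwich[OF _ _ tendsto_const])
    show "\<forall>\<^sub>F n in sequentially. nsq ?M (\<lambda>x. (u n x + v n x) + w n x) \<le> 2 * (2 * nsq ?M (u n) + 2 * nsq ?M (v n)) + 2 * nsq ?M (w n)"
    proof (intro always_eventually allI)
      fix n
      show "nsq ?M (\<lambda>x. (u n x + v n x) + w n x) \<le> 2 * (2 * nsq ?M (u n) + 2 * nsq ?M (v n)) + 2 * nsq ?M (w n)"
      proof -
        have "nsq ?M (\<lambda>x. (u n x + v n x) + w n x) \<le> 2 * nsq ?M (\<lambda>x. u n x + v n x) + 2 * nsq ?M (w n)"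
          by (rule sqint_add(2)[OF sqint_add(1)[OF un(1) vn] wn])
        moreover have "nsq ?M (\<lambda>x. u n x + v n x) \<le> 2 * nsq ?M (u n) + 2 * nsq ?M (v n)"
          by (rule sqint_add(2)[OF un(1) vn])
        moreover have "a \<le> 2 * (2 * c + 2 * d) + 2 * e" if "a \<le> 2 * b + 2 * e" "b \<le> 2 * c + 2 * d" for a b c d e :: real
          by (rule order_trans[OF that(1) add_right_mono[OF mult_left_mono[OF that(2)]]]) simp
        ultimately show ?thesis by blast
      qed
    qed
    have "(\<lambda>n. 2 * (2 * nsq ?M (u n) + 2 * nsq ?M (v n)) + 2 * nsq ?M (w n)) \<longlonglongrightarrow> 2 * (2 * 0 + 2 * 0) + 2 * 0"
      by (intro tendsto_intros l1 l2 l3)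
    then show "(\<lambda>n. 2 * (2 * nsq ?M (u n) + 2 * nsq ?M (v n)) + 2 * nsq ?M (w n)) \<longlonglongrightarrow> 0" by simp
  qed (simp add: nsq_nonneg)
  from diff_quot_limit_mulrel[OF af r this] show ?thesis .
qed

section \<open>Supremum bounds from one weak derivative\<close>

lemma bij_Suc_positive_Ints: "bij_betw (\<lambda>n. real (Suc n)) UNIV (\<int> \<inter> {0<..})"
proof (rule bij_betw_imageI)
  show "inj (\<lambda>n. real (Suc n))" by (auto simp: inj_on_def)
  show "range (\<lambda>n. real (Suc n)) = \<int> \<inter> {0<..}"
  proof safe
    fix x :: real assume "x \<in> \<int>" "0 < x"
    then obtain k where k: "x = of_int k" "k > 0" by (auto elim: Ints_cases)
    then have "x = real (Suc (nat (k - 1)))" by simp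
    then show "x \<in> range (\<lambda>n. real (Suc n))" by blast
  qed auto
qed

lemma freq_weight_integrable: "integrable (freq_measure X) (\<lambda>\<xi>. 1 / (1 + \<xi>\<^sup>2))"
proof (cases X)
  case Line
  then show ?thesis using cauchy_kernel_integral(1)[of 1 0] by simp
next
  case Circle
  let ?f = "\<lambda>\<xi>::real. complex_of_real (1 / (1 + \<xi>\<^sup>2))"
  define g where "g \<xi> = indicator {0<..} \<xi> *\<^sub>R ?f \<xi>" for \<xi>
  have "summable (\<lambda>n. norm (?f (real (Suc n))))"
  proof (rule summable_comparison_test'[where N = 0])
    show "summable (\<lambda>n. inverse (real (Suc n) ^ 2))"
      using inverse_power_summable[of 2, where 'a = real] summable_Suc_iff[of "\<lambda>n. inverse (real n ^ 2)"] by simp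
    show "norm (norm (?f (real (Suc n)))) \<le> inverse (real (Suc n) ^ 2)" for n
      unfolding norm_of_real inverse_eq_divide abs_divide real_norm_def
      by (intro order_trans[OF _ frac_le[of 1 1 "real (Suc n) ^ 2" "1 + real (Suc n) ^ 2"]]) (auto simp del: of_nat_Suc)
  qed
  then have "integrable (count_space UNIV) (\<lambda>n. ?f (real (Suc n)))"
    unfolding integrable_count_space_nat_iff .
  then have "integrable (count_space (\<int> \<inter> {0<..})) ?f"
    using integrable_bij_count_space[OF bij_Suc_positive_Ints, of ?f] by blast
  also have "count_space (\<int> \<inter> {0<..}) = restrict_space (count_space \<int>) {0::real<..}"
    by (simp add: restrict_count_space Int_commute)
  finally have gi: "integrable (freq_measure X) g"
    unfolding g_def Circle freq_measure.simps by (subst (asm) integrable_restrict_space) auto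
  have gi': "integrable (freq_measure X) (\<lambda>\<xi>. g (0 - \<xi>))"
    using integral_freq_reflect(1)[OF zero_in_freq borel_measurable_integrable[OF gi]] gi by blast
  have z: "integrable (freq_measure X) (\<lambda>\<xi>. indicator {0} \<xi> *\<^sub>R (1::complex))"
    using zero_mass_integral[of X 1] by (simp add: has_bochner_integral_iff)
  have "integrable (freq_measure X) (\<lambda>\<xi>. g \<xi> + g (0 - \<xi>) + indicator {0} \<xi> *\<^sub>R 1)"
    by (intro Bochner_Integration.integrable_add gi gi' z)
  also have "(\<lambda>\<xi>. g \<xi> + g (0 - \<xi>) + indicator {0} \<xi> *\<^sub>R 1) = ?f"
  proof
    fix \<xi> :: real show "g \<xi> + g (0 - \<xi>) + indicator {0} \<xi> *\<^sub>R 1 = ?f \<xi>"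
      by (cases "\<xi> > 0"; cases "\<xi> < 0") (auto simp: g_def)
  qed
  finally show ?thesis by (rule complex_of_real_integrable_eq[THEN iffD1])
qed

text \<open>Pointwise \<open>a \<le> w * a^2 + 1 / w\<close> with
  \<open>w = 1 + \<xi>\<^sup>2\<close>, and \<open>1 / w\<close> is integrable over the frequencies.
  The resulting bound is additive rather than homogeneous, which suffices where a finite bound is
  wanted.\<close>

lemma sobolev_frequency_L1:
  assumes F: "sqint (freq_measure X) F" and dF: "sqint (freq_measure X) (\<lambda>\<xi>. deriv_symbol \<xi> * F \<xi>)"
  shows "integrable (freq_measure X) F"
    and "(\<integral>\<xi>. cmod (F \<xi>) \<partial>freq_measure X) \<le> nsq (freq_measure X) F + nsq (freq_measure X) (\<lambda>\<xi>. deriv_symbol \<xi> * F \<xi>)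
       + (\<integral>\<xi>. 1 / (1 + \<xi>\<^sup>2) \<partial>freq_measure X)"
proof -
  let ?N = "freq_measure X"
  have i: "integrable ?N (\<lambda>\<xi>. (cmod (F \<xi>))\<^sup>2 + (cmod (deriv_symbol \<xi> * F \<xi>))\<^sup>2 + 1 / (1 + \<xi>\<^sup>2))"
    by (intro Bochner_Integration.integrable_add sqint_integrable F dF freq_weight_integrable)
  have le: "cmod (F \<xi>) \<le> (cmod (F \<xi>))\<^sup>2 + (cmod (deriv_symbol \<xi> * F \<xi>))\<^sup>2 + 1 / (1 + \<xi>\<^sup>2)" for \<xi>
  proof -
    define w a where "w = 1 + \<xi>\<^sup>2" and "a = cmod (F \<xi>)"
    have w: "w > 0" by (simp add: w_def add_pos_nonneg)
    have "0 \<le> (w * a - 1)\<^sup>2" by simp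
    then have "2 * (w * a) \<le> (w * a)\<^sup>2 + 1" by (simp add: power2_diff)
    moreover have "0 \<le> w * a" using w by (simp add: a_def)
    ultimately have "w * a \<le> (w * a)\<^sup>2 + 1" by simp
    then have "w * a \<le> w * (w * a\<^sup>2 + 1 / w)" using w by (simp add: algebra_simps power2_eq_square)
    then have "a \<le> w * a\<^sup>2 + 1 / w" using w by (rule mult_left_le_imp_le)
    then show ?thesis
      by (simp add: w_def a_def deriv_symbol_def norm_mult power_mult_distrib algebra_simps)
  qed
  show "integrable ?N F"
    by (rule Bochner_Integration.integrable_bound[OF i sqint_measurable[OF F]])
       (intro AE_I2, unfold real_norm_def, rule order_trans[OF le abs_ge_self])
  then have "(\<integral>\<xi>. cmod (F \<xi>) \<partial>?N) \<le> (\<integral>\<xi>. (cmod (F \<xi>))\<^sup>2 + (cmod (deriv_symbol \<xi> * F \<xi>))\<^sup>2 + 1 / (1 + \<xi>\<^sup>2) \<partial>?N)"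
    by (intro integral_mono i le) simp
  also have "\<dots> = nsq ?N F + nsq ?N (\<lambda>\<xi>. deriv_symbol \<xi> * F \<xi>) + (\<integral>\<xi>. 1 / (1 + \<xi>\<^sup>2) \<partial>?N)"
    unfolding nsq_def using sqint_integrable[OF F] sqint_integrable[OF dF] freq_weight_integrable[of X]
    by (simp only: Bochner_Integration.integral_add Bochner_Integration.integrable_add)
  finally show "(\<integral>\<xi>. cmod (F \<xi>) \<partial>?N) \<le> nsq ?N F + nsq ?N (\<lambda>\<xi>. deriv_symbol \<xi> * F \<xi>) + (\<integral>\<xi>. 1 / (1 + \<xi>\<^sup>2) \<partial>?N)" .
qed

text \<open>The bound passes through the integral of the modulus of the transform, which a symbol of
  modulus at most 1 does not increase. It therefore serves the Hilbert transform and the identity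
  alike.\<close>

lemma sobolev_multiplier_bounded:
  assumes F: "Ft (base_measure X) (freq_measure X) f F" and d: "sqint (freq_measure X) (\<lambda>\<xi>. deriv_symbol \<xi> * F \<xi>)"
    and r: "mulrel X m f g" and m: "m \<in> borel_measurable borel" "\<And>\<xi>. cmod (m \<xi>) \<le> 1"
  shows "AE x in lebesgue. cmod (g x) \<le> nsq (freq_measure X) F + nsq (freq_measure X) (\<lambda>\<xi>. deriv_symbol \<xi> * F \<xi>)
       + (\<integral>\<xi>. 1 / (1 + \<xi>\<^sup>2) \<partial>freq_measure X)" (is "AE x in lebesgue. _ \<le> ?B")
proof (rule AE_base_periodic)
  let ?N = "freq_measure X"
  note L = sobolev_frequency_L1[OF FtD(2)[OF F] d]
  show "periodic_on X (\<lambda>x. cmod (g x) \<le> ?B)" using L2_D(1)[OF mulrelD(2)[OF r]] by (cases X) auto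
  note G = mulrel_transform[OF r F m(1)]
  have le: "cmod (m \<xi> * F \<xi>) \<le> cmod (F \<xi>)" for \<xi>
    using mult_right_mono[OF m(2)[of \<xi>], of "cmod (F \<xi>)"] by (simp add: norm_mult)
  have i: "integrable ?N (\<lambda>\<xi>. m \<xi> * F \<xi>)"
    by (rule Bochner_Integration.integrable_bound[OF L(1) sqint_measurable[OF FtD(2)[OF G]]]) (intro AE_I2 le)
  have "(\<integral>\<xi>. cmod (m \<xi> * F \<xi>) \<partial>?N) \<le> (\<integral>\<xi>. cmod (F \<xi>) \<partial>?N)"
    by (intro integral_mono integrable_norm i L(1) le)
  then have B: "(\<integral>\<xi>. cmod (m \<xi> * F \<xi>) \<partial>?N) \<le> ?B" using L(2) by (rule order_trans)
  show "AE x in base_measure X. cmod (g x) \<le> ?B"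
    using Ft_sup_bound[OF fourier_pair_base G i] by eventually_elim (rule order_trans[OF _ B])
qed

section \<open>Products and the identity of Cotlar\<close>

text \<open>Modulation in space is translation in frequency, and conjugation reflects. In this
  combination the convolution formula becomes an instance of Parseval.\<close>

lemma Ft_modulate:
  assumes g: "Ft (base_measure X) (freq_measure X) g G" and \<xi>: "\<xi> \<in> space (freq_measure X)"
  shows "Ft (base_measure X) (freq_measure X) (\<lambda>x. cnj (g x * wave x \<xi>)) (\<lambda>\<eta>. cnj (G (\<xi> - \<eta>)))"
  unfolding Ft_def
proof (intro conjI allI impI)
  let ?M = "base_measure X" and ?N = "freq_measure X"
  note sg = FtD(1)[OF g] and sG = FtD(2)[OF g]
  have wm: "(\<lambda>x. wave x \<xi>) \<in> borel_measurable ?M"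
    by (intro borel_measurable_wave borel_measurable_const reg_measureD(2) reg_base_measure)
  have "sqint ?M (\<lambda>x. wave x \<xi> * g x)"
    by (rule sqint_bdd_mult(1)[OF sg wm, where C = 1]) simp
  from sqint_cnj[OF this] show "sqint ?M (\<lambda>x. cnj (g x * wave x \<xi>))" by (simp add: mult.commute)
  show "sqint ?N (\<lambda>\<eta>. cnj (G (\<xi> - \<eta>)))" by (intro sqint_cnj sqint_freq_reflect \<xi> sG)
  fix K assume K: "integrable ?N K" "sqint ?N K"
  have Kr: "integrable ?N (\<lambda>\<eta>. cnj (K (\<xi> - \<eta>)))" "sqint ?N (\<lambda>\<eta>. cnj (K (\<xi> - \<eta>)))"
    using integral_freq_reflect(1)[OF \<xi> borel_measurable_integrable[OF K(1)]] K(1) sqint_cnj[OF sqint_freq_reflect(1)[OF \<xi> K(2)]]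
    by auto
  have tr: "ftr ?N (\<lambda>\<eta>. cnj (K (\<xi> - \<eta>))) x = wave x \<xi> * cnj (ftr ?N K x)" for x
  proof -
    have m: "(\<lambda>\<eta>. wave (\<xi> - \<eta>) x * cnj (K \<eta>)) \<in> borel_measurable ?N"
      by (intro borel_measurable_times borel_measurable_wave borel_measurable_diff borel_measurable_const
        reg_measureD(2) reg_freq_measure borel_measurable_cnj borel_measurable_integrable K)
    have "ftr ?N (\<lambda>\<eta>. cnj (K (\<xi> - \<eta>))) x = (\<integral>\<eta>. wave (\<xi> - (\<xi> - \<eta>)) x * cnj (K (\<xi> - \<eta>)) \<partial>?N)"
      by (simp add: ftr_def)
    also have "\<dots> = (\<integral>\<eta>. wave (\<xi> - \<eta>) x * cnj (K \<eta>) \<partial>?N)"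
      by (rule integral_freq_reflect(2)[OF \<xi> m])
    also have "\<dots> = (\<integral>\<eta>. wave x \<xi> * cnj (wave \<eta> x * K \<eta>) \<partial>?N)"
      by (intro Bochner_Integration.integral_cong refl) (simp add: wave_diff wave_commute[of x \<xi>])
    also have "\<dots> = wave x \<xi> * cnj (ftr ?N K x)"
      unfolding ftr_def integral_mult_right_zero Bochner_Integration.integral_cnj ..
    finally show ?thesis .
  qed
  have m: "(\<lambda>\<eta>. cnj (G \<eta>) * K (\<xi> - \<eta>)) \<in> borel_measurable ?N"
    using sqint_measurable[OF sG] borel_measurable_cnj[OF borel_measurable_integrable[OF Kr(1)]]
    by (intro borel_measurable_times borel_measurable_cnj) auto
  have "(\<integral>\<eta>. cnj (G (\<xi> - \<eta>)) * K \<eta> \<partial>?N) = (\<integral>\<eta>. cnj (G (\<xi> - \<eta>)) * K (\<xi> - (\<xi> - \<eta>)) \<partial>?N)" by simp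
  also have "\<dots> = (\<integral>\<eta>. cnj (G \<eta>) * K (\<xi> - \<eta>) \<partial>?N)" by (rule integral_freq_reflect(2)[OF \<xi> m])
  also have "\<dots> = (\<integral>\<eta>. cnj (G \<eta> * cnj (K (\<xi> - \<eta>))) \<partial>?N)" by simp
  also have "\<dots> = cnj (\<integral>\<eta>. G \<eta> * cnj (K (\<xi> - \<eta>)) \<partial>?N)" by (rule Bochner_Integration.integral_cnj)
  also have "(\<integral>\<eta>. G \<eta> * cnj (K (\<xi> - \<eta>)) \<partial>?N) = (\<integral>x. g x * (wave x \<xi> * cnj (ftr ?N K x)) \<partial>?M)"
    unfolding FtD(3)[OF g Kr] tr ..
  also have "cnj \<dots> = (\<integral>x. cnj (g x * (wave x \<xi> * cnj (ftr ?N K x))) \<partial>?M)"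
    by (rule Bochner_Integration.integral_cnj[symmetric])
  also have "\<dots> = (\<integral>x. cnj (g x * wave x \<xi>) * ftr ?N K x \<partial>?M)" by (simp add: mult.assoc)
  finally show "(\<integral>\<eta>. cnj (G (\<xi> - \<eta>)) * K \<eta> \<partial>?N) = (\<integral>x. cnj (g x * wave x \<xi>) * ftr ?N K x \<partial>?M)" .
qed

text \<open>Parseval for \<open>f\<close> against the modulated conjugate of \<open>g\<close>. The
  product is merely integrable here, so its transform is the integral \<open>ftr\<close>, and the
  convolution is formed at each single frequency.\<close>

lemma ftr_product:
  assumes f: "Ft (base_measure X) (freq_measure X) f F" and g: "Ft (base_measure X) (freq_measure X) g G"
    and \<xi>: "\<xi> \<in> space (freq_measure X)"
  shows "2 * pi * ftr (base_measure X) (\<lambda>x. f x * g x) \<xi> = (\<integral>\<eta>. F \<eta> * G (\<xi> - \<eta>) \<partial>freq_measure X)"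
    and "integrable (freq_measure X) (\<lambda>\<eta>. F \<eta> * G (\<xi> - \<eta>))"
proof -
  have "(\<integral>\<eta>. F \<eta> * cnj (cnj (G (\<xi> - \<eta>))) \<partial>freq_measure X)
      = 2 * pi * (\<integral>x. f x * cnj (cnj (g x * wave x \<xi>)) \<partial>base_measure X)"
    by (rule Ft_parseval[OF fourier_pair_base f Ft_modulate[OF g \<xi>]])
  moreover have "(\<integral>x. f x * cnj (cnj (g x * wave x \<xi>)) \<partial>base_measure X) = ftr (base_measure X) (\<lambda>x. f x * g x) \<xi>"
    unfolding ftr_def by (intro Bochner_Integration.integral_cong refl) simp
  ultimately show "2 * pi * ftr (base_measure X) (\<lambda>x. f x * g x) \<xi> = (\<integral>\<eta>. F \<eta> * G (\<xi> - \<eta>) \<partial>freq_measure X)" by simp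
  show "integrable (freq_measure X) (\<lambda>\<eta>. F \<eta> * G (\<xi> - \<eta>))"
    by (rule sqint_prod[OF FtD(2)[OF f] sqint_freq_reflect(1)[OF \<xi> FtD(2)[OF g]]])
qed

text \<open>The clause concerns one frequency: it is empty on the line, where 0 is a null set, and
  says on the circle that the zeroth coefficient vanishes.\<close>

definition zero_mean :: "base \<Rightarrow> (real \<Rightarrow> complex) \<Rightarrow> bool" where
  "zero_mean X f \<longleftrightarrow> (\<exists>F. Ft (base_measure X) (freq_measure X) f F \<and> (AE \<xi> in freq_measure X. \<xi> = 0 \<longrightarrow> F \<xi> = 0))"

lemma zero_mean_line: "f \<in> L2 Line \<Longrightarrow> zero_mean Line f"
proof -
  assume f: "f \<in> L2 Line"
  have "AE \<xi> in freq_measure Line. \<xi> = 0 \<longrightarrow> (complex_of_real (fourier_const Line) * fourier Line f \<xi>) = 0"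
  proof -
    have "AE \<xi> in lebesgue. \<xi> \<noteq> (0::real)" by (rule AE_completion[OF AE_lborel_singleton])
    then show ?thesis unfolding freq_measure.simps by eventually_elim simp
  qed
  then show ?thesis unfolding zero_mean_def using Ft_fourier[OF f] by blast
qed

lemma zero_mean_derivative: "mulrel X deriv_symbol a f \<Longrightarrow> zero_mean X f"
  unfolding mulrel_def zero_mean_def by (force simp: deriv_symbol_def)

lemma zero_mean_transform:
  assumes "zero_mean X f" "Ft (base_measure X) (freq_measure X) f F"
  shows "AE \<xi> in freq_measure X. \<xi> = 0 \<longrightarrow> F \<xi> = 0"
proof -
  obtain F' where F': "Ft (base_measure X) (freq_measure X) f F'" "AE \<xi> in freq_measure X. \<xi> = 0 \<longrightarrow> F' \<xi> = 0"
    using assms(1) by (auto simp: zero_mean_def)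
  show ?thesis using F'(2) Ft_unique[OF fourier_pair_base F'(1) assms(2)] by eventually_elim auto
qed

text \<open>On the circle the Hilbert transform annihilates constants, so a function with a zero mode is not recovered.\<close>

lemma hilbert_involution:
  assumes "mulrel X hilbert_symbol f g" "mulrel X hilbert_symbol g h" "zero_mean X f"
  shows "AE x in lebesgue. h x = - f x"
proof (rule L2_AE_eq)
  note P = fourier_pair_base[of X]
  show "h \<in> L2 X" using assms by (auto simp: mulrel_def)
  have f: "f \<in> L2 X" using assms by (auto simp: mulrel_def)
  show "(\<lambda>x. - f x) \<in> L2 X" using L2_cmult[OF f, of "-1"] by simp
  note F = Ft_fourier[OF f]
  define F' where "F' \<xi> = complex_of_real (fourier_const X) * fourier X f \<xi>" for \<xi>
  have F': "Ft (base_measure X) (freq_measure X) f F'" unfolding F'_def by (rule F)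
  have H: "Ft (base_measure X) (freq_measure X) h (\<lambda>\<xi>. (hilbert_symbol \<xi> * hilbert_symbol \<xi>) * F' \<xi>)"
    by (rule mulrel_transform[OF mulrel_comp[OF assms(1,2) hilbert_symbol_measurable] F'])
       (intro borel_measurable_times hilbert_symbol_measurable)
  have "AE \<xi> in freq_measure X. (hilbert_symbol \<xi> * hilbert_symbol \<xi>) * F' \<xi> = (- 1) * F' \<xi>"
    using zero_mean_transform[OF assms(3) F']
    by eventually_elim (auto simp: hilbert_symbol_def sgn_if)
  from Ft_inj[OF P H Ft_cmult[OF P F', of "-1"] this]
  show "AE x in base_measure X. h x = - f x" by simp
qed

text \<open>In terms of signs, \<open>sgn (a + b) * (sgn a + sgn b) = 1 + sgn a * sgn b\<close>.
  When both arguments are 0 the left side is 0 and the right side 1, which is where a zero mode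
  would do damage.\<close>

lemma hilbert_symbol_identity:
  assumes "a \<noteq> 0 \<or> b \<noteq> 0"
  shows "hilbert_symbol (a + b) * (hilbert_symbol a + hilbert_symbol b) = hilbert_symbol a * hilbert_symbol b - 1"
  using assms unfolding hilbert_symbol_def
  by (cases "a > 0"; cases "a < 0"; cases "b > 0"; cases "b < 0"; cases "a + b > 0"; cases "a + b < 0")
     (auto simp: sgn_if algebra_simps)

text \<open>The sign identity with arguments \<open>\<eta>\<close> and
  \<open>\<xi> - \<eta>\<close>, integrated against \<open>F \<eta> * G (\<xi> - \<eta>)\<close>;
  the vanishing zero mode of \<open>f\<close> disposes of \<open>\<eta> = 0\<close>. The bounds on
  \<open>f\<close> and \<open>f'\<close> keep the products square integrable.\<close>

lemma cotlar_identity: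
  assumes rf: "mulrel X hilbert_symbol f f'" and rg: "mulrel X hilbert_symbol g g'" and z: "zero_mean X f"
    and b: "AE x in lebesgue. cmod (f x) \<le> C" "AE x in lebesgue. cmod (f' x) \<le> C"
  shows "mulrel X hilbert_symbol (\<lambda>x. f x * g' x + f' x * g x) (\<lambda>x. f' x * g' x - f x * g x)"
proof -
  let ?M = "base_measure X" and ?N = "freq_measure X"
  note P = fourier_pair_base[of X]
  note f = mulrelD(1)[OF rf] and f' = mulrelD(2)[OF rf] and g = mulrelD(1)[OF rg] and g' = mulrelD(2)[OF rg]
  obtain F where F: "Ft ?M ?N f F" "Ft ?M ?N f' (\<lambda>\<xi>. hilbert_symbol \<xi> * F \<xi>)" using rf by (auto simp: mulrel_def)
  obtain G where G: "Ft ?M ?N g G" "Ft ?M ?N g' (\<lambda>\<xi>. hilbert_symbol \<xi> * G \<xi>)" using rg by (auto simp: mulrel_def)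
  have F0: "AE \<eta> in ?N. \<eta> = 0 \<longrightarrow> F \<eta> = 0" by (rule zero_mean_transform[OF z F(1)])
  define u where "u x = f x * g' x + f' x * g x" for x
  define w where "w x = f' x * g' x - f x * g x" for x
  note bm = L2_bdd_mult[OF _ L2_D(1,2)[OF f] b(1)] L2_bdd_mult[OF _ L2_D(1,2)[OF f'] b(2)]
  have uL: "u \<in> L2 X" unfolding u_def by (rule L2_add[OF bm(1)[OF g'] bm(2)[OF g]])
  have wL: "w \<in> L2 X" unfolding w_def by (rule L2_diff[OF bm(2)[OF g'] bm(1)[OF g]])
  have i: "integrable ?M (\<lambda>x. f x * g' x)" "integrable ?M (\<lambda>x. f' x * g x)" "integrable ?M (\<lambda>x. f' x * g' x)" "integrable ?M (\<lambda>x. f x * g x)"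
    using f f' g g' by (auto intro!: sqint_prod simp: L2_iff)
  have ui: "integrable ?M u" unfolding u_def by (rule Bochner_Integration.integrable_add[OF i(1,2)])
  have wi: "integrable ?M w" unfolding w_def by (rule Bochner_Integration.integrable_diff[OF i(3,4)])
  have Fu: "Ft ?M ?N u (ftr ?M u)" by (rule Ft_ftr[OF P ui L2_D(3)[OF uL]])
  have Fw: "Ft ?M ?N w (ftr ?M w)" by (rule Ft_ftr[OF P wi L2_D(3)[OF wL]])
  have eq: "ftr ?M w \<xi> = hilbert_symbol \<xi> * ftr ?M u \<xi>" if xi: "\<xi> \<in> space ?N" for \<xi>
  proof -
    let ?h = hilbert_symbol
    note p1 = ftr_product[OF F(1) G(2) xi] and p2 = ftr_product[OF F(2) G(1) xi]
      and p3 = ftr_product[OF F(2) G(2) xi] and p4 = ftr_product[OF F(1) G(1) xi]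
    have U: "2 * pi * ftr ?M u \<xi> = (\<integral>\<eta>. F \<eta> * (?h (\<xi> - \<eta>) * G (\<xi> - \<eta>)) + ?h \<eta> * F \<eta> * G (\<xi> - \<eta>) \<partial>?N)"
      unfolding u_def ftr_add[OF reg_base_measure i(1,2)] distrib_left p1(1) p2(1)
      by (rule Bochner_Integration.integral_add[OF p1(2) p2(2), symmetric])
    have W: "2 * pi * ftr ?M w \<xi> = (\<integral>\<eta>. ?h \<eta> * F \<eta> * (?h (\<xi> - \<eta>) * G (\<xi> - \<eta>)) - F \<eta> * G (\<xi> - \<eta>) \<partial>?N)"
      unfolding w_def ftr_diff[OF reg_base_measure i(3,4)] right_diff_distrib p3(1) p4(1)
      by (rule Bochner_Integration.integral_diff[OF p3(2) p4(2), symmetric])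
    have "(\<integral>\<eta>. ?h \<eta> * F \<eta> * (?h (\<xi> - \<eta>) * G (\<xi> - \<eta>)) - F \<eta> * G (\<xi> - \<eta>) \<partial>?N)
       = (\<integral>\<eta>. ?h \<xi> * (F \<eta> * (?h (\<xi> - \<eta>) * G (\<xi> - \<eta>)) + ?h \<eta> * F \<eta> * G (\<xi> - \<eta>)) \<partial>?N)"
    proof (rule integral_cong_AE)
      show "(\<lambda>\<eta>. ?h \<eta> * F \<eta> * (?h (\<xi> - \<eta>) * G (\<xi> - \<eta>)) - F \<eta> * G (\<xi> - \<eta>)) \<in> borel_measurable ?N"
        by (intro borel_measurable_integrable Bochner_Integration.integrable_diff p3(2) p4(2))
      show "(\<lambda>\<eta>. ?h \<xi> * (F \<eta> * (?h (\<xi> - \<eta>) * G (\<xi> - \<eta>)) + ?h \<eta> * F \<eta> * G (\<xi> - \<eta>))) \<in> borel_measurable ?N"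
        by (intro borel_measurable_integrable integrable_mult_right Bochner_Integration.integrable_add p1(2) p2(2))
      show "AE \<eta> in ?N. ?h \<eta> * F \<eta> * (?h (\<xi> - \<eta>) * G (\<xi> - \<eta>)) - F \<eta> * G (\<xi> - \<eta>)
         = ?h \<xi> * (F \<eta> * (?h (\<xi> - \<eta>) * G (\<xi> - \<eta>)) + ?h \<eta> * F \<eta> * G (\<xi> - \<eta>))"
        using F0
      proof eventually_elim
        case (elim \<eta>)
        show ?case
        proof (cases "\<eta> = 0")
          case True
          then show ?thesis using elim by simp
        next
          case False
          have s: "?h \<xi> * (?h \<eta> + ?h (\<xi> - \<eta>)) = ?h \<eta> * ?h (\<xi> - \<eta>) - 1"
            using hilbert_symbol_identity[of \<eta> "\<xi> - \<eta>"] False by simp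
          have "?h \<xi> * (F \<eta> * (?h (\<xi> - \<eta>) * G (\<xi> - \<eta>)) + ?h \<eta> * F \<eta> * G (\<xi> - \<eta>))
             = (?h \<xi> * (?h \<eta> + ?h (\<xi> - \<eta>))) * (F \<eta> * G (\<xi> - \<eta>))" by (simp add: algebra_simps)
          also have "\<dots> = ?h \<eta> * F \<eta> * (?h (\<xi> - \<eta>) * G (\<xi> - \<eta>)) - F \<eta> * G (\<xi> - \<eta>)"
            unfolding s by (simp add: algebra_simps)
          finally show ?thesis by simp
        qed
      qed
    qed
    also have "\<dots> = ?h \<xi> * (2 * pi * ftr ?M u \<xi>)" unfolding U integral_mult_right_zero ..
    finally have "2 * pi * ftr ?M w \<xi> = 2 * pi * (?h \<xi> * ftr ?M u \<xi>)" unfolding W by (simp only: mult_ac)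
    then show ?thesis by simp
  qed
  have "Ft ?M ?N w (\<lambda>\<xi>. hilbert_symbol \<xi> * ftr ?M u \<xi>)"
  proof (rule Ft_cong[OF P Fw])
    show "AE \<xi> in ?N. ftr ?M w \<xi> = hilbert_symbol \<xi> * ftr ?M u \<xi>" by (intro AE_I2 eq)
    show "w \<in> borel_measurable ?M" by (rule sqint_measurable[OF L2_D(3)[OF wL]])
    show "(\<lambda>\<xi>. hilbert_symbol \<xi> * ftr ?M u \<xi>) \<in> borel_measurable ?N"
      by (intro borel_measurable_times freq_measurable hilbert_symbol_measurable sqint_measurable[OF FtD(2)[OF Fu]])
  qed simp
  then have "mulrel X hilbert_symbol u w" unfolding mulrel_def using uL wL Fu by blast
  then show ?thesis unfolding u_def w_def .
qed

section \<open>Vector-valued operators\<close>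

text \<open>The Hilbert transform normalised to the symbol \<open>- \<i> * sgn \<xi>\<close> on both
  domains.\<close>

definition hil :: "base \<Rightarrow> (real \<Rightarrow> complex^2) \<Rightarrow> real \<Rightarrow> complex^2" where
  "hil X \<phi> x = (1 / hilbert_const X) *\<^sub>R hilbert X \<phi> x"

lemma hilbert_const_nonzero: "hilbert_const X \<noteq> 0"
  by (cases X) auto

lemma hilbert_hil: "hilbert X \<phi> x = hilbert_const X *\<^sub>R hil X \<phi> x"
  unfolding hil_def using hilbert_const_nonzero[of X] by simp

lemma matrix_vector_2: "((M :: complex^2^2) *v v) $ i = M $ i $ 1 * v $ 1 + M $ i $ 2 * v $ 2"
  by (simp add: matrix_vector_mult_def sum_2)

lemma vec_mulrel_measurable_cong:
  assumes "vec_mulrel X m \<phi> \<psi>" "AE x in lebesgue. \<psi> x = \<psi>' x" "periodic_on X \<psi>'"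
  shows "vec_mulrel X m \<phi> \<psi>'"
  unfolding vec_mulrel_def
proof
  fix i
  have "periodic_on X (\<lambda>x. \<phi> x $ i)" using vec_L2_D(3)[OF vec_mulrelD(1)[OF assms(1)]] L2_D(1) by blast
  moreover have "periodic_on X (\<lambda>x. \<psi>' x $ i)" using assms(3) by (cases X) auto
  ultimately show "mulrel X m (\<lambda>x. \<phi> x $ i) (\<lambda>x. \<psi>' x $ i)"
    using mulrel_cong[OF vec_mulrelD(3)[OF assms(1)], of i "\<lambda>x. \<phi> x $ i" "\<lambda>x. \<psi>' x $ i"] assms(2)
    unfolding vec_AE_iff by blast
qed

lemma hil_mulrel:
  assumes "vec_L2 X \<phi>" shows "vec_mulrel X hilbert_symbol \<phi> (hil X \<phi>)"
proof -
  have "\<exists>g. mulrel X hilbert_symbol (\<lambda>x. \<phi> x $ i) g" for i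
    using mulrel_exists_bdd[OF vec_L2_D(3)[OF assms] hilbert_symbol_measurable norm_hilbert_symbol] by blast
  then obtain g where g: "\<And>i. mulrel X hilbert_symbol (\<lambda>x. \<phi> x $ i) (g i)" by metis
  define \<psi> :: "real \<Rightarrow> complex^2" where "\<psi> x = (\<chi> i. g i x)" for x
  have r: "vec_mulrel X hilbert_symbol \<phi> \<psi>" unfolding vec_mulrel_def \<psi>_def using g by simp
  have "AE x in lebesgue. \<psi> x = hil X \<phi> x"
    using hilbert_vec_mulrel_AE[OF r] by eventually_elim (simp add: hil_def hilbert_const_nonzero)
  moreover have "periodic_on X (hil X \<phi>)"
    using hilbert_periodic[OF vec_L2_D(1,2)[OF assms]] unfolding hil_def[abs_def] by (cases X) (auto simp del: hilbert.simps)
  ultimately show ?thesis by (rule vec_mulrel_measurable_cong[OF r])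
qed

lemma hil_L2: "vec_L2 X \<phi> \<Longrightarrow> vec_L2 X (hil X \<phi>)"
  using vec_mulrelD(2)[OF hil_mulrel] .

lemma vec_mulrel_unique:
  assumes "vec_mulrel X m \<phi> \<psi>" "vec_mulrel X m \<phi>' \<psi>'" "AE x in lebesgue. \<phi> x = \<phi>' x" "m \<in> borel_measurable borel"
  shows "AE x in lebesgue. \<psi> x = \<psi>' x"
  unfolding vec_AE_iff
  using mulrel_unique[OF vec_mulrelD(3)[OF assms(1)] vec_mulrelD(3)[OF assms(2)] _ assms(4)] assms(3)
  unfolding vec_AE_iff by blast

lemma hil_unique:
  assumes "vec_mulrel X hilbert_symbol \<phi> \<psi>"
  shows "AE x in lebesgue. hil X \<phi> x = \<psi> x"
  by (rule vec_mulrel_unique[OF hil_mulrel[OF vec_mulrelD(1)[OF assms]] assms _ hilbert_symbol_measurable]) simp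

lemma vec_L2_add: "vec_L2 X \<phi> \<Longrightarrow> vec_L2 X \<psi> \<Longrightarrow> vec_L2 X (\<lambda>x. \<phi> x + \<psi> x)"
  and vec_L2_diff: "vec_L2 X \<phi> \<Longrightarrow> vec_L2 X \<psi> \<Longrightarrow> vec_L2 X (\<lambda>x. \<phi> x - \<psi> x)"
  and vec_L2_cmult: "vec_L2 X \<phi> \<Longrightarrow> vec_L2 X (\<lambda>x. c *s \<phi> x)"
  unfolding vec_L2_def by (auto intro: L2_add L2_diff L2_cmult)

lemma vec_mulrel_add:
  "vec_mulrel X m \<phi> \<psi> \<Longrightarrow> vec_mulrel X m \<phi>' \<psi>' \<Longrightarrow> m \<in> borel_measurable borel \<Longrightarrow>
    vec_mulrel X m (\<lambda>x. \<phi> x + \<phi>' x) (\<lambda>x. \<psi> x + \<psi>' x)"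
  and vec_mulrel_diff:
  "vec_mulrel X m \<phi> \<psi> \<Longrightarrow> vec_mulrel X m \<phi>' \<psi>' \<Longrightarrow> m \<in> borel_measurable borel \<Longrightarrow>
    vec_mulrel X m (\<lambda>x. \<phi> x - \<phi>' x) (\<lambda>x. \<psi> x - \<psi>' x)"
  and vec_mulrel_cmult: "vec_mulrel X m \<phi> \<psi> \<Longrightarrow> vec_mulrel X m (\<lambda>x. c *s \<phi> x) (\<lambda>x. c *s \<psi> x)"
  unfolding vec_mulrel_def by (auto intro: mulrel_add mulrel_diff mulrel_cmult)

lemma hil_cong:
  assumes "vec_L2 X \<phi>" "vec_L2 X \<psi>" "AE x in lebesgue. \<phi> x = \<psi> x"
  shows "AE x in lebesgue. hil X \<phi> x = hil X \<psi> x"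
  by (rule vec_mulrel_unique[OF hil_mulrel hil_mulrel assms(3) hilbert_symbol_measurable]) (fact assms)+

lemma hil_add:
  assumes "vec_L2 X \<phi>" "vec_L2 X \<psi>"
  shows "AE x in lebesgue. hil X (\<lambda>x. \<phi> x + \<psi> x) x = hil X \<phi> x + hil X \<psi> x"
  by (rule hil_unique[OF vec_mulrel_add[OF hil_mulrel hil_mulrel hilbert_symbol_measurable]]) (fact assms)+

lemma hil_diff:
  assumes "vec_L2 X \<phi>" "vec_L2 X \<psi>"
  shows "AE x in lebesgue. hil X (\<lambda>x. \<phi> x - \<psi> x) x = hil X \<phi> x - hil X \<psi> x"
  by (rule hil_unique[OF vec_mulrel_diff[OF hil_mulrel hil_mulrel hilbert_symbol_measurable]]) (fact assms)+

lemma hil_cmult: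
  assumes "vec_L2 X \<phi>"
  shows "AE x in lebesgue. hil X (\<lambda>x. c *s \<phi> x) x = c *s hil X \<phi> x"
  by (rule hil_unique[OF vec_mulrel_cmult[OF hil_mulrel[OF assms]]])

text \<open>A derivative has no zero mode, so on both domains the normalised transform squares to
  \<open>-1\<close> on it.\<close>

lemma hil_hil_derivative:
  assumes "vec_mulrel X deriv_symbol \<phi> \<phi>'"
  shows "AE x in lebesgue. hil X (hil X \<phi>') x = - \<phi>' x"
  unfolding vec_AE_iff
proof
  fix i
  note L = vec_mulrelD(2)[OF assms]
  show "AE x in lebesgue. hil X (hil X \<phi>') x $ i = (- \<phi>' x) $ i"
    using hilbert_involution[OF vec_mulrelD(3)[OF hil_mulrel[OF L]] vec_mulrelD(3)[OF hil_mulrel[OF hil_L2[OF L]]]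
       zero_mean_derivative[OF vec_mulrelD(3)[OF assms]], of i] by simp
qed

lemma hil_derivative:
  assumes "vec_mulrel X deriv_symbol \<phi> \<phi>'"
  shows "vec_mulrel X deriv_symbol (hil X \<phi>) (hil X \<phi>')"
  unfolding vec_mulrel_def
proof
  fix i
  note r = vec_mulrelD(3)[OF assms, of i] and h = vec_mulrelD(3)[OF hil_mulrel[OF vec_mulrelD(1)[OF assms]], of i]
    and h' = vec_mulrelD(3)[OF hil_mulrel[OF vec_mulrelD(2)[OF assms]], of i]
  obtain F where F: "Ft (base_measure X) (freq_measure X) (\<lambda>x. \<phi> x $ i) F"
    "Ft (base_measure X) (freq_measure X) (\<lambda>x. \<phi>' x $ i) (\<lambda>\<xi>. deriv_symbol \<xi> * F \<xi>)"
    using r by (auto simp: mulrel_def)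
  have "Ft (base_measure X) (freq_measure X) (\<lambda>x. hil X \<phi>' x $ i) (\<lambda>\<xi>. deriv_symbol \<xi> * (hilbert_symbol \<xi> * F \<xi>))"
    using mulrel_transform[OF h' F(2) hilbert_symbol_measurable] by (simp add: mult.left_commute)
  then show "mulrel X deriv_symbol (\<lambda>x. hil X \<phi> x $ i) (\<lambda>x. hil X \<phi>' x $ i)"
    using mulrel_transform[OF h F(1) hilbert_symbol_measurable] mulrelD(2)[OF h] mulrelD(2)[OF h'] unfolding mulrel_def by blast
qed

text \<open>The bound holds almost everywhere because coefficients such as \<open>G\<close> arise as
  images under a multiplier.\<close>

definition bdd_coeff :: "base \<Rightarrow> (real \<Rightarrow> complex^2^2) \<Rightarrow> bool" where
  "bdd_coeff X M \<longleftrightarrow> (\<forall>i j. periodic_on X (\<lambda>x. M x $ i $ j) \<and> (\<lambda>x. M x $ i $ j) \<in> borel_measurable lebesgue \<and>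
     (\<exists>C. AE x in lebesgue. cmod (M x $ i $ j) \<le> C))"

lemma bdd_coeff_mult:
  assumes "bdd_coeff X M" "vec_L2 X \<phi>" shows "vec_L2 X (\<lambda>x. M x *v \<phi> x)"
proof -
  have "(\<lambda>x. M x $ i $ j * \<phi> x $ j) \<in> L2 X" for i j
  proof -
    obtain C where "AE x in lebesgue. cmod (M x $ i $ j) \<le> C" using assms(1) unfolding bdd_coeff_def by blast
    then show ?thesis
      using assms(1) unfolding bdd_coeff_def by (intro L2_bdd_mult[OF vec_L2_D(3)[OF assms(2)]]) auto
  qed
  then show ?thesis unfolding vec_L2_def matrix_vector_2 by (intro allI L2_add)
qed

text \<open>On the line only the derivative of a coefficient is square integrable, not the coefficient itself.\<close>

definition smooth_coeff :: "base \<Rightarrow> (real \<Rightarrow> complex) \<Rightarrow> (real \<Rightarrow> complex) \<Rightarrow> bool" where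
  "smooth_coeff X a a' \<longleftrightarrow> periodic_on X a \<and> periodic_on X a' \<and> (\<forall>x. (a has_vector_derivative a' x) (at x)) \<and>
     (\<exists>C. \<forall>x. cmod (a x) \<le> C) \<and> (\<exists>C. \<forall>x. cmod (a' x) \<le> C) \<and> a' \<in> borel_measurable lebesgue \<and>
     (\<exists>a''. mulrel X deriv_symbol a' a'') \<and> zero_mean X a'"

lemma smooth_coeffD:
  assumes "smooth_coeff X a a'"
  shows "periodic_on X a" "periodic_on X a'" "(a has_vector_derivative a' x) (at x)"
    "a' \<in> borel_measurable lebesgue" "zero_mean X a'" "a' \<in> L2 X" "a \<in> borel_measurable lebesgue"
proof -
  show "periodic_on X a" "periodic_on X a'" "(a has_vector_derivative a' x) (at x)"
    "a' \<in> borel_measurable lebesgue" "zero_mean X a'" "a' \<in> L2 X"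
    using assms mulrelD(1) by (auto simp: smooth_coeff_def)
  have "isCont a x" for x using assms has_vector_derivative_continuous unfolding smooth_coeff_def by blast
  then have "continuous_on UNIV a" by (intro continuous_at_imp_continuous_on) auto
  then show "a \<in> borel_measurable lebesgue"
    by (intro measurable_completion) (use borel_measurable_continuous_onI in simp)
qed

lemma zero_mean_add:
  assumes "zero_mean X f" "zero_mean X g" shows "zero_mean X (\<lambda>x. f x + g x)"
proof -
  obtain F G where F: "Ft (base_measure X) (freq_measure X) f F" "AE \<xi> in freq_measure X. \<xi> = 0 \<longrightarrow> F \<xi> = 0"
    and G: "Ft (base_measure X) (freq_measure X) g G" "AE \<xi> in freq_measure X. \<xi> = 0 \<longrightarrow> G \<xi> = 0"
    using assms by (auto simp: zero_mean_def)
  have "AE \<xi> in freq_measure X. \<xi> = 0 \<longrightarrow> F \<xi> + G \<xi> = 0" using F(2) G(2) by eventually_elim auto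
  then show ?thesis unfolding zero_mean_def using Ft_add[OF fourier_pair_base F(1) G(1)] by blast
qed

lemma zero_mean_cmult:
  assumes "zero_mean X f" shows "zero_mean X (\<lambda>x. c * f x)"
proof -
  obtain F where F: "Ft (base_measure X) (freq_measure X) f F" "AE \<xi> in freq_measure X. \<xi> = 0 \<longrightarrow> F \<xi> = 0"
    using assms by (auto simp: zero_mean_def)
  have "AE \<xi> in freq_measure X. \<xi> = 0 \<longrightarrow> c * F \<xi> = 0" using F(2) by eventually_elim auto
  then show ?thesis unfolding zero_mean_def using Ft_cmult[OF fourier_pair_base F(1)] by blast
qed

lemma smooth_coeff_add:
  assumes "smooth_coeff X a a'" "smooth_coeff X b b'"
  shows "smooth_coeff X (\<lambda>x. a x + b x) (\<lambda>x. a' x + b' x)"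
proof -
  obtain A A' B B' where bd: "\<And>x. cmod (a x) \<le> A" "\<And>x. cmod (a' x) \<le> A'" "\<And>x. cmod (b x) \<le> B" "\<And>x. cmod (b' x) \<le> B'"
    using assms unfolding smooth_coeff_def by metis
  obtain a'' b'' where d: "mulrel X deriv_symbol a' a''" "mulrel X deriv_symbol b' b''"
    using assms unfolding smooth_coeff_def by metis
  have "cmod (a x + b x) \<le> A + B" "cmod (a' x + b' x) \<le> A' + B'" for x
    using norm_triangle_mono bd by blast+
  moreover have "periodic_on X (\<lambda>x. a x + b x)" "periodic_on X (\<lambda>x. a' x + b' x)"
    using smooth_coeffD(1,2)[OF assms(1)] smooth_coeffD(1,2)[OF assms(2)] by (cases X; auto)+
  moreover have "((\<lambda>x. a x + b x) has_vector_derivative a' x + b' x) (at x)" for x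
    by (intro has_vector_derivative_add smooth_coeffD(3)[OF assms(1)] smooth_coeffD(3)[OF assms(2)])
  moreover have "(\<lambda>x. a' x + b' x) \<in> borel_measurable lebesgue"
    by (intro borel_measurable_add smooth_coeffD(4)[OF assms(1)] smooth_coeffD(4)[OF assms(2)])
  ultimately show ?thesis
    unfolding smooth_coeff_def
    using mulrel_add[OF d deriv_symbol_measurable] zero_mean_add[OF smooth_coeffD(5)[OF assms(1)] smooth_coeffD(5)[OF assms(2)]]
    by blast
qed

lemma smooth_coeff_cmult:
  assumes "smooth_coeff X a a'"
  shows "smooth_coeff X (\<lambda>x. c * a x) (\<lambda>x. c * a' x)"
proof -
  obtain A A' where bd: "\<And>x. cmod (a x) \<le> A" "\<And>x. cmod (a' x) \<le> A'"
    using assms unfolding smooth_coeff_def by metis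
  obtain a'' where d: "mulrel X deriv_symbol a' a''"
    using assms unfolding smooth_coeff_def by metis
  have "cmod (c * a x) \<le> cmod c * A" "cmod (c * a' x) \<le> cmod c * A'" for x
    unfolding norm_mult by (intro mult_left_mono bd norm_ge_zero)+
  moreover have "periodic_on X (\<lambda>x. c * a x)" "periodic_on X (\<lambda>x. c * a' x)"
    using smooth_coeffD(1,2)[OF assms] by (cases X; auto)+
  moreover have "((\<lambda>x. c * a x) has_vector_derivative c * a' x) (at x)" for x
    using bounded_linear.has_vector_derivative[OF bounded_linear_mult_right smooth_coeffD(3)[OF assms]] .
  moreover have "(\<lambda>x. c * a' x) \<in> borel_measurable lebesgue"
    by (intro borel_measurable_times borel_measurable_const smooth_coeffD(4)[OF assms])
  ultimately show ?thesis
    unfolding smooth_coeff_def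
    using mulrel_cmult(1)[OF d] zero_mean_cmult[OF smooth_coeffD(5)[OF assms]]
    by blast
qed

lemma smooth_coeff_product:
  assumes "smooth_coeff X a a'" "mulrel X deriv_symbol f f'"
  shows "mulrel X deriv_symbol (\<lambda>x. a x * f x) (\<lambda>x. a' x * f x + a x * f' x)"
proof -
  obtain A A' where bd: "\<And>x. cmod (a x) \<le> A" "\<And>x. cmod (a' x) \<le> A'"
    using assms unfolding smooth_coeff_def by metis
  show ?thesis
    by (rule mulrel_product_rule[OF assms(2) smooth_coeffD(1)[OF assms(1)] smooth_coeffD(3)[OF assms(1)] bd
        smooth_coeffD(4)[OF assms(1)] smooth_coeffD(2)[OF assms(1)]])
qed

text \<open>The derivative of a coefficient has itself a weak derivative, so its image under a
  symbol of modulus at most 1 is bounded. This makes \<open>G\<close> a bounded coefficient.\<close>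

lemma smooth_coeff_hilbert_bounded:
  assumes "smooth_coeff X a a'" "mulrel X m a' g" "m \<in> borel_measurable borel" "\<And>\<xi>. cmod (m \<xi>) \<le> 1"
  shows "\<exists>C. AE x in lebesgue. cmod (g x) \<le> C"
proof -
  obtain a'' where d: "mulrel X deriv_symbol a' a''" using assms unfolding smooth_coeff_def by metis
  then obtain F where F: "Ft (base_measure X) (freq_measure X) a' F"
    "Ft (base_measure X) (freq_measure X) a'' (\<lambda>\<xi>. deriv_symbol \<xi> * F \<xi>)" by (auto simp: mulrel_def)
  from sobolev_multiplier_bounded[OF F(1) FtD(2)[OF F(2)] assms(2-4)] show ?thesis by blast
qed

text \<open>The constant 1 is square integrable on the circle. Fed into the product rule as the
  second factor, it turns a classical derivative of a periodic function into a weak one.\<close>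

lemma circle_one_derivative: "mulrel Circle deriv_symbol (\<lambda>_. 1) (\<lambda>_. 0)"
proof -
  have "finite_measure (base_measure Circle)" by (auto intro!: finite_measureI simp: emeasure_restrict_space)
  then have "integrable (base_measure Circle) (\<lambda>_. 1 :: real)" by (simp add: finite_measure.integrable_const)
  then have one: "(\<lambda>_. 1 :: complex) \<in> L2 Circle" unfolding L2_iff sqint_def by (simp del: base_measure.simps)
  show ?thesis by (rule diff_quot_limit_mulrel[OF one L2_zero]) (simp add: diff_quot_def nsq_def)
qed

text \<open>Reconciles the two readings of \<open>abs_grad_bdd\<close>: on the line the principal
  value integral of \<open>a'\<close>, on the circle the multiplier applied to \<open>a\<close>,
  which is square integrable there.\<close>

lemma smooth_coeff_abs_grad:
  assumes a: "smooth_coeff X a a'" and g: "mulrel X hilbert_symbol a' g"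
  shows "AE x in lebesgue. abs_grad_bdd X a x = g x" "periodic_on X (abs_grad_bdd X a)"
proof -
  have "(AE x in lebesgue. abs_grad_bdd X a x = g x) \<and> periodic_on X (abs_grad_bdd X a)"
  proof (cases X)
    case Line
    have "(\<lambda>x. vector_derivative a (at x)) = a'"
      using smooth_coeffD(3)[OF a] by (auto simp: fun_eq_iff vector_derivative_at)
    then show ?thesis using hilbert_mulrel_AE[OF g] Line by simp
  next
    case Circle
    have "mulrel X deriv_symbol (\<lambda>_. 1) (\<lambda>_. 0)" unfolding Circle by (rule circle_one_derivative)
    from smooth_coeff_product[OF a this] have "mulrel X deriv_symbol a a'" by simp
    from abs_grad_AE[OF this g] show ?thesis using L2_D(1)[of "abs_grad X a" X] unfolding Circle by simp
  qed
  then show "AE x in lebesgue. abs_grad_bdd X a x = g x" "periodic_on X (abs_grad_bdd X a)" by auto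
qed

section \<open>The Lax identity\<close>

text \<open>In the application \<open>A\<close> is the matrix of a map into the hyperbolic plane, so that \<open>A\<^sup>2 = -1\<close>, and \<open>G\<close> is \<open>|\<nabla>|A\<close>.\<close>

locale lax_coefficients =
  fixes X :: base and A A' G :: "real \<Rightarrow> complex^2^2"
  assumes smooth: "\<And>i j. smooth_coeff X (\<lambda>x. A x $ i $ j) (\<lambda>x. A' x $ i $ j)"
    and hilbert_G: "\<And>i j. mulrel X hilbert_symbol (\<lambda>x. A' x $ i $ j) (\<lambda>x. G x $ i $ j)"
    and square: "\<And>x v. A x *v (A x *v v) = - v"
    and anticommute: "\<And>x v. A' x *v (A x *v v) = - (A x *v (A' x *v v))"
begin

lemma bdd_A: "bdd_coeff X A" and bdd_A': "bdd_coeff X A'" and bdd_G: "bdd_coeff X G"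
proof -
  have "\<exists>C. AE x in lebesgue. cmod (A x $ i $ j) \<le> C" "\<exists>C. AE x in lebesgue. cmod (A' x $ i $ j) \<le> C" for i j
    using smooth[of i j] unfolding smooth_coeff_def by (metis AE_I2)+
  then show "bdd_coeff X A" "bdd_coeff X A'"
    unfolding bdd_coeff_def using smooth_coeffD[OF smooth] by blast+
  show "bdd_coeff X G"
    unfolding bdd_coeff_def
    using smooth_coeff_hilbert_bounded[OF smooth hilbert_G hilbert_symbol_measurable norm_hilbert_symbol] L2_D mulrelD(2)[OF hilbert_G]
    by blast
qed

lemmas AL = bdd_coeff_mult[OF bdd_A] and A'L = bdd_coeff_mult[OF bdd_A'] and GL = bdd_coeff_mult[OF bdd_G]

lemma product_rule:
  assumes "vec_mulrel X deriv_symbol \<phi> \<phi>'"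
  shows "vec_mulrel X deriv_symbol (\<lambda>x. A x *v \<phi> x) (\<lambda>x. A' x *v \<phi> x + A x *v \<phi>' x)"
  unfolding vec_mulrel_def
proof
  fix i
  show "mulrel X deriv_symbol (\<lambda>x. (A x *v \<phi> x) $ i) (\<lambda>x. (A' x *v \<phi> x + A x *v \<phi>' x) $ i)"
    using mulrel_add[OF smooth_coeff_product[OF smooth vec_mulrelD(3)[OF assms]] smooth_coeff_product[OF smooth vec_mulrelD(3)[OF assms]] deriv_symbol_measurable,
      of i 1 1 i 2 2]
    unfolding vector_add_component matrix_vector_2 by (simp add: add_ac)
qed

text \<open>The scalar identity for each matrix entry of \<open>A'\<close> and each component of
  \<open>\<phi>\<close>, summed along rows; the order of matrix and vector is never changed.\<close>

lemma cotlar: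
  assumes "vec_L2 X \<phi>"
  shows "AE x in lebesgue. hil X (\<lambda>x. A' x *v hil X \<phi> x) x = G x *v hil X \<phi> x - A' x *v \<phi> x - hil X (\<lambda>x. G x *v \<phi> x) x"
proof -
  note h = vec_mulrelD(3)[OF hil_mulrel[OF assms]]
  have c: "mulrel X hilbert_symbol (\<lambda>x. A' x $ i $ j * hil X \<phi> x $ j + G x $ i $ j * \<phi> x $ j)
     (\<lambda>x. G x $ i $ j * hil X \<phi> x $ j - A' x $ i $ j * \<phi> x $ j)" for i j
  proof -
    obtain C1 C2 where b: "AE x in lebesgue. cmod (A' x $ i $ j) \<le> C1" "AE x in lebesgue. cmod (G x $ i $ j) \<le> C2"
      using bdd_A' bdd_G unfolding bdd_coeff_def by blast
    have "AE x in lebesgue. cmod (A' x $ i $ j) \<le> max C1 C2" using b(1) by eventually_elim simp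
    moreover have "AE x in lebesgue. cmod (G x $ i $ j) \<le> max C1 C2" using b(2) by eventually_elim simp
    ultimately show ?thesis by (rule cotlar_identity[OF hilbert_G h smooth_coeffD(5)[OF smooth]])
  qed
  have r: "vec_mulrel X hilbert_symbol (\<lambda>x. A' x *v hil X \<phi> x + G x *v \<phi> x) (\<lambda>x. G x *v hil X \<phi> x - A' x *v \<phi> x)"
    unfolding vec_mulrel_def
  proof
    fix i
    show "mulrel X hilbert_symbol (\<lambda>x. (A' x *v hil X \<phi> x + G x *v \<phi> x) $ i) (\<lambda>x. (G x *v hil X \<phi> x - A' x *v \<phi> x) $ i)"
      using mulrel_add[OF c[of i 1] c[of i 2] hilbert_symbol_measurable]
      unfolding vector_add_component vector_minus_component matrix_vector_2 by (simp add: algebra_simps)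
  qed
  show ?thesis
    using hil_unique[OF r] hil_add[OF A'L[OF hil_L2[OF assms]] GL[OF assms]]
  proof eventually_elim
    case (elim x)
    show ?case unfolding eq_diff_eq using elim by simp
  qed
qed

text \<open>With the normalised transform, \<open>\<psi>\<close> is \<open>[H, A] \<phi>\<close>,
  \<open>\<psi>'\<close> its weak derivative, and \<open>W\<close> satisfies
  \<open>B \<phi> = (- \<i> / 2) W\<close>. The left side is thus the commutator of \<open>B\<close>
  with \<open>[H, A]\<close> up to that scalar, and the right side is
  \<open>[H, [A, G]] \<phi>\<close>.\<close>

lemma lax_identity:
  assumes d: "vec_mulrel X deriv_symbol \<phi> \<phi>'"
  defines "\<psi> \<equiv> \<lambda>x. hil X (\<lambda>x. A x *v \<phi> x) x - A x *v hil X \<phi> x"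
  defines "\<psi>' \<equiv> \<lambda>x. hil X (\<lambda>x. A' x *v \<phi> x + A x *v \<phi>' x) x - (A' x *v hil X \<phi> x + A x *v hil X \<phi>' x)"
  defines "W \<equiv> \<lambda>x. A x *v hil X \<phi>' x + hil X (\<lambda>x. A' x *v \<phi> x + A x *v \<phi>' x) x - G x *v \<phi> x"
  shows "vec_mulrel X deriv_symbol \<psi> \<psi>'" and "vec_L2 X W"
    and "AE x in lebesgue. (A x *v hil X \<psi>' x + hil X (\<lambda>x. A' x *v \<psi> x + A x *v \<psi>' x) x - G x *v \<psi> x)
       - (hil X (\<lambda>x. A x *v W x) x - A x *v hil X W x)
       = hil X (\<lambda>x. A x *v (G x *v \<phi> x) - G x *v (A x *v \<phi> x)) x
         - (A x *v (G x *v hil X \<phi> x) - G x *v (A x *v hil X \<phi> x))"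
proof -
  note L = vec_mulrelD(1)[OF d] and L' = vec_mulrelD(2)[OF d]
  define f1 where "f1 x = A x *v \<phi> x" for x
  define f1' where "f1' x = A' x *v \<phi> x + A x *v \<phi>' x" for x
  define q where "q = hil X \<phi>"
  define p where "p = hil X \<phi>'"
  define h1 where "h1 = hil X f1"
  define h1' where "h1' = hil X f1'"
  have d1: "vec_mulrel X deriv_symbol f1 f1'" unfolding f1_def f1'_def by (rule product_rule[OF d])
  have dq: "vec_mulrel X deriv_symbol q p" unfolding q_def p_def by (rule hil_derivative[OF d])
  have dh: "vec_mulrel X deriv_symbol h1 h1'" unfolding h1_def h1'_def by (rule hil_derivative[OF d1])
  note L1 = vec_mulrelD(1)[OF d1] vec_mulrelD(2)[OF d1] vec_mulrelD(1)[OF dq] vec_mulrelD(2)[OF dq] vec_mulrelD(1)[OF dh] vec_mulrelD(2)[OF dh]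
  have psi: "\<psi> = (\<lambda>x. h1 x - A x *v q x)" unfolding \<psi>_def h1_def q_def f1_def ..
  have psi': "\<psi>' = (\<lambda>x. h1' x - (A' x *v q x + A x *v p x))" unfolding \<psi>'_def h1'_def q_def p_def f1'_def ..
  have W: "W = (\<lambda>x. A x *v p x + h1' x - G x *v \<phi> x)" unfolding W_def h1'_def p_def f1'_def ..
  show "vec_mulrel X deriv_symbol \<psi> \<psi>'"
    unfolding psi psi' by (rule vec_mulrel_diff[OF dh product_rule[OF dq] deriv_symbol_measurable])
  show WL: "vec_L2 X W" unfolding W by (intro vec_L2_diff vec_L2_add AL GL L L1)
  have e1: "AE x in lebesgue. hil X \<psi>' x = hil X h1' x - hil X (\<lambda>x. A' x *v q x + A x *v p x) x"
    unfolding psi' by (intro hil_diff vec_L2_add A'L AL L1)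
  have e2: "AE x in lebesgue. hil X (\<lambda>x. A' x *v q x + A x *v p x) x = hil X (\<lambda>x. A' x *v q x) x + hil X (\<lambda>x. A x *v p x) x"
    by (intro hil_add A'L AL L1)
  have e3: "AE x in lebesgue. hil X h1' x = - f1' x" unfolding h1'_def by (rule hil_hil_derivative[OF d1])
  have e4: "AE x in lebesgue. hil X p x = - \<phi>' x" unfolding p_def by (rule hil_hil_derivative[OF d])
  have c1: "AE x in lebesgue. hil X (\<lambda>x. A' x *v q x) x = G x *v q x - A' x *v \<phi> x - hil X (\<lambda>x. G x *v \<phi> x) x"
    unfolding q_def by (rule cotlar[OF L])
  have c2: "AE x in lebesgue. hil X (\<lambda>x. A' x *v h1 x) x = G x *v h1 x - A' x *v f1 x - hil X (\<lambda>x. G x *v f1 x) x"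
    unfolding h1_def by (rule cotlar[OF L1(1)])
  \<comment> \<open>\<open>A' A q + A A' q\<close> vanishes by anticommutation, and
    \<open>- A (A p)\<close> is \<open>p\<close>.\<close>
  have s1: "(\<lambda>x. A' x *v \<psi> x + A x *v \<psi>' x) = (\<lambda>x. A' x *v h1 x + A x *v h1' x + p x)"
    unfolding psi psi' by (rule ext)
      (simp add: matrix_vector_mult_diff_distrib matrix_vector_right_distrib square anticommute)
  have e5: "AE x in lebesgue. hil X (\<lambda>x. A' x *v h1 x + A x *v h1' x + p x) x = hil X (\<lambda>x. A' x *v h1 x + A x *v h1' x) x + hil X p x"
    by (intro hil_add vec_L2_add A'L AL L1)
  have e6: "AE x in lebesgue. hil X (\<lambda>x. A' x *v h1 x + A x *v h1' x) x = hil X (\<lambda>x. A' x *v h1 x) x + hil X (\<lambda>x. A x *v h1' x) x"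
    by (intro hil_add A'L AL L1)
  have s2: "(\<lambda>x. A x *v W x) = (\<lambda>x. A x *v h1' x - p x - A x *v (G x *v \<phi> x))"
    unfolding W by (rule ext) (simp add: matrix_vector_mult_diff_distrib matrix_vector_right_distrib square)
  have e7: "AE x in lebesgue. hil X (\<lambda>x. A x *v h1' x - p x - A x *v (G x *v \<phi> x)) x = hil X (\<lambda>x. A x *v h1' x - p x) x - hil X (\<lambda>x. A x *v (G x *v \<phi> x)) x"
    by (intro hil_diff vec_L2_diff A'L AL GL L L1)
  have e8: "AE x in lebesgue. hil X (\<lambda>x. A x *v h1' x - p x) x = hil X (\<lambda>x. A x *v h1' x) x - hil X p x"
    by (intro hil_diff A'L AL L1)
  have e9: "AE x in lebesgue. hil X W x = hil X (\<lambda>x. A x *v p x + h1' x) x - hil X (\<lambda>x. G x *v \<phi> x) x"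
    unfolding W by (intro hil_diff vec_L2_add AL GL L L1)
  have e10: "AE x in lebesgue. hil X (\<lambda>x. A x *v p x + h1' x) x = hil X (\<lambda>x. A x *v p x) x + hil X h1' x"
    by (intro hil_add AL L1)
  have e11: "AE x in lebesgue. hil X (\<lambda>x. A x *v (G x *v \<phi> x) - G x *v f1 x) x = hil X (\<lambda>x. A x *v (G x *v \<phi> x)) x - hil X (\<lambda>x. G x *v f1 x) x"
    by (intro hil_diff AL GL L L1)
  \<comment> \<open>After expansion both parts contain \<open>A H (G \<phi>)\<close>,
    \<open>- A H (A p)\<close>, \<open>A A' \<phi>\<close> and \<open>H (A h1')\<close>, which
    cancel in the difference, while \<open>\<phi>'\<close> cancels within each part. What remains
    are the terms with both \<open>A\<close> and \<open>G\<close>.\<close>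
  have "AE x in lebesgue. (A x *v hil X \<psi>' x + hil X (\<lambda>x. A' x *v \<psi> x + A x *v \<psi>' x) x - G x *v \<psi> x)
       - (hil X (\<lambda>x. A x *v W x) x - A x *v hil X W x)
       = hil X (\<lambda>x. A x *v (G x *v \<phi> x) - G x *v f1 x) x - (A x *v (G x *v q x) - G x *v (A x *v q x))"
    unfolding s1 s2
    using e1 e2 e3 e4 c1 c2 e5 e6 e7 e8 e9 e10 e11
  proof eventually_elim
    case (elim x)
    have f1': "A x *v f1' x = A x *v (A' x *v \<phi> x) - \<phi>' x"
      unfolding f1'_def by (simp add: matrix_vector_right_distrib square)
    have f1: "A' x *v f1 x = - (A x *v (A' x *v \<phi> x))" unfolding f1_def by (rule anticommute)
    have neg: "A x *v (- f1' x) = - (A x *v f1' x)"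
      using matrix_vector_mult_diff_distrib[of "A x" 0 "f1' x"] by simp
    have psx: "\<psi> x = h1 x - A x *v q x" by (simp add: psi)
    show ?case
      unfolding elim psx matrix_vector_mult_diff_distrib matrix_vector_right_distrib neg f1' f1
      by (simp add: algebra_simps)
  qed
  then show "AE x in lebesgue. (A x *v hil X \<psi>' x + hil X (\<lambda>x. A' x *v \<psi> x + A x *v \<psi>' x) x - G x *v \<psi> x)
       - (hil X (\<lambda>x. A x *v W x) x - A x *v hil X W x)
       = hil X (\<lambda>x. A x *v (G x *v \<phi> x) - G x *v (A x *v \<phi> x)) x
         - (A x *v (G x *v hil X \<phi> x) - G x *v (A x *v hil X \<phi> x))"
    unfolding f1_def q_def .
qed

end

section \<open>The Lax pair\<close>

definition lax_commutator :: "base \<Rightarrow> (real \<Rightarrow> complex^2^2) \<Rightarrow> (real \<Rightarrow> complex^2) \<Rightarrow> real \<Rightarrow> complex^2" where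
  "lax_commutator X M \<phi> x = hil X (\<lambda>x. M x *v \<phi> x) x - M x *v hil X \<phi> x"

lemma H1_iff: "\<phi> \<in> H1 X \<longleftrightarrow> (\<exists>\<phi>'. vec_mulrel X deriv_symbol \<phi> \<phi>')"
proof
  assume "\<phi> \<in> H1 X"
  then have "\<forall>i. \<exists>f. mulrel X deriv_symbol (\<lambda>x. \<phi> x $ i) f" by (simp add: H1_def sobolev_iff)
  then obtain f where "\<forall>i. mulrel X deriv_symbol (\<lambda>x. \<phi> x $ i) (f i)" by metis
  then have "vec_mulrel X deriv_symbol \<phi> (\<lambda>x. \<chi> i. f i x)" by (simp add: vec_mulrel_def)
  then show "\<exists>\<phi>'. vec_mulrel X deriv_symbol \<phi> \<phi>'" by blast
qed (auto simp: H1_def sobolev_iff vec_mulrel_def)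

lemma scaleR_eq_vector_scale: "r *\<^sub>R (v :: complex^2) = complex_of_real r *s v"
  by (simp add: vec_eq_iff) (simp add: scaleR_conv_of_real)

lemma matrix_vector_scale: "(M :: complex^2^2) *v (c *s v) = c *s (M *v v)"
  by (simp add: vec_eq_iff matrix_vector_2 algebra_simps)

lemma vec_sqnorm:
  assumes "vec_L2 X \<phi>"
  shows "sqnorm (base_measure X) \<phi> = ennreal (nsq (base_measure X) (\<lambda>x. \<phi> x $ 1) + nsq (base_measure X) (\<lambda>x. \<phi> x $ 2))"
proof -
  let ?M = "base_measure X"
  note s = L2_D(3)[OF vec_L2_D(3)[OF assms]]
  have n: "(norm (\<phi> x))\<^sup>2 = (cmod (\<phi> x $ 1))\<^sup>2 + (cmod (\<phi> x $ 2))\<^sup>2" for x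
    unfolding norm_vec_def L2_set_def sum_2 by (rule real_sqrt_pow2) simp
  have "sqnorm ?M \<phi> = (\<integral>\<^sup>+x. ennreal ((cmod (\<phi> x $ 1))\<^sup>2) + ennreal ((cmod (\<phi> x $ 2))\<^sup>2) \<partial>?M)"
    unfolding sqnorm_def n by (intro nn_integral_cong) (simp add: ennreal_plus)
  also have "\<dots> = ennreal (nsq ?M (\<lambda>x. \<phi> x $ 1)) + ennreal (nsq ?M (\<lambda>x. \<phi> x $ 2))"
    using sqint_measurable[OF s] by (subst nn_integral_add) (auto simp: nn_eq_nsq[OF s])
  finally show ?thesis by (simp add: ennreal_plus nsq_nonneg)
qed

lemma vec_L2_in_L2:
  assumes "vec_L2 X \<phi>" shows "\<phi> \<in> L2 X"
  using vec_L2_D(1,2)[OF assms] vec_sqnorm[OF assms] by (simp add: L2_def)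

lemma vec_L2_cong_AE:
  assumes "vec_L2 X \<phi>" "AE x in lebesgue. \<phi> x = \<psi> x" "periodic_on X \<psi>"
  shows "vec_L2 X \<psi>"
  unfolding vec_L2_def
proof
  fix i
  have "periodic_on X (\<lambda>x. \<psi> x $ i)" using assms(3) by (cases X) auto
  then show "(\<lambda>x. \<psi> x $ i) \<in> L2 X"
    by (rule L2_cong_AE[OF vec_L2_D(3)[OF assms(1)] assms(2)[unfolded vec_AE_iff, rule_format]])
qed

lemma abs_grad_vec_AE:
  assumes "vec_mulrel X deriv_symbol \<phi> \<phi>'"
  shows "AE x in lebesgue. abs_grad_vec X \<phi> x = hil X \<phi>' x" "periodic_on X (abs_grad_vec X \<phi>)"
proof -
  note r = abs_grad_AE[OF vec_mulrelD(3)[OF assms] vec_mulrelD(3)[OF hil_mulrel[OF vec_mulrelD(2)[OF assms]]]]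
  show "AE x in lebesgue. abs_grad_vec X \<phi> x = hil X \<phi>' x"
    unfolding vec_AE_iff abs_grad_vec_def using r(1) by simp
  show "periodic_on X (abs_grad_vec X \<phi>)"
    using L2_D(1)[OF r(2)] unfolding abs_grad_vec_def by (cases X) (auto simp: vec_eq_iff)
qed

text \<open>All dependence on the normalisation of the kernel is concentrated in this
  scalar.\<close>

lemma lax_L_eq: "lax_L X M \<phi> = (\<lambda>x. complex_of_real (hilbert_const X) *s lax_commutator X M \<phi> x)"
proof
  fix x
  have "lax_L X M \<phi> x = hilbert X (\<lambda>x. M x *v \<phi> x) x - M x *v hilbert X \<phi> x"
    unfolding lax_L_def commutator_def mult_op_def ..
  also have "\<dots> = complex_of_real (hilbert_const X) *s lax_commutator X M \<phi> x"
    unfolding hilbert_hil scaleR_eq_vector_scale matrix_vector_scale lax_commutator_def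
    by (simp add: vec_eq_iff algebra_simps)
  finally show "lax_L X M \<phi> x = complex_of_real (hilbert_const X) *s lax_commutator X M \<phi> x" .
qed

lemma lax_commutator_L2:
  assumes "bdd_coeff X M" "vec_L2 X \<phi>" shows "vec_L2 X (lax_commutator X M \<phi>)"
  unfolding lax_commutator_def[abs_def]
  by (intro vec_L2_diff hil_L2 bdd_coeff_mult assms)

lemma lax_L_L2:
  assumes "bdd_coeff X M" "vec_L2 X \<phi>" shows "vec_L2 X (lax_L X M \<phi>)"
  unfolding lax_L_eq by (intro vec_L2_cmult lax_commutator_L2 assms)

lemma lax_commutator_cong:
  assumes "bdd_coeff X M" "vec_L2 X \<phi>" "vec_L2 X \<psi>" "AE x in lebesgue. \<phi> x = \<psi> x"
  shows "AE x in lebesgue. lax_commutator X M \<phi> x = lax_commutator X M \<psi> x"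
proof -
  have "AE x in lebesgue. M x *v \<phi> x = M x *v \<psi> x" using assms(4) by eventually_elim simp
  from hil_cong[OF bdd_coeff_mult[OF assms(1,2)] bdd_coeff_mult[OF assms(1,3)] this] hil_cong[OF assms(2-4)]
  show ?thesis unfolding lax_commutator_def by eventually_elim simp
qed

lemma lax_commutator_scale:
  assumes "bdd_coeff X M" "vec_L2 X \<phi>"
  shows "AE x in lebesgue. lax_commutator X M (\<lambda>x. c *s \<phi> x) x = c *s lax_commutator X M \<phi> x"
  using hil_cmult[OF bdd_coeff_mult[OF assms], of c] hil_cmult[OF assms(2), of c]
  unfolding lax_commutator_def matrix_vector_scale
  by eventually_elim (simp add: vec_eq_iff algebra_simps matrix_vector_2)

section \<open>The identity for \<open>lax_L\<close> and \<open>lax_B\<close> themselves\<close>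

context lax_coefficients
begin

text \<open>In the commutator \<open>lax_B\<close> is applied to \<open>lax_L X A \<phi>\<close>, so
  that function must have a weak derivative of its own, and an explicit one is needed for the
  identity.\<close>

lemma lax_L_H1:
  assumes d: "vec_mulrel X deriv_symbol \<phi> \<phi>'"
  defines "\<psi>' \<equiv> \<lambda>x. hil X (\<lambda>x. A' x *v \<phi> x + A x *v \<phi>' x) x - (A' x *v hil X \<phi> x + A x *v hil X \<phi>' x)"
  shows "vec_mulrel X deriv_symbol (lax_L X A \<phi>) (\<lambda>x. complex_of_real (hilbert_const X) *s \<psi>' x)"
  unfolding lax_L_eq lax_commutator_def \<psi>'_def by (rule vec_mulrel_cmult[OF lax_identity(1)[OF d]])

lemma abs_grad_mat_AE:
  "AE x in lebesgue. abs_grad_mat X A x = G x" "periodic_on X (abs_grad_mat X A)"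
proof -
  note s = smooth_coeff_abs_grad[OF smooth hilbert_G]
  have "AE x in lebesgue. \<forall>i j. abs_grad_mat X A x $ i $ j = G x $ i $ j"
    unfolding forall_2 abs_grad_mat_def using s(1) by simp
  then show "AE x in lebesgue. abs_grad_mat X A x = G x" by (simp add: vec_eq_iff)
  show "periodic_on X (abs_grad_mat X A)"
    using s(2) unfolding abs_grad_mat_def by (cases X) (auto simp: vec_eq_iff)
qed

lemma lax_B_AE:
  assumes d: "vec_mulrel X deriv_symbol \<phi> \<phi>'"
  shows "AE x in lebesgue. lax_B X A \<phi> x
      = (- \<i> / 2) *s (A x *v hil X \<phi>' x + hil X (\<lambda>x. A' x *v \<phi> x + A x *v \<phi>' x) x - G x *v \<phi> x)"
    and "vec_L2 X (lax_B X A \<phi>)"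
proof -
  note p = product_rule[OF d]
  show ae: "AE x in lebesgue. lax_B X A \<phi> x
      = (- \<i> / 2) *s (A x *v hil X \<phi>' x + hil X (\<lambda>x. A' x *v \<phi> x + A x *v \<phi>' x) x - G x *v \<phi> x)"
    using abs_grad_vec_AE(1)[OF d] abs_grad_vec_AE(1)[OF p] abs_grad_mat_AE(1)
    unfolding lax_B_def mult_op_def
  proof eventually_elim
    case (elim x)
    show ?case unfolding elim by (simp add: vec_eq_iff algebra_simps)
  qed
  have A: "periodic_on X A" using bdd_A unfolding bdd_coeff_def by (cases X) (auto simp: vec_eq_iff)
  have per: "periodic_on X (lax_B X A \<phi>)"
    using A abs_grad_mat_AE(2) abs_grad_vec_AE(2)[OF d] abs_grad_vec_AE(2)[OF p] vec_L2_D(1)[OF vec_mulrelD(1)[OF d]]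
    unfolding lax_B_def mult_op_def by (cases X) auto
  have ae': "AE x in lebesgue. (- \<i> / 2) *s (A x *v hil X \<phi>' x + hil X (\<lambda>x. A' x *v \<phi> x + A x *v \<phi>' x) x - G x *v \<phi> x)
     = lax_B X A \<phi> x"
    using ae by eventually_elim simp
  show "vec_L2 X (lax_B X A \<phi>)"
    by (rule vec_L2_cong_AE[OF vec_L2_cmult[OF lax_identity(2)[OF d]] ae' per])
qed

text \<open>Here \<open>D\<close> stands for half the commutator of \<open>A\<close> and
  \<open>G\<close>. Both products of the two operators contain \<open>lax_L\<close> once, so the
  constant \<open>?k\<close> factors out of the whole equation.\<close>

lemma lax_equation:
  assumes d: "vec_mulrel X deriv_symbol \<phi> \<phi>'"
    and D: "\<And>x v. D x *v v = (1 / 2) *s (A x *v (G x *v v) - G x *v (A x *v v))"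
  shows "AE x in lebesgue. \<i> *s commutator (lax_B X A) (lax_L X A) \<phi> x
      = complex_of_real (hilbert_const X) *s lax_commutator X D \<phi> x"
    and "vec_L2 X (\<lambda>x. \<i> *s commutator (lax_B X A) (lax_L X A) \<phi> x)"
proof -
  note L = vec_mulrelD(1)[OF d]
  let ?k = "complex_of_real (hilbert_const X)"
  define W where "W = (\<lambda>x. A x *v hil X \<phi>' x + hil X (\<lambda>x. A' x *v \<phi> x + A x *v \<phi>' x) x - G x *v \<phi> x)"
  define \<psi> where "\<psi> = (\<lambda>x. hil X (\<lambda>x. A x *v \<phi> x) x - A x *v hil X \<phi> x)"
  define \<psi>' where "\<psi>' = (\<lambda>x. hil X (\<lambda>x. A' x *v \<phi> x + A x *v \<phi>' x) x - (A' x *v hil X \<phi> x + A x *v hil X \<phi>' x))"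
  have dpsi: "vec_mulrel X deriv_symbol \<psi> \<psi>'" unfolding \<psi>_def \<psi>'_def by (rule lax_identity(1)[OF d])
  have WL: "vec_L2 X W" unfolding W_def by (rule lax_identity(2)[OF d])
  have dL: "vec_mulrel X deriv_symbol (lax_L X A \<phi>) (\<lambda>x. ?k *s \<psi>' x)" unfolding \<psi>'_def by (rule lax_L_H1[OF d])
  have B1: "AE x in lebesgue. lax_B X A \<phi> x = (- \<i> / 2) *s W x" unfolding W_def by (rule lax_B_AE(1)[OF d])
  note B2 = lax_B_AE(2)[OF d] and BL = lax_B_AE[OF dL]
  have id: "AE x in lebesgue. (A x *v hil X \<psi>' x + hil X (\<lambda>x. A' x *v \<psi> x + A x *v \<psi>' x) x - G x *v \<psi> x)
       - (hil X (\<lambda>x. A x *v W x) x - A x *v hil X W x)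
       = hil X (\<lambda>x. A x *v (G x *v \<phi> x) - G x *v (A x *v \<phi> x)) x
         - (A x *v (G x *v hil X \<phi> x) - G x *v (A x *v hil X \<phi> x))"
    unfolding \<psi>_def \<psi>'_def W_def by (rule lax_identity(3)[OF d])
  have Lpsi: "lax_L X A \<phi> = (\<lambda>x. ?k *s \<psi> x)" unfolding lax_L_eq lax_commutator_def \<psi>_def ..
  have BA: "AE x in lebesgue. lax_B X A (lax_L X A \<phi>) x = (- \<i> / 2) *s (?k *s
      (A x *v hil X \<psi>' x + hil X (\<lambda>x. A' x *v \<psi> x + A x *v \<psi>' x) x - G x *v \<psi> x))"
  proof -
    have "(\<lambda>x. A' x *v (?k *s \<psi> x) + A x *v (?k *s \<psi>' x)) = (\<lambda>x. ?k *s (A' x *v \<psi> x + A x *v \<psi>' x))"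
      by (rule ext) (simp add: matrix_vector_scale vector_add_ldistrib)
    then have "AE x in lebesgue. hil X (\<lambda>x. A' x *v (?k *s \<psi> x) + A x *v (?k *s \<psi>' x)) x
        = ?k *s hil X (\<lambda>x. A' x *v \<psi> x + A x *v \<psi>' x) x"
      using hil_cmult[OF vec_mulrelD(2)[OF product_rule[OF dpsi]]] by simp
    then show ?thesis
      using BL(1) hil_cmult[OF vec_mulrelD(2)[OF dpsi], of ?k]
      unfolding Lpsi
    proof eventually_elim
      case (elim x)
      show ?case unfolding elim unfolding matrix_vector_scale by (simp add: vec_eq_iff algebra_simps)
    qed
  qed
  have AB: "AE x in lebesgue. lax_L X A (lax_B X A \<phi>) x = ?k *s ((- \<i> / 2) *s (hil X (\<lambda>x. A x *v W x) x - A x *v hil X W x))"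
    unfolding lax_L_eq
    using lax_commutator_cong[OF bdd_A B2 vec_L2_cmult[OF WL] B1]
      lax_commutator_scale[OF bdd_A WL, of "- \<i> / 2"]
    by eventually_elim (simp add: lax_commutator_def)
  have CL: "vec_L2 X (\<lambda>x. A x *v (G x *v \<phi> x) - G x *v (A x *v \<phi> x))"
    by (intro vec_L2_diff AL GL L)
  have C: "AE x in lebesgue. hil X (\<lambda>x. (1 / 2) *s (A x *v (G x *v \<phi> x) - G x *v (A x *v \<phi> x))) x
     = (1 / 2) *s hil X (\<lambda>x. A x *v (G x *v \<phi> x) - G x *v (A x *v \<phi> x)) x"
    by (rule hil_cmult[OF CL])
  show "AE x in lebesgue. \<i> *s commutator (lax_B X A) (lax_L X A) \<phi> x = ?k *s lax_commutator X D \<phi> x"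
    using BA AB C id
  proof eventually_elim
    case (elim x)
    \<comment> \<open>The factor \<open>1/2\<close> is \<open>\<i> * (- \<i> / 2)\<close>.\<close>
    have "\<i> *s commutator (lax_B X A) (lax_L X A) \<phi> x = (?k / 2) *s
       ((A x *v hil X \<psi>' x + hil X (\<lambda>x. A' x *v \<psi> x + A x *v \<psi>' x) x - G x *v \<psi> x)
       - (hil X (\<lambda>x. A x *v W x) x - A x *v hil X W x))"
      unfolding commutator_def elim(1,2) by (simp add: vec_eq_iff field_simps)
    also have "\<dots> = ?k *s lax_commutator X D \<phi> x"
      unfolding elim(4) lax_commutator_def D elim(3) by (simp add: vec_eq_iff field_simps)
    finally show ?case .
  qed
  show "vec_L2 X (\<lambda>x. \<i> *s commutator (lax_B X A) (lax_L X A) \<phi> x)"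
    unfolding commutator_def by (intro vec_L2_cmult vec_L2_diff BL(2) lax_L_L2[OF bdd_A B2])
qed

end

section \<open>Differentiation in time\<close>

text \<open>The symbol has modulus at most 1, and Plancherel carries the same constant on both
  sides.\<close>

lemma nsq_hil_le:
  assumes "vec_L2 X \<phi>"
  shows "nsq (base_measure X) (\<lambda>x. hil X \<phi> x $ i) \<le> nsq (base_measure X) (\<lambda>x. \<phi> x $ i)"
proof -
  obtain F where F: "Ft (base_measure X) (freq_measure X) (\<lambda>x. \<phi> x $ i) F"
    "Ft (base_measure X) (freq_measure X) (\<lambda>x. hil X \<phi> x $ i) (\<lambda>\<xi>. hilbert_symbol \<xi> * F \<xi>)"
    using vec_mulrelD(3)[OF hil_mulrel[OF assms], of i] by (auto simp: mulrel_def)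
  have "nsq (freq_measure X) (\<lambda>\<xi>. hilbert_symbol \<xi> * F \<xi>) \<le> 1\<^sup>2 * nsq (freq_measure X) F"
  proof (rule sqint_dominated(2)[OF FtD(2)[OF F(1)] sqint_measurable[OF FtD(2)[OF F(2)]]], rule AE_I2)
    fix \<xi> show "cmod (hilbert_symbol \<xi> * F \<xi>) \<le> 1 * cmod (F \<xi>)"
      unfolding norm_mult by (intro mult_right_mono norm_hilbert_symbol norm_ge_zero)
  qed
  then show ?thesis
    unfolding Ft_plancherel[OF fourier_pair_base F(1)] Ft_plancherel[OF fourier_pair_base F(2)] by simp
qed

lemma nsq_squeeze:
  assumes "\<And>n. nsq M (f n) \<le> b n" "b \<longlonglongrightarrow> 0"
  shows "(\<lambda>n. nsq M (f n)) \<longlonglongrightarrow> 0"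
  by (rule tendsto_sandwich[OF always_eventually[OF allI[OF nsq_nonneg]] always_eventually[OF allI[OF assms(1)]] tendsto_const assms(2)])

lemma bdd_coeff_mult_tendsto:
  assumes E: "\<And>n::nat. bdd_coeff X (E n)" and b: "\<And>n i j. AE x in lebesgue. cmod (E n x $ i $ j) \<le> K"
    and lim: "\<And>i j. AE x in lebesgue. (\<lambda>n. E n x $ i $ j) \<longlonglongrightarrow> 0" and \<phi>: "vec_L2 X \<phi>"
  shows "(\<lambda>n. nsq (base_measure X) (\<lambda>x. (E n x *v \<phi> x) $ i)) \<longlonglongrightarrow> 0"
proof -
  let ?M = "base_measure X"
  have L: "(\<lambda>x. E n x $ i $ j * \<phi> x $ j) \<in> L2 X" for n j
    using E[of n] b[of n i j] unfolding bdd_coeff_def by (intro L2_bdd_mult[OF vec_L2_D(3)[OF \<phi>]]) auto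
  note s = L2_D(3)[OF L]
  have t: "(\<lambda>n. nsq ?M (\<lambda>x. E n x $ i $ j * \<phi> x $ j)) \<longlonglongrightarrow> 0" for j
  proof -
    have "(\<lambda>n. nsq ?M (\<lambda>x. E n x $ i $ j * \<phi> x $ j - 0)) \<longlonglongrightarrow> 0"
    proof (rule nsq_dominated_convergence(2)[where w = "\<lambda>x. complex_of_real K * \<phi> x $ j"])
      show "(\<lambda>x. E n x $ i $ j * \<phi> x $ j) \<in> borel_measurable ?M" for n by (rule sqint_measurable[OF s])
      show "sqint ?M (\<lambda>x. complex_of_real K * \<phi> x $ j)" by (rule sqint_cmult[OF L2_D(3)[OF vec_L2_D(3)[OF \<phi>]]])
      show "AE x in ?M. cmod (E n x $ i $ j * \<phi> x $ j) \<le> cmod (complex_of_real K * \<phi> x $ j)" for n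
        using AE_base_of_lebesgue[OF b[of n i j]]
      proof eventually_elim
        case (elim x)
        then have "cmod (E n x $ i $ j) \<le> \<bar>K\<bar>" by simp
        then show ?case unfolding norm_mult norm_of_real by (rule mult_right_mono) simp
      qed
      show "AE x in ?M. (\<lambda>n. E n x $ i $ j * \<phi> x $ j) \<longlonglongrightarrow> 0"
        using AE_base_of_lebesgue[OF lim[of i j]] by eventually_elim (rule tendsto_mult_left_zero)
    qed simp
    then show ?thesis by simp
  qed
  have "(\<lambda>n. 2 * nsq ?M (\<lambda>x. E n x $ i $ 1 * \<phi> x $ 1) + 2 * nsq ?M (\<lambda>x. E n x $ i $ 2 * \<phi> x $ 2)) \<longlonglongrightarrow> 2 * 0 + 2 * 0"
    by (intro tendsto_intros t)
  then have lim0: "(\<lambda>n. 2 * nsq ?M (\<lambda>x. E n x $ i $ 1 * \<phi> x $ 1) + 2 * nsq ?M (\<lambda>x. E n x $ i $ 2 * \<phi> x $ 2)) \<longlonglongrightarrow> 0"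
    by simp
  have le: "nsq ?M (\<lambda>x. (E n x *v \<phi> x) $ i)
      \<le> 2 * nsq ?M (\<lambda>x. E n x $ i $ 1 * \<phi> x $ 1) + 2 * nsq ?M (\<lambda>x. E n x $ i $ 2 * \<phi> x $ 2)" for n
    unfolding matrix_vector_2 by (rule sqint_add(2)[OF s s])
  show ?thesis by (rule nsq_squeeze[OF le lim0])
qed

text \<open>By the contraction property, the commutator of \<open>H\<close> with \<open>E n\<close>
  on \<open>\<phi>\<close> is controlled by \<open>E n\<close> acting on \<open>\<phi>\<close> and
  on \<open>H \<phi>\<close>. Each tends to 0 by dominated convergence, although \<open>E n\<close>
  need not be small uniformly in \<open>x\<close>.\<close>

lemma lax_commutator_tendsto:
  assumes E: "\<And>n::nat. bdd_coeff X (E n)" and b: "\<And>n i j. AE x in lebesgue. cmod (E n x $ i $ j) \<le> K"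
    and lim: "\<And>i j. AE x in lebesgue. (\<lambda>n. E n x $ i $ j) \<longlonglongrightarrow> 0" and \<phi>: "vec_L2 X \<phi>"
  shows "(\<lambda>n. nsq (base_measure X) (\<lambda>x. lax_commutator X (E n) \<phi> x $ i)) \<longlonglongrightarrow> 0"
proof -
  let ?M = "base_measure X"
  note EL = bdd_coeff_mult[OF E \<phi>] and EH = bdd_coeff_mult[OF E hil_L2[OF \<phi>]]
  have le: "nsq ?M (\<lambda>x. lax_commutator X (E n) \<phi> x $ i)
     \<le> 2 * nsq ?M (\<lambda>x. (E n x *v \<phi> x) $ i) + 2 * nsq ?M (\<lambda>x. (E n x *v hil X \<phi> x) $ i)" for n
  proof -
    have "nsq ?M (\<lambda>x. lax_commutator X (E n) \<phi> x $ i)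
      \<le> 2 * nsq ?M (\<lambda>x. hil X (\<lambda>x. E n x *v \<phi> x) x $ i) + 2 * nsq ?M (\<lambda>x. (E n x *v hil X \<phi> x) $ i)"
      unfolding lax_commutator_def vector_minus_component
      by (rule sqint_diff(2)[OF L2_D(3)[OF vec_L2_D(3)[OF hil_L2[OF EL]]] L2_D(3)[OF vec_L2_D(3)[OF EH]]])
    then show ?thesis using nsq_hil_le[OF EL, of n i] by linarith
  qed
  have "(\<lambda>n. 2 * nsq ?M (\<lambda>x. (E n x *v \<phi> x) $ i) + 2 * nsq ?M (\<lambda>x. (E n x *v hil X \<phi> x) $ i)) \<longlonglongrightarrow> 2 * 0 + 2 * 0"
    by (intro tendsto_intros bdd_coeff_mult_tendsto[OF E b lim \<phi>] bdd_coeff_mult_tendsto[OF E b lim hil_L2[OF \<phi>]])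
  then have lim0: "(\<lambda>n. 2 * nsq ?M (\<lambda>x. (E n x *v \<phi> x) $ i) + 2 * nsq ?M (\<lambda>x. (E n x *v hil X \<phi> x) $ i)) \<longlonglongrightarrow> 0"
    by simp
  show ?thesis by (rule nsq_squeeze[OF le lim0])
qed

lemma lax_commutator_linear:
  assumes "bdd_coeff X M1" "bdd_coeff X M2" "bdd_coeff X D" "vec_L2 X \<phi>"
    and E: "\<And>x v. E x *v v = c *s (M1 x *v v - M2 x *v v) - D x *v v"
  shows "AE x in lebesgue. lax_commutator X E \<phi> x
     = c *s (lax_commutator X M1 \<phi> x - lax_commutator X M2 \<phi> x) - lax_commutator X D \<phi> x"
proof -
  note L = bdd_coeff_mult[OF assms(1) assms(4)] bdd_coeff_mult[OF assms(2) assms(4)] bdd_coeff_mult[OF assms(3) assms(4)]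
  show ?thesis
    using hil_diff[OF vec_L2_cmult[OF vec_L2_diff[OF L(1,2)], of c] L(3)] hil_cmult[OF vec_L2_diff[OF L(1,2)], of c]
      hil_diff[OF L(1,2)]
  proof eventually_elim
    case (elim x)
    show ?case unfolding lax_commutator_def E elim by (simp add: vec_eq_iff algebra_simps)
  qed
qed

text \<open>The commutator is linear in its coefficient, so the error of the difference quotient is
  the commutator with the coefficient \<open>E n\<close>, a difference quotient of \<open>M\<close>
  minus \<open>D\<close>. The Lipschitz bound dominates \<open>E n\<close> and the pointwise
  derivative makes it tend to 0.\<close>

lemma has_L2_derivative_lax_L:
  assumes M: "\<And>s. s \<in> I \<Longrightarrow> bdd_coeff X (M s)" and D: "bdd_coeff X D" and \<phi>: "vec_L2 X \<phi>" and t: "t \<in> I"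
    and U: "vec_L2 X U" "AE x in lebesgue. U x = complex_of_real (hilbert_const X) *s lax_commutator X D \<phi> x"
    and lip: "\<forall>\<^sub>F s in at t within I. \<forall>x i j. cmod (M s x $ i $ j - M t x $ i $ j) \<le> K * \<bar>s - t\<bar>"
    and der: "\<And>i j. AE x in lebesgue. ((\<lambda>s. M s x $ i $ j) has_vector_derivative D x $ i $ j) (at t within I)"
  shows "has_L2_derivative X (\<lambda>s. lax_L X (M s) \<phi>) U t I"
  unfolding has_L2_derivative_def
proof (intro conjI ballI)
  let ?M = "base_measure X" and ?k = "complex_of_real (hilbert_const X)"
  show "lax_L X (M s) \<phi> \<in> L2 X" if "s \<in> I" for s
    by (rule vec_L2_in_L2[OF lax_L_L2[OF M[OF that] \<phi>]])
  show "U \<in> L2 X" by (rule vec_L2_in_L2[OF U(1)])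
  show "((\<lambda>s. sqnorm ?M (\<lambda>x. (1 / (s - t)) *\<^sub>R (lax_L X (M s) \<phi> x - lax_L X (M t) \<phi> x) - U x)) \<longlongrightarrow> 0) (at t within I)"
    unfolding tendsto_at_iff_sequentially comp_def
  proof (intro allI impI)
    fix s :: "nat \<Rightarrow> real"
    assume sI: "\<forall>n. s n \<in> I - {t}" and st: "s \<longlonglongrightarrow> t"
    have sf: "filterlim s (at t within I) sequentially" using sI st by (auto simp: filterlim_at)
    \<comment> \<open>The Lipschitz bound holds only near \<open>t\<close>, so the sequence is
      entered at \<open>n0\<close>, and the shift is undone at the end.\<close>
    obtain n0 where n0: "\<And>n x i j. n \<ge> n0 \<Longrightarrow> cmod (M (s n) x $ i $ j - M t x $ i $ j) \<le> K * \<bar>s n - t\<bar>"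
      using filterlim_iff[THEN iffD1, OF sf, rule_format, OF lip] unfolding eventually_sequentially by blast
    obtain C where C: "\<And>i j. AE x in lebesgue. cmod (D x $ i $ j) \<le> C i j"
      using D unfolding bdd_coeff_def by metis
    define K' where "K' = K + Max (range (\<lambda>(i, j). C i j))"
    have C': "AE x in lebesgue. cmod (D x $ i $ j) \<le> Max (range (\<lambda>(i, j). C i j))" for i j
    proof -
      have "C i j \<le> Max (range (\<lambda>(i, j). C i j))" by (intro Max_ge) auto
      then show ?thesis using C[of i j] by (auto elim: eventually_mono)
    qed
    define r where "r n = 1 / (s (n + n0) - t)" for n
    define E where "E n x = (\<chi> i j. complex_of_real (r n) * (M (s (n + n0)) x $ i $ j - M t x $ i $ j) - D x $ i $ j)" for n x
    have E: "E n x *v v = complex_of_real (r n) *s (M (s (n + n0)) x *v v - M t x *v v) - D x *v v" for n x v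
      unfolding E_def by (simp add: vec_eq_iff matrix_vector_2 algebra_simps)
    have Eb: "AE x in lebesgue. cmod (E n x $ i $ j) \<le> K'" for n i j
      using C'[of i j]
    proof eventually_elim
      case (elim x)
      have "0 < \<bar>s (n + n0) - t\<bar>" using sI by auto
      moreover have "cmod (complex_of_real (r n) * (M (s (n + n0)) x $ i $ j - M t x $ i $ j))
          = cmod (M (s (n + n0)) x $ i $ j - M t x $ i $ j) / \<bar>s (n + n0) - t\<bar>"
        unfolding norm_mult norm_of_real r_def by simp
      ultimately have "cmod (complex_of_real (r n) * (M (s (n + n0)) x $ i $ j - M t x $ i $ j)) \<le> K"
        using n0[of "n + n0" x i j] by (simp add: divide_le_eq)
      then have "cmod (E n x $ i $ j) \<le> K + Max (range (\<lambda>(i, j). C i j))"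
        unfolding E_def using elim by (simp add: norm_triangle_le_diff)
      then show ?case unfolding K'_def .
    qed
    have EC: "bdd_coeff X (E n)" for n
      unfolding bdd_coeff_def
    proof (intro allI conjI)
      fix i j
      have sn: "s (n + n0) \<in> I" using sI by auto
      note m = M[OF sn] M[OF t] D
      show "periodic_on X (\<lambda>x. E n x $ i $ j)"
        using m unfolding bdd_coeff_def E_def by (cases X) auto
      have "(\<lambda>x. complex_of_real (r n) * (M (s (n + n0)) x $ i $ j - M t x $ i $ j) - D x $ i $ j) \<in> borel_measurable lebesgue"
        using m unfolding bdd_coeff_def by (intro borel_measurable_diff borel_measurable_times borel_measurable_const) auto
      then show "(\<lambda>x. E n x $ i $ j) \<in> borel_measurable lebesgue" unfolding E_def by simp
      show "\<exists>C. AE x in lebesgue. cmod (E n x $ i $ j) \<le> C" using Eb by blast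
    qed
    have El: "AE x in lebesgue. (\<lambda>n. E n x $ i $ j) \<longlonglongrightarrow> 0" for i j
      using der[of i j]
    proof eventually_elim
      case (elim x)
      have "filterlim (\<lambda>n. s (n + n0)) (at t within I) sequentially" using sI LIMSEQ_ignore_initial_segment[OF st, of n0] by (auto simp: filterlim_at)
      from filterlim_compose[OF has_vector_derivative_quotient[OF elim] this]
      have "(\<lambda>n. complex_of_real (r n) * (M (s (n + n0)) x $ i $ j - M t x $ i $ j)) \<longlonglongrightarrow> D x $ i $ j"
        by (simp add: r_def scaleR_conv_of_real inverse_eq_divide)
      from tendsto_diff[OF this tendsto_const[of "D x $ i $ j"]] show ?case unfolding E_def by simp
    qed
    have "(\<lambda>n. (cmod ?k)\<^sup>2 * nsq ?M (\<lambda>x. lax_commutator X (E n) \<phi> x $ 1) + (cmod ?k)\<^sup>2 * nsq ?M (\<lambda>x. lax_commutator X (E n) \<phi> x $ 2)) \<longlonglongrightarrow> (cmod ?k)\<^sup>2 * 0 + (cmod ?k)\<^sup>2 * 0"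
      by (intro tendsto_intros lax_commutator_tendsto[OF EC Eb El \<phi>])
    from tendsto_ennrealI[OF this]
    have lim: "(\<lambda>n. ennreal ((cmod ?k)\<^sup>2 * nsq ?M (\<lambda>x. lax_commutator X (E n) \<phi> x $ 1) + (cmod ?k)\<^sup>2 * nsq ?M (\<lambda>x. lax_commutator X (E n) \<phi> x $ 2))) \<longlonglongrightarrow> 0"
      by simp
    have eq: "sqnorm ?M (\<lambda>x. (1 / (s (n + n0) - t)) *\<^sub>R (lax_L X (M (s (n + n0))) \<phi> x - lax_L X (M t) \<phi> x) - U x)
       = ennreal ((cmod ?k)\<^sup>2 * nsq ?M (\<lambda>x. lax_commutator X (E n) \<phi> x $ 1) + (cmod ?k)\<^sup>2 * nsq ?M (\<lambda>x. lax_commutator X (E n) \<phi> x $ 2))" for n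
    proof -
      have sn: "s (n + n0) \<in> I" using sI by auto
      have "AE x in lebesgue. (1 / (s (n + n0) - t)) *\<^sub>R (lax_L X (M (s (n + n0))) \<phi> x - lax_L X (M t) \<phi> x) - U x
         = ?k *s lax_commutator X (E n) \<phi> x"
        using lax_commutator_linear[OF M[OF sn] M[OF t] D \<phi> E] U(2)
      proof eventually_elim
        case (elim x)
        show ?case unfolding lax_L_eq r_def[symmetric] scaleR_eq_vector_scale elim by (simp add: vec_eq_iff algebra_simps)
      qed
      from AE_base_of_lebesgue[OF this, of X]
      have "sqnorm ?M (\<lambda>x. (1 / (s (n + n0) - t)) *\<^sub>R (lax_L X (M (s (n + n0))) \<phi> x - lax_L X (M t) \<phi> x) - U x)
         = sqnorm ?M (\<lambda>x. ?k *s lax_commutator X (E n) \<phi> x)"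
        unfolding sqnorm_def by (intro nn_integral_cong_AE) (elim eventually_mono, simp only:)
      also have "\<dots> = ennreal (nsq ?M (\<lambda>x. ?k * lax_commutator X (E n) \<phi> x $ 1) + nsq ?M (\<lambda>x. ?k * lax_commutator X (E n) \<phi> x $ 2))"
        using vec_sqnorm[OF vec_L2_cmult[OF lax_commutator_L2[OF EC \<phi>], of ?k]] by simp
      finally show ?thesis unfolding nsq_cmult .
    qed
    show "(\<lambda>n. sqnorm ?M (\<lambda>x. (1 / (s n - t)) *\<^sub>R (lax_L X (M (s n)) \<phi> x - lax_L X (M t) \<phi> x) - U x)) \<longlonglongrightarrow> 0"
      by (rule LIMSEQ_offset[where k = n0]) (simp only: eq lim)
  qed
qed

section \<open>Half-wave maps\<close>

lemma dot_rho_nth: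
  "dot_rho v $ i $ j = complex_of_real (v $ 1) * rho1 $ i $ j + complex_of_real (v $ 2) * rho2 $ i $ j
     + complex_of_real (v $ 3) * rho3 $ i $ j"
  by (simp only: dot_rho_def vector_add_component vector_scaleR_component) (simp only: scaleR_conv_of_real)

lemma dot_rho_entries:
  "dot_rho v $ 1 $ 1 = \<i> * v $ 1" "dot_rho v $ 1 $ 2 = v $ 2 + \<i> * v $ 3"
  "dot_rho v $ 2 $ 1 = v $ 2 - \<i> * v $ 3" "dot_rho v $ 2 $ 2 = - (\<i> * v $ 1)"
  by (simp_all add: dot_rho_nth rho1_def rho2_def rho3_def)

text \<open>The matrices represent the Minkowski form: the anticommutator is twice the form, times
  the identity. For a map into the hyperbolic plane this gives square \<open>-1\<close> and, after
  differentiation, anticommutation of the map with its derivative.\<close>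

lemma dot_rho_anticommutator:
  "dot_rho v *v (dot_rho w *v u) + dot_rho w *v (dot_rho v *v u)
     = complex_of_real (2 * (- (v $ 1 * w $ 1) + v $ 2 * w $ 2 + v $ 3 * w $ 3)) *s u"
  by (simp add: vec_eq_iff forall_2 matrix_vector_2 dot_rho_entries) (simp add: complex_eq_iff algebra_simps)

text \<open>Under \<open>dot_rho\<close> the Minkowski wedge becomes half the commutator, with the
  signs of \<open>wedge_eta\<close> and of the three matrices matching. This is the form in which
  the half-wave maps equation enters.\<close>

lemma dot_rho_wedge:
  "dot_rho (wedge_eta v w) *v u = (1 / 2) *s (dot_rho v *v (dot_rho w *v u) - dot_rho w *v (dot_rho v *v u))"
  by (simp add: vec_eq_iff forall_2 matrix_vector_2 dot_rho_entries wedge_eta_def) (simp add: complex_eq_iff field_simps)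

lemma norm_rho_entries: "cmod (rho1 $ i $ j) \<le> 1" "cmod (rho2 $ i $ j) \<le> 1" "cmod (rho3 $ i $ j) \<le> 1"
  using exhaust_2[of i] exhaust_2[of j] by (auto simp: rho1_def rho2_def rho3_def)

lemma norm_dot_rho_nth: "cmod (dot_rho v $ i $ j) \<le> 3 * norm v"
proof -
  have "cmod (complex_of_real (v $ k) * c) \<le> norm v" if "cmod c \<le> 1" for k c
    using mult_mono[OF component_le_norm_cart[of v k] that] by (simp add: norm_mult)
  then have "cmod (complex_of_real (v $ 1) * rho1 $ i $ j) \<le> norm v" "cmod (complex_of_real (v $ 2) * rho2 $ i $ j) \<le> norm v"
    "cmod (complex_of_real (v $ 3) * rho3 $ i $ j) \<le> norm v" using norm_rho_entries by blast+
  from norm_add_rule_thm[OF norm_add_rule_thm[OF this(1,2)] this(3)] show ?thesis unfolding dot_rho_nth by simp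
qed

lemma dot_rho_diff: "dot_rho v - dot_rho w = dot_rho (v - w)"
  by (simp add: dot_rho_def algebra_simps)

lemma norm_wedge_eta: "norm (wedge_eta v w) \<le> 6 * norm v * norm w"
proof -
  have p: "\<bar>v $ i * w $ j\<bar> \<le> norm v * norm w" for i j
    unfolding abs_mult by (intro mult_mono component_le_norm_cart) auto
  have "\<bar>wedge_eta v w $ 1\<bar> \<le> 2 * (norm v * norm w)" "\<bar>wedge_eta v w $ 2\<bar> \<le> 2 * (norm v * norm w)"
    "\<bar>wedge_eta v w $ 3\<bar> \<le> 2 * (norm v * norm w)"
    using p[of 2 3] p[of 3 2] p[of 3 1] p[of 1 3] p[of 1 2] p[of 2 1] unfolding wedge_eta_def vector_3 by linarith+
  note c = this
  have "norm (wedge_eta v w) \<le> (\<Sum>i\<in>UNIV. \<bar>wedge_eta v w $ i\<bar>)" by (rule norm_le_l1_cart)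
  also have "\<dots> \<le> 6 * (norm v * norm w)"
    using c unfolding sum_3 by linarith
  finally show ?thesis by simp
qed

section \<open>Regularity and bounds for the components of the map\<close>

lemma continuous_AE_le:
  fixes f :: "real \<Rightarrow> real"
  assumes c: "continuous_on UNIV f" and le: "AE x in lebesgue. f x \<le> C"
  shows "f x \<le> C"
proof (rule ccontr)
  assume "\<not> f x \<le> C"
  have o: "open {x. C < f x}" by (intro open_Collect_less continuous_on_const c)
  obtain N where "negligible N" "{x. \<not> f x \<le> C} \<subseteq> N" using le unfolding eventually_ae_filter_negligible by blast
  then have "negligible {x. C < f x}" using negligible_subset by (auto simp: not_le)
  moreover have "x \<in> {x. C < f x}" using \<open>\<not> f x \<le> C\<close> by simp
  ultimately show False using open_not_negligible[OF o] by blast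
qed

lemma continuous_periodic_bounded:
  fixes f :: "real \<Rightarrow> complex"
  assumes c: "continuous_on UNIV f" and p: "\<forall>x. f (x + 2 * pi) = f x"
  shows "\<exists>C. \<forall>x. cmod (f x) \<le> C"
proof -
  have "compact (f ` {-pi..pi})" by (intro compact_continuous_image continuous_on_subset[OF c]) auto
  from compact_imp_bounded[OF this] obtain C where "\<forall>y\<in>f ` {-pi..pi}. cmod y \<le> C" unfolding bounded_iff by (elim exE)
  then have C: "cmod (f x) \<le> C" if "x \<in> {-pi..pi}" for x using that by simp
  have "cmod (f x) \<le> C" for x
    using C[of "period_rep x"] period_rep_range[of x] period_rep_value[OF p, of x] by simp
  then show ?thesis by blast
qed

lemma has_vector_derivative_periodic:
  assumes p: "\<forall>x. f (x + c) = f x" and d: "\<And>x. (f has_vector_derivative f' x) (at x)"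
  shows "f' (x + c) = f' x"
proof -
  have "((\<lambda>x. x + c) has_vector_derivative 1) (at x)" by (auto intro!: derivative_eq_intros)
  from vector_diff_chain_at[OF this d] have "(f has_vector_derivative f' (x + c)) (at x)"
    using p by (simp add: comp_def)
  then show ?thesis using d[of x] vector_derivative_unique_at by blast
qed

text \<open>With the identity as multiplier, the supremum bound for multiplier images applies to the
  function itself.\<close>

lemma mulrel_one: "f \<in> L2 X \<Longrightarrow> mulrel X (\<lambda>_. 1) f f"
  unfolding mulrel_def using Ft_fourier by fastforce

lemma regular_map_space_derivatives:
  assumes "regular_map X I S" "t \<in> I"
  obtains V V' where "\<And>x. (S t has_vector_derivative V x) (at x)" "\<And>x. (V has_vector_derivative V' x) (at x)"
    "continuous_on UNIV V'"
proof -
  have "Ck_on (Suc (Suc 0)) I S" using assms(1) unfolding regular_map_def by blast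
  then obtain fx where fx: "\<forall>t\<in>I. \<forall>x. (S t has_vector_derivative fx t x) (at x)" "Ck_on (Suc 0) I fx"
    unfolding Ck_on.simps(2)[of "Suc 0"] by blast
  then obtain fxx where fxx: "\<forall>t\<in>I. \<forall>x. (fx t has_vector_derivative fxx t x) (at x)" "Ck_on 0 I fxx"
    unfolding Ck_on.simps(2)[of 0] by blast
  have "continuous_on UNIV (\<lambda>x. (\<lambda>(t, x). fxx t x) (t, x))"
    by (rule continuous_on_compose2[OF fxx(2)[unfolded Ck_on.simps(1)]]) (use assms(2) in \<open>auto intro!: continuous_intros\<close>)
  then show ?thesis using that[of "fx t" "fxx t"] fx(1) fxx(1) assms(2) by simp
qed

text \<open>On the line the weak derivative of \<open>dx S j t\<close> and its bound come from the
  Sobolev hypothesis, the bound being extended to every \<open>x\<close> by continuity. On the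
  circle both come from continuity and periodicity of the classical derivatives.\<close>

lemma smooth_coeff_component:
  assumes R: "regular_map X I S" and t: "t \<in> I"
  shows "smooth_coeff X (\<lambda>x. complex_of_real (S t x $ j)) (dx S j t)"
proof -
  obtain V V' where V: "\<And>x. (S t has_vector_derivative V x) (at x)" and V': "\<And>x. (V has_vector_derivative V' x) (at x)"
    and cV': "continuous_on UNIV V'" using regular_map_space_derivatives[OF R t] by blast
  let ?c = "\<lambda>v :: real^3. complex_of_real (v $ j)"
  have bl: "bounded_linear ?c" by (rule bounded_linear_compose[OF bounded_linear_of_real bounded_linear_vec_nth])
  have dx: "dx S j t = (\<lambda>x. ?c (V x))" unfolding dx_def using vector_derivative_at[OF V] by simp
  have d: "((\<lambda>x. ?c (S t x)) has_vector_derivative dx S j t x) (at x)" for x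
    unfolding dx by (rule bounded_linear.has_vector_derivative[OF bl V])
  have d': "(dx S j t has_vector_derivative ?c (V' x)) (at x)" for x
    unfolding dx by (rule bounded_linear.has_vector_derivative[OF bl V'])
  have c': "continuous_on UNIV (dx S j t)"
    using has_vector_derivative_continuous[OF d'] by (intro continuous_at_imp_continuous_on) auto
  have c'': "continuous_on UNIV (\<lambda>x. ?c (V' x))" by (intro continuous_intros cV')
  have m: "f \<in> borel_measurable lebesgue" if "continuous_on UNIV f" for f :: "real \<Rightarrow> complex"
    by (intro measurable_completion) (use borel_measurable_continuous_onI[OF that] in simp)
  obtain B where B: "\<forall>t\<in>I. \<forall>x. norm (S t x) \<le> B" using R unfolding regular_map_def by blast
  have b: "cmod (?c (S t x)) \<le> B" for x
    using B t component_le_norm_cart[of "S t x" j] by (auto intro: order_trans)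
  have pS: "periodic_on X (S t)" using R t unfolding regular_map_def by blast
  then have pa: "periodic_on X (\<lambda>x. ?c (S t x))" by (cases X) auto
  have pa': "periodic_on X (dx S j t)"
    using pa has_vector_derivative_periodic[OF _ d, of "2 * pi"] by (cases X) auto
  have "(\<exists>a''. mulrel X deriv_symbol (dx S j t) a'') \<and> zero_mean X (dx S j t) \<and> (\<exists>C. \<forall>x. cmod (dx S j t x) \<le> C)"
  proof (cases X)
    case Line
    have "\<forall>r\<ge>0. \<forall>j. \<forall>t\<in>I. dx S j t \<in> sobolev Line r" using R Line unfolding regular_map_def by blast
    then have "dx S j t \<in> sobolev X 1" using t Line by simp
    then obtain a'' where a'': "mulrel X deriv_symbol (dx S j t) a''" unfolding sobolev_iff by blast
    then obtain F where F: "Ft (base_measure X) (freq_measure X) (dx S j t) F"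
      "Ft (base_measure X) (freq_measure X) a'' (\<lambda>\<xi>. deriv_symbol \<xi> * F \<xi>)" by (auto simp: mulrel_def)
    have one: "(\<lambda>_::real. 1 :: complex) \<in> borel_measurable borel" by simp
    from sobolev_multiplier_bounded[OF F(1) FtD(2)[OF F(2)] mulrel_one[OF mulrelD(1)[OF a'']] one]
    obtain C where C: "AE x in lebesgue. cmod (dx S j t x) \<le> C" by auto
    have "cmod (dx S j t x) \<le> C" for x
      by (rule continuous_AE_le[OF continuous_on_norm[OF c'] C])
    then show ?thesis using a'' zero_mean_line mulrelD(1)[OF a''] unfolding Line by blast
  next
    case Circle
    have p': "\<forall>x. dx S j t (x + 2 * pi) = dx S j t x" using pa' Circle by simp
    have p'': "\<forall>x. ?c (V' (x + 2 * pi)) = ?c (V' x)" using has_vector_derivative_periodic[OF p' d'] by blast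
    obtain C where C: "\<And>x. cmod (dx S j t x) \<le> C" using continuous_periodic_bounded[OF c' p'] by blast
    obtain C' where C': "\<And>x. cmod (?c (V' x)) \<le> C'" using continuous_periodic_bounded[OF c'' p''] by blast
    \<comment> \<open>The product rule with the constant function 1, applied twice: to the
      component, so that its derivative has zero mean, and to the derivative, so that it has a weak
      derivative.\<close>
    have "mulrel Circle deriv_symbol (\<lambda>x. ?c (S t x) * 1) (\<lambda>x. dx S j t x * 1 + ?c (S t x) * 0)"
      by (rule mulrel_product_rule[OF circle_one_derivative pa[unfolded Circle] d b C m[OF c'] pa'[unfolded Circle]])
    moreover have "mulrel Circle deriv_symbol (\<lambda>x. dx S j t x * 1) (\<lambda>x. ?c (V' x) * 1 + dx S j t x * 0)"
      by (rule mulrel_product_rule[OF circle_one_derivative pa'[unfolded Circle] d' C C' m[OF c'']]) (use p'' in simp)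
    ultimately show ?thesis using zero_mean_derivative C unfolding Circle by auto
  qed
  then show ?thesis unfolding smooth_coeff_def using pa pa' d b m[OF c'] by blast
qed

text \<open>\<open>abs_grad_map\<close> is defined by a real part; it agrees with the complex
  multiplier image because the Hilbert transform of a real function is real.\<close>

lemma abs_grad_component:
  assumes R: "regular_map X I S" and t: "t \<in> I"
  shows "mulrel X hilbert_symbol (dx S j t) (\<lambda>x. complex_of_real (abs_grad_map X (S t) x $ j))"
proof -
  note s = smooth_coeff_component[OF R t, of j]
  obtain g where g: "mulrel X hilbert_symbol (dx S j t) g"
    using mulrel_exists_bdd[OF smooth_coeffD(6)[OF s] hilbert_symbol_measurable norm_hilbert_symbol] .
  note ag = smooth_coeff_abs_grad[OF s g]
  have "AE x in lebesgue. Im (g x) = 0"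
  proof (rule AE_base_periodic)
    show "periodic_on X (\<lambda>x. Im (g x) = 0)" using L2_D(1)[OF mulrelD(2)[OF g]] by (cases X) auto
    show "AE x in base_measure X. Im (g x) = 0" by (rule hilbert_mulrel_real[OF g]) (simp add: dx_def)
  qed
  with ag(1) have "AE x in lebesgue. g x = complex_of_real (abs_grad_map X (S t) x $ j)"
    by eventually_elim (simp add: abs_grad_map_def complex_eq_iff)
  moreover have "periodic_on X (\<lambda>x. complex_of_real (abs_grad_map X (S t) x $ j))"
    using ag(2) unfolding abs_grad_map_def by (cases X) auto
  ultimately show ?thesis by (rule mulrel_cong[OF g AE_I2[OF refl] L2_D(1)[OF mulrelD(1)[OF g]]])
qed

lemma lax_coefficients_half_wave:
  assumes R: "regular_map X I S" and t: "t \<in> I" and hyp: "\<And>x. S t x \<in> hyperbolic_plane"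
  shows "lax_coefficients X (\<lambda>x. dot_rho (S t x)) (\<lambda>x. dot_rho (vector_derivative (S t) (at x)))
     (\<lambda>x. dot_rho (abs_grad_map X (S t) x))"
proof
  note s = smooth_coeff_component[OF R t] and g = abs_grad_component[OF R t]
  show "smooth_coeff X (\<lambda>x. dot_rho (S t x) $ i $ j) (\<lambda>x. dot_rho (vector_derivative (S t) (at x)) $ i $ j)" for i j
    using smooth_coeff_add[OF smooth_coeff_add[OF smooth_coeff_cmult[OF s[of 1], of "rho1 $ i $ j"]
        smooth_coeff_cmult[OF s[of 2], of "rho2 $ i $ j"]] smooth_coeff_cmult[OF s[of 3], of "rho3 $ i $ j"]]
    unfolding dot_rho_nth dx_def by (simp add: mult.commute)
  show "mulrel X hilbert_symbol (\<lambda>x. dot_rho (vector_derivative (S t) (at x)) $ i $ j)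
     (\<lambda>x. dot_rho (abs_grad_map X (S t) x) $ i $ j)" for i j
    using mulrel_add[OF mulrel_add[OF mulrel_cmult(1)[OF g[of 1], of "rho1 $ i $ j"] mulrel_cmult(1)[OF g[of 2], of "rho2 $ i $ j"]
        hilbert_symbol_measurable] mulrel_cmult(1)[OF g[of 3], of "rho3 $ i $ j"] hilbert_symbol_measurable]
    unfolding dot_rho_nth dx_def by (simp add: mult.commute)
  have h: "- (S t x $ 1 * S t x $ 1) + S t x $ 2 * S t x $ 2 + S t x $ 3 * S t x $ 3 = -1" for x
    using hyp[of x] by (simp add: hyperbolic_plane_def power2_eq_square)
  show "dot_rho (S t x) *v (dot_rho (S t x) *v v) = - v" for x v
    using dot_rho_anticommutator[of "S t x" "S t x" v] unfolding h
    by (simp add: vec_eq_iff forall_2)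
  show "dot_rho (vector_derivative (S t) (at x)) *v (dot_rho (S t x) *v v)
      = - (dot_rho (S t x) *v (dot_rho (vector_derivative (S t) (at x)) *v v))" for x v
  proof -
    let ?V = "vector_derivative (S t) (at x)"
    obtain V where "(S t has_vector_derivative V) (at x)" using regular_map_space_derivatives[OF R t] by metis
    then have d: "(S t has_vector_derivative ?V) (at x)" using vector_derivative_at by blast
    have c: "((\<lambda>x. S t x $ j) has_real_derivative ?V $ j) (at x)" for j
      unfolding has_real_derivative_iff_has_vector_derivative
      by (rule bounded_linear.has_vector_derivative[OF bounded_linear_vec_nth d])
    have "((\<lambda>x. - (S t x $ 1 * S t x $ 1) + S t x $ 2 * S t x $ 2 + S t x $ 3 * S t x $ 3) has_real_derivative
       2 * (- (?V $ 1 * S t x $ 1) + ?V $ 2 * S t x $ 2 + ?V $ 3 * S t x $ 3)) (at x)"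
      by (auto intro!: derivative_eq_intros c)
    then have "2 * (- (?V $ 1 * S t x $ 1) + ?V $ 2 * S t x $ 2 + ?V $ 3 * S t x $ 3) = 0"
      unfolding h by (rule DERIV_unique[OF _ DERIV_const])
    then have "dot_rho ?V *v (dot_rho (S t x) *v v) + dot_rho (S t x) *v (dot_rho ?V *v v) = 0"
      unfolding dot_rho_anticommutator by (simp only: of_real_0 vector_smult_lzero)
    then show ?thesis by (simp only: eq_neg_iff_add_eq_0)
  qed
qed

text \<open>A compact subinterval of \<open>I\<close> around \<open>t\<close> that contains all
  points of \<open>I\<close> near \<open>t\<close>, whether \<open>t\<close> is interior or an end
  point. The mean value estimate is applied on it.\<close>

lemma interval_neighbourhood:
  assumes I: "is_interval (I :: real set)" and t: "t \<in> I" and d: "0 < d"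
  obtains a b where "t \<in> {a..b}" "{a..b} \<subseteq> I" "{a..b} \<subseteq> ball t d" "\<forall>\<^sub>F s in at t within I. s \<in> {a..b}"
proof -
  have I': "z \<in> I" if "x \<in> I" "y \<in> I" "x \<le> z" "z \<le> y" for x y z
    using mem_is_interval_1_I[OF I that(1,2,3,4)] .
  \<comment> \<open>On each side the end point is a nearby point of \<open>I\<close> if there is
    one, and \<open>t\<close> itself otherwise; \<open>d / 2\<close> keeps it inside the open
    ball.\<close>
  define a where "a = (if \<exists>y\<in>I. y < t then max (SOME y. y \<in> I \<and> y < t) (t - d / 2) else t)"
  define b where "b = (if \<exists>y\<in>I. t < y then min (SOME y. y \<in> I \<and> t < y) (t + d / 2) else t)"
  have A: "a \<in> I \<and> a \<le> t \<and> t - d / 2 \<le> a \<and> ((\<exists>y\<in>I. y < t) \<longrightarrow> a < t)"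
  proof (cases "\<exists>y\<in>I. y < t")
    case True
    let ?y = "SOME y. y \<in> I \<and> y < t"
    have y: "?y \<in> I" "?y < t" using someI_ex[of "\<lambda>y. y \<in> I \<and> y < t"] True by auto
    have "a = max ?y (t - d / 2)" using True by (simp add: a_def)
    then show ?thesis using y I'[OF y(1) t, of a] d by auto
  next
    case False
    then have "a = t" by (auto simp: a_def)
    then show ?thesis using t d False by auto
  qed
  have B: "b \<in> I \<and> t \<le> b \<and> b \<le> t + d / 2 \<and> ((\<exists>y\<in>I. t < y) \<longrightarrow> t < b)"
  proof (cases "\<exists>y\<in>I. t < y")
    case True
    let ?y = "SOME y. y \<in> I \<and> t < y"
    have y: "?y \<in> I" "t < ?y" using someI_ex[of "\<lambda>y. y \<in> I \<and> t < y"] True by auto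
    have "b = min ?y (t + d / 2)" using True by (simp add: b_def)
    then show ?thesis using y I'[OF t y(1), of b] d by auto
  next
    case False
    then have "b = t" by (auto simp: b_def)
    then show ?thesis using t d False by auto
  qed
  have 1: "\<forall>\<^sub>F s in at t within I. a < s \<or> a = t"
    using A order_tendstoD(1)[OF tendsto_ident_at, of a t I] by (cases "a = t") auto
  have 2: "\<forall>\<^sub>F s in at t within I. s < b \<or> b = t"
    using B order_tendstoD(2)[OF tendsto_ident_at, of t b I] by (cases "b = t") auto
  have 3: "\<forall>\<^sub>F s in at t within I. s \<in> I" by (simp add: eventually_at_filter)
  have ev: "\<forall>\<^sub>F s in at t within I. s \<in> {a..b}"
    using 1 2 3
  proof eventually_elim
    case (elim s)
    then show ?case using A B by (cases "s < t"; cases "t < s") force+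
  qed
  show thesis
  proof (rule that[OF _ _ _ ev])
    show "t \<in> {a..b}" using A B by auto
    show "{a..b} \<subseteq> I" using I'[of a b] A B by auto
    show "{a..b} \<subseteq> ball t d" using A B d by (auto simp: dist_real_def)
  qed
qed

section \<open>Lipschitz dependence on time, uniform in space\<close>

lemma time_lipschitz_of_bound:
  assumes f: "\<And>s. s \<in> I \<Longrightarrow> ((\<lambda>s. S s x) has_vector_derivative ft s) (at s within I)"
    and J: "{a..b} \<subseteq> I" and K: "\<And>s. s \<in> {a..b} \<Longrightarrow> norm (ft s) \<le> K" and st: "s \<in> {a..b}" "t \<in> {a..b}"
  shows "norm (S s x - S t x) \<le> K * \<bar>s - t\<bar>"
proof -
  have "norm ((\<lambda>s. S s x) s - (\<lambda>s. S s x) t) \<le> K * norm (s - t)"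
  proof (rule differentiable_bound[where S = "{a..b}" and f' = "\<lambda>s h. h *\<^sub>R ft s"])
    fix r assume r: "r \<in> {a..b}"
    with J have "r \<in> I" by blast
    from has_vector_derivative_within_subset[OF f[OF this] J]
    have "((\<lambda>s. S s x) has_vector_derivative ft r) (at r within {a..b})" .
    then show "((\<lambda>s. S s x) has_derivative (\<lambda>h. h *\<^sub>R ft r)) (at r within {a..b})" by (simp add: has_vector_derivative_def)
    show "onorm (\<lambda>h. h *\<^sub>R ft r) \<le> K"
    proof (rule onorm_le)
      show "norm (h *\<^sub>R ft r) \<le> K * norm h" for h
        using mult_left_mono[OF K[OF r], of "\<bar>h\<bar>"] by (simp add: mult.commute)
    qed
  qed (use st in auto)
  then show ?thesis by simp
qed

lemma sobolev_line_bound: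
  assumes d: "mulrel X deriv_symbol f f'" and X: "X = Line"
    and h: "mulrel X hilbert_symbol f g" and s: "sobolev_sqnorm X 1 f \<le> ennreal B" and B: "0 \<le> B"
  shows "AE x in lebesgue. cmod (g x) \<le> B + (\<integral>\<xi>. 1 / (1 + \<xi>\<^sup>2) \<partial>freq_measure X)"
proof -
  let ?F = "fourier X f"
  have F: "Ft (base_measure X) (freq_measure X) f ?F" using Ft_fourier[OF mulrelD(1)[OF d]] X by simp
  have "nsq (freq_measure X) ?F + nsq (freq_measure X) (\<lambda>\<xi>. deriv_symbol \<xi> * ?F \<xi>) \<le> B"
    using s B unfolding sobolev_sqnorm_eq[OF d] by simp
  with sobolev_multiplier_bounded[OF F FtD(2)[OF mulrel_transform[OF d F deriv_symbol_measurable]] h hilbert_symbol_measurable norm_hilbert_symbol]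
  show ?thesis by (auto elim!: eventually_mono)
qed

text \<open>
  On the circle the bound comes from compactness. On the line it comes from the equation, by means of
  a bound on \<open>|\<nabla>|S\<close> that is uniform in \<open>x\<close> and, by the continuity of \<open>\<partial>\<^sub>xS\<close> in time, near \<open>t\<close>.
\<close>

lemma time_lipschitz:
  assumes I: "is_interval I" and R: "regular_map X I S" and H: "half_wave_map X I S" and t: "t \<in> I"
  shows "\<exists>K. \<forall>\<^sub>F s in at t within I. \<forall>x. norm (S s x - S t x) \<le> K * \<bar>s - t\<bar>"
proof (cases "at t within I = bot")
  \<comment> \<open>When \<open>t\<close> is not a limit point of \<open>I\<close> the filter is
    trivial and any constant works.\<close>
  case True
  then show ?thesis by simp
next
  case nontrivial: False
  have "Ck_on (Suc 0) I S" using R unfolding regular_map_def by blast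
  then obtain ft where ft: "\<And>t x. t \<in> I \<Longrightarrow> ((\<lambda>s. S s x) has_vector_derivative ft t x) (at t within I)"
    and cft: "continuous_on (I \<times> UNIV) (\<lambda>(t, x). ft t x)" unfolding Ck_on.simps by blast
  show ?thesis
  proof (cases X)
    case Circle
    obtain a b where J: "t \<in> {a..b}" "{a..b} \<subseteq> I" "\<forall>\<^sub>F s in at t within I. s \<in> {a..b}"
      using interval_neighbourhood[OF I t zero_less_one] .
    have "continuous_on ({a..b} \<times> {-pi..pi}) (\<lambda>(t, x). ft t x)"
      by (rule continuous_on_subset[OF cft]) (use J in auto)
    then have "compact ((\<lambda>(t, x). ft t x) ` ({a..b} \<times> {-pi..pi}))"
      by (intro compact_continuous_image compact_Times compact_Icc)
    from compact_imp_bounded[OF this] obtain K where K: "\<forall>y\<in>(\<lambda>(t, x). ft t x) ` ({a..b} \<times> {-pi..pi}). norm y \<le> K"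
      unfolding bounded_iff by (elim exE)
    have lip: "norm (S s x - S t x) \<le> K * \<bar>s - t\<bar>" if s: "s \<in> {a..b}" for s x
    proof -
      \<comment> \<open>The bound from compactness covers one period in space; periodicity carries
        it to all \<open>x\<close>.\<close>
      let ?y = "period_rep x"
      have y: "?y \<in> {-pi..pi}" using period_rep_range[of x] by simp
      have "norm (S s ?y - S t ?y) \<le> K * \<bar>s - t\<bar>"
      proof (rule time_lipschitz_of_bound[where I = I and ft = "\<lambda>s. ft s ?y"])
        show "norm (ft r ?y) \<le> K" if "r \<in> {a..b}" for r
          using K[rule_format, of "ft r ?y"] that y by force
      qed (use ft J s in auto)
      moreover have "S r ?y = S r x" if "r \<in> I" for r
      proof (rule period_rep_value)
        show "\<forall>x. S r (x + 2 * pi) = S r x" using R that Circle unfolding regular_map_def by simp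
      qed
      ultimately show ?thesis using s t J by (metis subsetD)
    qed
    have "\<forall>\<^sub>F s in at t within I. \<forall>x. norm (S s x - S t x) \<le> K * \<bar>s - t\<bar>"
      using J(3) by (rule eventually_mono) (use lip in blast)
    then show ?thesis by blast
  next
    case Line
    obtain B where B: "\<forall>t\<in>I. \<forall>x. norm (S t x) \<le> B" using R unfolding regular_map_def by blast
    have "norm (S t 0) \<le> B" using B t by blast
    then have B0: "0 \<le> B" by (rule order_trans[OF norm_ge_zero])
    \<comment> \<open>A connected set with more than one point has no isolated points, so
      derivatives within \<open>I\<close> are unique and the equation identifies \<open>ft\<close>
      with its right-hand side.\<close>
    have "I \<noteq> {x}" for x
      using nontrivial islimpt_finite[of "{x}" t] trivial_limit_within[of t I] by auto
    then have limpt: "at s within I \<noteq> bot" if "s \<in> I" for s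
      using connected_imp_perfect[OF is_interval_connected[OF I] that] trivial_limit_within[of s I] by auto
    have eq: "AE x in lebesgue. ft s x = wedge_eta (S s x) (abs_grad_map X (S s) x)" if s: "s \<in> I" for s
    proof -
      have "AE x in lebesgue. ((\<lambda>s. S s x) has_vector_derivative wedge_eta (S s x) (abs_grad_map X (S s) x)) (at s within I)"
        using H s unfolding half_wave_map_def by blast
      then show ?thesis
        by eventually_elim (rule vector_derivative_unique_within[OF limpt[OF s] ft[OF s]])
    qed
    define K0 where "K0 = (\<integral>\<xi>. 1 / (1 + \<xi>\<^sup>2) \<partial>freq_measure X)"
    have K0: "0 \<le> K0" unfolding K0_def by (intro integral_nonneg_AE AE_I2) simp
    have "\<exists>C. AE x in lebesgue. cmod (complex_of_real (abs_grad_map X (S t) x $ j)) \<le> C" for j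
      by (rule smooth_coeff_hilbert_bounded[OF smooth_coeff_component[OF R t] abs_grad_component[OF R t]
            hilbert_symbol_measurable norm_hilbert_symbol])
    then obtain C where C: "\<And>j. AE x in lebesgue. cmod (complex_of_real (abs_grad_map X (S t) x $ j)) \<le> C j" by metis
    have tend: "((\<lambda>s. sobolev_sqnorm Line r (\<lambda>x. dx S j s x - dx S j t x)) \<longlongrightarrow> 0) (at t within I)" if "0 \<le> r" for r j
      using R Line t that unfolding regular_map_def by blast
    \<comment> \<open>The threshold 1 is a convenient choice; it reappears as the first summand of
      the bound \<open>1 + K0 + C j\<close>.\<close>
    have "\<forall>\<^sub>F s in at t within I. \<forall>j. sobolev_sqnorm X 1 (\<lambda>x. dx S j s x - dx S j t x) < 1"
      unfolding Line by (intro eventually_all_finite order_tendstoD(2)[OF tend]) auto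
    then obtain d where d: "0 < d" and small: "\<And>s j. s \<in> I \<Longrightarrow> s \<noteq> t \<Longrightarrow> dist s t < d
        \<Longrightarrow> sobolev_sqnorm X 1 (\<lambda>x. dx S j s x - dx S j t x) < 1"
      unfolding eventually_at by blast
    have g: "AE x in lebesgue. \<bar>abs_grad_map X (S s) x $ j\<bar> \<le> 1 + K0 + C j" if s: "s \<in> I" "dist s t < d" for s j
    proof (cases "s = t")
      case True
      show ?thesis using C[of j] unfolding True by eventually_elim (use K0 in simp)
    next
      case False
      obtain f1 f2 where f: "mulrel X deriv_symbol (dx S j s) f1" "mulrel X deriv_symbol (dx S j t) f2"
        using smooth_coeff_component[OF R s(1), of j] smooth_coeff_component[OF R t, of j] unfolding smooth_coeff_def by blast
      have "AE x in lebesgue. cmod (complex_of_real (abs_grad_map X (S s) x $ j) - complex_of_real (abs_grad_map X (S t) x $ j))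
         \<le> 1 + K0"
        unfolding K0_def
        by (rule sobolev_line_bound[OF mulrel_diff[OF f deriv_symbol_measurable] Line
              mulrel_diff[OF abs_grad_component[OF R s(1)] abs_grad_component[OF R t] hilbert_symbol_measurable]])
           (use small[OF s(1) False s(2), of j] in auto)
      then show ?thesis using C[of j]
      proof eventually_elim
        case (elim x)
        have "\<bar>abs_grad_map X (S s) x $ j - abs_grad_map X (S t) x $ j\<bar> \<le> 1 + K0"
          using elim(1) unfolding of_real_diff[symmetric] norm_of_real .
        then show ?case using elim(2) unfolding norm_of_real by linarith
      qed
    qed
    \<comment> \<open>\<open>6 * B\<close> comes from the estimate of the wedge and the bound on the
      map; the bracket is the sum of the bounds \<open>1 + K0 + C j\<close> over the three
      components.\<close>
    define K where "K = 6 * B * (3 * (1 + K0) + C 1 + C 2 + C 3)"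
    have "AE x in lebesgue. norm (ft s x) \<le> K" if s: "s \<in> I" "dist s t < d" for s
      using eq[OF s(1)] g[OF s, of 1] g[OF s, of 2] g[OF s, of 3]
    proof eventually_elim
      case (elim x)
      have "norm (abs_grad_map X (S s) x) \<le> (\<Sum>j\<in>UNIV. \<bar>abs_grad_map X (S s) x $ j\<bar>)" by (rule norm_le_l1_cart)
      also have "\<dots> \<le> 3 * (1 + K0) + C 1 + C 2 + C 3" using add_mono[OF add_mono[OF elim(2,3)] elim(4)] unfolding sum_3 by simp
      finally have n: "norm (abs_grad_map X (S s) x) \<le> 3 * (1 + K0) + C 1 + C 2 + C 3" .
      have "6 * norm (S s x) * norm (abs_grad_map X (S s) x) \<le> K"
        unfolding K_def using B s(1) B0 by (intro mult_mono n) auto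
      then show ?case unfolding elim(1) using norm_wedge_eta order_trans by blast
    qed
    moreover have "continuous_on UNIV (ft s)" if "s \<in> I" for s
    proof -
      have "continuous_on UNIV (\<lambda>x. (\<lambda>(t, x). ft t x) (s, x))"
        by (rule continuous_on_compose2[OF cft]) (use that in \<open>auto intro!: continuous_intros\<close>)
      then show ?thesis by simp
    qed
    \<comment> \<open>The equation gives the bound for almost every \<open>x\<close>; continuity of
      \<open>ft\<close> in \<open>x\<close> gives it for all, as the mean value estimate at fixed
      \<open>x\<close> requires.\<close>
    ultimately have K: "norm (ft s x) \<le> K" if "s \<in> I" "dist s t < d" for s x
      using continuous_AE_le[OF continuous_on_norm] that by blast
    obtain a b where J: "t \<in> {a..b}" "{a..b} \<subseteq> I" "{a..b} \<subseteq> ball t d" "\<forall>\<^sub>F s in at t within I. s \<in> {a..b}"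
      using interval_neighbourhood[OF I t d] .
    have lip: "norm (S s x - S t x) \<le> K * \<bar>s - t\<bar>" if s: "s \<in> {a..b}" for s x
    proof (rule time_lipschitz_of_bound[where I = I and ft = "\<lambda>s. ft s x"])
      show "norm (ft r x) \<le> K" if "r \<in> {a..b}" for r
        using K[of r x] that J(2,3) by (auto simp: dist_commute subset_iff)
    qed (use ft J s in auto)
    have "\<forall>\<^sub>F s in at t within I. \<forall>x. norm (S s x - S t x) \<le> K * \<bar>s - t\<bar>"
      using J(4) by (rule eventually_mono) (use lip in blast)
    then show ?thesis by blast
  qed
qed

text \<open>The time derivative of the coefficient is such a commutator, and it has to be a bounded
  coefficient for its commutator with \<open>H\<close> to act on square-integrable
  functions.\<close>

lemma bdd_coeff_commutator:
  assumes "bdd_coeff X M" "bdd_coeff X N"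
  shows "bdd_coeff X (\<lambda>x. (1 / 2) *\<^sub>R (M x ** N x - N x ** M x))"
proof -
  have e: "((1 / 2) *\<^sub>R (M x ** N x - N x ** M x)) $ i $ j
      = (1 / 2) *\<^sub>R (M x $ i $ 1 * N x $ 1 $ j + M x $ i $ 2 * N x $ 2 $ j - (N x $ i $ 1 * M x $ 1 $ j + N x $ i $ 2 * M x $ 2 $ j))" for x i j
    by (simp add: matrix_matrix_mult_def sum_2)
  obtain C D where C: "\<And>i j. AE x in lebesgue. cmod (M x $ i $ j) \<le> C i j" and D: "\<And>i j. AE x in lebesgue. cmod (N x $ i $ j) \<le> D i j"
    using assms unfolding bdd_coeff_def by metis
  show ?thesis
    unfolding bdd_coeff_def e
  proof (intro allI conjI)
    fix i j
    show "periodic_on X (\<lambda>x. (1 / 2) *\<^sub>R (M x $ i $ 1 * N x $ 1 $ j + M x $ i $ 2 * N x $ 2 $ j - (N x $ i $ 1 * M x $ 1 $ j + N x $ i $ 2 * M x $ 2 $ j)))"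
      using assms unfolding bdd_coeff_def by (cases X) auto
    show "(\<lambda>x. (1 / 2) *\<^sub>R (M x $ i $ 1 * N x $ 1 $ j + M x $ i $ 2 * N x $ 2 $ j - (N x $ i $ 1 * M x $ 1 $ j + N x $ i $ 2 * M x $ 2 $ j)))
        \<in> borel_measurable lebesgue"
      using assms unfolding bdd_coeff_def
      by (intro borel_measurable_scaleR borel_measurable_const borel_measurable_diff borel_measurable_add borel_measurable_times) auto
    have p: "AE x in lebesgue. cmod (M x $ i $ k * N x $ k $ j) \<le> C i k * D k j" "AE x in lebesgue. cmod (N x $ i $ k * M x $ k $ j) \<le> D i k * C k j" for k
    proof -
      show "AE x in lebesgue. cmod (M x $ i $ k * N x $ k $ j) \<le> C i k * D k j"
        using C[of i k] D[of k j]
      proof eventually_elim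
        case (elim x)
        show ?case unfolding norm_mult using elim by (intro mult_mono) (auto intro: order_trans[OF norm_ge_zero])
      qed
      show "AE x in lebesgue. cmod (N x $ i $ k * M x $ k $ j) \<le> D i k * C k j"
        using D[of i k] C[of k j]
      proof eventually_elim
        case (elim x)
        show ?case unfolding norm_mult using elim by (intro mult_mono) (auto intro: order_trans[OF norm_ge_zero])
      qed
    qed
    have "AE x in lebesgue. cmod ((1 / 2) *\<^sub>R (M x $ i $ 1 * N x $ 1 $ j + M x $ i $ 2 * N x $ 2 $ j - (N x $ i $ 1 * M x $ 1 $ j + N x $ i $ 2 * M x $ 2 $ j)))
       \<le> (1 / 2) * ((C i 1 * D 1 j + C i 2 * D 2 j) + (D i 1 * C 1 j + D i 2 * C 2 j))"
      using p(1)[of 1] p(1)[of 2] p(2)[of 1] p(2)[of 2]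
    proof eventually_elim
      case (elim x)
      have "cmod (M x $ i $ 1 * N x $ 1 $ j + M x $ i $ 2 * N x $ 2 $ j - (N x $ i $ 1 * M x $ 1 $ j + N x $ i $ 2 * M x $ 2 $ j))
        \<le> (C i 1 * D 1 j + C i 2 * D 2 j) + (D i 1 * C 1 j + D i 2 * C 2 j)"
        by (rule order_trans[OF norm_triangle_ineq4 add_mono[OF norm_triangle_mono[OF elim(1,2)] norm_triangle_mono[OF elim(3,4)]]])
      then show ?case unfolding norm_scaleR by simp
    qed
    then show "\<exists>C. AE x in lebesgue. cmod ((1 / 2) *\<^sub>R (M x $ i $ 1 * N x $ 1 $ j + M x $ i $ 2 * N x $ 2 $ j - (N x $ i $ 1 * M x $ 1 $ j + N x $ i $ 2 * M x $ 2 $ j))) \<le> C"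
      by blast
  qed
qed

lemma scaleR_matrix_vector: "((1 / 2) *\<^sub>R (M :: complex^2^2)) *v v = (1 / 2) *s (M *v v)"
  by (simp add: vec_eq_iff matrix_vector_2) (simp add: scaleR_conv_of_real algebra_simps)

lemma bounded_linear_dot_rho_nth: "bounded_linear (\<lambda>v. dot_rho v $ i $ j)"
  unfolding dot_rho_nth
  by (intro bounded_linear_add bounded_linear_compose[OF bounded_linear_mult_left bounded_linear_compose[OF bounded_linear_of_real bounded_linear_vec_nth]])

text \<open>The two membership clauses make the composed operators meaningful on \<open>H1\<close>:
  \<open>lax_L\<close> returns to the domain of \<open>lax_B\<close>, and \<open>lax_B\<close> lands
  where \<open>lax_L\<close> acts.\<close>

theorem theorem2:
  fixes X :: base and I :: "real set" and S :: "real \<Rightarrow> real \<Rightarrow> real^3"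
  assumes "is_interval I"
    and "regular_map X I S"
    and "half_wave_map X I S"
  defines "A \<equiv> \<lambda>t x. dot_rho (S t x)"
  shows "\<forall>t\<in>I.
           (\<forall>\<phi>\<in>H1 X. lax_L X (A t) \<phi> \<in> H1 X \<and> lax_B X (A t) \<phi> \<in> L2 X) \<and>
           has_strong_derivative_on_H1 X (\<lambda>s. lax_L X (A s))
             (\<lambda>\<phi> x. \<i> *s commutator (lax_B X (A t)) (lax_L X (A t)) \<phi> x) t I"
proof (intro ballI conjI)
  note I = assms(1) and R = assms(2) and H = assms(3)
  have hyp: "S s x \<in> hyperbolic_plane" if "s \<in> I" for s x using H that unfolding half_wave_map_def by blast
  have coeff: "lax_coefficients X (A s) (\<lambda>x. dot_rho (vector_derivative (S s) (at x))) (\<lambda>x. dot_rho (abs_grad_map X (S s) x))"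
    if "s \<in> I" for s
    unfolding A_def by (rule lax_coefficients_half_wave[OF R that hyp[OF that]])
  fix t assume t: "t \<in> I"
  interpret lax_coefficients X "A t" "\<lambda>x. dot_rho (vector_derivative (S t) (at x))" "\<lambda>x. dot_rho (abs_grad_map X (S t) x)"
    by (rule coeff[OF t])
  show "lax_L X (A t) \<phi> \<in> H1 X" "lax_B X (A t) \<phi> \<in> L2 X" if "\<phi> \<in> H1 X" for \<phi>
  proof -
    obtain \<phi>' where d: "vec_mulrel X deriv_symbol \<phi> \<phi>'" using \<open>\<phi> \<in> H1 X\<close> unfolding H1_iff by blast
    show "lax_L X (A t) \<phi> \<in> H1 X" unfolding H1_iff using lax_L_H1[OF d] by blast
    show "lax_B X (A t) \<phi> \<in> L2 X" by (rule vec_L2_in_L2[OF lax_B_AE(2)[OF d]])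
  qed
  define D where "D x = dot_rho (wedge_eta (S t x) (abs_grad_map X (S t) x))" for x
  have D: "D x *v v = (1 / 2) *s (A t x *v (dot_rho (abs_grad_map X (S t) x) *v v) - dot_rho (abs_grad_map X (S t) x) *v (A t x *v v))" for x v
    unfolding D_def A_def by (rule dot_rho_wedge)
  have bD: "bdd_coeff X D"
  proof -
    \<comment> \<open>The wedge identity is an identity of actions on vectors; matrices with the
      same action are equal, and as a matrix commutator \<open>D\<close> inherits boundedness from
      \<open>A t\<close> and the matrix of \<open>|\<nabla>|S\<close>.\<close>
    have "D = (\<lambda>x. (1 / 2) *\<^sub>R (A t x ** dot_rho (abs_grad_map X (S t) x) - dot_rho (abs_grad_map X (S t) x) ** A t x))"
    proof
      fix x
      have "D x *v v = ((1 / 2) *\<^sub>R (A t x ** dot_rho (abs_grad_map X (S t) x) - dot_rho (abs_grad_map X (S t) x) ** A t x)) *v v" for v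
        unfolding D scaleR_matrix_vector by (simp add: matrix_vector_mult_diff_rdistrib matrix_vector_mul_assoc)
      then show "D x = (1 / 2) *\<^sub>R (A t x ** dot_rho (abs_grad_map X (S t) x) - dot_rho (abs_grad_map X (S t) x) ** A t x)"
        unfolding matrix_eq by blast
    qed
    then show ?thesis using bdd_coeff_commutator[OF bdd_A bdd_G] by simp
  qed
  obtain K where K: "\<forall>\<^sub>F s in at t within I. \<forall>x. norm (S s x - S t x) \<le> K * \<bar>s - t\<bar>"
    using time_lipschitz[OF I R H t] by blast
  show "has_strong_derivative_on_H1 X (\<lambda>s. lax_L X (A s)) (\<lambda>\<phi> x. \<i> *s commutator (lax_B X (A t)) (lax_L X (A t)) \<phi> x) t I"
    unfolding has_strong_derivative_on_H1_def
  proof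
    fix \<phi> assume "\<phi> \<in> H1 X"
    then obtain \<phi>' where d: "vec_mulrel X deriv_symbol \<phi> \<phi>'" unfolding H1_iff by blast
    note eq = lax_equation[OF d D]
    show "has_L2_derivative X (\<lambda>s. lax_L X (A s) \<phi>) (\<lambda>x. \<i> *s commutator (lax_B X (A t)) (lax_L X (A t)) \<phi> x) t I"
    proof (rule has_L2_derivative_lax_L[where M = A, OF _ bD vec_mulrelD(1)[OF d] t eq(2) eq(1)])
      show "bdd_coeff X (A s)" if "s \<in> I" for s by (rule lax_coefficients.bdd_A[OF coeff[OF that]])
      \<comment> \<open>The factor 3 counts the terms of \<open>dot_rho\<close>, whose matrix
        entries have modulus at most 1.\<close>
      show "\<forall>\<^sub>F s in at t within I. \<forall>x i j. cmod (A s x $ i $ j - A t x $ i $ j) \<le> 3 * K * \<bar>s - t\<bar>"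
        using K
      proof eventually_elim
        case (elim s)
        show ?case
        proof (intro allI)
          fix x i j
          have "A s x $ i $ j - A t x $ i $ j = dot_rho (S s x - S t x) $ i $ j"
            unfolding A_def dot_rho_diff[symmetric] by simp
          then show "cmod (A s x $ i $ j - A t x $ i $ j) \<le> 3 * K * \<bar>s - t\<bar>"
            using order_trans[OF norm_dot_rho_nth[of "S s x - S t x" i j] mult_left_mono[OF elim[rule_format, of x], of 3]] by simp
        qed
      qed
      show "AE x in lebesgue. ((\<lambda>s. A s x $ i $ j) has_vector_derivative D x $ i $ j) (at t within I)" for i j
      proof -
        have "AE x in lebesgue. ((\<lambda>s. S s x) has_vector_derivative wedge_eta (S t x) (abs_grad_map X (S t) x)) (at t within I)"
          using H t unfolding half_wave_map_def by blast
        then show ?thesis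
          unfolding A_def D_def by eventually_elim (rule bounded_linear.has_vector_derivative[OF bounded_linear_dot_rho_nth])
      qed
    qed
  qed
qed

end
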